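(* Let $(M,g)$ be a complete connected $d$-dimensional Riemannian manifold and let $Q$ be a probability measure on $M$ that is absolutely continuous with respect to the volume measure. Let $X_1,X_2,\dots$ be i.i.d. with distribution $Q$. Assume that (i) the intrinsic mean $\mu_I$ of $Q$ exists; and, for a chart $(U,\phi)$ of $M$ with $Q(U)=1$ and $\mu_I\in U$, writing $\mu=\phi(\mu_I)$, $\tilde X_i=\phi(X_i)$, (ii) $E|\Psi(\tilde X_i;\mu)|^2<\infty$ and $E|D_{r'}\Psi^r(\tilde X_i;\mu)|^2<\infty$ for all $1\le r,r'\le d$; (iii) the Hessian matrix $\Lambda$ of $F\circ\phi^{-1}$ at $\mu$ is nonsingular; (iv) the covariance matrix $C$ of $\Psi(\tilde X_i;\mu)$ is nonsingular. Then $\sqrt n(\mu_n-\mu)\xrightarrow{\mathcal L}\mathcal N(0,\Gamma)$, where $\Gamma=\Lambda^{-1}C(\Lambda^t)^{-1}$ and $\mu_n=\phi(\mu_{n,I})$ is the image of the intrinsic sample mean.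
   Context: $\rho=\rho_g$ is the geodesic distance and $F(x)=\int\rho^2(x,y)\,Q(dy)$. The intrinsic mean set of a probability measure $P$ is the set of minimizers of $x\mapsto\int\rho^2(x,y)P(dy)$; the intrinsic mean exists if the minimizer exists and is unique. $\mu_{n,I}$ is a measurable selection from the intrinsic mean set of $\hat Q_n=\frac1n\sum_{i=1}^n\delta_{X_i}$ ($\mu_n$ is given an arbitrary fixed value if $\mu_{n,I}\notin U$). For $u,v\in\phi(U)$, $\rho^\phi(u,v)=\rho(\phi^{-1}(u),\phi^{-1}(v))$; $\Psi(u;\theta)=(\Psi^r(u;\theta))_{r=1}^d=\operatorname{grad}_\theta(\rho^\phi)^2(u,\theta)$ (Euclidean gradient), $D_{r'}=\partial/\partial\theta^{r'}$; these derivatives at $\theta=\mu$ exist for $Q^\phi$-almost every $u$, where $Q^\phi$ is the image of $Q$ under $\phi$. A chart $(U,\phi)$ with $Q(U)=1$ always exists here: for any $p\in M$ take $U=M\setminus C(p)$, $C(p)$ the cut locus, and $\phi=(\mathrm{Exp}_p)^{-1}$. *)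

theory Defs
  imports "HOL-Probability.Probability"
begin

section \<open>Smooth maps between Euclidean spaces\<close>

text \<open>Intended for open sets \<open>S\<close>: continuous directional derivatives of every order
  up to \<open>k\<close>.\<close>

primrec C_k_on :: "nat \<Rightarrow> 'a::real_normed_vector set \<Rightarrow> ('a \<Rightarrow> 'b::real_normed_vector) \<Rightarrow> bool" where
  "C_k_on 0 S f \<longleftrightarrow> continuous_on S f"
| "C_k_on (Suc k) S f \<longleftrightarrow>
     (\<forall>x\<in>S. f differentiable (at x)) \<and> (\<forall>v. C_k_on k S (\<lambda>x. frechet_derivative f (at x) v))"

definition smooth_on :: "'a::real_normed_vector set \<Rightarrow> ('a \<Rightarrow> 'b::real_normed_vector) \<Rightarrow> bool" where
  "smooth_on S f \<longleftrightarrow> (\<forall>k. C_k_on k S f)"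


section \<open>Riemannian manifolds\<close>

text \<open>A manifold is a whole type \<open>'a\<close> with its (Hausdorff, second countable) topology together
  with a smooth atlas; its dimension is the cardinality of the index type \<open>'d\<close>. A chart is a pair
  of its domain and its coordinate map, and only the values of that map on the domain matter. The
  inverse of a chart \<open>(U, \<phi>)\<close> is \<open>inv_into U \<phi>\<close>.\<close>

type_synonym ('a, 'd) chart = "'a set \<times> ('a \<Rightarrow> real ^ 'd)"

definition topological_chart :: "('a::topological_space, 'd::finite) chart \<Rightarrow> bool" where
  "topological_chart = (\<lambda>(U, \<phi>).
     open U \<and> open (\<phi> ` U) \<and> homeomorphism U (\<phi> ` U) \<phi> (inv_into U \<phi>))"

definition smooth_transition :: "('a, 'd::finite) chart \<Rightarrow> ('a, 'd) chart \<Rightarrow> bool" where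
  "smooth_transition = (\<lambda>(U, \<phi>) (V, \<psi>). smooth_on (\<phi> ` (U \<inter> V)) (\<psi> \<circ> inv_into U \<phi>))"

definition smooth_atlas :: "('a::topological_space, 'd::finite) chart set \<Rightarrow> bool" where
  "smooth_atlas A \<longleftrightarrow>
     (\<forall>c\<in>A. topological_chart c) \<and> (\<Union>c\<in>A. fst c) = UNIV \<and>
     (\<forall>c\<in>A. \<forall>c'\<in>A. smooth_transition c c')"

text \<open>The charts of the manifold, i.e. the elements of the maximal atlas containing \<open>A\<close>.\<close>

definition manifold_chart ::
    "('a::topological_space, 'd::finite) chart set \<Rightarrow> ('a, 'd) chart \<Rightarrow> bool" where
  "manifold_chart A c \<longleftrightarrow>
     topological_chart c \<and> (\<forall>c'\<in>A. smooth_transition c c' \<and> smooth_transition c' c)"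

text \<open>A Riemannian metric is given by its coordinate matrices: \<open>G c p\<close> is the Gram matrix of
  the metric at \<open>p\<close> in the chart \<open>c\<close>, and a change of charts acts on it as on a covariant
  2-tensor.\<close>

definition riemannian_manifold ::
    "('a::topological_space, 'd::finite) chart set \<Rightarrow> (('a, 'd) chart \<Rightarrow> 'a \<Rightarrow> real ^ 'd ^ 'd) \<Rightarrow> bool" where
  "riemannian_manifold A G \<longleftrightarrow>
     smooth_atlas A \<and>
     (\<forall>c\<in>A. smooth_on (snd c ` fst c) (G c \<circ> inv_into (fst c) (snd c))) \<and>
     (\<forall>c\<in>A. \<forall>p\<in>fst c. transpose (G c p) = G c p \<and> (\<forall>v. v \<noteq> 0 \<longrightarrow> v \<bullet> (G c p *v v) > 0)) \<and>
     (\<forall>c\<in>A. \<forall>c'\<in>A. \<forall>p\<in>fst c \<inter> fst c'.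
        let J = matrix (frechet_derivative (snd c' \<circ> inv_into (fst c) (snd c)) (at (snd c p)))
        in G c p = transpose J ** G c' p ** J)"


subsection \<open>Geodesic distance\<close>

definition piecewise_C1_curve :: "('a::topological_space, 'd::finite) chart set \<Rightarrow> (real \<Rightarrow> 'a) \<Rightarrow> bool" where
  "piecewise_C1_curve A \<gamma> \<longleftrightarrow>
     path \<gamma> \<and>
     (\<forall>(U, \<phi>)\<in>A. \<forall>a b. 0 \<le> a \<and> a < b \<and> b \<le> 1 \<and> \<gamma> ` {a..b} \<subseteq> U \<longrightarrow>
        (\<phi> \<circ> \<gamma>) piecewise_C1_differentiable_on {a..b})"

text \<open>The Riemannian norm of the velocity of \<open>\<gamma>\<close> at time \<open>t\<close>. By the transformation
  law of the metric, it does not depend on the chart that is chosen around \<open>\<gamma> t\<close>.\<close>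

definition speed ::
    "('a::topological_space, 'd::finite) chart set \<Rightarrow> (('a, 'd) chart \<Rightarrow> 'a \<Rightarrow> real ^ 'd ^ 'd)
      \<Rightarrow> (real \<Rightarrow> 'a) \<Rightarrow> real \<Rightarrow> real" where
  "speed A G \<gamma> t =
     (let c = (SOME c. c \<in> A \<and> \<gamma> t \<in> fst c);
          v = vector_derivative (snd c \<circ> \<gamma>) (at t)
      in sqrt (v \<bullet> (G c (\<gamma> t) *v v)))"

definition curve_length ::
    "('a::topological_space, 'd::finite) chart set \<Rightarrow> (('a, 'd) chart \<Rightarrow> 'a \<Rightarrow> real ^ 'd ^ 'd)
      \<Rightarrow> (real \<Rightarrow> 'a) \<Rightarrow> ennreal" where
  "curve_length A G \<gamma> = (\<integral>\<^sup>+t\<in>{0..1}. ennreal (speed A G \<gamma> t) \<partial>lborel)"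

definition geodesic_dist ::
    "('a::topological_space, 'd::finite) chart set \<Rightarrow> (('a, 'd) chart \<Rightarrow> 'a \<Rightarrow> real ^ 'd ^ 'd)
      \<Rightarrow> 'a \<Rightarrow> 'a \<Rightarrow> real" where
  "geodesic_dist A G x y =
     enn2real (INF \<gamma>\<in>{\<gamma>. piecewise_C1_curve A \<gamma> \<and> pathstart \<gamma> = x \<and> pathfinish \<gamma> = y}.
       curve_length A G \<gamma>)"

text \<open>For connected manifolds, completeness of the geodesic distance is equivalent to geodesic
  completeness by the Hopf--Rinow theorem.\<close>

definition complete_manifold ::
    "('a::topological_space, 'd::finite) chart set \<Rightarrow> (('a, 'd) chart \<Rightarrow> 'a \<Rightarrow> real ^ 'd ^ 'd) \<Rightarrow> bool" where
  "complete_manifold A G \<longleftrightarrow> Metric_space.mcomplete UNIV (geodesic_dist A G)"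


subsection \<open>Volume measure\<close>

text \<open>The unique Borel measure that has density \<open>sqrt (det g)\<close> in the coordinates of every
  chart.\<close>

definition riemannian_volume ::
    "('a::topological_space, 'd::finite) chart set \<Rightarrow> (('a, 'd) chart \<Rightarrow> 'a \<Rightarrow> real ^ 'd ^ 'd)
      \<Rightarrow> 'a measure" where
  "riemannian_volume A G = (THE V. sets V = sets borel \<and>
     (\<forall>(U, \<phi>)\<in>A. \<forall>B\<in>sets borel. B \<subseteq> U \<longrightarrow>
        emeasure V B = (\<integral>\<^sup>+u\<in>\<phi> ` B. ennreal (sqrt (det (G (U, \<phi>) (inv_into U \<phi> u)))) \<partial>lborel)))"


section \<open>Intrinsic means\<close>

definition frechet_function :: "('a \<Rightarrow> 'a \<Rightarrow> real) \<Rightarrow> 'a measure \<Rightarrow> 'a \<Rightarrow> ennreal" where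
  "frechet_function \<rho> P x = (\<integral>\<^sup>+y. ennreal ((\<rho> x y)\<^sup>2) \<partial>P)"

definition intrinsic_mean_set ::
    "('a::topological_space, 'd::finite) chart set \<Rightarrow> (('a, 'd) chart \<Rightarrow> 'a \<Rightarrow> real ^ 'd ^ 'd)
      \<Rightarrow> 'a measure \<Rightarrow> 'a set" where
  "intrinsic_mean_set A G P =
     {x. \<forall>z. frechet_function (geodesic_dist A G) P x \<le> frechet_function (geodesic_dist A G) P z}"

text \<open>The image of the uniform distribution on the indices \<open>0, \<dots>, n - 1\<close>, i.e. the
  average of the Dirac measures at \<open>x 0, \<dots>, x (n - 1)\<close>, for \<open>n \<ge> 1\<close>.\<close>

definition empirical_measure :: "nat \<Rightarrow> (nat \<Rightarrow> 'a::topological_space) \<Rightarrow> 'a measure" where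
  "empirical_measure n x = distr (uniform_count_measure {..<n}) borel x"

text \<open>Chart coordinates, with the fixed value \<open>z\<close> outside the chart domain.\<close>

definition chart_coord :: "('a, 'd) chart \<Rightarrow> real ^ 'd \<Rightarrow> 'a \<Rightarrow> real ^ 'd" where
  "chart_coord c z x = (if x \<in> fst c then snd c x else z)"


section \<open>Gradients and Hessians\<close>

definition partial_deriv :: "'d::finite \<Rightarrow> (real ^ 'd \<Rightarrow> real) \<Rightarrow> real ^ 'd \<Rightarrow> real" where
  "partial_deriv r f x = deriv (\<lambda>t. f (x + t *\<^sub>R axis r 1)) 0"

definition grad :: "(real ^ 'd::finite \<Rightarrow> real) \<Rightarrow> real ^ 'd \<Rightarrow> real ^ 'd" where
  "grad f x = (\<chi> r. partial_deriv r f x)"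

text \<open>\<open>f\<close> is twice differentiable at \<open>x\<close> with Hessian matrix \<open>H\<close>.\<close>

definition has_hessian :: "(real ^ 'd::finite \<Rightarrow> real) \<Rightarrow> real ^ 'd ^ 'd \<Rightarrow> real ^ 'd \<Rightarrow> bool" where
  "has_hessian f H x \<longleftrightarrow>
     (\<forall>\<^sub>F y in nhds x. f differentiable (at y)) \<and> (grad f has_derivative (\<lambda>v. H *v v)) (at x)"

definition chart_dist :: "('a \<Rightarrow> 'a \<Rightarrow> real) \<Rightarrow> ('a, 'd) chart \<Rightarrow> real ^ 'd \<Rightarrow> real ^ 'd \<Rightarrow> real" where
  "chart_dist \<rho> = (\<lambda>(U, \<phi>) u v. \<rho> (inv_into U \<phi> u) (inv_into U \<phi> v))"

definition Psi :: "('a \<Rightarrow> 'a \<Rightarrow> real) \<Rightarrow> ('a, 'd::finite) chart \<Rightarrow> real ^ 'd \<Rightarrow> real ^ 'd \<Rightarrow> real ^ 'd" where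
  "Psi \<rho> c u \<theta> = grad (\<lambda>\<theta>. (chart_dist \<rho> c u \<theta>)\<^sup>2) \<theta>"

text \<open>\<open>D_Psi \<rho> c r' r u \<theta>\<close> is the derivative of the \<open>r\<close>-th component of \<open>Psi\<close> in the
  direction of the \<open>r'\<close>-th coordinate of \<open>\<theta>\<close>.\<close>

definition D_Psi ::
    "('a \<Rightarrow> 'a \<Rightarrow> real) \<Rightarrow> ('a, 'd::finite) chart \<Rightarrow> 'd \<Rightarrow> 'd \<Rightarrow> real ^ 'd \<Rightarrow> real ^ 'd \<Rightarrow> real" where
  "D_Psi \<rho> c r' r u \<theta> = partial_deriv r' (\<lambda>\<theta>. Psi \<rho> c u \<theta> $ r) \<theta>"


section \<open>Random vectors\<close>

definition covariance_matrix :: "'w measure \<Rightarrow> ('w \<Rightarrow> real ^ 'd::finite) \<Rightarrow> real ^ 'd ^ 'd" where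
  "covariance_matrix P Z = (\<chi> r s.
     \<integral>\<omega>. (Z \<omega> $ r - (\<integral>\<omega>'. Z \<omega>' $ r \<partial>P)) * (Z \<omega> $ s - (\<integral>\<omega>'. Z \<omega>' $ s \<partial>P)) \<partial>P)"

text \<open>The normal distribution with mean \<open>m\<close> and positive definite covariance matrix \<open>S\<close>.\<close>

definition multivariate_normal :: "real ^ 'd::finite \<Rightarrow> real ^ 'd ^ 'd \<Rightarrow> (real ^ 'd) measure" where
  "multivariate_normal m S = density lborel (\<lambda>x. ennreal
     (exp (- ((x - m) \<bullet> (matrix_inv S *v (x - m))) / 2) / sqrt ((2 * pi) ^ CARD('d) * det S)))"

text \<open>Weak convergence of Borel probability measures.\<close>

definition weakly_converges :: "(nat \<Rightarrow> 'e::topological_space measure) \<Rightarrow> 'e measure \<Rightarrow> bool" where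
  "weakly_converges M N \<longleftrightarrow>
     (\<forall>f :: 'e \<Rightarrow> real. continuous_on UNIV f \<and> bounded (range f) \<longrightarrow>
        (\<lambda>n. \<integral>x. f x \<partial>M n) \<longlonglongrightarrow> (\<integral>x. f x \<partial>N))"

end

theory Submission
  imports Defs
begin

text \<open>In a chart around \<open>\<mu>\<close>, the functions \<open>f\<^sub>x(\<theta>) = \<rho>\<^sup>2(x, \<theta>)\<close> are Lipschitz and semiconcave, with constants
  growing linearly in \<open>\<rho>(x, \<mu>)\<close>; this follows by bending almost minimal curves and needs no cut locus.
  A semiconcave function has one-sided directional derivatives \<open>D\<close> with \<open>D h + D (- h) \<le> 0\<close>, and minimality of \<open>F\<close> at \<open>\<mu>\<close>
  forces equality almost surely, so that \<open>\<Psi>\<close> is almost surely a two-sided derivative, centered and square integrable.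
  Semiconcavity also bounds the empirical function from below by its values on a finite net. With Chebyshev's inequality at the net
  points this gives first the rate \<open>n\<^bsup>-1/2\<^esup>\<close> of the minimizers (by peeling) and then
  \<open>\<surd>n(\<mu>\<^sub>n - \<mu>) = - \<Lambda>\<inverse> n\<^bsup>-1/2\<^esup> \<Sum> \<Psi>(X\<^sub>i; \<mu>) + o\<^sub>P(1)\<close>. Hopf--Rinow compactness of closed balls gives consistency,
  and the multivariate central limit theorem, proved via characteristic functions, gives the limit law.\<close>

section \<open>Second differences of smooth maps\<close>

text \<open>The classical argument expands \<open>Psi\<close> around \<open>\<mu>\<close> with the
  mean value theorem. This needs every squared distance to be twice differentiable on a whole
  neighbourhood of \<open>\<mu>\<close>, but each sample point has its own cut locus, and the cut
  loci of a growing sample may come arbitrarily close to the mean. What holds at every point is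
  one-sided: an upper bound on second differences. One side suffices because locating a minimizer
  takes a lower bound at all points at once and an upper bound at one point only, and a function
  that is concave up to a quadratic is bounded below on a convex hull by its values at the vertices.
  Limits at finitely many fixed points therefore control the random minimizer. All constants grow
  linearly in the distance from the mean, and that distance is square integrable because the minimum
  of \<open>F\<close> is finite; so every second moment and dominating function is at hand. The
  Hessian hypothesis enters through the integrated function \<open>F\<close>, as a quadratic
  expansion at the single point \<open>\<mu>\<close>; minimality and nonsingularity together make it
  positive definite.\<close>

lemma linear_Basis_expansion:
  fixes g :: "'a::euclidean_space \<Rightarrow> 'b::real_vector"
  assumes "linear g"
  shows "g v = (\<Sum>i\<in>Basis. (v \<bullet> i) *\<^sub>R g i)"
proof -
  have "g v = g (\<Sum>i\<in>Basis. (v \<bullet> i) *\<^sub>R i)"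
    by (simp add: euclidean_representation)
  also have "\<dots> = (\<Sum>i\<in>Basis. (v \<bullet> i) *\<^sub>R g i)"
    by (simp add: linear_sum[OF assms] linear_scale[OF assms])
  finally show ?thesis .
qed

lemma bounded_linear_norm_le_Basis:
  fixes g :: "'a::euclidean_space \<Rightarrow> 'b::real_normed_vector"
  assumes "bounded_linear g"
  shows "norm (g v) \<le> (\<Sum>i\<in>Basis. norm (g i)) * norm v"
proof -
  have "g v = (\<Sum>i\<in>Basis. (v \<bullet> i) *\<^sub>R g i)"
    using assms by (intro linear_Basis_expansion bounded_linear.linear)
  also have "norm \<dots> \<le> (\<Sum>i\<in>Basis. norm ((v \<bullet> i) *\<^sub>R g i))"
    by (rule norm_sum)
  also have "\<dots> \<le> (\<Sum>i\<in>Basis. norm (g i) * norm v)"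
    by (intro sum_mono) (simp add: mult.commute[of "norm (g _)"] mult_right_mono Basis_le_norm)
  finally show ?thesis by (simp add: sum_distrib_right)
qed

lemma onorm_le_Basis:
  fixes g :: "'a::euclidean_space \<Rightarrow> 'b::real_normed_vector"
  assumes "bounded_linear g" "\<And>i. i \<in> Basis \<Longrightarrow> norm (g i) \<le> B i"
  shows "onorm g \<le> (\<Sum>i\<in>Basis. B i)"
proof (rule onorm_le)
  fix v
  have "norm (g v) \<le> (\<Sum>i\<in>Basis. norm (g i)) * norm v"
    by (rule bounded_linear_norm_le_Basis) fact
  also have "\<dots> \<le> (\<Sum>i\<in>Basis. B i) * norm v"
    by (intro mult_right_mono sum_mono assms) auto
  finally show "norm (g v) \<le> (\<Sum>i\<in>Basis. B i) * norm v" .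
qed

text \<open>\<open>C_k_on\<close> controls derivatives in one fixed direction at a time. Each basis
  direction is continuous, hence bounded on the compact set, and the finitely many bounds add up to
  a bound of the operator norm.\<close>

lemma C_1_on_bound:
  fixes f :: "'a::euclidean_space \<Rightarrow> 'b::real_normed_vector"
  assumes "C_k_on (Suc 0) S f" "compact T" "T \<subseteq> S"
  obtains B where "B > 0" "\<And>x. x \<in> T \<Longrightarrow> onorm (frechet_derivative f (at x)) \<le> B"
proof -
  have d: "\<And>x. x \<in> S \<Longrightarrow> f differentiable (at x)"
    and c: "\<And>v. continuous_on S (\<lambda>x. frechet_derivative f (at x) v)"
    using assms(1) by auto
  have "\<exists>B. \<forall>x\<in>T. norm (frechet_derivative f (at x) v) \<le> B" for v
    using compact_imp_bounded[OF compact_continuous_image[OF continuous_on_subset[OF c assms(3)] assms(2)]]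
    by (auto simp: bounded_iff)
  then obtain B where B: "\<And>v x. x \<in> T \<Longrightarrow> norm (frechet_derivative f (at x) v) \<le> B v"
    by metis
  show thesis
  proof (rule that[of "max 1 (\<Sum>i\<in>Basis. B i)"])
    fix x assume "x \<in> T"
    then show "onorm (frechet_derivative f (at x)) \<le> max 1 (\<Sum>i\<in>Basis. B i)"
      using assms(3) d B
      by (intro max.coboundedI2 onorm_le_Basis
          has_derivative_bounded_linear[OF iffD1[OF frechet_derivative_works]]) auto
  qed auto
qed

lemma C_1_on_lipschitz:
  fixes f :: "'a::euclidean_space \<Rightarrow> 'b::real_normed_vector"
  assumes "C_k_on (Suc 0) S f" "compact T" "T \<subseteq> S" "convex T"
  obtains B where "B > 0" "\<And>x y. x \<in> T \<Longrightarrow> y \<in> T \<Longrightarrow> norm (f x - f y) \<le> B * norm (x - y)"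
proof -
  from C_1_on_bound[OF assms(1-3)] obtain B where "B > 0"
    and B: "\<And>x. x \<in> T \<Longrightarrow> onorm (frechet_derivative f (at x)) \<le> B" by auto
  have "norm (f x - f y) \<le> B * norm (x - y)" if "x \<in> T" "y \<in> T" for x y
  proof (rule differentiable_bound[of T f "\<lambda>x. frechet_derivative f (at x)"])
    fix x assume "x \<in> T"
    then have "f differentiable (at x)" using assms by auto
    then show "(f has_derivative frechet_derivative f (at x)) (at x within T)"
      unfolding frechet_derivative_works by (rule has_derivative_at_withinI)
  qed (use assms that B in auto)
  with \<open>B > 0\<close> that show thesis by blast
qed

lemma smooth_on_differentiable:
  assumes "smooth_on S f" "x \<in> S"
  shows "(f has_derivative frechet_derivative f (at x)) (at x)"
  using assms unfolding smooth_on_def frechet_derivative_works[symmetric]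
  by (metis C_k_on.simps(2))

lemma smooth_on_continuous_derivative:
  assumes "smooth_on S f"
  shows "continuous_on S (\<lambda>x. frechet_derivative f (at x) v)"
  using assms unfolding smooth_on_def by (metis C_k_on.simps)

lemma scaleR_convex_combination_endpoints:
  fixes x h :: "'a::real_vector"
  shows "((1 + t) / 2) *\<^sub>R (x + h) + ((1 - t) / 2) *\<^sub>R (x - h) = x + t *\<^sub>R h"
    "((1 - t) / 2) *\<^sub>R (x + h) + ((1 + t) / 2) *\<^sub>R (x - h) = x - t *\<^sub>R h"
proof -
  have "((1 + t) / 2) *\<^sub>R (x + h) + ((1 - t) / 2) *\<^sub>R (x - h) =
    ((1 + t) / 2 + (1 - t) / 2) *\<^sub>R x + ((1 + t) / 2 - (1 - t) / 2) *\<^sub>R h" for t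
    by (simp only: scaleR_add_right scaleR_diff_right scaleR_add_left scaleR_diff_left) simp
  from this[of t] this[of "- t"] show "((1 + t) / 2) *\<^sub>R (x + h) + ((1 - t) / 2) *\<^sub>R (x - h) = x + t *\<^sub>R h"
    "((1 - t) / 2) *\<^sub>R (x + h) + ((1 + t) / 2) *\<^sub>R (x - h) = x - t *\<^sub>R h"
    by (simp_all flip: add_divide_distrib diff_divide_distrib)
qed

text \<open>The function \<open>f (x + t h) + f (x - t h)\<close> of \<open>t\<close> has as
  derivative a difference of the derivatives of \<open>f\<close> at two points at distance
  \<open>2 t |h|\<close>, applied to \<open>h\<close>. Since the derivative is Lipschitz on a ball,
  this is of order \<open>|h|^2\<close>.\<close>

lemma smooth_on_second_difference:
  fixes f :: "'a::euclidean_space \<Rightarrow> 'b::real_normed_vector"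
  assumes "smooth_on S f" "open S" "x0 \<in> S"
  obtains r L where "r > 0" "L > 0" "cball x0 r \<subseteq> S"
    "\<And>x y. x \<in> cball x0 r \<Longrightarrow> y \<in> cball x0 r \<Longrightarrow> norm (f x - f y) \<le> L * norm (x - y)"
    "\<And>x h. x + h \<in> cball x0 r \<Longrightarrow> x - h \<in> cball x0 r \<Longrightarrow>
        norm (f (x + h) + f (x - h) - 2 *\<^sub>R f x) \<le> L * (norm h)\<^sup>2"
proof -
  let ?f' = "\<lambda>x. frechet_derivative f (at x)"
  obtain r where r: "r > 0" "cball x0 r \<subseteq> S"
    using assms open_contains_cball by blast
  have 1: "C_k_on (Suc 0) S f"
    using assms(1) unfolding smooth_on_def by blast
  have "C_k_on (Suc (Suc 0)) S f"
    using assms(1) unfolding smooth_on_def by blast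
  then have "\<And>v. C_k_on (Suc 0) S (\<lambda>x. ?f' x v)"
    by simp
  then have "\<exists>B>0. \<forall>x\<in>cball x0 r. \<forall>y\<in>cball x0 r. norm (?f' x v - ?f' y v) \<le> B * norm (x - y)" for v
    using C_1_on_lipschitz[of S _ "cball x0 r"] r(2) by (metis compact_cball convex_cball)
  then obtain B where B: "\<And>v. B v > 0"
    "\<And>v x y. x \<in> cball x0 r \<Longrightarrow> y \<in> cball x0 r \<Longrightarrow> norm (?f' x v - ?f' y v) \<le> B v * norm (x - y)"
    by metis
  obtain B' where B': "B' > 0"
    "\<And>x y. x \<in> cball x0 r \<Longrightarrow> y \<in> cball x0 r \<Longrightarrow> norm (f x - f y) \<le> B' * norm (x - y)"
    using C_1_on_lipschitz[OF 1, of "cball x0 r"] r(2) by (metis compact_cball convex_cball)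
  \<comment> \<open>One constant for both conclusions. The factor 2 comes from the distance
    \<open>2 * t * norm h\<close> of the two points at which derivatives are compared, with
    \<open>t \<le> 1\<close>.\<close>
  define L where "L = max B' (2 * (\<Sum>i\<in>Basis. B i))"
  have d: "\<And>x. x \<in> cball x0 r \<Longrightarrow> (f has_derivative ?f' x) (at x)"
    using r(2) smooth_on_differentiable[OF assms(1)] by blast
  have on: "onorm (\<lambda>v. ?f' x v - ?f' y v) \<le> (\<Sum>i\<in>Basis. B i) * norm (x - y)"
    if "x \<in> cball x0 r" "y \<in> cball x0 r" for x y
    unfolding sum_distrib_right
    using that by (intro onorm_le_Basis B bounded_linear_sub has_derivative_bounded_linear[OF d]) auto
  have sd: "norm (f (x + h) + f (x - h) - 2 *\<^sub>R f x) \<le> L * (norm h)\<^sup>2"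
    if h: "x + h \<in> cball x0 r" "x - h \<in> cball x0 r" for x h
  proof -
    let ?u = "\<lambda>t::real. f (x + t *\<^sub>R h) + f (x - t *\<^sub>R h)"
    let ?u' = "\<lambda>t s. ?f' (x + t *\<^sub>R h) (s *\<^sub>R h) - ?f' (x - t *\<^sub>R h) (s *\<^sub>R h)"
    \<comment> \<open>Only the ends \<open>x + h\<close> and \<open>x - h\<close> are known to lie
      in the ball, so the points between them are written as convex combinations of these
      two.\<close>
    have mem: "x + t *\<^sub>R h \<in> cball x0 r" "x - t *\<^sub>R h \<in> cball x0 r" if "t \<in> {0..1}" for t
    proof -
      have "x + t *\<^sub>R h = ((1 + t) / 2) *\<^sub>R (x + h) + ((1 - t) / 2) *\<^sub>R (x - h)"
        "x - t *\<^sub>R h = ((1 - t) / 2) *\<^sub>R (x + h) + ((1 + t) / 2) *\<^sub>R (x - h)"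
        by (simp_all add: scaleR_convex_combination_endpoints)
      then show "x + t *\<^sub>R h \<in> cball x0 r" "x - t *\<^sub>R h \<in> cball x0 r"
        using that h
        by (auto intro!: convexD[OF convex_cball] simp: add_divide_distrib[symmetric] simp del: mem_cball)
    qed
    have "norm (?u 1 - ?u 0) \<le> (2 * (\<Sum>i\<in>Basis. B i) * (norm h)\<^sup>2) * norm (1 - 0 :: real)"
    proof (rule differentiable_bound[of "{0..1::real}" ?u ?u'])
      show "(?u has_derivative ?u' t) (at t within {0..1})" if "t \<in> {0..1}" for t
      proof -
        have [derivative_intros]: "((\<lambda>t. f (x + t *\<^sub>R h)) has_derivative (\<lambda>s. ?f' (x + t *\<^sub>R h) (s *\<^sub>R h))) (at t within {0..1})"
          by (rule has_derivative_compose[where g=f and f="\<lambda>t. x + t *\<^sub>R h", OF _ d[OF mem(1)[OF that]]])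
            (auto intro!: derivative_eq_intros)
        have 2: "((\<lambda>t. f (x - t *\<^sub>R h)) has_derivative (\<lambda>s. ?f' (x - t *\<^sub>R h) (- (s *\<^sub>R h)))) (at t within {0..1})"
          by (rule has_derivative_compose[where g=f and f="\<lambda>t. x - t *\<^sub>R h", OF _ d[OF mem(2)[OF that]]])
            (auto intro!: derivative_eq_intros)
        have "?f' (x - t *\<^sub>R h) (- v) = - ?f' (x - t *\<^sub>R h) v" for v
          using has_derivative_linear[OF d[OF mem(2)[OF that]]] by (simp add: linear_neg)
        with 2 have [derivative_intros]: "((\<lambda>t. f (x - t *\<^sub>R h)) has_derivative (\<lambda>s. - ?f' (x - t *\<^sub>R h) (s *\<^sub>R h))) (at t within {0..1})"
          by simp
        show ?thesis by (auto intro!: derivative_eq_intros)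
      qed
      show "onorm (?u' t) \<le> 2 * (\<Sum>i\<in>Basis. B i) * (norm h)\<^sup>2" if "t \<in> {0..1}" for t
      proof (rule onorm_le)
        fix s :: real
        have "norm (?u' t s) \<le> onorm (\<lambda>v. ?f' (x + t *\<^sub>R h) v - ?f' (x - t *\<^sub>R h) v) * norm (s *\<^sub>R h)"
          by (intro onorm[where f="\<lambda>v. ?f' (x + t *\<^sub>R h) v - ?f' (x - t *\<^sub>R h) v"] bounded_linear_sub
              has_derivative_bounded_linear[OF d] mem that)
        also have "\<dots> \<le> ((\<Sum>i\<in>Basis. B i) * norm ((x + t *\<^sub>R h) - (x - t *\<^sub>R h))) * norm (s *\<^sub>R h)"
          by (intro mult_right_mono on mem that) auto
        also have "(x + t *\<^sub>R h) - (x - t *\<^sub>R h) = (2 * t) *\<^sub>R h"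
          by (simp add: scaleR_2[symmetric] flip: scaleR_scaleR)
        also have "(\<Sum>i\<in>Basis. B i) * norm ((2 * t) *\<^sub>R h) * norm (s *\<^sub>R h) =
           (\<Sum>i\<in>Basis. B i) * (2 * t * norm h * (norm s * norm h))"
          using that by simp
        also have "\<dots> \<le> (\<Sum>i\<in>Basis. B i) * (2 * 1 * norm h * (norm s * norm h))"
          using that B(1) by (intro mult_left_mono mult_right_mono sum_nonneg) (auto simp: less_imp_le)
        finally show "norm (?u' t s) \<le> 2 * (\<Sum>i\<in>Basis. B i) * (norm h)\<^sup>2 * norm s"
          by (simp add: power2_eq_square algebra_simps)
      qed
    qed auto
    also have "?u 1 - ?u 0 = f (x + h) + f (x - h) - 2 *\<^sub>R f x"
      by (simp add: scaleR_2)
    also have "2 * (\<Sum>i\<in>Basis. B i) * (norm h)\<^sup>2 * norm (1 - 0 :: real) \<le> L * (norm h)\<^sup>2"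
      by (simp add: L_def mult_right_mono)
    finally show ?thesis .
  qed
  show thesis
  proof (rule that[OF r(1) _ r(2) _ sd])
    show "L > 0" using B'(1) by (simp add: L_def)
    show "norm (f x - f y) \<le> L * norm (x - y)" if "x \<in> cball x0 r" "y \<in> cball x0 r" for x y
      using B'(2)[OF that] mult_right_mono[of B' L "norm (x - y)"] by (simp add: L_def)
  qed
qed

lemma smooth_on_imp_continuous_on: "smooth_on S f \<Longrightarrow> continuous_on S f"
  unfolding smooth_on_def by (metis C_k_on.simps(1))

section \<open>Speed of curves in charts\<close>

abbreviation chart_inv :: "('a, 'd) chart \<Rightarrow> real ^ 'd \<Rightarrow> 'a" where
  "chart_inv c \<equiv> inv_into (fst c) (snd c)"

lemma
  assumes "topological_chart c"
  shows topological_chart_open: "open (fst c)" "open (snd c ` fst c)"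
    and topological_chart_homeomorphism: "homeomorphism (fst c) (snd c ` fst c) (snd c) (chart_inv c)"
    and topological_chart_continuous: "continuous_on (fst c) (snd c)"
      "continuous_on (snd c ` fst c) (chart_inv c)"
    and topological_chart_inv: "\<And>x. x \<in> fst c \<Longrightarrow> chart_inv c (snd c x) = x"
      "\<And>u. u \<in> snd c ` fst c \<Longrightarrow> snd c (chart_inv c u) = u"
      "\<And>u. u \<in> snd c ` fst c \<Longrightarrow> chart_inv c u \<in> fst c"
  using assms unfolding topological_chart_def homeomorphism_def
  by (auto simp: case_prod_beta f_inv_into_f inv_into_into)

lemma topological_chart_open_image:
  assumes c: "topological_chart c" and "open W" "W \<subseteq> fst c"
  shows "open (snd c ` W)"
proof -
  have "snd c ` W = snd c ` fst c \<inter> chart_inv c -` W"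
    using \<open>W \<subseteq> fst c\<close> topological_chart_inv[OF c] by (force simp: image_iff)
  moreover have "open \<dots>"
    using continuous_open_preimage topological_chart_continuous(2)[OF c] topological_chart_open(2)[OF c]
      \<open>open W\<close> by blast
  ultimately show ?thesis by simp
qed

lemma topological_chart_open_inv_image:
  assumes c: "topological_chart c" and "open W" "W \<subseteq> snd c ` fst c"
  shows "open (chart_inv c ` W)"
proof -
  have "chart_inv c ` W = fst c \<inter> snd c -` W"
    using \<open>W \<subseteq> snd c ` fst c\<close> topological_chart_inv[OF c] by (force simp: image_iff)
  moreover have "open \<dots>"
    using continuous_open_preimage topological_chart_continuous(1)[OF c] topological_chart_open(1)[OF c]
      \<open>open W\<close> by blast
  ultimately show ?thesis by simp
qed

definition metric_norm :: "(('a, 'd::finite) chart \<Rightarrow> 'a \<Rightarrow> real ^ 'd ^ 'd) \<Rightarrow> ('a, 'd) chart \<Rightarrow> 'a \<Rightarrow> real ^ 'd \<Rightarrow> real" where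
  "metric_norm G c p v = sqrt (v \<bullet> (G c p *v v))"

text \<open>A full ball around \<open>t\<close> is required because \<open>speed\<close> uses the
  two-sided derivative, and because this derivative has to be continuous near
  \<open>t\<close>.\<close>

definition C1_at_in :: "('a, 'd::finite) chart \<Rightarrow> (real \<Rightarrow> 'a) \<Rightarrow> real \<Rightarrow> real \<Rightarrow> bool" where
  "C1_at_in c \<gamma> t e \<longleftrightarrow> e > 0 \<and> \<gamma> ` ball t e \<subseteq> fst c \<and> (snd c \<circ> \<gamma>) C1_differentiable_on ball t e"

definition C1_at :: "('a, 'd::finite) chart set \<Rightarrow> (real \<Rightarrow> 'a) \<Rightarrow> real \<Rightarrow> bool" where
  "C1_at A \<gamma> t \<longleftrightarrow> (\<exists>c\<in>A. \<exists>e. C1_at_in c \<gamma> t e)"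

lemma C1_at_in_mono:
  assumes "C1_at_in c \<gamma> t e" "s \<in> ball t e" "e' > 0" "ball s e' \<subseteq> ball t e"
  shows "C1_at_in c \<gamma> s e'"
  using assms unfolding C1_at_in_def by (blast intro: C1_differentiable_on_subset)

lemma C1_at_in_has_vector_derivative:
  assumes "C1_at_in c \<gamma> t e" "s \<in> ball t e"
  shows "((snd c \<circ> \<gamma>) has_vector_derivative vector_derivative (snd c \<circ> \<gamma>) (at s)) (at s)"
  using assms unfolding C1_at_in_def C1_differentiable_on_eq
  by (auto simp: vector_derivative_works)

lemma C1_at_in_continuous:
  assumes "C1_at_in c \<gamma> t e"
  shows "continuous_on (ball t e) (snd c \<circ> \<gamma>)" "continuous_on (ball t e) (\<lambda>s. vector_derivative (snd c \<circ> \<gamma>) (at s))"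
  using assms C1_differentiable_imp_continuous_on
  unfolding C1_at_in_def C1_differentiable_on_eq by blast+

lemma C1_at_in_continuous_curve:
  assumes "C1_at_in c \<gamma> t e" "topological_chart c"
  shows "continuous_on (ball t e) \<gamma>"
proof -
  have "continuous_on (ball t e) (chart_inv c \<circ> (snd c \<circ> \<gamma>))"
    using assms(1) unfolding C1_at_in_def
    by (intro continuous_on_compose C1_at_in_continuous[OF assms(1)]
        continuous_on_subset[OF topological_chart_continuous(2)[OF assms(2)]]) auto
  then show ?thesis
    by (rule continuous_on_eq)
      (use assms in \<open>auto simp: C1_at_in_def topological_chart_inv(1)[OF assms(2)] image_subset_iff\<close>)
qed

text \<open>Chain rule with the transition map; the time interval shrinks so that the curve stays in
  both chart domains.\<close>

lemma C1_at_in_change_chart: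
  fixes c c' :: "('a::topological_space, 'd::finite) chart"
  assumes c: "topological_chart c" and c': "topological_chart c'" and sm: "smooth_transition c c'"
    and 1: "C1_at_in c \<gamma> t e" and \<gamma>t: "\<gamma> t \<in> fst c'"
  obtains e' where "e' \<le> e" "C1_at_in c' \<gamma> t e'"
    "\<And>s. s \<in> ball t e' \<Longrightarrow> vector_derivative (snd c' \<circ> \<gamma>) (at s) =
       frechet_derivative (snd c' \<circ> chart_inv c) (at (snd c (\<gamma> s))) (vector_derivative (snd c \<circ> \<gamma>) (at s))"
proof -
  have "open (ball t e \<inter> \<gamma> -` fst c')"
    using C1_at_in_continuous_curve[OF 1 c] topological_chart_open(1)[OF c']
    by (simp add: continuous_open_preimage)
  moreover have "t \<in> ball t e \<inter> \<gamma> -` fst c'"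
    using 1 \<gamma>t by (simp add: C1_at_in_def)
  ultimately obtain e0 where e0: "e0 > 0" "ball t e0 \<subseteq> ball t e \<inter> \<gamma> -` fst c'"
    using open_contains_ball by blast
  define e' where "e' = min e e0"
  have e': "e' > 0" "ball t e' \<subseteq> ball t e \<inter> \<gamma> -` fst c'" "e' \<le> e"
    using e0 1 by (auto simp: e'_def C1_at_in_def)
  have dom: "\<gamma> s \<in> fst c" "\<gamma> s \<in> fst c'" "s \<in> ball t e" if "s \<in> ball t e'" for s
    using that e'(2) 1 by (auto simp: C1_at_in_def image_subset_iff subset_eq)
  let ?T = "snd c' \<circ> chart_inv c" and ?W = "snd c ` (fst c \<inter> fst c')"
  let ?D = "\<lambda>s. frechet_derivative ?T (at (snd c (\<gamma> s))) (vector_derivative (snd c \<circ> \<gamma>) (at s))"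
  have smT: "smooth_on ?W ?T"
    using sm by (auto simp: smooth_transition_def case_prod_beta)
  have dT: "(?T has_derivative frechet_derivative ?T (at (snd c (\<gamma> s)))) (at (snd c (\<gamma> s)))"
    if "s \<in> ball t e'" for s
    using dom[OF that] by (intro smooth_on_differentiable[OF smT]) auto
  have hvd: "((snd c' \<circ> \<gamma>) has_vector_derivative ?D s) (at s)" if s: "s \<in> ball t e'" for s
  proof -
    have "(?T \<circ> (snd c \<circ> \<gamma>) has_vector_derivative ?D s) (at s)"
    proof -
      have "(?T has_derivative frechet_derivative ?T (at (snd c (\<gamma> s)))) (at ((snd c \<circ> \<gamma>) s))"
        using dT[OF s] by simp
      from vector_derivative_diff_chain_within[OF C1_at_in_has_vector_derivative[OF 1 dom(3)[OF s]] has_derivative_at_withinI[OF this]]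
      show ?thesis .
    qed
    then show ?thesis
    proof (rule has_vector_derivative_transform_within_open[OF _ open_ball s])
      fix s' assume "s' \<in> ball t e'"
      then show "(?T \<circ> (snd c \<circ> \<gamma>)) s' = (snd c' \<circ> \<gamma>) s'"
        using dom[of s'] by (simp add: topological_chart_inv(1)[OF c])
    qed
  qed
  have "continuous_on (ball t e') ?D"
  proof -
    \<comment> \<open>Smoothness of the transition map makes its derivative continuous in each fixed
      direction, whereas here the direction moves with \<open>s\<close>; hence the basis
      expansion.\<close>
    have eq: "?D s = (\<Sum>i\<in>Basis. (vector_derivative (snd c \<circ> \<gamma>) (at s) \<bullet> i) *\<^sub>R
        frechet_derivative ?T (at ((snd c \<circ> \<gamma>) s)) i)" if "s \<in> ball t e'" for s
      unfolding comp_apply[of "snd c" \<gamma>] by (rule linear_Basis_expansion[OF has_derivative_linear[OF dT[OF that]]])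
    have "continuous_on (ball t e') (\<lambda>s. frechet_derivative ?T (at ((snd c \<circ> \<gamma>) s)) i)" for i
      using dom e'(2)
      by (intro continuous_on_compose2[OF smooth_on_continuous_derivative[OF smT]]
          continuous_on_subset[OF C1_at_in_continuous(1)[OF 1]]) auto
    then have "continuous_on (ball t e') (\<lambda>s. \<Sum>i\<in>Basis. (vector_derivative (snd c \<circ> \<gamma>) (at s) \<bullet> i) *\<^sub>R
        frechet_derivative ?T (at ((snd c \<circ> \<gamma>) s)) i)"
      using e'(2) by (intro continuous_intros continuous_on_subset[OF C1_at_in_continuous(2)[OF 1]]) auto
    then show ?thesis by (rule continuous_on_eq) (rule eq[symmetric])
  qed
  then have "(snd c' \<circ> \<gamma>) C1_differentiable_on ball t e'"
    unfolding C1_differentiable_on_def using hvd by (intro exI[of _ ?D]) simp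
  then have "C1_at_in c' \<gamma> t e'"
    using e' dom by (auto simp: C1_at_in_def)
  then show thesis
    using that e'(3) vector_derivative_at[OF hvd] by blast
qed

locale riemannian =
  fixes A :: "('a::{t2_space, second_countable_topology}, 'd::finite) chart set"
    and G :: "('a, 'd) chart \<Rightarrow> 'a \<Rightarrow> real ^ 'd ^ 'd"
  assumes riemannian: "riemannian_manifold A G"
begin

lemma atlas: "smooth_atlas A"
  using riemannian unfolding riemannian_manifold_def by blast

lemma chart_topological: "c \<in> A \<Longrightarrow> topological_chart c"
  using atlas unfolding smooth_atlas_def by blast

lemma chart_exists: obtains c where "c \<in> A" "p \<in> fst c"
  using atlas unfolding smooth_atlas_def by blast

lemma chart_transition: "c \<in> A \<Longrightarrow> c' \<in> A \<Longrightarrow> smooth_transition c c'"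
  using atlas unfolding smooth_atlas_def by blast

lemma metric_smooth: "c \<in> A \<Longrightarrow> smooth_on (snd c ` fst c) (G c \<circ> chart_inv c)"
  using riemannian unfolding riemannian_manifold_def by blast

lemma metric_pos: "c \<in> A \<Longrightarrow> p \<in> fst c \<Longrightarrow> v \<noteq> 0 \<Longrightarrow> v \<bullet> (G c p *v v) > 0"
  using riemannian unfolding riemannian_manifold_def by blast

lemma metric_nonneg: "c \<in> A \<Longrightarrow> p \<in> fst c \<Longrightarrow> v \<bullet> (G c p *v v) \<ge> 0"
  using metric_pos by (cases "v = 0") (auto simp: less_imp_le)

lemma metric_transform:
  assumes "c \<in> A" "c' \<in> A" "p \<in> fst c" "p \<in> fst c'"
  shows "G c p = transpose (matrix (frechet_derivative (snd c' \<circ> chart_inv c) (at (snd c p)))) ** G c' p **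
    matrix (frechet_derivative (snd c' \<circ> chart_inv c) (at (snd c p)))"
proof -
  have "let J = matrix (frechet_derivative (snd c' \<circ> chart_inv c) (at (snd c p)))
        in G c p = transpose J ** G c' p ** J"
    using assms riemannian unfolding riemannian_manifold_def by blast
  then show ?thesis by (simp add: Let_def)
qed

text \<open>The Gram matrices transform as a covariant tensor, so the derivative of the transition
  map is an isometry between the two coordinate norms.\<close>

lemma metric_norm_transform:
  assumes "c \<in> A" "c' \<in> A" "p \<in> fst c" "p \<in> fst c'"
  shows "metric_norm G c p v =
    metric_norm G c' p (frechet_derivative (snd c' \<circ> chart_inv c) (at (snd c p)) v)"
proof -
  let ?f = "frechet_derivative (snd c' \<circ> chart_inv c) (at (snd c p))"
  let ?J = "matrix ?f"
  have "smooth_on (snd c ` (fst c \<inter> fst c')) (snd c' \<circ> chart_inv c)"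
    using chart_transition[OF assms(1,2)] by (auto simp: smooth_transition_def case_prod_beta)
  then have "linear ?f"
    using assms by (intro has_derivative_linear[OF smooth_on_differentiable]) auto
  then have "?f v = ?J *v v" by simp
  moreover have "v \<bullet> (G c p *v v) = (?J *v v) \<bullet> (G c' p *v (?J *v v))"
    using dot_lmul_matrix[of v "transpose ?J", symmetric]
    by (simp add: metric_transform[OF assms] matrix_vector_mul_assoc[symmetric] vector_transpose_matrix
        del: matrix_vector_mul_assoc)
  ultimately show ?thesis by (simp add: metric_norm_def)
qed

text \<open>\<open>speed\<close> works in a chart selected by \<open>SOME\<close>. Both that chart
  and \<open>c\<close> are compared with a chart \<open>c0\<close> in which the curve is known to be
  continuously differentiable.\<close>

lemma speed_eq:
  assumes "C1_at A \<gamma> t" "c \<in> A" "\<gamma> t \<in> fst c"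
  shows "speed A G \<gamma> t = metric_norm G c (\<gamma> t) (vector_derivative (snd c \<circ> \<gamma>) (at t))"
proof -
  obtain c0 e where c0: "c0 \<in> A" "C1_at_in c0 \<gamma> t e"
    using assms(1) unfolding C1_at_def by blast
  then have t: "\<gamma> t \<in> fst c0" by (auto simp: C1_at_in_def)
  have *: "metric_norm G c' (\<gamma> t) (vector_derivative (snd c' \<circ> \<gamma>) (at t)) =
     metric_norm G c0 (\<gamma> t) (vector_derivative (snd c0 \<circ> \<gamma>) (at t))"
    if c': "c' \<in> A" "\<gamma> t \<in> fst c'" for c'
  proof -
    obtain e' where e': "C1_at_in c' \<gamma> t e'"
      "\<And>s. s \<in> ball t e' \<Longrightarrow> vector_derivative (snd c' \<circ> \<gamma>) (at s) =
       frechet_derivative (snd c' \<circ> chart_inv c0) (at (snd c0 (\<gamma> s))) (vector_derivative (snd c0 \<circ> \<gamma>) (at s))"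
      using C1_at_in_change_chart[OF chart_topological chart_topological chart_transition c0(2)] c0 c' by metis
    from e'(2)[of t] e'(1) metric_norm_transform[OF c0(1) c'(1) t c'(2)] show ?thesis
      by (simp add: C1_at_in_def)
  qed
  define c1 where "c1 = (SOME c. c \<in> A \<and> \<gamma> t \<in> fst c)"
  have "c1 \<in> A \<and> \<gamma> t \<in> fst c1"
    unfolding c1_def by (rule someI[of _ c]) (use assms in auto)
  then show ?thesis
    using *[of c1] *[OF assms(2,3)] by (simp add: speed_def metric_norm_def Let_def flip: c1_def)
qed

lemma C1_at_chart:
  assumes "C1_at A \<gamma> t" "c \<in> A" "\<gamma> t \<in> fst c"
  obtains e where "C1_at_in c \<gamma> t e"
proof -
  obtain c0 e where c0: "c0 \<in> A" "C1_at_in c0 \<gamma> t e"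
    using assms(1) unfolding C1_at_def by blast
  with C1_at_in_change_chart[OF chart_topological chart_topological chart_transition c0(2)] assms that
  show thesis by metis
qed

lemma C1_at_in_imp:
  assumes "c \<in> A" "C1_at_in c \<gamma> t e" "s \<in> ball t e"
  shows "C1_at A \<gamma> s"
proof -
  obtain e' where "e' > 0" "ball s e' \<subseteq> ball t e"
    using assms(3) open_ball open_contains_ball by blast
  then show ?thesis
    using C1_at_in_mono[OF assms(2,3)] assms(1) unfolding C1_at_def by blast
qed

lemma metric_continuous:
  assumes "c \<in> A" "continuous_on S u" "u ` S \<subseteq> fst c" "continuous_on S v"
  shows "continuous_on S (\<lambda>s. metric_norm G c (u s) (v s))"
proof -
  have "continuous_on S (\<lambda>s. (G c \<circ> chart_inv c) (snd c (u s)))"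
    using assms(3)
    by (intro continuous_on_compose2[OF smooth_on_imp_continuous_on[OF metric_smooth[OF assms(1)]]]
       continuous_on_compose2[OF topological_chart_continuous(1)[OF chart_topological[OF assms(1)]] assms(2)]) auto
  then have "continuous_on S (\<lambda>s. G c (u s))"
    by (rule continuous_on_eq)
      (use assms(3) in \<open>auto simp: topological_chart_inv(1)[OF chart_topological[OF assms(1)]] image_subset_iff\<close>)
  then show ?thesis unfolding metric_norm_def matrix_vector_mult_def inner_vec_def
    using assms(4) by (auto intro!: continuous_intros)
qed

lemma speed_continuous:
  assumes "C1_at A \<gamma> t"
  shows "isCont (speed A G \<gamma>) t"
proof -
  obtain c e where c: "c \<in> A" "C1_at_in c \<gamma> t e"
    using assms(1) unfolding C1_at_def by blast
  have "continuous_on (ball t e) (\<lambda>s. metric_norm G c (\<gamma> s) (vector_derivative (snd c \<circ> \<gamma>) (at s)))"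
    using c chart_topological[OF c(1)]
    by (intro metric_continuous C1_at_in_continuous(2)[OF c(2)] C1_at_in_continuous_curve[OF c(2)])
      (auto simp: C1_at_in_def)
  then have "continuous_on (ball t e) (speed A G \<gamma>)"
    by (rule continuous_on_eq) (use c C1_at_in_imp[OF c] in \<open>auto simp: C1_at_in_def image_subset_iff intro!: speed_eq[symmetric]\<close>)
  then show ?thesis
    using c(2) by (simp add: continuous_on_eq_continuous_at C1_at_in_def)
qed

end

section \<open>Lengths of curves\<close>

context riemannian
begin

text \<open>A version of \<open>piecewise_C1_curve\<close> for any interval, with no quantification
  over subintervals and charts. Differentiability is asked only at interior points off a finite set,
  a condition that is stable under restriction, affine reparametrization and concatenation.\<close>

definition regular_curve :: "(real \<Rightarrow> 'a) \<Rightarrow> real \<Rightarrow> real \<Rightarrow> bool" where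
  "regular_curve \<gamma> a b \<longleftrightarrow> continuous_on {a..b} \<gamma> \<and> (\<exists>S. finite S \<and> (\<forall>t\<in>{a<..<b} - S. C1_at A \<gamma> t))"

text \<open>The end points are left out because the two-sided derivative in \<open>speed\<close>
  depends there on values of the curve outside the interval.\<close>

definition len :: "(real \<Rightarrow> 'a) \<Rightarrow> real \<Rightarrow> real \<Rightarrow> ennreal" where
  "len \<gamma> a b = (\<integral>\<^sup>+t\<in>{a<..<b}. ennreal (speed A G \<gamma> t) \<partial>lborel)"

lemma regular_curve_piecewise_C1:
  assumes "regular_curve \<gamma> a b" "c \<in> A" "\<gamma> ` {a..b} \<subseteq> fst c"
  shows "(snd c \<circ> \<gamma>) piecewise_C1_differentiable_on {a..b}"
proof -
  obtain S where S: "finite S" "\<And>t. t \<in> {a<..<b} - S \<Longrightarrow> C1_at A \<gamma> t"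
    using assms(1) unfolding regular_curve_def by blast
  have "(snd c \<circ> \<gamma>) differentiable (at t) \<and> isCont (\<lambda>t. vector_derivative (snd c \<circ> \<gamma>) (at t)) t"
    if t: "t \<in> {a..b} - (S \<union> {a, b})" for t
  proof -
    have "C1_at A \<gamma> t" "\<gamma> t \<in> fst c"
      using t S assms(3) by (auto simp: image_subset_iff)
    then obtain e where e: "C1_at_in c \<gamma> t e"
      using C1_at_chart assms(2) by blast
    then have "t \<in> ball t e" by (simp add: C1_at_in_def)
    then show ?thesis
      using e C1_at_in_continuous(2)[OF e] unfolding C1_at_in_def C1_differentiable_on_eq
      by (simp add: continuous_on_eq_continuous_at)
  qed
  then have "(snd c \<circ> \<gamma>) C1_differentiable_on {a..b} - (S \<union> {a, b})"
    unfolding C1_differentiable_on_eq by (blast intro: continuous_at_imp_continuous_on)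
  moreover have "continuous_on {a..b} (snd c \<circ> \<gamma>)"
    using assms unfolding regular_curve_def
    by (intro continuous_on_compose continuous_on_subset[OF topological_chart_continuous(1)[OF chart_topological[OF assms(2)]]]) auto
  ultimately show ?thesis
    unfolding piecewise_C1_differentiable_on_def using S(1) by (meson finite.emptyI finite_insert finite_UnI)
qed

lemma regular_curve_subset:
  "regular_curve \<gamma> a b \<Longrightarrow> a \<le> a' \<Longrightarrow> b' \<le> b \<Longrightarrow> regular_curve \<gamma> a' b'"
  unfolding regular_curve_def
  by (auto intro: continuous_on_subset)

text \<open>The nontrivial direction is a bisection argument: near each time the curve stays in one
  chart, and when two adjacent intervals are joined, their exceptional sets and the common end point
  are collected.\<close>

lemma piecewise_C1_curve_iff: "piecewise_C1_curve A \<gamma> \<longleftrightarrow> regular_curve \<gamma> 0 1"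
proof
  assume r: "regular_curve \<gamma> 0 1"
  have "(snd c \<circ> \<gamma>) piecewise_C1_differentiable_on {a..b}"
    if "c \<in> A" "0 \<le> a" "b \<le> 1" "\<gamma> ` {a..b} \<subseteq> fst c" for a b c
    using that by (intro regular_curve_piecewise_C1 regular_curve_subset[OF r])
  then show "piecewise_C1_curve A \<gamma>"
    using r by (force simp: piecewise_C1_curve_def path_def regular_curve_def)
next
  assume p: "piecewise_C1_curve A \<gamma>"
  have cont: "continuous_on {0..1} \<gamma>"
    using p unfolding piecewise_C1_curve_def path_def by blast
  \<comment> \<open>The intervals that bisection tests around a time may stick out of the unit
    interval, hence the intersection with \<open>{0<..<1}\<close>.\<close>
  define P where "P a b \<longleftrightarrow> (\<exists>S. finite S \<and> (\<forall>t\<in>{a<..<b} \<inter> {0<..<1} - S. C1_at A \<gamma> t))" for a b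
  have "P 0 1"
  proof (rule Bolzano[of 0 1 P])
    fix a b c assume "P a b" "P b c" "a \<le> b" "b \<le> c"
    then obtain S S' where fin: "finite S" "finite S'"
      and S: "\<And>t. t \<in> {a<..<b} \<inter> {0<..<1} - S \<Longrightarrow> C1_at A \<gamma> t"
      and S': "\<And>t. t \<in> {b<..<c} \<inter> {0<..<1} - S' \<Longrightarrow> C1_at A \<gamma> t"
      unfolding P_def by (elim exE conjE) auto
    have "C1_at A \<gamma> t" if "t \<in> {a<..<c} \<inter> {0<..<1} - (S \<union> S' \<union> {b})" for t
      using that S[of t] S'[of t] by (cases "t < b") simp_all
    with fin show "P a c" unfolding P_def
      by (intro exI[of _ "S \<union> S' \<union> {b}"]) simp
  next
    fix x :: real assume local: "0 \<le> x" "x \<le> 1"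
    obtain c where c: "c \<in> A" "\<gamma> x \<in> fst c" using chart_exists by blast
    obtain d where d: "d > 0" "\<And>y. y \<in> {0..1} \<Longrightarrow> dist y x < d \<Longrightarrow> \<gamma> y \<in> fst c"
    proof -
      obtain T where T: "open T" "T \<inter> {0..1} = \<gamma> -` fst c \<inter> {0..1}"
        using cont topological_chart_open(1)[OF chart_topological[OF c(1)]]
        unfolding continuous_on_open_invariant by meson
      moreover have "x \<in> T"
      proof -
        have "x \<in> \<gamma> -` fst c \<inter> {0..1}" using c(2) local by simp
        then show ?thesis unfolding T(2)[symmetric] by simp
      qed
      ultimately obtain d where "d > 0" "\<forall>y. dist y x < d \<longrightarrow> y \<in> T"
        using open_dist by metis
      with T that show thesis by blast
    qed
    have "P a b" if ab: "a \<le> x" "x \<le> b" "b - a < d" for a b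
    proof (cases "max 0 a < min 1 b")
      case True
      let ?a = "max 0 a" and ?b = "min 1 b"
      have "\<gamma> ` {?a..?b} \<subseteq> fst c"
        using ab d(2) by (auto simp: dist_real_def)
      then have "(snd c \<circ> \<gamma>) piecewise_C1_differentiable_on {?a..?b}"
        using p c(1) True unfolding piecewise_C1_curve_def by (auto simp: case_prod_beta)
      then obtain S where S: "finite S" "(snd c \<circ> \<gamma>) C1_differentiable_on {?a..?b} - S"
        unfolding piecewise_C1_differentiable_on_def by blast
      have "C1_at A \<gamma> t" if "t \<in> {?a<..<?b} - S" for t
      proof -
        have "open ({?a<..<?b} - S)" using S(1) by (simp add: finite_imp_closed open_Diff)
        with that obtain e where "e > 0" "ball t e \<subseteq> {?a<..<?b} - S"
          using open_contains_ball by blast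
        moreover from this have "ball t e \<subseteq> {?a..?b} - S" by fastforce
        ultimately have "C1_at_in c \<gamma> t e"
          using \<open>\<gamma> ` {?a..?b} \<subseteq> fst c\<close> C1_differentiable_on_subset[OF S(2)]
          unfolding C1_at_in_def by blast
        then show ?thesis using c(1) unfolding C1_at_def by blast
      qed
      then show ?thesis using S(1) unfolding P_def by (intro exI[of _ S]) auto
    next
      case False
      then have "{a<..<b} \<inter> {0<..<1} = {}" by (auto simp: not_less min_le_iff_disj le_max_iff_disj)
      then show ?thesis unfolding P_def by (metis Diff_empty empty_iff finite.emptyI)
    qed
    then show "\<exists>d>0. \<forall>a b. a \<le> x \<and> x \<le> b \<and> b - a < d \<longrightarrow> P a b" using d(1) by blast
  qed simp
  then show "regular_curve \<gamma> 0 1"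
    using cont unfolding regular_curve_def P_def by auto
qed

lemma curve_length_eq_len: "curve_length A G \<gamma> = len \<gamma> 0 1"
  unfolding curve_length_def len_def
proof (rule nn_integral_cong_AE)
  show "AE t in lborel. ennreal (speed A G \<gamma> t) * indicator {0..1} t =
     ennreal (speed A G \<gamma> t) * indicator {0<..<1} t"
    using AE_lborel_singleton[of "0::real"] AE_lborel_singleton[of "1::real"]
    by eventually_elim (auto simp: indicator_def)
qed

lemma C1_at_cong:
  assumes "C1_at A \<gamma> t" "open T" "t \<in> T" "\<And>s. s \<in> T \<Longrightarrow> \<gamma>' s = \<gamma> s"
  shows "C1_at A \<gamma>' t" "speed A G \<gamma>' t = speed A G \<gamma> t"
proof -
  obtain c e where c: "c \<in> A" "C1_at_in c \<gamma> t e"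
    using assms(1) unfolding C1_at_def by blast
  obtain e0 where "e0 > 0" "ball t e0 \<subseteq> T"
    using assms open_contains_ball by blast
  define e' where "e' = min e e0"
  have e': "e' > 0" "ball t e' \<subseteq> ball t e" "ball t e' \<subseteq> T"
    using \<open>e0 > 0\<close> \<open>ball t e0 \<subseteq> T\<close> c by (auto simp: e'_def C1_at_in_def)
  have eq: "\<And>s. s \<in> ball t e' \<Longrightarrow> \<gamma>' s = \<gamma> s"
    using e' assms(4) by blast
  have hvd: "((snd c \<circ> \<gamma>') has_vector_derivative vector_derivative (snd c \<circ> \<gamma>) (at s)) (at s)"
    if s: "s \<in> ball t e'" for s
  proof (rule has_vector_derivative_transform_within_open[OF _ open_ball s])
    show "((snd c \<circ> \<gamma>) has_vector_derivative vector_derivative (snd c \<circ> \<gamma>) (at s)) (at s)"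
      using s e' by (intro C1_at_in_has_vector_derivative[OF c(2)]) auto
  qed (use eq in auto)
  have "(snd c \<circ> \<gamma>') C1_differentiable_on ball t e'"
    unfolding C1_differentiable_on_def
    using hvd continuous_on_subset[OF C1_at_in_continuous(2)[OF c(2)] e'(2)]
    by (intro exI[of _ "\<lambda>s. vector_derivative (snd c \<circ> \<gamma>) (at s)"]) simp
  then have "C1_at_in c \<gamma>' t e'"
    using c(2) e' eq unfolding C1_at_in_def by fastforce
  then show *: "C1_at A \<gamma>' t" using c(1) unfolding C1_at_def by blast
  have "\<gamma> t \<in> fst c" "\<gamma>' t = \<gamma> t"
    using c(2) eq[of t] e'(1) by (auto simp: C1_at_in_def)
  then show "speed A G \<gamma>' t = speed A G \<gamma> t"
    using vector_derivative_at[OF hvd[of t]] e'(1)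
    by (simp add: speed_eq[OF * c(1)] speed_eq[OF assms(1) c(1)])
qed

lemma C1_at_affine:
  assumes "C1_at A \<gamma> (m * t + k)" "m \<noteq> 0"
  shows "C1_at A (\<lambda>t. \<gamma> (m * t + k)) t" "speed A G (\<lambda>t. \<gamma> (m * t + k)) t = \<bar>m\<bar> * speed A G \<gamma> (m * t + k)"
proof -
  obtain c e where c: "c \<in> A" "C1_at_in c \<gamma> (m * t + k) e"
    using assms(1) unfolding C1_at_def by blast
  define e' where "e' = e / \<bar>m\<bar>"
  have "e' > 0" using c(2) assms(2) by (simp add: e'_def C1_at_in_def)
  have in_ball: "m * s + k \<in> ball (m * t + k) e" if "s \<in> ball t e'" for s
  proof -
    have "dist (m * t + k) (m * s + k) = \<bar>m\<bar> * \<bar>t - s\<bar>"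
      by (simp add: dist_real_def algebra_simps flip: abs_mult)
    then show ?thesis
      using that assms(2) by (simp add: e'_def dist_real_def field_simps)
  qed
  let ?d = "\<lambda>s. vector_derivative (snd c \<circ> \<gamma>) (at s)"
  have hvd: "((snd c \<circ> (\<lambda>t. \<gamma> (m * t + k))) has_vector_derivative m *\<^sub>R ?d (m * s + k)) (at s)"
    if s: "s \<in> ball t e'" for s
  proof -
    have "((snd c \<circ> \<gamma>) \<circ> (\<lambda>t. m * t + k) has_vector_derivative m *\<^sub>R ?d (m * s + k)) (at s)"
      by (rule vector_diff_chain_at[where f="\<lambda>t. m * t + k" and g="snd c \<circ> \<gamma>", OF _ C1_at_in_has_vector_derivative[OF c(2) in_ball[OF s]]])
        (auto intro!: derivative_eq_intros)
    then show ?thesis by (simp add: o_def)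
  qed
  have "continuous_on (ball t e') (\<lambda>s. m *\<^sub>R ?d (m * s + k))"
    by (intro continuous_on_scaleR continuous_on_const
        continuous_on_compose2[OF C1_at_in_continuous(2)[OF c(2)], of _ "\<lambda>s. m * s + k"] continuous_intros)
      (use in_ball in auto)
  then have "(snd c \<circ> (\<lambda>t. \<gamma> (m * t + k))) C1_differentiable_on ball t e'"
    unfolding C1_differentiable_on_def using hvd by (intro exI[of _ "\<lambda>s. m *\<^sub>R ?d (m * s + k)"]) simp
  then have "C1_at_in c (\<lambda>t. \<gamma> (m * t + k)) t e'"
    using c(2) \<open>e' > 0\<close> in_ball unfolding C1_at_in_def by blast
  then show *: "C1_at A (\<lambda>t. \<gamma> (m * t + k)) t" using c(1) unfolding C1_at_def by blast
  have "\<gamma> (m * t + k) \<in> fst c"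
    using c(2) by (auto simp: C1_at_in_def)
  then show "speed A G (\<lambda>t. \<gamma> (m * t + k)) t = \<bar>m\<bar> * speed A G \<gamma> (m * t + k)"
    using vector_derivative_at[OF hvd[of t]] \<open>e' > 0\<close>
    by (simp add: speed_eq[OF * c(1)] speed_eq[OF assms(1) c(1)] metric_norm_def scaleR_matrix_vector_assoc[symmetric]
        matrix_vector_mult_scaleR real_sqrt_mult flip: power2_eq_square mult.assoc)
qed

text \<open>Nothing is known about \<open>speed\<close> at the exceptional times, but a change on a
  finite set does not affect Borel measurability.\<close>

lemma len_measurable:
  assumes "regular_curve \<gamma> a b"
  shows "(\<lambda>t. ennreal (speed A G \<gamma> t) * indicator {a<..<b} t) \<in> borel_measurable borel"
proof -
  obtain S where S: "finite S" "\<And>t. t \<in> {a<..<b} - S \<Longrightarrow> C1_at A \<gamma> t"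
    using assms(1) unfolding regular_curve_def by blast
  have "continuous_on ({a<..<b} - S) (speed A G \<gamma>)"
    using S speed_continuous by (intro continuous_at_imp_continuous_on) blast
  moreover have "open ({a<..<b} - S)" using S(1) by (simp add: finite_imp_closed open_Diff)
  ultimately have "(\<lambda>t. indicator ({a<..<b} - S) t *\<^sub>R speed A G \<gamma> t) \<in> borel_measurable borel"
    by (intro borel_measurable_continuous_on_indicator) auto
  then have "(\<lambda>t. ennreal (indicator ({a<..<b} - S) t *\<^sub>R speed A G \<gamma> t)) \<in> borel_measurable borel"
    by measurable
  then show ?thesis
    by (rule measurable_discrete_difference[OF _ countable_finite[OF S(1)]])
      (auto simp: indicator_def)
qed

lemma len_split:
  assumes "regular_curve \<gamma> a b" "a \<le> c" "c \<le> b"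
  shows "len \<gamma> a b = len \<gamma> a c + len \<gamma> c b"
proof -
  have "len \<gamma> a b = (\<integral>\<^sup>+t. ennreal (speed A G \<gamma> t) * indicator {a<..<c} t +
      ennreal (speed A G \<gamma> t) * indicator {c<..<b} t \<partial>lborel)"
    unfolding len_def
  proof (rule nn_integral_cong_AE)
    show "AE t in lborel. ennreal (speed A G \<gamma> t) * indicator {a<..<b} t =
       ennreal (speed A G \<gamma> t) * indicator {a<..<c} t + ennreal (speed A G \<gamma> t) * indicator {c<..<b} t"
      using AE_lborel_singleton[of c] by eventually_elim (use assms in \<open>auto simp: indicator_def\<close>)
  qed
  also have "\<dots> = len \<gamma> a c + len \<gamma> c b"
    unfolding len_def using len_measurable[OF regular_curve_subset[OF assms(1)]] assms(2,3)
    by (intro nn_integral_add) auto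
  finally show ?thesis .
qed

lemma len_cong:
  assumes "regular_curve \<gamma> a b" "\<And>t. t \<in> {a<..<b} \<Longrightarrow> \<gamma>' t = \<gamma> t"
  shows "len \<gamma>' a b = len \<gamma> a b"
proof -
  obtain S where S: "finite S" "\<And>t. t \<in> {a<..<b} - S \<Longrightarrow> C1_at A \<gamma> t"
    using assms(1) unfolding regular_curve_def by blast
  have "AE t in lborel. t \<notin> S"
    using S(1) by (intro AE_not_in finite_imp_null_set_lborel)
  then show ?thesis unfolding len_def
  proof (intro nn_integral_cong_AE, eventually_elim)
    fix t assume "t \<notin> S"
    then show "ennreal (speed A G \<gamma>' t) * indicator {a<..<b} t = ennreal (speed A G \<gamma> t) * indicator {a<..<b} t"
      using C1_at_cong(2)[OF S(2), of t "{a<..<b}" \<gamma>'] assms(2) by (cases "t \<in> {a<..<b}") auto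
  qed
qed

text \<open>The factor \<open>\<bar>m\<bar>\<close> in the speed cancels against the substitution;
  \<open>min\<close> and \<open>max\<close> order the image interval for either sign of
  \<open>m\<close>. Positive \<open>m\<close> rescales or shifts a curve, and \<open>m = -1\<close>
  yields the symmetry of the distance.\<close>

lemma regular_curve_affine:
  assumes "regular_curve \<gamma> (min (m * a + k) (m * b + k)) (max (m * a + k) (m * b + k))" "m \<noteq> 0" "a \<le> b"
  shows "regular_curve (\<lambda>t. \<gamma> (m * t + k)) a b"
    "len (\<lambda>t. \<gamma> (m * t + k)) a b = len \<gamma> (min (m * a + k) (m * b + k)) (max (m * a + k) (m * b + k))"
proof -
  let ?a = "min (m * a + k) (m * b + k)" and ?b = "max (m * a + k) (m * b + k)"
  have mem: "m * t + k \<in> {?a<..<?b}" if "t \<in> {a<..<b}" for t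
    using that assms(2) by (cases "m > 0") (auto simp: min_less_iff_disj less_max_iff_disj mult_less_cancel_left)
  have mem_iff: "m * t + k \<in> {?a<..<?b} \<longleftrightarrow> t \<in> {a<..<b}" for t
    using assms(2,3) by (cases "m > 0") (auto simp: min_less_iff_disj less_max_iff_disj mult_less_cancel_left)
  have memc: "m * t + k \<in> {?a..?b}" if "t \<in> {a..b}" for t
    using that assms(2) by (cases "m > 0") (auto simp: min_le_iff_disj le_max_iff_disj mult_le_cancel_left)
  obtain S where S: "finite S" "\<And>t. t \<in> {?a<..<?b} - S \<Longrightarrow> C1_at A \<gamma> t"
    using assms(1) unfolding regular_curve_def by blast
  define S' where "S' = (\<lambda>s. (s - k) / m) ` S"
  have S': "finite S'" "\<And>t. t \<notin> S' \<Longrightarrow> m * t + k \<notin> S"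
    using S(1) assms(2) by (force simp: S'_def image_iff)+
  have C1: "C1_at A \<gamma> (m * t + k)" if "t \<in> {a<..<b} - S'" for t
    using that mem S(2) S'(2) by auto
  have "continuous_on {a..b} (\<lambda>t. \<gamma> (m * t + k))"
    using memc assms(1) unfolding regular_curve_def
    by (intro continuous_on_compose2[of "{?a..?b}" \<gamma> _ "\<lambda>t. m * t + k"] continuous_intros) auto
  with C1_at_affine(1)[OF C1 assms(2)] S'(1) show "regular_curve (\<lambda>t. \<gamma> (m * t + k)) a b"
    unfolding regular_curve_def by blast
  have "AE t in lborel. t \<notin> S'"
    using S'(1) by (intro AE_not_in finite_imp_null_set_lborel)
  then have "len (\<lambda>t. \<gamma> (m * t + k)) a b =
     (\<integral>\<^sup>+t. ennreal \<bar>m\<bar> * (ennreal (speed A G \<gamma> (k + m * t)) * indicator {?a<..<?b} (k + m * t)) \<partial>lborel)"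
    unfolding len_def
  proof (intro nn_integral_cong_AE, eventually_elim)
    fix t assume t: "t \<notin> S'"
    show "ennreal (speed A G (\<lambda>t. \<gamma> (m * t + k)) t) * indicator {a<..<b} t =
         ennreal \<bar>m\<bar> * (ennreal (speed A G \<gamma> (k + m * t)) * indicator {?a<..<?b} (k + m * t))"
      using mem_iff[of t] C1_at_affine(2)[OF C1 assms(2), of t] t
      by (cases "t \<in> {a<..<b}") (auto simp: add.commute ennreal_mult')
  qed
  also have "\<dots> = \<bar>m\<bar> * (\<integral>\<^sup>+t. ennreal (speed A G \<gamma> (k + m * t)) * indicator {?a<..<?b} (k + m * t) \<partial>lborel)"
    using measurable_compose[OF _ len_measurable[OF assms(1)], of "\<lambda>t. k + m * t" borel]
    by (intro nn_integral_cmult) auto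
  also have "\<dots> = len \<gamma> ?a ?b"
    unfolding len_def using nn_integral_real_affine[OF len_measurable[OF assms(1)] assms(2), of k] by simp
  finally show "len (\<lambda>t. \<gamma> (m * t + k)) a b = len \<gamma> ?a ?b" .
qed

text \<open>\<open>enn2real\<close> turns an infinite infimum into 0, which would spoil the triangle
  inequality. The extended distance is therefore used until connectedness makes it finite.\<close>

definition edist :: "'a \<Rightarrow> 'a \<Rightarrow> ennreal" where
  "edist x y = (INF \<gamma>\<in>{\<gamma>. regular_curve \<gamma> 0 1 \<and> \<gamma> 0 = x \<and> \<gamma> 1 = y}. len \<gamma> 0 1)"

lemma geodesic_dist_eq: "geodesic_dist A G x y = enn2real (edist x y)"
  unfolding geodesic_dist_def edist_def
  by (simp add: piecewise_C1_curve_iff curve_length_eq_len pathstart_def pathfinish_def)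

lemma edist_le_len:
  assumes "regular_curve \<gamma> a b" "a < b"
  shows "edist (\<gamma> a) (\<gamma> b) \<le> len \<gamma> a b"
proof -
  have eq: "min ((b - a) * 0 + a) ((b - a) * 1 + a) = a" "max ((b - a) * 0 + a) ((b - a) * 1 + a) = b"
    using assms(2) by auto
  note * = regular_curve_affine[of \<gamma> "b - a" 0 a 1, unfolded eq, OF assms(1)]
  show ?thesis unfolding edist_def
    by (rule INF_lower2[of "\<lambda>t. \<gamma> ((b - a) * t + a)"]) (use * assms(2) in auto)
qed

lemma edist_curve:
  assumes "edist x y < B"
  obtains \<gamma> where "regular_curve \<gamma> 0 1" "\<gamma> 0 = x" "\<gamma> 1 = y" "len \<gamma> 0 1 < B"
  using assms unfolding edist_def by (auto simp: INF_less_iff)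

lemma edist_sym_le: "edist x y \<le> edist y x"
proof (rule dense_ge)
  fix B assume "edist y x < B"
  then obtain \<gamma> where \<gamma>: "regular_curve \<gamma> 0 1" "\<gamma> 0 = y" "\<gamma> 1 = x" "len \<gamma> 0 1 < B"
    using edist_curve by blast
  have eq: "min ((-1) * 0 + 1) ((-1) * 1 + 1 :: real) = 0" "max ((-1) * 0 + 1) ((-1) * 1 + 1 :: real) = 1"
    by auto
  note * = regular_curve_affine[of \<gamma> "-1" 0 1 1, unfolded eq, OF \<gamma>(1)]
  have "edist ((\<lambda>t. \<gamma> ((-1) * t + 1)) 0) ((\<lambda>t. \<gamma> ((-1) * t + 1)) 1) \<le> len (\<lambda>t. \<gamma> ((-1) * t + 1)) 0 1"
    using * by (intro edist_le_len) auto
  then show "edist x y \<le> B"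
    using \<gamma> * by auto
qed

lemma edist_sym: "edist x y = edist y x"
  by (intro antisym edist_sym_le)

lemma edist_triangle: "edist x z \<le> edist x y + edist y z"
proof (rule ennreal_le_epsilon)
  fix e :: real assume "edist x y + edist y z < \<top>" "0 < e"
  then have fin: "edist x y < \<top>" "edist y z < \<top>" by auto
  have "edist x y < edist x y + ennreal (e / 2)" "edist y z < edist y z + ennreal (e / 2)"
    using fin \<open>0 < e\<close>
    by (cases "edist x y"; cases "edist y z"; simp add: ennreal_less_iff flip: ennreal_plus)+
  then obtain \<gamma> \<delta> where \<gamma>: "regular_curve \<gamma> 0 1" "\<gamma> 0 = x" "\<gamma> 1 = y" "len \<gamma> 0 1 < edist x y + ennreal (e / 2)"
    and \<delta>: "regular_curve \<delta> 0 1" "\<delta> 0 = y" "\<delta> 1 = z" "len \<delta> 0 1 < edist y z + ennreal (e / 2)"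
    using edist_curve by metis
  let ?\<delta> = "\<lambda>t. \<delta> (1 * t + (-1))"
  have \<delta>': "regular_curve ?\<delta> 1 2" "len ?\<delta> 1 2 = len \<delta> 0 1"
    using regular_curve_affine[of \<delta> 1 1 "-1" 2] \<delta>(1) by simp_all
  \<comment> \<open>The concatenation lives on \<open>{0..2}\<close>; \<open>edist_le_len\<close>
    rescales it to the unit interval.\<close>
  define \<eta> where "\<eta> t = (if t \<le> 1 then \<gamma> t else ?\<delta> t)" for t
  obtain S S' where S: "finite S" "\<And>t. t \<in> {0<..<1} - S \<Longrightarrow> C1_at A \<gamma> t"
    and S': "finite S'" "\<And>t. t \<in> {1<..<2} - S' \<Longrightarrow> C1_at A ?\<delta> t"
    using \<gamma>(1) \<delta>'(1) unfolding regular_curve_def by blast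
  have "continuous_on ({0..1} \<union> {1..2}) \<eta>"
    unfolding \<eta>_def using \<gamma>(1,3) \<delta>(2) \<delta>'(1) unfolding regular_curve_def
    by (intro continuous_on_If) auto
  moreover have "{0..1} \<union> {1..2} = {0..2::real}" by auto
  moreover have "C1_at A \<eta> t" if t: "t \<in> {0<..<2} - (S \<union> S' \<union> {1})" for t
  proof (cases "t < 1")
    case True
    then show ?thesis using t
      by (intro C1_at_cong(1)[OF S(2), of t "{..<1}"]) (auto simp: \<eta>_def)
  next
    case False
    then show ?thesis using t
      by (intro C1_at_cong(1)[OF S'(2), of t "{1<..}"]) (auto simp: \<eta>_def)
  qed
  ultimately have reg: "regular_curve \<eta> 0 2"
    unfolding regular_curve_def using S(1) S'(1) by (intro conjI exI[of _ "S \<union> S' \<union> {1}"]) auto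
  have "edist (\<eta> 0) (\<eta> 2) \<le> len \<eta> 0 2"
    by (rule edist_le_len[OF reg]) simp
  also have "\<dots> = len \<eta> 0 1 + len \<eta> 1 2"
    by (rule len_split[OF reg]) auto
  also have "len \<eta> 0 1 = len \<gamma> 0 1"
    by (rule len_cong[OF \<gamma>(1)]) (auto simp: \<eta>_def)
  also have "len \<eta> 1 2 = len \<delta> 0 1"
    unfolding \<delta>'(2)[symmetric] by (rule len_cong[OF \<delta>'(1)]) (auto simp: \<eta>_def)
  also have "len \<gamma> 0 1 + len \<delta> 0 1 \<le> (edist x y + ennreal (e / 2)) + (edist y z + ennreal (e / 2))"
    using \<gamma>(4) \<delta>(4) by (intro add_mono) auto
  also have "\<dots> = edist x y + edist y z + ennreal e"
    using \<open>0 < e\<close> by (simp add: algebra_simps flip: ennreal_plus)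
  finally show "edist x z \<le> edist x y + edist y z + ennreal e"
    using \<gamma>(2) \<delta>(3) by (simp add: \<eta>_def)
qed

end

section \<open>Comparison of the geodesic distance with coordinates\<close>

text \<open>The derivative may be unbounded near the points of \<open>S\<close>. The fundamental
  theorem is therefore applied to the gauge integral, which tolerates a finite exceptional set, and
  is transferred to the Lebesgue integral once the right-hand side is finite.\<close>

lemma norm_diff_le_nn_integral_deriv:
  fixes \<eta> :: "real \<Rightarrow> 'b::euclidean_space"
  assumes "a \<le> b" "finite S" "continuous_on {a..b} \<eta>"
    and D: "\<And>t. t \<in> {a<..<b} - S \<Longrightarrow> (\<eta> has_vector_derivative D t) (at t)"
    and contD: "continuous_on ({a<..<b} - S) D"
  shows "ennreal (norm (\<eta> b - \<eta> a)) \<le> (\<integral>\<^sup>+t\<in>{a<..<b} - S. ennreal (norm (D t)) \<partial>lborel)"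
proof (cases "(\<integral>\<^sup>+t\<in>{a<..<b} - S. ennreal (norm (D t)) \<partial>lborel) = \<infinity>")
  case False
  let ?D = "\<lambda>t. indicator ({a<..<b} - S) t *\<^sub>R D t"
  have "open ({a<..<b} - S)" using \<open>finite S\<close> by (simp add: finite_imp_closed open_Diff)
  then have m: "?D \<in> borel_measurable borel"
    using contD by (intro borel_measurable_continuous_on_indicator) auto
  have eq: "(\<integral>\<^sup>+t. ennreal (norm (?D t)) \<partial>lborel) = (\<integral>\<^sup>+t\<in>{a<..<b} - S. ennreal (norm (D t)) \<partial>lborel)"
    by (intro nn_integral_cong) (auto simp: indicator_def)
  have int: "integrable lborel ?D"
    using m False eq by (intro integrableI_bounded) (simp_all add: less_top)
  have "(D has_integral (\<eta> b - \<eta> a)) {a..b}"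
    using assms by (intro fundamental_theorem_of_calculus_interior_strong[of S]) auto
  then have "((\<lambda>t. if t \<in> {a..b} then D t else 0) has_integral (\<eta> b - \<eta> a)) UNIV"
    unfolding has_integral_restrict_UNIV .
  then have "(?D has_integral (\<eta> b - \<eta> a)) UNIV"
    by (rule has_integral_spike[rotated 2, of _ _ _ "S \<union> {a, b}"])
      (use \<open>finite S\<close> in \<open>auto simp: indicator_def intro!: negligible_finite\<close>)
  moreover have "(?D has_integral (integral\<^sup>L lborel ?D)) UNIV"
    by (rule has_integral_integral_lborel[OF int])
  ultimately have "\<eta> b - \<eta> a = integral\<^sup>L lborel ?D"
    by (rule has_integral_unique)
  then show ?thesis
    using integral_norm_bound_ennreal[OF int] unfolding eq by simp
qed simp

context riemannian
begin

lemma metric_norm_scaleR: "metric_norm G c p (k *\<^sub>R v) = \<bar>k\<bar> * metric_norm G c p v"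
  by (simp add: metric_norm_def matrix_vector_mult_scaleR real_sqrt_mult flip: power2_eq_square mult.assoc)

lemma metric_norm_pos: "c \<in> A \<Longrightarrow> p \<in> fst c \<Longrightarrow> v \<noteq> 0 \<Longrightarrow> metric_norm G c p v > 0"
  by (simp add: metric_norm_def metric_pos)

text \<open>By homogeneity unit vectors suffice; on the compact product of ball and sphere the norm
  is continuous and positive and so attains positive extrema.\<close>

lemma metric_norm_bounds:
  assumes c: "c \<in> A" and u0: "u0 \<in> snd c ` fst c"
  obtains r \<alpha> \<beta> where "r > 0" "\<alpha> > 0" "\<beta> > 0" "cball u0 r \<subseteq> snd c ` fst c"
    "\<And>u v. u \<in> cball u0 r \<Longrightarrow> \<alpha> * norm v \<le> metric_norm G c (chart_inv c u) v"
    "\<And>u v. u \<in> cball u0 r \<Longrightarrow> metric_norm G c (chart_inv c u) v \<le> \<beta> * norm v"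
proof -
  note tc = chart_topological[OF c]
  obtain r where r: "r > 0" "cball u0 r \<subseteq> snd c ` fst c"
    using open_contains_cball topological_chart_open(2)[OF tc] u0 by metis
  let ?K = "cball u0 r \<times> sphere (0::real^'d) 1"
  let ?f = "\<lambda>x. metric_norm G c (chart_inv c (fst x)) (snd x)"
  obtain v0 :: "real^'d" where "norm v0 = 1" using vector_choose_size[of 1] by auto
  then have ne: "?K \<noteq> {}" using r by force
  have cpt: "compact ?K" by (intro compact_Times) auto
  have dom: "chart_inv c u \<in> fst c" if "u \<in> cball u0 r" for u
    using that r topological_chart_inv(3)[OF tc] by blast
  have cont: "continuous_on ?K ?f"
  proof (rule metric_continuous[OF c])
    show "continuous_on ?K (\<lambda>x. chart_inv c (fst x))"
      using r by (intro continuous_on_compose2[OF topological_chart_continuous(2)[OF tc]] continuous_intros) auto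
  qed (use dom in \<open>auto intro!: continuous_intros\<close>)
  obtain x1 where x1: "x1 \<in> ?K" "\<And>x. x \<in> ?K \<Longrightarrow> ?f x1 \<le> ?f x"
    using continuous_attains_inf[OF cpt ne cont] by blast
  obtain x2 where x2: "x2 \<in> ?K" "\<And>x. x \<in> ?K \<Longrightarrow> ?f x \<le> ?f x2"
    using continuous_attains_sup[OF cpt ne cont] by blast
  have pos: "?f x > 0" if "x \<in> ?K" for x
    using that dom by (intro metric_norm_pos[OF c]) auto
  have scale: "metric_norm G c (chart_inv c u) v = norm v * ?f (u, (1 / norm v) *\<^sub>R v)" for u v
    by (simp add: metric_norm_scaleR) (simp add: metric_norm_def)
  have K: "(u, (1 / norm v) *\<^sub>R v) \<in> ?K" if "u \<in> cball u0 r" "v \<noteq> 0" for u v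
    using that by simp
  show thesis
  proof (rule that[OF r(1) pos[OF x1(1)] pos[OF x2(1)] r(2)])
    fix u and v :: "real^'d" assume u: "u \<in> cball u0 r"
    show "?f x1 * norm v \<le> metric_norm G c (chart_inv c u) v"
    proof (cases "v = 0")
      case False
      show ?thesis unfolding scale[of u v]
        using x1(2)[OF K[OF u False]] by (simp add: mult.commute[of "norm v"] mult_right_mono del: fst_conv snd_conv)
    qed (simp add: metric_norm_def)
    show "metric_norm G c (chart_inv c u) v \<le> ?f x2 * norm v"
    proof (cases "v = 0")
      case False
      show ?thesis unfolding scale[of u v]
        using x2(2)[OF K[OF u False]] by (simp add: mult.commute[of "norm v"] mult_right_mono del: fst_conv snd_conv)
    qed (simp add: metric_norm_def)
  qed
qed

text \<open>Allows curves to be built in coordinates. It serves for straight segments and for the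
  bent curves of the semiconcavity estimate.\<close>

lemma chart_curve:
  assumes c: "c \<in> A" and S: "finite S" and cont: "continuous_on {a..b} \<eta>" and im: "\<eta> ` {a..b} \<subseteq> snd c ` fst c"
    and D: "\<And>t. t \<in> {a<..<b} - S \<Longrightarrow> (\<eta> has_vector_derivative D t) (at t)"
    and contD: "continuous_on ({a<..<b} - S) D"
  shows "regular_curve (\<lambda>t. chart_inv c (\<eta> t)) a b"
    "\<And>t. t \<in> {a<..<b} - S \<Longrightarrow> C1_at A (\<lambda>t. chart_inv c (\<eta> t)) t"
    "\<And>t. t \<in> {a<..<b} - S \<Longrightarrow> speed A G (\<lambda>t. chart_inv c (\<eta> t)) t = metric_norm G c (chart_inv c (\<eta> t)) (D t)"
proof -
  note tc = chart_topological[OF c]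
  let ?\<gamma> = "\<lambda>t. chart_inv c (\<eta> t)"
  have im': "\<eta> t \<in> snd c ` fst c" if "t \<in> {a..b}" for t using that im by blast
  have *: "C1_at A ?\<gamma> t \<and> speed A G ?\<gamma> t = metric_norm G c (?\<gamma> t) (D t)" if t: "t \<in> {a<..<b} - S" for t
  proof -
    have "open ({a<..<b} - S)" using S(1) by (simp add: finite_imp_closed open_Diff)
    with t obtain e where e: "e > 0" "ball t e \<subseteq> {a<..<b} - S"
      using open_contains_ball by blast
    have eq: "(snd c \<circ> ?\<gamma>) s = \<eta> s" "?\<gamma> s \<in> fst c" if "s \<in> ball t e" for s
    proof -
      have "s \<in> {a..b}" using that e(2) by auto
      then show "(snd c \<circ> ?\<gamma>) s = \<eta> s" "?\<gamma> s \<in> fst c"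
        using im' topological_chart_inv(2,3)[OF tc] by auto
    qed
    have hvd: "((snd c \<circ> ?\<gamma>) has_vector_derivative D s) (at s)" if s: "s \<in> ball t e" for s
      by (rule has_vector_derivative_transform_within_open[OF D open_ball s])
        (use s e(2) eq(1) in auto)
    have "(snd c \<circ> ?\<gamma>) C1_differentiable_on ball t e"
      unfolding C1_differentiable_on_def using hvd continuous_on_subset[OF contD e(2)]
      by (intro exI[of _ D]) simp
    then have 1: "C1_at_in c ?\<gamma> t e"
      using e(1) eq(2) unfolding C1_at_in_def by blast
    then have 2: "C1_at A ?\<gamma> t" using c unfolding C1_at_def by blast
    have "vector_derivative (snd c \<circ> ?\<gamma>) (at t) = D t"
      using e(1) by (intro vector_derivative_at hvd) simp
    then show ?thesis
      using 2 speed_eq[OF 2 c] eq(2)[of t] e(1) by simp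
  qed
  have "continuous_on {a..b} ?\<gamma>"
    using im by (intro continuous_on_compose2[OF topological_chart_continuous(2)[OF tc] cont])
  with * S show "regular_curve ?\<gamma> a b" unfolding regular_curve_def by blast
  show "\<And>t. t \<in> {a<..<b} - S \<Longrightarrow> C1_at A ?\<gamma> t"
    "\<And>t. t \<in> {a<..<b} - S \<Longrightarrow> speed A G ?\<gamma> t = metric_norm G c (?\<gamma> t) (D t)"
    using * by auto
qed

lemma AE_not_in_finite: "finite S \<Longrightarrow> AE t::real in lborel. t \<notin> S"
  by (intro AE_not_in finite_imp_null_set_lborel)

lemma edist_le_chart:
  assumes c: "c \<in> A" and dom: "cball u0 r \<subseteq> snd c ` fst c"
    and \<beta>: "\<And>u v. u \<in> cball u0 r \<Longrightarrow> metric_norm G c (chart_inv c u) v \<le> \<beta> * norm v"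
    and uv: "u \<in> cball u0 r" "v \<in> cball u0 r"
  shows "edist (chart_inv c u) (chart_inv c v) \<le> ennreal (\<beta> * norm (u - v))"
proof -
  let ?\<eta> = "\<lambda>t::real. u + t *\<^sub>R (v - u)"
  have mem: "?\<eta> t \<in> cball u0 r" if "t \<in> {0..1}" for t
  proof -
    have "?\<eta> t = (1 - t) *\<^sub>R u + t *\<^sub>R v" by (simp add: algebra_simps)
    then show ?thesis using that uv convexD_alt[OF convex_cball, of u u0 r v t] by simp
  qed
  note cc = chart_curve[OF c, of "{}" 0 1 ?\<eta> "\<lambda>_. v - u"]
  have reg: "regular_curve (\<lambda>t. chart_inv c (?\<eta> t)) 0 1"
    using mem dom by (intro cc) (auto intro!: continuous_intros derivative_eq_intros)
  have sp: "speed A G (\<lambda>t. chart_inv c (?\<eta> t)) t = metric_norm G c (chart_inv c (?\<eta> t)) (v - u)"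
    if "t \<in> {0<..<1}" for t
    using mem dom that by (intro cc) (auto intro!: continuous_intros derivative_eq_intros)
  have "edist (chart_inv c (?\<eta> 0)) (chart_inv c (?\<eta> 1)) \<le> len (\<lambda>t. chart_inv c (?\<eta> t)) 0 1"
    by (rule edist_le_len[OF reg]) simp
  also have "\<dots> \<le> (\<integral>\<^sup>+t\<in>{0<..<1::real}. ennreal (\<beta> * norm (u - v)) \<partial>lborel)"
    unfolding len_def
  proof (rule nn_integral_mono)
    fix t :: real
    show "ennreal (speed A G (\<lambda>t. chart_inv c (?\<eta> t)) t) * indicator {0<..<1} t
         \<le> ennreal (\<beta> * norm (u - v)) * indicator {0<..<1} t"
    proof (cases "t \<in> {0<..<1}")
      case True
      then show ?thesis using sp[OF True] \<beta>[OF mem[of t], of "v - u"]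
        by (auto intro!: ennreal_leI simp: norm_minus_commute)
    qed simp
  qed
  also have "\<dots> = ennreal (\<beta> * norm (u - v))" by (simp add: nn_integral_cmult)
  finally show ?thesis by simp
qed

text \<open>Being at finite distance is an equivalence relation, and its classes are open since
  coordinate segments have finite length; connectedness leaves a single class.\<close>

lemma edist_finite:
  assumes "connected (UNIV :: 'a set)"
  shows "edist x y < \<infinity>"
proof -
  have "edist x y < \<infinity>"
  proof (rule connected_equivalence_relation[of UNIV x y "\<lambda>x y. edist x y < \<infinity>", OF assms])
    fix x y z assume "edist x y < \<infinity>" "edist y z < \<infinity>"
    then show "edist x z < \<infinity>"
      using edist_triangle[of x z y] by (metis ennreal_add_less_top infinity_ennreal_def le_less_trans)
  next
    fix p
    obtain c where c: "c \<in> A" "p \<in> fst c" using chart_exists by blast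
    note tc = chart_topological[OF c(1)]
    obtain r \<alpha> \<beta> where r: "r > 0" "cball (snd c p) r \<subseteq> snd c ` fst c"
      and \<beta>: "\<And>u v. u \<in> cball (snd c p) r \<Longrightarrow> metric_norm G c (chart_inv c u) v \<le> \<beta> * norm v"
      using metric_norm_bounds[OF c(1), of "snd c p"] c(2) by (metis image_eqI)
    let ?T = "chart_inv c ` ball (snd c p) r"
    have "open ?T" using r by (intro topological_chart_open_inv_image[OF tc]) auto
    moreover have "p \<in> ?T"
      using r(1) topological_chart_inv(1)[OF tc c(2)] by (metis centre_in_ball image_eqI)
    moreover have "edist p x < \<infinity>" if "x \<in> ?T" for x
    proof -
      obtain v where v: "v \<in> ball (snd c p) r" "x = chart_inv c v" using \<open>x \<in> ?T\<close> by blast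
      have "edist (chart_inv c (snd c p)) (chart_inv c v) \<le> ennreal (\<beta> * norm (snd c p - v))"
        using v r by (intro edist_le_chart[OF c(1) r(2) \<beta>]) auto
      then show ?thesis using v topological_chart_inv(1)[OF tc c(2)]
        by (simp add: le_less_trans[OF _ ennreal_less_top])
    qed
    ultimately show "\<exists>T. openin (top_of_set UNIV) T \<and> p \<in> T \<and> (\<forall>x\<in>T. edist p x < \<infinity>)"
      by (auto intro!: exI[of _ ?T])
  qed (auto simp: edist_sym)
  then show ?thesis .
qed

text \<open>Until its first exit from the coordinate ball the curve runs in the chart, where its
  speed is at least \<open>\<alpha>\<close> times the Euclidean speed, and up to then it covers the
  Euclidean distance \<open>s\<close>.\<close>

lemma edist_ge_chart:
  assumes c: "c \<in> A" and dom: "cball u s \<subseteq> snd c ` fst c" and "0 < s" "0 \<le> \<alpha>"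
    and \<alpha>: "\<And>w v. w \<in> cball u s \<Longrightarrow> \<alpha> * norm v \<le> metric_norm G c (chart_inv c w) v"
    and \<gamma>: "regular_curve \<gamma> 0 1" "\<gamma> 0 = chart_inv c u" "t0 \<in> {0..1}" "\<gamma> t0 \<notin> chart_inv c ` ball u s"
  shows "ennreal (\<alpha> * s) \<le> len \<gamma> 0 1"
proof -
  note tc = chart_topological[OF c]
  let ?B = "chart_inv c ` ball u s" and ?C = "chart_inv c ` cball u s"
  have "open ?B" using dom by (intro topological_chart_open_inv_image[OF tc]) auto
  have "compact ?C" using dom
    by (intro compact_continuous_image continuous_on_subset[OF topological_chart_continuous(2)[OF tc]]) auto
  \<comment> \<open>Compact sets are closed because the manifold is Hausdorff. Hence the curve is
    still in the chart domain at the exit time itself.\<close>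
  then have "closed ?C" by (rule compact_imp_closed)
  define T where "T = {0..1} \<inter> \<gamma> -` (- ?B)"
  have cont: "continuous_on {0..1} \<gamma>" using \<gamma>(1) unfolding regular_curve_def by blast
  have "closed T" unfolding T_def using cont \<open>open ?B\<close> by (intro continuous_closed_preimage) auto
  moreover have "T \<noteq> {}" using \<gamma>(3,4) by (auto simp: T_def)
  moreover have bdd: "bdd_below T" unfolding T_def by auto
  ultimately have "Inf T \<in> T" by (intro closed_contains_Inf)
  define t1 where "t1 = Inf T"
  have t1: "t1 \<in> {0..1}" "\<gamma> t1 \<notin> ?B" using \<open>Inf T \<in> T\<close> by (auto simp: t1_def T_def)
  have below: "\<gamma> t \<in> ?B" if "0 \<le> t" "t < t1" for t
    using that t1(1) cInf_lower[OF _ bdd, of t] by (fastforce simp: t1_def T_def)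
  have "t1 \<noteq> 0" using t1(2) \<gamma>(2) \<open>0 < s\<close> by auto
  then have "0 < t1" using t1(1) by auto
  have inC: "\<gamma> t \<in> ?C" if "t \<in> {0..t1}" for t
  proof (cases "t < t1")
    case True
    then show ?thesis using below[of t] that by auto
  next
    case False
    then have "t = t1" using that by simp
    have "\<gamma> ` {0<..<t1} \<subseteq> ?C"
    proof (intro image_subsetI)
      fix t assume "t \<in> {0<..<t1}"
      then have "\<gamma> t \<in> ?B" by (intro below) auto
      then show "\<gamma> t \<in> ?C" using ball_subset_cball by blast
    qed
    then have "\<gamma> ` closure {0<..<t1} \<subseteq> ?C"
      using \<open>0 < t1\<close> t1(1)
      by (intro image_closure_subset continuous_on_subset[OF cont] \<open>closed ?C\<close>) auto
    then show ?thesis using \<open>t = t1\<close> \<open>0 < t1\<close> by auto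
  qed
  define \<eta> where "\<eta> = snd c \<circ> \<gamma>"
  have \<eta>: "\<eta> t \<in> cball u s" "chart_inv c (\<eta> t) = \<gamma> t" "\<gamma> t \<in> fst c" if t: "t \<in> {0..t1}" for t
  proof -
    obtain w where w: "w \<in> cball u s" "\<gamma> t = chart_inv c w" using inC[OF t] by blast
    then show "\<eta> t \<in> cball u s" "chart_inv c (\<eta> t) = \<gamma> t" "\<gamma> t \<in> fst c"
      using dom topological_chart_inv[OF tc] by (auto simp: \<eta>_def subset_eq)
  qed
  have "\<eta> 0 = u" using \<gamma>(2) subsetD[OF dom, of u] \<open>0 < s\<close> topological_chart_inv(2)[OF tc, of u] by (auto simp: \<eta>_def)
  have "\<eta> t1 \<notin> ball u s" using \<eta>(2)[of t1] t1 \<open>0 < t1\<close> by force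
  then have "norm (\<eta> t1 - \<eta> 0) \<ge> s" using \<open>\<eta> 0 = u\<close> by (simp add: dist_norm norm_minus_commute)
  have reg: "regular_curve \<gamma> 0 t1" by (rule regular_curve_subset[OF \<gamma>(1)]) (use t1 in auto)
  then obtain S where S: "finite S" "\<And>t. t \<in> {0<..<t1} - S \<Longrightarrow> C1_at A \<gamma> t"
    unfolding regular_curve_def by blast
  let ?D = "\<lambda>t. vector_derivative \<eta> (at t)"
  have D: "(\<eta> has_vector_derivative ?D t) (at t) \<and> isCont ?D t" if t: "t \<in> {0<..<t1} - S" for t
  proof -
    obtain e where e: "C1_at_in c \<gamma> t e"
      using C1_at_chart[OF S(2)[OF t] c] \<eta>(3) t by auto
    then have "t \<in> ball t e" by (simp add: C1_at_in_def)
    then show ?thesis using C1_at_in_has_vector_derivative[OF e] C1_at_in_continuous(2)[OF e]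
      by (simp add: \<eta>_def continuous_on_eq_continuous_at)
  qed
  have "ennreal s \<le> ennreal (norm (\<eta> t1 - \<eta> 0))" using \<open>norm (\<eta> t1 - \<eta> 0) \<ge> s\<close> by (rule ennreal_leI)
  also have "\<dots> \<le> (\<integral>\<^sup>+t\<in>{0<..<t1} - S. ennreal (norm (?D t)) \<partial>lborel)"
  proof (rule norm_diff_le_nn_integral_deriv[OF _ S(1)])
    show "continuous_on {0..t1} \<eta>" unfolding \<eta>_def using \<eta>(3) t1(1)
      by (intro continuous_on_compose continuous_on_subset[OF cont] continuous_on_subset[OF topological_chart_continuous(1)[OF tc]]) auto
    show "continuous_on ({0<..<t1} - S) ?D" using D by (intro continuous_at_imp_continuous_on) auto
  qed (use D \<open>0 < t1\<close> in auto)
  finally have "ennreal \<alpha> * ennreal s \<le> ennreal \<alpha> * (\<integral>\<^sup>+t\<in>{0<..<t1} - S. ennreal (norm (?D t)) \<partial>lborel)"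
    by (intro mult_left_mono) auto
  also have "\<dots> = (\<integral>\<^sup>+t. ennreal \<alpha> * (ennreal (norm (?D t)) * indicator ({0<..<t1} - S) t) \<partial>lborel)"
  proof (rule nn_integral_cmult[symmetric])
    have "open ({0<..<t1} - S)" using S(1) by (simp add: finite_imp_closed open_Diff)
    moreover have "continuous_on ({0<..<t1} - S) (\<lambda>t. norm (?D t))"
      using D by (intro continuous_at_imp_continuous_on ballI isCont_norm) auto
    ultimately have "(\<lambda>t. indicator ({0<..<t1} - S) t *\<^sub>R norm (?D t)) \<in> borel_measurable borel"
      by (intro borel_measurable_continuous_on_indicator) auto
    then have "(\<lambda>t. ennreal (indicator ({0<..<t1} - S) t *\<^sub>R norm (?D t))) \<in> borel_measurable borel"
      by measurable
    then show "(\<lambda>t. ennreal (norm (?D t)) * indicator ({0<..<t1} - S) t) \<in> borel_measurable lborel"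
      by (subst measurable_lborel2, rule measurable_cong[THEN iffD1, rotated]) (auto simp: indicator_def)
  qed
  also have "\<dots> \<le> len \<gamma> 0 t1"
    unfolding len_def
  proof (rule nn_integral_mono)
    fix t
    show "ennreal \<alpha> * (ennreal (norm (?D t)) * indicator ({0<..<t1} - S) t) \<le>
       ennreal (speed A G \<gamma> t) * indicator {0<..<t1} t"
    proof (cases "t \<in> {0<..<t1} - S")
      case True
      then have "\<alpha> * norm (?D t) \<le> speed A G \<gamma> t"
        using \<alpha>[of "\<eta> t" "?D t"] \<eta>[of t] by (simp add: speed_eq[OF S(2)[OF True] c] \<eta>_def)
      then show ?thesis using True \<open>0 \<le> \<alpha>\<close> by (simp add: ennreal_leI flip: ennreal_mult')
    qed simp
  qed
  also have "\<dots> \<le> len \<gamma> 0 1"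
    using len_split[OF \<gamma>(1), of t1] t1(1) by simp
  finally show ?thesis using \<open>0 < s\<close> \<open>0 \<le> \<alpha>\<close> by (simp add: ennreal_mult)
qed

end

section \<open>The Hopf--Rinow theorem for length spaces\<close>

text \<open>Points that lie almost between two given points, at any prescribed distance from the
  first, take the place of geodesics.\<close>

locale approx_length_space = Metric_space UNIV d for d :: "'a \<Rightarrow> 'a \<Rightarrow> real" +
  assumes approx_between: "\<And>x y s e. 0 \<le> s \<Longrightarrow> s \<le> d x y \<Longrightarrow> 0 < e \<Longrightarrow> \<exists>z. d x z \<le> s \<and> d z y \<le> d x y - s + e"
    and locally_compact: "\<And>p. \<exists>r>0. compactin mtopology (mcball p r)"
    and complete: "mcomplete"
begin

lemma compactin_if_mtotally_bounded:
  assumes "mtotally_bounded S" "closedin mtopology S"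
  shows "compactin mtopology S"
proof -
  have "\<exists>l r. l \<in> S \<and> strict_mono r \<and> limitin mtopology (\<sigma> \<circ> r) l sequentially" if "range \<sigma> \<subseteq> S" for \<sigma> :: "nat \<Rightarrow> 'a"
  proof -
    obtain r where r: "strict_mono r" "MCauchy (\<sigma> \<circ> r)"
      using assms(1) \<open>range \<sigma> \<subseteq> S\<close> unfolding mtotally_bounded_sequentially by blast
    then obtain l where l: "limitin mtopology (\<sigma> \<circ> r) l sequentially"
      using complete unfolding mcomplete_def by blast
    moreover have "l \<in> S"
      by (rule limitin_closedin[OF l assms(2)]) (use that in \<open>auto simp: image_subset_iff\<close>)
    ultimately show ?thesis using r(1) by blast
  qed
  then show ?thesis by (simp add: compactin_sequentially)
qed

text \<open>Points of the large ball are close to a slightly smaller ball, so a net of the latter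
  serves for the former. Together with completeness, total boundedness gives compactness.\<close>

lemma compactin_mcball_sup:
  assumes "R > 0" "\<And>r. 0 \<le> r \<Longrightarrow> r < R \<Longrightarrow> compactin mtopology (mcball p r)"
  shows "compactin mtopology (mcball p R)"
proof (rule compactin_if_mtotally_bounded)
  show "mtotally_bounded (mcball p R)"
    unfolding mtotally_bounded_def
  proof (intro allI impI)
    fix e :: real assume "e > 0"
    \<comment> \<open>A point of the \<open>R\<close>-ball is at most
      \<open>(R - r) + e / 4 \<le> e / 2\<close> away from the smaller ball, whose net has mesh
      \<open>e / 4\<close>.\<close>
    define r where "r = max 0 (R - e / 4)"
    have r: "0 \<le> r" "r < R" "R - r \<le> e / 4"
      using \<open>e > 0\<close> assms(1) by (auto simp: r_def max_def)
    have "mtotally_bounded (mcball p r)"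
      using compactin_imp_mtotally_bounded[OF assms(2)[OF r(1,2)]] .
    then obtain K where K: "finite K" "K \<subseteq> mcball p r" "mcball p r \<subseteq> (\<Union>x\<in>K. mball x (e / 4))"
      unfolding mtotally_bounded_def using \<open>e > 0\<close> by (metis divide_pos_pos zero_less_numeral)
    have "y \<in> (\<Union>x\<in>K. mball x e)" if y: "y \<in> mcball p R" for y
    proof -
      obtain z where z: "d p z \<le> r" "d z y \<le> e / 2"
      proof (cases "d p y \<le> r")
        case True
        then show thesis using \<open>e > 0\<close> that[of y] by (simp add: mdist_zero)
      next
        case False
        then obtain z where "d p z \<le> r" "d z y \<le> d p y - r + e / 4"
          using approx_between[of r p y "e / 4"] \<open>e > 0\<close> r(1) by auto
        moreover have "d p y \<le> R" using y by simp
        ultimately show thesis using that[of z] r(3) by auto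
      qed
      then obtain x where "x \<in> K" "d x z < e / 4" using K(3) by auto
      then have "d x y < e" using triangle[of x z y] z(2) \<open>e > 0\<close> by simp
      with \<open>x \<in> K\<close> show ?thesis by auto
    qed
    then show "\<exists>K. finite K \<and> K \<subseteq> mcball p R \<and> mcball p R \<subseteq> (\<Union>x\<in>K. mball x e)"
      using K(1,2) r(2) by (intro exI[of _ K]) auto
  qed
qed (rule closedin_mcball)

lemma compactin_mcball_extend:
  assumes "R \<ge> 0" "compactin mtopology (mcball p R)"
  obtains e where "e > 0" "compactin mtopology (mcball p (R + e))"
proof -
  obtain r where r: "\<And>x. r x > 0" "\<And>x. compactin mtopology (mcball x (r x))"
    using locally_compact by metis
  have "\<exists>\<F>. finite \<F> \<and> \<F> \<subseteq> (\<lambda>x. mball x (r x / 2)) ` mcball p R \<and> mcball p R \<subseteq> \<Union>\<F>"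
    by (rule compactinD[OF assms(2)]) (use r(1) in \<open>auto simp: mdist_zero\<close>)
  then obtain \<F> where \<F>: "finite \<F>" "\<F> \<subseteq> (\<lambda>x. mball x (r x / 2)) ` mcball p R" "mcball p R \<subseteq> \<Union>\<F>"
    by auto
  then obtain K where "K \<subseteq> mcball p R" "finite K" "\<F> = (\<lambda>x. mball x (r x / 2)) ` K"
    using finite_subset_image[OF \<F>(1,2)] by auto
  with \<F> have K: "finite K" "K \<subseteq> mcball p R" "mcball p R \<subseteq> (\<Union>x\<in>K. mball x (r x / 2))"
    by auto
  have "p \<in> mcball p R" using assms(1) by simp
  then have "K \<noteq> {}" using K(3) by auto
  \<comment> \<open>Points of the enlarged ball are within \<open>2 * e \<le> r x / 3\<close> of a
    half ball, whose radius is \<open>r x / 2\<close>; so they stay in the compact ball of radius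
    \<open>r x\<close>.\<close>
  define e where "e = Min (r ` K) / 6"
  have e: "e > 0" "\<And>x. x \<in> K \<Longrightarrow> e \<le> r x / 6"
    using K(1) \<open>K \<noteq> {}\<close> r(1) by (auto simp: e_def)
  have "y \<in> (\<Union>x\<in>K. mcball x (r x))" if y: "y \<in> mcball p (R + e)" for y
  proof -
    obtain z where z: "d p z \<le> R" "d z y \<le> 2 * e"
    proof (cases "d p y \<le> R")
      case True
      then show thesis using \<open>e > 0\<close> that[of y] by (simp add: mdist_zero)
    next
      case False
      then obtain z where "d p z \<le> R" "d z y \<le> d p y - R + e"
        using approx_between[of R p y e] \<open>e > 0\<close> assms(1) by auto
      moreover have "d p y \<le> R + e" using y by simp
      ultimately show thesis using that[of z] by auto
    qed
    then obtain x where "x \<in> K" "d x z < r x / 2" using K(3) by auto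
    then have "d x y \<le> r x" using triangle[of x z y] z(2) e(2)[of x] r(1)[of x] by simp
    with \<open>x \<in> K\<close> show ?thesis by auto
  qed
  then have "mcball p (R + e) \<subseteq> (\<Union>x\<in>K. mcball x (r x))" by blast
  moreover have "compactin mtopology (\<Union>x\<in>K. mcball x (r x))"
    using K(1) r(2) by (intro compactin_Union) auto
  ultimately have "compactin mtopology (mcball p (R + e))"
    by (meson closed_compactin closedin_mcball)
  with e(1) that show thesis by blast
qed

text \<open>The radii with compact balls form an interval starting at 0. A finite supremum would
  belong to it by \<open>compactin_mcball_sup\<close> and could then be exceeded by
  \<open>compactin_mcball_extend\<close>.\<close>

theorem Hopf_Rinow_compactin_mcball: "compactin mtopology (mcball p R)"
proof -
  define S where "S = {r. 0 \<le> r \<and> compactin mtopology (mcball p r)}"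
  have down: "r' \<in> S" if "r \<in> S" "0 \<le> r'" "r' \<le> r" for r r'
    using that closed_compactin[of mtopology "mcball p r" "mcball p r'"] mcball_subset_concentric[of r' r p]
    by (auto simp: S_def)
  obtain r0 where r0: "r0 > 0" "r0 \<in> S" using locally_compact[of p] by (auto simp: S_def)
  have "\<not> bdd_above S"
  proof
    assume bdd: "bdd_above S"
    let ?R = "Sup S"
    have "?R \<ge> r0" using cSup_upper[OF r0(2) bdd] .
    then have "?R > 0" using r0(1) by simp
    have "compactin mtopology (mcball p r)" if r: "0 \<le> r" "r < ?R" for r
    proof -
      obtain r' where "r' \<in> S" "r < r'" using less_cSupE[OF r(2)] r0(2) by blast
      then have "r \<in> S" using down r(1) by auto
      then show ?thesis unfolding S_def by simp
    qed
    then have "compactin mtopology (mcball p ?R)"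
      by (rule compactin_mcball_sup[OF \<open>?R > 0\<close>])
    then obtain e where "e > 0" "compactin mtopology (mcball p (?R + e))"
      using compactin_mcball_extend[of ?R p] \<open>?R > 0\<close> by auto
    moreover from this have "0 \<le> ?R + e" using \<open>?R > 0\<close> by simp
    ultimately have "?R + e \<in> S" unfolding S_def by blast
    then show False using cSup_upper[OF _ bdd, of "?R + e"] \<open>e > 0\<close> by simp
  qed
  then have "\<exists>r\<in>S. max 0 R < r" unfolding bdd_above_def by (meson not_le)
  then obtain r where r: "r \<in> S" "max 0 R < r" by blast
  then have "mcball p R \<subseteq> mcball p r" by auto
  with r(1) show ?thesis unfolding S_def by (auto intro: closed_compactin)
qed

end

section \<open>The geodesic distance as a metric\<close>

locale connected_riemannian = riemannian A G
  for A :: "('a::{t2_space, second_countable_topology}, 'd::finite) chart set" and G +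
  assumes connected: "connected (UNIV :: 'a set)"
begin

abbreviation \<rho> :: "'a \<Rightarrow> 'a \<Rightarrow> real" where "\<rho> \<equiv> geodesic_dist A G"

lemma edist_eq: "edist x y = ennreal (\<rho> x y)"
  using edist_finite[OF connected] by (simp add: geodesic_dist_eq)

lemma rho_nonneg [simp]: "\<rho> x y \<ge> 0"
  by (simp add: geodesic_dist_eq)

lemma rho_sym: "\<rho> x y = \<rho> y x"
  by (simp add: geodesic_dist_eq edist_sym)

lemma rho_triangle: "\<rho> x z \<le> \<rho> x y + \<rho> y z"
  using edist_triangle[of x z y] by (simp add: edist_eq flip: ennreal_plus)

lemma rho_curve:
  assumes "\<rho> x y < B"
  obtains \<gamma> where "regular_curve \<gamma> 0 1" "\<gamma> 0 = x" "\<gamma> 1 = y" "len \<gamma> 0 1 < ennreal B"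
proof -
  have "0 < B" using assms rho_nonneg[of x y] by linarith
  then have "edist x y < ennreal B" using assms by (simp add: edist_eq ennreal_less_iff)
  then show thesis using that by (rule edist_curve)
qed

text \<open>The lower bound for the distance and the confinement of short curves rest on the same
  exit argument. The confinement is what keeps an almost shortest curve inside one chart.\<close>

lemma rho_local_comparison:
  assumes c: "c \<in> A" and p: "p \<in> fst c"
  obtains r \<alpha> \<beta> where "r > 0" "\<alpha> > 0" "\<beta> > 0" "cball (snd c p) r \<subseteq> snd c ` fst c"
    "\<And>u v. u \<in> cball (snd c p) r \<Longrightarrow> v \<in> cball (snd c p) r \<Longrightarrow>
       \<rho> (chart_inv c u) (chart_inv c v) \<le> \<beta> * norm (u - v)"
    "\<And>u s y. cball u s \<subseteq> cball (snd c p) r \<Longrightarrow> 0 < s \<Longrightarrow> y \<notin> chart_inv c ` ball u s \<Longrightarrow>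
       \<alpha> * s \<le> \<rho> (chart_inv c u) y"
    "\<And>u s \<gamma> t. cball u s \<subseteq> cball (snd c p) r \<Longrightarrow> 0 < s \<Longrightarrow> regular_curve \<gamma> 0 1 \<Longrightarrow>
       \<gamma> 0 = chart_inv c u \<Longrightarrow> len \<gamma> 0 1 < ennreal (\<alpha> * s) \<Longrightarrow> t \<in> {0..1} \<Longrightarrow> \<gamma> t \<in> chart_inv c ` ball u s"
    "\<And>u v. u \<in> cball (snd c p) r \<Longrightarrow> \<alpha> * norm v \<le> metric_norm G c (chart_inv c u) v"
    "\<And>u v. u \<in> cball (snd c p) r \<Longrightarrow> metric_norm G c (chart_inv c u) v \<le> \<beta> * norm v"
proof -
  obtain r \<alpha> \<beta> where r: "r > 0" "\<alpha> > 0" "\<beta> > 0" "cball (snd c p) r \<subseteq> snd c ` fst c"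
    and \<alpha>: "\<And>u v. u \<in> cball (snd c p) r \<Longrightarrow> \<alpha> * norm v \<le> metric_norm G c (chart_inv c u) v"
    and \<beta>: "\<And>u v. u \<in> cball (snd c p) r \<Longrightarrow> metric_norm G c (chart_inv c u) v \<le> \<beta> * norm v"
    using metric_norm_bounds[OF c, of "snd c p"] p by (metis image_eqI)
  have up: "\<rho> (chart_inv c u) (chart_inv c v) \<le> \<beta> * norm (u - v)"
    if "u \<in> cball (snd c p) r" "v \<in> cball (snd c p) r" for u v
    using edist_le_chart[OF c r(4) \<beta> that] r(3) by (simp add: edist_eq)
  have low: "ennreal (\<alpha> * s) \<le> len \<gamma> 0 1"
    if "cball u s \<subseteq> cball (snd c p) r" "0 < s" "regular_curve \<gamma> 0 1" "\<gamma> 0 = chart_inv c u"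
      "t \<in> {0..1}" "\<gamma> t \<notin> chart_inv c ` ball u s" for u s \<gamma> t
    using that r(2,4) \<alpha> by (intro edist_ge_chart[OF c, of u s]) auto
  have low': "\<alpha> * s \<le> \<rho> (chart_inv c u) y"
    if s: "cball u s \<subseteq> cball (snd c p) r" "0 < s" "y \<notin> chart_inv c ` ball u s" for u s y
  proof (rule ccontr)
    assume "\<not> \<alpha> * s \<le> \<rho> (chart_inv c u) y"
    then obtain \<gamma> where "regular_curve \<gamma> 0 1" "\<gamma> 0 = chart_inv c u" "\<gamma> 1 = y" "len \<gamma> 0 1 < ennreal (\<alpha> * s)"
      using rho_curve[of "chart_inv c u" y] by (auto simp: not_le)
    then show False using low[OF s(1,2), of \<gamma> 1] s(3) by auto
  qed
  show thesis
  proof (rule that[OF r up low' _ \<alpha> \<beta>])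
    show "\<gamma> t \<in> chart_inv c ` ball u s" if "cball u s \<subseteq> cball (snd c p) r" "0 < s" "regular_curve \<gamma> 0 1"
       "\<gamma> 0 = chart_inv c u" "len \<gamma> 0 1 < ennreal (\<alpha> * s)" "t \<in> {0..1}" for u s \<gamma> t
      using low[OF that(1-4,6)] that(5) by (auto simp: not_le[symmetric])
  qed
qed

lemma rho_refl [simp]: "\<rho> x x = 0"
proof -
  obtain c where c: "c \<in> A" "x \<in> fst c" using chart_exists by blast
  from rho_local_comparison[OF this] obtain r \<beta> where "r > 0"
    "\<And>u v. u \<in> cball (snd c x) r \<Longrightarrow> v \<in> cball (snd c x) r \<Longrightarrow>
       \<rho> (chart_inv c u) (chart_inv c v) \<le> \<beta> * norm (u - v)" by metis
  from this(2)[of "snd c x" "snd c x"] this(1) show ?thesis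
    using topological_chart_inv(1)[OF chart_topological[OF c(1)] c(2)] rho_nonneg[of x x] by simp
qed

lemma rho_ball_chart:
  assumes "open S" "x \<in> S"
  obtains e where "e > 0" "\<And>y. \<rho> x y < e \<Longrightarrow> y \<in> S"
proof -
  obtain c where c: "c \<in> A" "x \<in> fst c" using chart_exists by blast
  note tc = chart_topological[OF c(1)]
  from rho_local_comparison[OF c] obtain r \<alpha> where r: "r > 0" "\<alpha> > 0" and
    low: "\<And>u s y. cball u s \<subseteq> cball (snd c x) r \<Longrightarrow> 0 < s \<Longrightarrow> y \<notin> chart_inv c ` ball u s \<Longrightarrow>
       \<alpha> * s \<le> \<rho> (chart_inv c u) y"
    by metis
  have "open (snd c ` (S \<inter> fst c))"
    using assms(1) topological_chart_open(1)[OF tc] by (intro topological_chart_open_image[OF tc]) auto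
  moreover have "snd c x \<in> snd c ` (S \<inter> fst c)" using c(2) assms(2) by blast
  ultimately obtain s0 where s0: "s0 > 0" "ball (snd c x) s0 \<subseteq> snd c ` (S \<inter> fst c)"
    using open_contains_ball by blast
  define s where "s = min s0 r"
  have s: "s > 0" "s \<le> r" "s \<le> s0" using s0 r by (auto simp: s_def)
  have "y \<in> S" if y: "\<rho> x y < \<alpha> * s" for y
  proof -
    have "y \<in> chart_inv c ` ball (snd c x) s"
      using low[of "snd c x" s y] s y topological_chart_inv(1)[OF tc c(2)] by (auto simp: subset_cball)
    then obtain u where "u \<in> ball (snd c x) s0" "y = chart_inv c u"
      using subset_ball[OF s(3)] by blast
    then show ?thesis using s0(2) topological_chart_inv(1)[OF tc] by auto
  qed
  then show thesis using that[of "\<alpha> * s"] r(2) s(1) by auto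
qed

lemma rho_zero_iff: "\<rho> x y = 0 \<longleftrightarrow> x = y"
proof
  assume "\<rho> x y = 0"
  show "x = y"
  proof (rule ccontr)
    assume "x \<noteq> y"
    then obtain e where "e > 0" "\<And>z. \<rho> x z < e \<Longrightarrow> z \<in> - {y}"
      using rho_ball_chart[of "- {y}" x] by (auto simp: open_Compl)
    from this(2)[of y] this(1) \<open>\<rho> x y = 0\<close> show False by simp
  qed
qed simp

sublocale Metric_space UNIV \<rho>
  by unfold_locales (auto simp: rho_sym rho_zero_iff rho_triangle)

lemma open_if_rho_balls:
  assumes "\<And>x. x \<in> S \<Longrightarrow> \<exists>e>0. \<forall>y. \<rho> x y < e \<longrightarrow> y \<in> S"
  shows "open S"
proof (rule topological_space_class.openI)
  fix x assume "x \<in> S"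
  then obtain e where e: "e > 0" "\<And>y. \<rho> x y < e \<Longrightarrow> y \<in> S" using assms by blast
  obtain c where c: "c \<in> A" "x \<in> fst c" using chart_exists by blast
  note tc = chart_topological[OF c(1)]
  from rho_local_comparison[OF c] obtain r \<beta> where r: "r > 0" "\<beta> > 0" "cball (snd c x) r \<subseteq> snd c ` fst c" and
    up: "\<And>u v. u \<in> cball (snd c x) r \<Longrightarrow> v \<in> cball (snd c x) r \<Longrightarrow>
       \<rho> (chart_inv c u) (chart_inv c v) \<le> \<beta> * norm (u - v)"
    by metis
  define s where "s = min r (e / \<beta>)"
  have s: "s > 0" "s \<le> r" "\<beta> * s \<le> e" using e r by (auto simp: s_def min_def field_simps)
  let ?T = "chart_inv c ` ball (snd c x) s"
  have sub: "ball (snd c x) s \<subseteq> cball (snd c x) r" using s by auto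
  have "open ?T" using sub r(3) by (intro topological_chart_open_inv_image[OF tc]) auto
  moreover have "x \<in> ?T" using s(1) topological_chart_inv(1)[OF tc c(2)] by (metis centre_in_ball image_eqI)
  moreover have "?T \<subseteq> S"
  proof
    fix y assume "y \<in> ?T"
    then obtain u where u: "u \<in> ball (snd c x) s" "y = chart_inv c u" by blast
    have "\<rho> (chart_inv c (snd c x)) y \<le> \<beta> * norm (snd c x - u)"
      unfolding u(2) using u(1) sub r(1) by (intro up) auto
    also have "\<dots> < \<beta> * s" using u(1) r(2) by (simp add: dist_norm)
    finally show "y \<in> S" using s(3) e(2) topological_chart_inv(1)[OF tc c(2)] by simp
  qed
  ultimately show "\<exists>T. open T \<and> x \<in> T \<and> T \<subseteq> S" by blast
qed

text \<open>Transfers the Hopf--Rinow theorem, which speaks of the metric topology, to compactness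
  in the topology of the manifold.\<close>

lemma mtopology_eq_euclidean: "mtopology = euclidean"
  unfolding topology_eq openin_mtopology open_openin[symmetric]
proof (intro allI iffI conjI impI)
  fix S assume "S \<subseteq> UNIV \<and> (\<forall>x. x \<in> S \<longrightarrow> (\<exists>r>0. mball x r \<subseteq> S))"
  then show "open S" by (intro open_if_rho_balls) (simp add: subset_eq Ball_def)
next
  fix S :: "'a set" and x assume "open S" "x \<in> S"
  then obtain e where "e > 0" "\<And>y. \<rho> x y < e \<Longrightarrow> y \<in> S"
    using rho_ball_chart[of S x] by blast
  then show "\<exists>r>0. mball x r \<subseteq> S" by auto
qed simp

lemma continuous_rho: "continuous_on UNIV (\<rho> x)"
proof (rule continuous_on_open_vimage[OF open_UNIV, THEN iffD2], intro allI impI)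
  fix B :: "real set" assume "open B"
  show "open (\<rho> x -` B \<inter> UNIV)"
  proof (rule open_if_rho_balls)
    fix p assume "p \<in> \<rho> x -` B \<inter> UNIV"
    then obtain e where e: "e > 0" "\<And>t. dist t (\<rho> x p) < e \<Longrightarrow> t \<in> B"
      using \<open>open B\<close> unfolding open_dist by auto
    have "\<rho> x y \<in> B" if "\<rho> p y < e" for y
      using e(2)[of "\<rho> x y"] that rho_triangle[of x y p] rho_triangle[of x p y] rho_sym[of p y]
      by (auto simp: dist_real_def)
    then show "\<exists>e>0. \<forall>y. \<rho> p y < e \<longrightarrow> y \<in> \<rho> x -` B \<inter> UNIV" using e(1) by auto
  qed
qed

lemma rho_le_len:
  assumes "regular_curve \<gamma> a b" "a \<le> b"
  shows "ennreal (\<rho> (\<gamma> a) (\<gamma> b)) \<le> len \<gamma> a b"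
  using edist_le_len[OF assms(1)] assms(2) by (cases "a = b") (auto simp: edist_eq)

text \<open>Along an almost shortest curve from \<open>x\<close> to \<open>y\<close> the distance
  from \<open>x\<close> is continuous, so it takes the value \<open>s\<close>; the length of the
  rest of the curve bounds the remaining distance.\<close>

lemma rho_approx_between:
  assumes "0 \<le> s" "s \<le> \<rho> x y" "0 < e"
  obtains z where "\<rho> x z = s" "\<rho> z y \<le> \<rho> x y - s + e"
proof -
  obtain \<gamma> where \<gamma>: "regular_curve \<gamma> 0 1" "\<gamma> 0 = x" "\<gamma> 1 = y" "len \<gamma> 0 1 < ennreal (\<rho> x y + e)"
    using rho_curve[of x y "\<rho> x y + e"] assms(3) by auto
  have "continuous_on {0..1} (\<lambda>t. \<rho> x (\<gamma> t))"
    using \<gamma>(1) unfolding regular_curve_def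
    by (intro continuous_on_compose2[OF continuous_rho]) auto
  then obtain t where t: "0 \<le> t" "t \<le> 1" "\<rho> x (\<gamma> t) = s"
    using IVT'[of "\<lambda>t. \<rho> x (\<gamma> t)" 0 s 1] assms(1,2) \<gamma>(2,3) by auto
  have "ennreal (s + \<rho> (\<gamma> t) y) = ennreal (\<rho> (\<gamma> 0) (\<gamma> t)) + ennreal (\<rho> (\<gamma> t) (\<gamma> 1))"
    using t \<gamma> assms(1) by (simp add: ennreal_plus)
  also have "\<dots> \<le> len \<gamma> 0 t + len \<gamma> t 1"
    using t by (intro add_mono rho_le_len regular_curve_subset[OF \<gamma>(1)]) auto
  also have "\<dots> = len \<gamma> 0 1" using len_split[OF \<gamma>(1) t(1,2)] by simp
  finally have "ennreal (s + \<rho> (\<gamma> t) y) < ennreal (\<rho> x y + e)" using \<gamma>(4) by (rule le_less_trans)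
  then have "s + \<rho> (\<gamma> t) y < \<rho> x y + e"
    using assms(1) by (subst (asm) ennreal_less_iff) auto
  then show thesis using that[of "\<gamma> t"] t(3) by simp
qed

lemma rho_locally_compact: "\<exists>r>0. compactin mtopology (mcball p r)"
proof -
  obtain c where c: "c \<in> A" "p \<in> fst c" using chart_exists by blast
  note tc = chart_topological[OF c(1)]
  from rho_local_comparison[OF c] obtain r \<alpha> where r: "r > 0" "\<alpha> > 0" "cball (snd c p) r \<subseteq> snd c ` fst c" and
    low: "\<And>u s y. cball u s \<subseteq> cball (snd c p) r \<Longrightarrow> 0 < s \<Longrightarrow> y \<notin> chart_inv c ` ball u s \<Longrightarrow>
       \<alpha> * s \<le> \<rho> (chart_inv c u) y"
    by metis
  have "compact (chart_inv c ` cball (snd c p) r)" using r(3)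
    by (intro compact_continuous_image continuous_on_subset[OF topological_chart_continuous(2)[OF tc]]) auto
  moreover have "mcball p (\<alpha> * r / 2) \<subseteq> chart_inv c ` cball (snd c p) r"
  proof
    fix y assume y: "y \<in> mcball p (\<alpha> * r / 2)"
    have "\<rho> (chart_inv c (snd c p)) y < \<alpha> * r"
      unfolding topological_chart_inv(1)[OF tc c(2)]
      using y mult_pos_pos[OF r(2,1)] by simp
    then have "y \<in> chart_inv c ` ball (snd c p) r"
      using low[of "snd c p" r y] r(1) by auto
    then show "y \<in> chart_inv c ` cball (snd c p) r" using ball_subset_cball by blast
  qed
  ultimately have "compactin mtopology (mcball p (\<alpha> * r / 2))"
    by (intro closed_compactin[OF _ _ closedin_mcball, of "chart_inv c ` cball (snd c p) r"])
      (auto simp: mtopology_eq_euclidean)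
  then show ?thesis using r by (intro exI[of _ "\<alpha> * r / 2"]) auto
qed

lemma compact_rho_cball:
  assumes "complete_manifold A G"
  shows "compact {y. \<rho> p y \<le> R}"
proof -
  interpret approx_length_space \<rho>
  proof
    show "\<exists>z. \<rho> x z \<le> s \<and> \<rho> z y \<le> \<rho> x y - s + e" if "0 \<le> s" "s \<le> \<rho> x y" "0 < e" for x y s e
      using rho_approx_between[OF that] by (metis order_refl)
  qed (use rho_locally_compact assms in \<open>auto simp: complete_manifold_def\<close>)
  have "compactin mtopology (mcball p R)" by (rule Hopf_Rinow_compactin_mcball)
  then show ?thesis by (simp add: mtopology_eq_euclidean mcball_def)
qed

end

section \<open>Semiconcavity of the squared distance\<close>

lemma norm_matrix_vector_mult_le:
  fixes E :: "real ^ 'n ^ 'm"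
  shows "norm (E *v x) \<le> norm E * norm x"
proof -
  have "norm (E *v x) = L2_set (\<lambda>i. norm (E $ i \<bullet> x)) UNIV"
    unfolding norm_vec_def[of "E *v x"] by (simp add: matrix_vector_mul_component)
  also have "\<dots> \<le> L2_set (\<lambda>i. norm (E $ i) * norm x) UNIV"
    by (intro L2_set_mono) (auto simp: Cauchy_Schwarz_ineq2)
  also have "\<dots> = norm E * norm x"
    unfolding norm_vec_def[of E] by (simp add: L2_set_left_distrib)
  finally show ?thesis .
qed

lemma abs_inner_matrix_le:
  fixes E :: "real ^ 'n ^ 'n"
  shows "\<bar>x \<bullet> (E *v y)\<bar> \<le> norm E * (norm x * norm y)"
proof -
  have "\<bar>x \<bullet> (E *v y)\<bar> \<le> norm x * norm (E *v y)" by (rule Cauchy_Schwarz_ineq2)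
  also have "\<dots> \<le> norm x * (norm E * norm y)"
    by (intro mult_left_mono norm_matrix_vector_mult_le) auto
  finally show ?thesis by (simp add: mult_ac)
qed

text \<open>Arc length is the parameter by which curves will be bent. The integrand may be unbounded
  near the exceptional times, but its integral is finite, so the indefinite integral is still
  continuous.\<close>

lemma arclength_function:
  fixes w :: "real \<Rightarrow> real"
  assumes "finite S" and cont: "continuous_on ({0<..<1} - S) w" and nonneg: "\<And>t. t \<in> {0<..<1} - S \<Longrightarrow> w t \<ge> 0"
    and l: "(\<integral>\<^sup>+t\<in>{0<..<1} - S. ennreal (w t) \<partial>lborel) = ennreal l" "l \<ge> 0"
  obtains \<sigma> where "continuous_on {0..1} \<sigma>" "\<sigma> 0 = 0" "\<sigma> 1 = l" "\<And>t. t \<in> {0..1} \<Longrightarrow> 0 \<le> \<sigma> t \<and> \<sigma> t \<le> l"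
    "\<And>t. t \<in> {0<..<1} - S \<Longrightarrow> (\<sigma> has_vector_derivative w t) (at t)"
proof -
  let ?I = "{0<..<1} - S"
  let ?W = "\<lambda>t. indicator ?I t *\<^sub>R w t"
  have op: "open ?I" using \<open>finite S\<close> by (simp add: finite_imp_closed open_Diff)
  then have m: "?W \<in> borel_measurable borel"
    using cont by (intro borel_measurable_continuous_on_indicator) auto
  have W0: "?W t \<ge> 0" for t using nonneg[of t] by (auto simp: indicator_def)
  have eq: "(\<integral>\<^sup>+t. ennreal (?W t) \<partial>lborel) = ennreal l"
    unfolding l(1)[symmetric] by (intro nn_integral_cong) (auto simp: indicator_def)
  have int: "integrable lborel ?W"
    using m W0 eq by (intro integrableI_nonneg) auto
  have "integral\<^sup>L lborel ?W = l"
    using nn_integral_eq_integral[OF int] W0 eq l(2) by (simp add: integral_nonneg_AE)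
  then have hi: "(?W has_integral l) UNIV"
    using has_integral_integral_lborel[OF int] by simp
  have "((\<lambda>t. if t \<in> {0..1} then ?W t else 0) has_integral l) UNIV"
    by (rule has_integral_eq[OF _ hi]) (auto simp: indicator_def)
  then have h01: "(?W has_integral l) {0..1}"
    unfolding has_integral_restrict_UNIV .
  then have io: "?W integrable_on {0..1}" by blast
  define \<sigma> where "\<sigma> t = integral {0..t} ?W" for t
  show thesis
  proof (rule that[of \<sigma>])
    show "continuous_on {0..1} \<sigma>"
      unfolding \<sigma>_def by (rule indefinite_integral_continuous_1[OF io])
    show "\<sigma> 0 = 0" by (simp add: \<sigma>_def)
    show "\<sigma> 1 = l" using h01 by (simp add: \<sigma>_def integral_unique)
    show "0 \<le> \<sigma> t \<and> \<sigma> t \<le> l" if t: "t \<in> {0..1}" for t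
    proof
      have io': "?W integrable_on {0..t}" by (rule integrable_on_subinterval[OF io]) (use t in auto)
      show "0 \<le> \<sigma> t" unfolding \<sigma>_def using W0 by (intro integral_nonneg io') auto
      have "\<sigma> t \<le> integral {0..1} ?W"
        unfolding \<sigma>_def using t W0 by (intro integral_subset_le io io') auto
      then show "\<sigma> t \<le> l" using h01 by (simp add: integral_unique)
    qed
    show "(\<sigma> has_vector_derivative w t) (at t)" if t: "t \<in> ?I" for t
    proof -
      have "continuous_on ?I ?W" by (rule continuous_on_eq[OF cont]) auto
      then have "isCont ?W t" using op t by (simp add: continuous_on_eq_continuous_at)
      then have "(\<sigma> has_vector_derivative ?W t) (at t within {0..1})"
        unfolding \<sigma>_def using t
        by (intro integral_has_vector_derivative_continuous_at[where S="{}", OF io, unfolded Diff_empty])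
          (auto intro: continuous_at_imp_continuous_at_within)
      moreover have "at t within {0..1} = at t"
        using t by (intro at_within_interior) auto
      ultimately show ?thesis using t by simp
    qed
  qed
qed

context connected_riemannian
begin

lemma metric_norm_sq: "c \<in> A \<Longrightarrow> p \<in> fst c \<Longrightarrow> (metric_norm G c p v)\<^sup>2 = v \<bullet> (G c p *v v)"
  by (simp add: metric_norm_def metric_nonneg)

text \<open>The curve from \<open>chart_inv c \<eta>\<close> is bent to start at \<open>chart_inv c (\<eta> \<plusminus> h)\<close> by adding \<open>\<plusminus> s h\<close>,
  where \<open>s\<close> decreases from 1 to 0 proportionally to arc length. Squared speeds instead of
  speeds are compared, so that no square roots have to be expanded.\<close>

lemma rho_sq_semiconcave_near:
  assumes c: "c \<in> A" and p: "p \<in> fst c"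
  obtains r K \<delta> \<beta> where "r > 0" "K > 0" "\<delta> > 0" "\<beta> > 0" "cball (snd c p) (2 * r) \<subseteq> snd c ` fst c"
    "\<And>u v. u \<in> cball (snd c p) (2 * r) \<Longrightarrow> v \<in> cball (snd c p) (2 * r) \<Longrightarrow>
       \<rho> (chart_inv c u) (chart_inv c v) \<le> \<beta> * norm (u - v)"
    "\<And>z \<eta> h. \<eta> \<in> cball (snd c p) r \<Longrightarrow> norm h \<le> r \<Longrightarrow> \<rho> (chart_inv c \<eta>) z < \<delta> \<Longrightarrow>
       (\<rho> (chart_inv c (\<eta> + h)) z)\<^sup>2 + (\<rho> (chart_inv c (\<eta> - h)) z)\<^sup>2 \<le>
         2 * (\<rho> (chart_inv c \<eta>) z)\<^sup>2 + K * (norm h)\<^sup>2"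
proof -
  note tc = chart_topological[OF c]
  let ?u0 = "snd c p" and ?\<xi> = "chart_inv c"
  let ?g = "G c \<circ> ?\<xi>"
  show thesis
  proof (rule rho_local_comparison[OF c p])
  fix r1 \<alpha> \<beta> assume r1: "r1 > 0" "\<alpha> > 0" "\<beta> > 0" "cball ?u0 r1 \<subseteq> snd c ` fst c"
    and up: "\<And>u v. u \<in> cball ?u0 r1 \<Longrightarrow> v \<in> cball ?u0 r1 \<Longrightarrow> \<rho> (?\<xi> u) (?\<xi> v) \<le> \<beta> * norm (u - v)"
    and low: "\<And>u s y. cball u s \<subseteq> cball ?u0 r1 \<Longrightarrow> 0 < s \<Longrightarrow> y \<notin> ?\<xi> ` ball u s \<Longrightarrow>
       \<alpha> * s \<le> \<rho> (?\<xi> u) y"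
    and stay: "\<And>u s \<gamma> t. cball u s \<subseteq> cball ?u0 r1 \<Longrightarrow> 0 < s \<Longrightarrow> regular_curve \<gamma> 0 1 \<Longrightarrow>
       \<gamma> 0 = ?\<xi> u \<Longrightarrow> len \<gamma> 0 1 < ennreal (\<alpha> * s) \<Longrightarrow> t \<in> {0..1} \<Longrightarrow> \<gamma> t \<in> ?\<xi> ` ball u s"
    and \<alpha>: "\<And>u v. u \<in> cball ?u0 r1 \<Longrightarrow> \<alpha> * norm v \<le> metric_norm G c (?\<xi> u) v"
    and \<beta>: "\<And>u v. u \<in> cball ?u0 r1 \<Longrightarrow> metric_norm G c (?\<xi> u) v \<le> \<beta> * norm v"
  show thesis
  proof (rule smooth_on_second_difference[OF metric_smooth[OF c] topological_chart_open(2)[OF tc]])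
  show "?u0 \<in> snd c ` fst c" using p by blast
  fix r2 L assume r2: "r2 > 0" "L > 0"
    and lip: "\<And>x y. x \<in> cball ?u0 r2 \<Longrightarrow> y \<in> cball ?u0 r2 \<Longrightarrow> norm (?g x - ?g y) \<le> L * norm (x - y)"
    and sd: "\<And>x h. x + h \<in> cball ?u0 r2 \<Longrightarrow> x - h \<in> cball ?u0 r2 \<Longrightarrow>
        norm (?g (x + h) + ?g (x - h) - 2 *\<^sub>R ?g x) \<le> L * (norm h)\<^sup>2"
  \<comment> \<open>Base points range over radius \<open>r\<close>, the curves from them over radius
    \<open>2 * r\<close>, and the bent curves stay within radius \<open>4 * r\<close>, where all
    bounds on the metric hold.\<close>
  define r where "r = min r1 r2 / 4"
  have r: "r > 0" "4 * r \<le> r1" "4 * r \<le> r2" using r1(1) r2(1) by (auto simp: r_def)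
  \<comment> \<open>A curve shorter than \<open>\<alpha> * r\<close> cannot leave the coordinate
    ball of radius \<open>r\<close> around its starting point.\<close>
  define \<delta> where "\<delta> = \<alpha> * r"
  have "\<delta> > 0" using r r1(2) by (simp add: \<delta>_def)
  \<comment> \<open>The summands bound, in this order, the second difference of the metric, its
    first difference paired with the velocity of the displacement, and the metric applied to that
    velocity, for lengths up to \<open>\<delta>\<close>. The last one also covers distance
    0.\<close>
  define K where "K = L * \<delta>\<^sup>2 / \<alpha>\<^sup>2 + 4 * L * \<delta> / \<alpha> + 2 * \<beta>\<^sup>2"
  have "K > 0" using r1 r2 \<open>\<delta> > 0\<close> by (simp add: K_def add_pos_pos)
  \<comment> \<open>The distance need not be attained by a curve, so the estimate is made for curves
    shorter than \<open>l'\<close>; at the end \<open>l'\<close> tends to the distance.\<close>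
  have main: "(\<rho> (?\<xi> (\<eta> + h)) z)\<^sup>2 + (\<rho> (?\<xi> (\<eta> - h)) z)\<^sup>2 \<le> 2 * l'\<^sup>2 + K * (norm h)\<^sup>2"
    if \<eta>: "\<eta> \<in> cball ?u0 r" and h: "norm h \<le> r" and pos: "0 < \<rho> (?\<xi> \<eta>) z" and l': "\<rho> (?\<xi> \<eta>) z < l'" "l' < \<delta>"
    for z \<eta> h l'
  proof -
    obtain \<gamma> where \<gamma>: "regular_curve \<gamma> 0 1" "\<gamma> 0 = ?\<xi> \<eta>" "\<gamma> 1 = z" "len \<gamma> 0 1 < ennreal l'"
      using rho_curve[OF l'(1)] by blast
    define l where "l = enn2real (len \<gamma> 0 1)"
    have "len \<gamma> 0 1 < \<top>" using \<gamma>(4) ennreal_less_top less_trans by blast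
    then have len: "len \<gamma> 0 1 = ennreal l" "l \<ge> 0" by (simp_all add: l_def)
    have "ennreal (\<rho> (\<gamma> 0) (\<gamma> 1)) \<le> len \<gamma> 0 1" by (rule rho_le_len[OF \<gamma>(1)]) simp
    then have "\<rho> (?\<xi> \<eta>) z \<le> l" using \<gamma>(2,3) len by simp
    then have "l > 0" using pos by linarith
    have "l < l'" using \<gamma>(4) len by (simp add: ennreal_less_iff)
    have sub: "cball \<eta> r \<subseteq> cball ?u0 (2 * r)"
      using \<eta> by (simp add: cball_subset_cball_iff dist_commute)
    have mem3: "u + k \<in> cball ?u0 (4 * r)" if "u \<in> cball ?u0 (2 * r)" "norm k \<le> r" for u k
      using that norm_triangle_ineq[of "u - ?u0" k] r(1) by (simp add: dist_norm norm_minus_commute algebra_simps)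
    have big: "u \<in> cball ?u0 r1" "u \<in> cball ?u0 r2" if "u \<in> cball ?u0 (4 * r)" for u
      using that r by auto
    have in_ball: "\<gamma> t \<in> ?\<xi> ` ball \<eta> r" if "t \<in> {0..1}" for t
    proof (rule stay[OF _ _ \<gamma>(1,2) _ that])
      show "cball \<eta> r \<subseteq> cball ?u0 r1" using sub r by auto
      show "len \<gamma> 0 1 < ennreal (\<alpha> * r)" using \<gamma>(4) l'(2) unfolding \<delta>_def
        by (meson ennreal_leI less_imp_le less_le_trans)
    qed (use r in auto)
    define \<kappa> where "\<kappa> = snd c \<circ> \<gamma>"
    have \<kappa>: "\<kappa> t \<in> cball ?u0 (2 * r)" "?\<xi> (\<kappa> t) = \<gamma> t" "\<gamma> t \<in> fst c" if t: "t \<in> {0..1}" for t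
    proof -
      obtain u where u: "u \<in> ball \<eta> r" "\<gamma> t = ?\<xi> u" using in_ball[OF t] by blast
      then have "u \<in> cball ?u0 (2 * r)" using sub ball_subset_cball by blast
      moreover from this have "u \<in> snd c ` fst c" using r1(4) r by auto
      ultimately show "\<kappa> t \<in> cball ?u0 (2 * r)" "?\<xi> (\<kappa> t) = \<gamma> t" "\<gamma> t \<in> fst c"
        using u topological_chart_inv[OF tc] by (auto simp: \<kappa>_def)
    qed
    have "\<eta> \<in> cball ?u0 r1" using \<eta> r by auto
    then have \<kappa>0: "\<kappa> 0 = \<eta>" using \<gamma>(2) r1(4) topological_chart_inv(2)[OF tc, of \<eta>] by (auto simp: \<kappa>_def)
    obtain S where S: "finite S" "\<And>t. t \<in> {0<..<1} - S \<Longrightarrow> C1_at A \<gamma> t"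
      using \<gamma>(1) unfolding regular_curve_def by blast
    let ?I = "{0<..<1} - S"
    define w where "w = speed A G \<gamma>"
    define v where "v t = vector_derivative \<kappa> (at t)" for t
    have v: "(\<kappa> has_vector_derivative v t) (at t) \<and> isCont v t" if t: "t \<in> ?I" for t
    proof -
      obtain e where e: "C1_at_in c \<gamma> t e"
        using C1_at_chart[OF S(2)[OF t] c] \<kappa>(3) t by auto
      then have "t \<in> ball t e" by (simp add: C1_at_in_def)
      then show ?thesis using C1_at_in_has_vector_derivative[OF e] C1_at_in_continuous(2)[OF e]
        by (simp add: \<kappa>_def v_def[abs_def] continuous_on_eq_continuous_at)
    qed
    have w: "w t = metric_norm G c (?\<xi> (\<kappa> t)) (v t)" if t: "t \<in> ?I" for t
      using speed_eq[OF S(2)[OF t] c] \<kappa>(2,3)[of t] t by (simp add: w_def v_def \<kappa>_def)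
    have w0: "w t \<ge> 0" if t: "t \<in> ?I" for t
      using w[OF t] \<kappa>(2,3)[of t] t metric_nonneg[OF c] by (simp add: metric_norm_def)
    have contw: "continuous_on ?I w"
      unfolding w_def using S(2) speed_continuous by (intro continuous_at_imp_continuous_on) blast
    have openI: "open ?I" using S(1) by (simp add: finite_imp_closed open_Diff)
    have aeS: "AE t in lborel. t \<notin> S" using S(1) by (rule AE_not_in_finite)
    have lenI: "len \<gamma>' 0 1 = (\<integral>\<^sup>+t\<in>?I. ennreal (speed A G \<gamma>' t) \<partial>lborel)" for \<gamma>'
      unfolding len_def by (rule nn_integral_cong_AE) (use aeS in \<open>eventually_elim, auto simp: indicator_def\<close>)
    have "(\<integral>\<^sup>+t\<in>?I. ennreal (w t) \<partial>lborel) = ennreal l" using lenI[of \<gamma>] len by (simp add: w_def)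
    from arclength_function[OF S(1) contw w0 this len(2)] obtain \<sigma>
      where \<sigma>: "continuous_on {0..1} \<sigma>" "\<sigma> 0 = 0" "\<sigma> 1 = l" "\<And>t. t \<in> {0..1} \<Longrightarrow> 0 \<le> \<sigma> t \<and> \<sigma> t \<le> l"
        and d\<sigma>: "\<And>t. t \<in> ?I \<Longrightarrow> (\<sigma> has_vector_derivative w t) (at t)" by metis
    define s where "s t = 1 - \<sigma> t / l" for t
    have s: "0 \<le> s t" "s t \<le> 1" if "t \<in> {0..1}" for t
      using \<sigma>(4)[OF that] \<open>l > 0\<close> by (auto simp: s_def)
    \<comment> \<open>Speed of the bent curve that starts at \<open>\<eta> + k\<close>. The
      displacement decreases at the rate \<open>w t / l\<close>, proportional to the speed of the
      curve itself, so the relative distortion \<open>C\<close> below is the same at all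
      times.\<close>
    define N where "N k t = metric_norm G c (?\<xi> (\<kappa> t + s t *\<^sub>R k)) (v t - (w t / l) *\<^sub>R k)" for k t
    have bent: "ennreal (\<rho> (?\<xi> (\<eta> + k)) z) \<le> (\<integral>\<^sup>+t\<in>?I. ennreal (N k t) \<partial>lborel)"
      "(\<lambda>t. ennreal (N k t) * indicator ?I t) \<in> borel_measurable lborel"
      if k: "norm k \<le> r" for k
    proof -
      let ?\<eta> = "\<lambda>t. \<kappa> t + s t *\<^sub>R k"
      have mem: "?\<eta> t \<in> cball ?u0 (4 * r)" if "t \<in> {0..1}" for t
      proof (rule mem3[OF \<kappa>(1)[OF that]])
        show "norm (s t *\<^sub>R k) \<le> r" using s[OF that] k mult_mono[of "s t" 1 "norm k" r] by simp
      qed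
      have cont\<kappa>: "continuous_on {0..1} \<kappa>"
        unfolding \<kappa>_def using \<gamma>(1) \<kappa>(3) unfolding regular_curve_def
        by (intro continuous_on_compose continuous_on_subset[OF topological_chart_continuous(1)[OF tc]]) auto
      have cont: "continuous_on {0..1} ?\<eta>"
        unfolding s_def by (intro continuous_intros cont\<kappa> \<sigma>(1)) (use \<open>l > 0\<close> in auto)
      have im: "?\<eta> ` {0..1} \<subseteq> snd c ` fst c" using mem big(1) r1(4) by blast
      have D: "(?\<eta> has_vector_derivative (v t - (w t / l) *\<^sub>R k)) (at t)" if "t \<in> ?I" for t
        unfolding s_def using v[OF that] d\<sigma>[OF that] \<open>l > 0\<close>
        by (auto intro!: derivative_eq_intros simp: has_real_derivative_iff_has_vector_derivative[symmetric])
      have contD: "continuous_on ?I (\<lambda>t. v t - (w t / l) *\<^sub>R k)"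
        using v \<open>l > 0\<close> by (intro continuous_intros contw continuous_at_imp_continuous_on) auto
      note cc = chart_curve[OF c S(1) cont im D contD]
      have reg: "regular_curve (\<lambda>t. ?\<xi> (?\<eta> t)) 0 1" by (rule cc(1))
      have sp: "speed A G (\<lambda>t. ?\<xi> (?\<eta> t)) t = N k t" if "t \<in> ?I" for t
        using cc(3)[OF _ that] by (simp add: N_def)
      have "ennreal (\<rho> (?\<xi> (?\<eta> 0)) (?\<xi> (?\<eta> 1))) \<le> len (\<lambda>t. ?\<xi> (?\<eta> t)) 0 1"
        by (rule rho_le_len[OF reg]) simp
      also have "\<dots> = (\<integral>\<^sup>+t\<in>?I. ennreal (N k t) \<partial>lborel)"
        unfolding lenI using sp by (intro nn_integral_cong) (auto simp: indicator_def)
      finally show "ennreal (\<rho> (?\<xi> (\<eta> + k)) z) \<le> (\<integral>\<^sup>+t\<in>?I. ennreal (N k t) \<partial>lborel)"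
        using \<kappa>0 \<kappa>(2)[of 1] \<gamma>(3) \<sigma>(2,3) \<open>l > 0\<close> by (simp add: s_def)
      have "continuous_on ?I (N k)"
        unfolding N_def
      proof (rule metric_continuous[OF c _ _ contD])
        have "continuous_on {0..1} (\<lambda>t. ?\<xi> (?\<eta> t))" using reg unfolding regular_curve_def by (rule conjunct1)
        then show "continuous_on ?I (\<lambda>t. ?\<xi> (?\<eta> t))" by (rule continuous_on_subset) auto
        show "(\<lambda>t. ?\<xi> (?\<eta> t)) ` ?I \<subseteq> fst c"
        proof (intro image_subsetI)
          fix t assume "t \<in> ?I"
          then have "?\<eta> t \<in> snd c ` fst c" by (intro subsetD[OF im] imageI) auto
          then show "?\<xi> (?\<eta> t) \<in> fst c" by (rule topological_chart_inv(3)[OF tc])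
        qed
      qed
      then have "(\<lambda>t. indicator ?I t *\<^sub>R N k t) \<in> borel_measurable borel"
        using openI by (intro borel_measurable_continuous_on_indicator) auto
      then have "(\<lambda>t. ennreal (indicator ?I t *\<^sub>R N k t)) \<in> borel_measurable borel" by measurable
      then show "(\<lambda>t. ennreal (N k t) * indicator ?I t) \<in> borel_measurable lborel"
        by (subst measurable_lborel2, rule measurable_cong[THEN iffD1, rotated]) (auto simp: indicator_def)
    qed
    define C where "C = 2 + K * (norm h)\<^sup>2 / l\<^sup>2"
    have C: "(N h t)\<^sup>2 + (N (- h) t)\<^sup>2 \<le> (w t)\<^sup>2 * C" if t: "t \<in> ?I" for t
    proof -
      have t01: "t \<in> {0..1}" using t by auto
      define sh where "sh = s t *\<^sub>R h"
      have nsh: "norm sh \<le> norm h" using s[OF t01] mult_right_mono[of "s t" 1 "norm h"] by (simp add: sh_def)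
      have m1: "\<kappa> t + sh \<in> cball ?u0 (4 * r)" using mem3[OF \<kappa>(1)[OF t01], of sh] nsh h by simp
      have m2: "\<kappa> t - sh \<in> cball ?u0 (4 * r)" using mem3[OF \<kappa>(1)[OF t01], of "- sh"] nsh h by simp
      have m0: "\<kappa> t \<in> cball ?u0 (4 * r)" using \<kappa>(1)[OF t01] r by auto
      have dm: "?\<xi> u \<in> fst c" if "u \<in> cball ?u0 (4 * r)" for u
        using big(1)[OF that] r1(4) topological_chart_inv(3)[OF tc] by blast
      define a where "a = (w t / l) *\<^sub>R h"
      have na: "norm a = w t * norm h / l" using w0[OF t] \<open>l > 0\<close> by (simp add: a_def)
      have nv: "norm (v t) \<le> w t / \<alpha>"
        using \<alpha>[OF big(1)[OF m0], of "v t"] r1(2) by (simp add: w[OF t] field_simps)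
      let ?gp = "?g (\<kappa> t + sh)" and ?gm = "?g (\<kappa> t - sh)" and ?gz = "?g (\<kappa> t)"
      have Np: "(N h t)\<^sup>2 = (v t - a) \<bullet> (?gp *v (v t - a))"
        using metric_norm_sq[OF c dm[OF m1], of "v t - a"] by (simp add: N_def a_def sh_def)
      have Nm: "(N (- h) t)\<^sup>2 = (v t + a) \<bullet> (?gm *v (v t + a))"
        using metric_norm_sq[OF c dm[OF m2], of "v t + a"] by (simp add: N_def a_def sh_def)
      have w2: "(w t)\<^sup>2 = v t \<bullet> (?gz *v v t)"
        using metric_norm_sq[OF c dm[OF m0], of "v t"] by (simp add: w[OF t])
      \<comment> \<open>The cross terms of the two squares have opposite signs, so only
        \<open>?gp - ?gm\<close> remains in them. This difference and \<open>a\<close> are both of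
        order \<open>h\<close>, which makes all errors quadratic in \<open>h\<close>.\<close>
      have "(N h t)\<^sup>2 + (N (- h) t)\<^sup>2 = 2 * (v t \<bullet> (?gz *v v t)) + v t \<bullet> ((?gp + ?gm - 2 *\<^sub>R ?gz) *v v t)
         + a \<bullet> (?gp *v a) + a \<bullet> (?gm *v a) - v t \<bullet> ((?gp - ?gm) *v a) - a \<bullet> ((?gp - ?gm) *v v t)"
        unfolding Np Nm
        by (simp add: inner_diff_left inner_diff_right inner_add_left inner_add_right matrix_vector_mult_diff_distrib
            matrix_vector_right_distrib matrix_vector_mult_add_rdistrib matrix_vector_mult_diff_rdistrib
            scaleR_matrix_vector_assoc[symmetric])
      moreover have "v t \<bullet> ((?gp + ?gm - 2 *\<^sub>R ?gz) *v v t) \<le> L * (norm h)\<^sup>2 * ((w t / \<alpha>) * (w t / \<alpha>))"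
      proof -
        have "v t \<bullet> ((?gp + ?gm - 2 *\<^sub>R ?gz) *v v t) \<le> norm (?gp + ?gm - 2 *\<^sub>R ?gz) * (norm (v t) * norm (v t))"
          using abs_inner_matrix_le[of "v t" "?gp + ?gm - 2 *\<^sub>R ?gz" "v t"] by linarith
        also have "\<dots> \<le> (L * (norm sh)\<^sup>2) * ((w t / \<alpha>) * (w t / \<alpha>))"
          using nv r1(2) r2(2) w0[OF t] by (intro mult_mono sd big(2) m1 m2) auto
        also have "\<dots> \<le> L * (norm h)\<^sup>2 * ((w t / \<alpha>) * (w t / \<alpha>))"
          using nsh r2(2) by (intro mult_right_mono mult_left_mono power_mono) auto
        finally show ?thesis .
      qed
      moreover have "a \<bullet> (?gp *v a) \<le> \<beta>\<^sup>2 * (norm a)\<^sup>2" "a \<bullet> (?gm *v a) \<le> \<beta>\<^sup>2 * (norm a)\<^sup>2"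
      proof -
        have *: "a \<bullet> (?g u *v a) \<le> \<beta>\<^sup>2 * (norm a)\<^sup>2" if u: "u \<in> cball ?u0 (4 * r)" for u
        proof -
          have "(metric_norm G c (?\<xi> u) a)\<^sup>2 \<le> (\<beta> * norm a)\<^sup>2"
            using \<beta>[OF big(1)[OF u], of a] metric_nonneg[OF c dm[OF u]]
            by (intro power_mono) (auto simp: metric_norm_def)
          then show ?thesis using metric_norm_sq[OF c dm[OF u], of a] by (simp add: power_mult_distrib)
        qed
        show "a \<bullet> (?gp *v a) \<le> \<beta>\<^sup>2 * (norm a)\<^sup>2" "a \<bullet> (?gm *v a) \<le> \<beta>\<^sup>2 * (norm a)\<^sup>2"
          using *[OF m1] *[OF m2] by auto
      qed
      moreover have "\<bar>x \<bullet> ((?gp - ?gm) *v y)\<bar> \<le> 2 * L * norm h * (norm x * norm y)" for x y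
      proof -
        have "norm (?gp - ?gm) \<le> L * norm ((\<kappa> t + sh) - (\<kappa> t - sh))"
          by (intro lip big(2) m1 m2)
        also have "(\<kappa> t + sh) - (\<kappa> t - sh) = 2 *\<^sub>R sh" by (simp add: scaleR_2)
        also have "L * norm (2 *\<^sub>R sh) \<le> 2 * L * norm h" using nsh r2(2) by simp
        finally show ?thesis
          using abs_inner_matrix_le[of x "?gp - ?gm" y] mult_right_mono[of "norm (?gp - ?gm)" "2 * L * norm h" "norm x * norm y"]
          by simp
      qed
      from this[of "v t" a] this[of a "v t"]
      have "- (v t \<bullet> ((?gp - ?gm) *v a)) - a \<bullet> ((?gp - ?gm) *v v t) \<le> 4 * L * norm h * (norm (v t) * norm a)"
        by (simp add: mult.commute)
      moreover have "4 * L * norm h * (norm (v t) * norm a) \<le> 4 * L * norm h * ((w t / \<alpha>) * norm a)"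
        using nv r2(2) by (intro mult_left_mono mult_right_mono) auto
      ultimately have "(N h t)\<^sup>2 + (N (- h) t)\<^sup>2 \<le> 2 * (w t)\<^sup>2 + L * (norm h)\<^sup>2 * ((w t / \<alpha>) * (w t / \<alpha>))
         + 2 * \<beta>\<^sup>2 * (norm a)\<^sup>2 + 4 * L * norm h * ((w t / \<alpha>) * norm a)"
        unfolding w2 by linarith
      also have "\<dots> = (w t)\<^sup>2 * (2 + (norm h)\<^sup>2 / l\<^sup>2 * (L * l\<^sup>2 / \<alpha>\<^sup>2 + 4 * L * l / \<alpha> + 2 * \<beta>\<^sup>2))"
        unfolding na using \<open>l > 0\<close> r1(2) by (simp add: field_simps power2_eq_square)
      also have "\<dots> \<le> (w t)\<^sup>2 * (2 + (norm h)\<^sup>2 / l\<^sup>2 * K)"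
        unfolding K_def using \<open>l > 0\<close> \<open>l < l'\<close> l'(2) r1(2) r2(2)
        by (intro mult_left_mono add_mono order_refl divide_right_mono power_mono) auto
      finally show ?thesis by (simp add: C_def mult.commute)
    qed
    \<comment> \<open>A Cauchy--Schwarz argument in disguise: the weights are the unknown distances
      in units of \<open>l\<close>. Integrating \<open>2 mp N \<le> (N^2 + mp^2 w^2) / w\<close>,
      summed over both signs, gives \<open>mp^2 + mm^2 \<le> C\<close>.\<close>
    define mp mm where "mp = \<rho> (?\<xi> (\<eta> + h)) z / l" and "mm = \<rho> (?\<xi> (\<eta> - h)) z / l"
    have m0: "mp \<ge> 0" "mm \<ge> 0" using \<open>l > 0\<close> by (auto simp: mp_def mm_def)
    have N0: "N k t \<ge> 0" if "t \<in> ?I" "norm k \<le> r" for k t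
    proof -
      have t01: "t \<in> {0..1}" using that by auto
      have "norm (s t *\<^sub>R k) \<le> r" using s[OF t01] that(2) mult_mono[of "s t" 1 "norm k" r] by simp
      then have "\<kappa> t + s t *\<^sub>R k \<in> cball ?u0 (4 * r)" by (rule mem3[OF \<kappa>(1)[OF t01]])
      then have "?\<xi> (\<kappa> t + s t *\<^sub>R k) \<in> fst c"
        using big(1) r1(4) topological_chart_inv(3)[OF tc] by blast
      then show ?thesis using metric_nonneg[OF c] by (simp add: N_def metric_norm_def)
    qed
    have pw: "2 * mp * N h t + 2 * mm * N (- h) t \<le> (C + mp\<^sup>2 + mm\<^sup>2) * w t" if t: "t \<in> ?I" for t
    proof (cases "w t = 0")
      case True
      then have "(N h t)\<^sup>2 + (N (- h) t)\<^sup>2 \<le> 0" using C[OF t] by simp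
      then have "N h t = 0" "N (- h) t = 0" by (simp_all add: sum_power2_le_zero_iff)
      then show ?thesis using True by simp
    next
      case False
      then have "w t > 0" using w0[OF t] by simp
      have "0 \<le> (N h t - mp * w t)\<^sup>2 + (N (- h) t - mm * w t)\<^sup>2" by simp
      then have "(2 * mp * N h t + 2 * mm * N (- h) t) * w t \<le>
          (N h t)\<^sup>2 + (N (- h) t)\<^sup>2 + (mp\<^sup>2 + mm\<^sup>2) * (w t)\<^sup>2"
        by (simp add: power2_eq_square algebra_simps)
      also have "\<dots> \<le> ((C + mp\<^sup>2 + mm\<^sup>2) * w t) * w t"
        using C[OF t] by (simp add: power2_eq_square algebra_simps)
      finally show ?thesis using \<open>w t > 0\<close> by (simp add: mult_le_cancel_right)
    qed
    have C0: "C + mp\<^sup>2 + mm\<^sup>2 \<ge> 0" using \<open>K > 0\<close> by (simp add: C_def)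
    have "ennreal (2 * mp * \<rho> (?\<xi> (\<eta> + h)) z + 2 * mm * \<rho> (?\<xi> (\<eta> - h)) z)
       = ennreal (2 * mp) * ennreal (\<rho> (?\<xi> (\<eta> + h)) z) + ennreal (2 * mm) * ennreal (\<rho> (?\<xi> (\<eta> + - h)) z)"
      using m0 by (simp add: ennreal_mult' ennreal_plus)
    also have "\<dots> \<le> ennreal (2 * mp) * (\<integral>\<^sup>+t\<in>?I. ennreal (N h t) \<partial>lborel)
        + ennreal (2 * mm) * (\<integral>\<^sup>+t\<in>?I. ennreal (N (- h) t) \<partial>lborel)"
      using h by (intro add_mono mult_left_mono bent) auto
    also have "\<dots> = (\<integral>\<^sup>+t. ennreal (2 * mp) * (ennreal (N h t) * indicator ?I t) \<partial>lborel)
        + (\<integral>\<^sup>+t. ennreal (2 * mm) * (ennreal (N (- h) t) * indicator ?I t) \<partial>lborel)"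
      using bent(2)[of h] bent(2)[of "- h"] h by (simp add: nn_integral_cmult)
    also have "\<dots> = (\<integral>\<^sup>+t. ennreal (2 * mp) * (ennreal (N h t) * indicator ?I t) +
        ennreal (2 * mm) * (ennreal (N (- h) t) * indicator ?I t) \<partial>lborel)"
    proof (rule nn_integral_add[symmetric])
      have "norm (- h) \<le> r" using h by simp
      then show "(\<lambda>t. ennreal (2 * mm) * (ennreal (N (- h) t) * indicator ?I t)) \<in> borel_measurable lborel"
        by (intro borel_measurable_times_ennreal[OF borel_measurable_const bent(2)])
      show "(\<lambda>t. ennreal (2 * mp) * (ennreal (N h t) * indicator ?I t)) \<in> borel_measurable lborel"
        using h by (intro borel_measurable_times_ennreal[OF borel_measurable_const bent(2)])
    qed
    also have "\<dots> \<le> (\<integral>\<^sup>+t. ennreal (C + mp\<^sup>2 + mm\<^sup>2) * (ennreal (w t) * indicator ?I t) \<partial>lborel)"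
    proof (rule nn_integral_mono)
      fix t
      show "ennreal (2 * mp) * (ennreal (N h t) * indicator ?I t) + ennreal (2 * mm) * (ennreal (N (- h) t) * indicator ?I t)
        \<le> ennreal (C + mp\<^sup>2 + mm\<^sup>2) * (ennreal (w t) * indicator ?I t)"
      proof (cases "t \<in> ?I")
        case True
        have "ennreal (2 * mp) * ennreal (N h t) + ennreal (2 * mm) * ennreal (N (- h) t) =
            ennreal (2 * mp * N h t + 2 * mm * N (- h) t)"
          using m0 N0[OF True, of h] N0[OF True, of "- h"] h by (simp add: ennreal_mult' ennreal_plus)
        also have "\<dots> \<le> ennreal ((C + mp\<^sup>2 + mm\<^sup>2) * w t)" using pw[OF True] by (rule ennreal_leI)
        also have "\<dots> = ennreal (C + mp\<^sup>2 + mm\<^sup>2) * ennreal (w t)" using C0 by (rule ennreal_mult')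
        finally show ?thesis using True by simp
      qed simp
    qed
    also have "\<dots> = ennreal (C + mp\<^sup>2 + mm\<^sup>2) * ennreal l"
    proof (subst nn_integral_cmult)
      show "(\<lambda>t. ennreal (w t) * indicator ?I t) \<in> borel_measurable lborel"
      proof -
        have "(\<lambda>t. indicator ?I t *\<^sub>R w t) \<in> borel_measurable borel"
          using openI contw by (intro borel_measurable_continuous_on_indicator) auto
        then have "(\<lambda>t. ennreal (indicator ?I t *\<^sub>R w t)) \<in> borel_measurable borel" by measurable
        then show ?thesis
          by (subst measurable_lborel2, rule measurable_cong[THEN iffD1, rotated]) (auto simp: indicator_def)
      qed
    qed (simp add: \<open>(\<integral>\<^sup>+t\<in>?I. ennreal (w t) \<partial>lborel) = ennreal l\<close>)
    also have "\<dots> = ennreal ((C + mp\<^sup>2 + mm\<^sup>2) * l)" using C0 by (simp add: ennreal_mult')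
    finally have "2 * mp * \<rho> (?\<xi> (\<eta> + h)) z + 2 * mm * \<rho> (?\<xi> (\<eta> - h)) z \<le> (C + mp\<^sup>2 + mm\<^sup>2) * l"
      using C0 \<open>l > 0\<close> by (subst (asm) ennreal_le_iff) auto
    then have "2 * mp * (mp * l) + 2 * mm * (mm * l) \<le> (C + mp\<^sup>2 + mm\<^sup>2) * l"
      using \<open>l > 0\<close> by (simp add: mp_def mm_def)
    then have "(mp\<^sup>2 + mm\<^sup>2) * l \<le> C * l" by (simp add: power2_eq_square algebra_simps)
    then have "mp\<^sup>2 + mm\<^sup>2 \<le> C" using \<open>l > 0\<close> by simp
    then have "(mp\<^sup>2 + mm\<^sup>2) * l\<^sup>2 \<le> C * l\<^sup>2" by (rule mult_right_mono) simp
    moreover have "C * l\<^sup>2 = 2 * l\<^sup>2 + K * (norm h)\<^sup>2"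
      using \<open>l > 0\<close> by (simp add: C_def distrib_right)
    moreover have "\<rho> (?\<xi> (\<eta> + h)) z = mp * l" "\<rho> (?\<xi> (\<eta> - h)) z = mm * l"
      using \<open>l > 0\<close> by (simp_all add: mp_def mm_def)
    ultimately have "(\<rho> (?\<xi> (\<eta> + h)) z)\<^sup>2 + (\<rho> (?\<xi> (\<eta> - h)) z)\<^sup>2 \<le> 2 * l\<^sup>2 + K * (norm h)\<^sup>2"
      by (simp add: power_mult_distrib distrib_right)
    also have "\<dots> \<le> 2 * l'\<^sup>2 + K * (norm h)\<^sup>2" using \<open>l < l'\<close> \<open>l > 0\<close> by (simp add: power_mono)
    finally show ?thesis .
  qed
  show thesis
  proof (rule that[OF r(1) \<open>K > 0\<close> \<open>\<delta> > 0\<close> r1(3)])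
    show "cball ?u0 (2 * r) \<subseteq> snd c ` fst c" using subset_trans[OF subset_cball r1(4), of "2 * r"] r by simp
    show "\<rho> (?\<xi> u) (?\<xi> v) \<le> \<beta> * norm (u - v)" if "u \<in> cball ?u0 (2 * r)" "v \<in> cball ?u0 (2 * r)" for u v
      using that r by (intro up) auto
    fix z and \<eta> h :: "real ^ 'd" assume \<eta>: "\<eta> \<in> cball ?u0 r" and h: "norm h \<le> r" and z: "\<rho> (?\<xi> \<eta>) z < \<delta>"
    show "(\<rho> (?\<xi> (\<eta> + h)) z)\<^sup>2 + (\<rho> (?\<xi> (\<eta> - h)) z)\<^sup>2 \<le> 2 * (\<rho> (?\<xi> \<eta>) z)\<^sup>2 + K * (norm h)\<^sup>2"
    \<comment> \<open>At distance 0 there is no positive length to normalize by, but then both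
      displaced points are within \<open>\<beta> * norm h\<close> of \<open>z\<close>.\<close>
    proof (cases "\<rho> (?\<xi> \<eta>) z = 0")
      case True
      then have z: "z = ?\<xi> \<eta>" by (simp add: rho_zero_iff)
      have *: "\<rho> (?\<xi> (\<eta> + k)) z \<le> \<beta> * norm k" if "norm k \<le> r" for k
        using up[of "\<eta> + k" \<eta>] \<eta> that r norm_triangle_ineq[of "\<eta> - ?u0" k]
        by (auto simp: z dist_norm norm_minus_commute algebra_simps)
      have "(\<rho> (?\<xi> (\<eta> + h)) z)\<^sup>2 \<le> (\<beta> * norm h)\<^sup>2" "(\<rho> (?\<xi> (\<eta> - h)) z)\<^sup>2 \<le> (\<beta> * norm h)\<^sup>2"
        using *[of h] *[of "- h"] h by (auto intro!: power_mono)
      moreover have "2 * \<beta>\<^sup>2 * (norm h)\<^sup>2 \<le> K * (norm h)\<^sup>2"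
        using r1 r2 \<open>\<delta> > 0\<close> by (intro mult_right_mono) (auto simp: K_def)
      ultimately show ?thesis using True by (simp add: power_mult_distrib)
    next
      case False
      then have pos: "0 < \<rho> (?\<xi> \<eta>) z" using rho_nonneg[of "?\<xi> \<eta>" z] by simp
      let ?l = "\<rho> (?\<xi> \<eta>) z"
      have "((\<lambda>l'. 2 * l'\<^sup>2 + K * (norm h)\<^sup>2) \<longlongrightarrow> 2 * ?l\<^sup>2 + K * (norm h)\<^sup>2) (at_right ?l)"
        by (intro tendsto_intros)
      moreover have "eventually (\<lambda>l'. (\<rho> (?\<xi> (\<eta> + h)) z)\<^sup>2 + (\<rho> (?\<xi> (\<eta> - h)) z)\<^sup>2 \<le> 2 * l'\<^sup>2 + K * (norm h)\<^sup>2) (at_right ?l)"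
        using z main[OF \<eta> h pos] by (auto simp: eventually_at_right)
      ultimately show ?thesis by (rule tendsto_lowerbound) simp
    qed
  qed
  qed
  qed
qed

lemma rho_diff_le: "\<bar>\<rho> x y - \<rho> x z\<bar> \<le> \<rho> y z"
  using rho_triangle[of x y z] rho_triangle[of x z y] rho_sym[of y z] by linarith

text \<open>Near points are covered by the previous estimate. For a far \<open>x\<close>, let
  \<open>z\<close> lie almost on a shortest curve, about \<open>\<delta> / 2\<close> before the base
  point, at distance \<open>a\<close> from \<open>x\<close>. Then \<open>a + \<rho> z\<close> bounds
  \<open>\<rho> x\<close> from above and is almost exact at the base point. Squaring multiplies the
  second difference of \<open>\<rho> z\<close> by \<open>a\<close>, hence the linear growth of the
  constant.\<close>

lemma rho_sq_semiconcave:
  assumes c: "c \<in> A" and p: "p \<in> fst c"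
  obtains r K where "r > 0" "K > 0" "cball (snd c p) (2 * r) \<subseteq> snd c ` fst c"
    "\<And>x \<eta> h. \<eta> \<in> cball (snd c p) r \<Longrightarrow> norm h \<le> r \<Longrightarrow>
       (\<rho> x (chart_inv c (\<eta> + h)))\<^sup>2 + (\<rho> x (chart_inv c (\<eta> - h)))\<^sup>2 \<le>
         2 * (\<rho> x (chart_inv c \<eta>))\<^sup>2 + K * (1 + \<rho> x p) * (norm h)\<^sup>2"
    "\<And>x u v. u \<in> cball (snd c p) (2 * r) \<Longrightarrow> v \<in> cball (snd c p) (2 * r) \<Longrightarrow>
       \<bar>\<rho> x (chart_inv c u) - \<rho> x (chart_inv c v)\<bar> \<le> K * norm (u - v)"
proof (rule rho_sq_semiconcave_near[OF c p])
  let ?u0 = "snd c p" and ?\<xi> = "chart_inv c"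
  have \<xi>p: "?\<xi> ?u0 = p" using topological_chart_inv(1)[OF chart_topological[OF c] p] .
  fix r K \<delta> \<beta> assume r: "r > 0" and K: "K > 0" and \<delta>: "\<delta> > 0" and \<beta>: "\<beta> > 0"
    and dom: "cball ?u0 (2 * r) \<subseteq> snd c ` fst c"
    and up: "\<And>u v. u \<in> cball ?u0 (2 * r) \<Longrightarrow> v \<in> cball ?u0 (2 * r) \<Longrightarrow>
       \<rho> (?\<xi> u) (?\<xi> v) \<le> \<beta> * norm (u - v)"
    and near: "\<And>z \<eta> h. \<eta> \<in> cball ?u0 r \<Longrightarrow> norm h \<le> r \<Longrightarrow> \<rho> (?\<xi> \<eta>) z < \<delta> \<Longrightarrow>
       (\<rho> (?\<xi> (\<eta> + h)) z)\<^sup>2 + (\<rho> (?\<xi> (\<eta> - h)) z)\<^sup>2 \<le> 2 * (\<rho> (?\<xi> \<eta>) z)\<^sup>2 + K * (norm h)\<^sup>2"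
  \<comment> \<open>Turns growth in the distance from the moving point \<open>\<eta>\<close> into
    growth in \<open>\<rho> x p\<close>; the two distances differ by at most
    \<open>\<beta> * r\<close>.\<close>
  define K' where "K' = max \<beta> (K * (1 + 2 / \<delta> + 2 * \<beta> * r / \<delta>))"
  have "K' > 0" using \<beta> by (simp add: K'_def)
  have far: "(\<rho> x (?\<xi> (\<eta> + h)))\<^sup>2 + (\<rho> x (?\<xi> (\<eta> - h)))\<^sup>2 \<le>
      2 * (\<rho> x (?\<xi> \<eta>))\<^sup>2 + K * (1 + 2 * \<rho> x (?\<xi> \<eta>) / \<delta>) * (norm h)\<^sup>2"
    if \<eta>: "\<eta> \<in> cball ?u0 r" and h: "norm h \<le> r" for x \<eta> h
  proof (cases "\<rho> x (?\<xi> \<eta>) < \<delta>")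
    case True
    have "K * (norm h)\<^sup>2 \<le> K * (1 + 2 * \<rho> x (?\<xi> \<eta>) / \<delta>) * (norm h)\<^sup>2"
      using K \<delta> by (intro mult_right_mono) (auto simp: mult_le_cancel_left1)
    then show ?thesis
      using near[OF \<eta> h, of x] True by (simp add: rho_sym[of x])
  next
    case False
    let ?R = "\<rho> x (?\<xi> \<eta>)" and ?S = "(\<rho> x (?\<xi> (\<eta> + h)))\<^sup>2 + (\<rho> x (?\<xi> (\<eta> - h)))\<^sup>2"
    have le: "?S \<le> 2 * (?R + e)\<^sup>2 + K * (1 + 2 * ?R / \<delta>) * (norm h)\<^sup>2" if e: "0 < e" "e < \<delta> / 2" for e
    proof -
      define a where "a = ?R - \<delta> / 2"
      have a: "0 \<le> a" "a \<le> ?R" using False \<delta> by (auto simp: a_def)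
      obtain z where z: "\<rho> x z = a" "\<rho> z (?\<xi> \<eta>) \<le> ?R - a + e"
        using rho_approx_between[OF a e(1)] by blast
      define \<nu> where "\<nu> = \<delta> / 2 + e"
      have \<nu>: "\<nu> > 0" "\<nu> < \<delta>" "\<rho> z (?\<xi> \<eta>) \<le> \<nu>" using e \<delta> z(2) by (auto simp: \<nu>_def a_def)
      define lp lm where "lp = \<rho> z (?\<xi> (\<eta> + h))" and "lm = \<rho> z (?\<xi> (\<eta> - h))"
      have "lp\<^sup>2 + lm\<^sup>2 \<le> 2 * (\<rho> z (?\<xi> \<eta>))\<^sup>2 + K * (norm h)\<^sup>2"
        using near[OF \<eta> h, of z] \<nu> by (simp add: rho_sym[of z] lp_def lm_def)
      also have "\<dots> \<le> 2 * \<nu>\<^sup>2 + K * (norm h)\<^sup>2" using \<nu>(3) by (simp add: power_mono)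
      finally have l2: "lp\<^sup>2 + lm\<^sup>2 \<le> 2 * \<nu>\<^sup>2 + K * (norm h)\<^sup>2" .
      \<comment> \<open>Passes from squares of distances to distances. The division by
        \<open>\<nu>\<close> costs only a constant, since \<open>\<nu>\<close> stays above
        \<open>\<delta> / 2\<close>.\<close>
      have "0 \<le> (lp - \<nu>)\<^sup>2 + (lm - \<nu>)\<^sup>2" by simp
      then have "2 * \<nu> * (lp + lm) \<le> lp\<^sup>2 + lm\<^sup>2 + 2 * \<nu>\<^sup>2"
        by (simp add: power2_eq_square algebra_simps)
      with l2 have "2 * \<nu> * (lp + lm) \<le> 4 * \<nu>\<^sup>2 + K * (norm h)\<^sup>2" by simp
      then have "2 * (lp + lm) \<le> (4 * \<nu>\<^sup>2 + K * (norm h)\<^sup>2) / \<nu>"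
        using \<nu>(1) by (simp add: pos_le_divide_eq mult_ac)
      also have "\<dots> = 4 * \<nu> + K * (norm h)\<^sup>2 / \<nu>" using \<nu>(1) by (simp add: add_divide_distrib power2_eq_square)
      finally have l1: "2 * (lp + lm) \<le> 4 * \<nu> + K * (norm h)\<^sup>2 / \<nu>" .
      have "?S \<le> (a + lp)\<^sup>2 + (a + lm)\<^sup>2"
        using rho_triangle[of x "?\<xi> (\<eta> + h)" z] rho_triangle[of x "?\<xi> (\<eta> - h)" z] z(1)
        by (intro add_mono power_mono) (auto simp: lp_def lm_def)
      also have "\<dots> = 2 * a\<^sup>2 + a * (2 * (lp + lm)) + (lp\<^sup>2 + lm\<^sup>2)"
        by (simp add: power2_eq_square algebra_simps)
      also have "\<dots> \<le> 2 * a\<^sup>2 + a * (4 * \<nu> + K * (norm h)\<^sup>2 / \<nu>) + (2 * \<nu>\<^sup>2 + K * (norm h)\<^sup>2)"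
        using mult_left_mono[OF l1 a(1)] l2 by linarith
      also have "\<dots> = 2 * (a + \<nu>)\<^sup>2 + K * (1 + a / \<nu>) * (norm h)\<^sup>2"
        by (simp add: power2_eq_square algebra_simps)
      also have "\<dots> \<le> 2 * (?R + e)\<^sup>2 + K * (1 + 2 * ?R / \<delta>) * (norm h)\<^sup>2"
      proof -
        have "a / \<nu> \<le> ?R / (\<delta> / 2)" using a \<nu>(1) e \<delta> by (intro frac_le) (auto simp: \<nu>_def)
        then have "a / \<nu> \<le> 2 * ?R / \<delta>" by (simp add: mult.commute)
        then show ?thesis using K by (intro add_mono mult_right_mono mult_left_mono) (auto simp: a_def \<nu>_def)
      qed
      finally show ?thesis .
    qed
    have "((\<lambda>e. 2 * (?R + e)\<^sup>2 + K * (1 + 2 * ?R / \<delta>) * (norm h)\<^sup>2) \<longlongrightarrow>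
        2 * (?R + 0)\<^sup>2 + K * (1 + 2 * ?R / \<delta>) * (norm h)\<^sup>2) (at_right 0)"
      by (intro tendsto_intros)
    moreover have "eventually (\<lambda>e. ?S \<le> 2 * (?R + e)\<^sup>2 + K * (1 + 2 * ?R / \<delta>) * (norm h)\<^sup>2) (at_right 0)"
      using \<delta> le unfolding eventually_at_right_field by (intro exI[of _ "\<delta> / 2"]) auto
    ultimately have "?S \<le> 2 * (?R + 0)\<^sup>2 + K * (1 + 2 * ?R / \<delta>) * (norm h)\<^sup>2"
      by (rule tendsto_lowerbound) simp
    then show ?thesis by simp
  qed
  show thesis
  proof (rule that[OF r \<open>K' > 0\<close> dom])
    fix x and \<eta> h :: "real ^ 'd" assume \<eta>: "\<eta> \<in> cball ?u0 r" and h: "norm h \<le> r"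
    have "?u0 \<in> cball ?u0 (2 * r)" "\<eta> \<in> cball ?u0 (2 * r)" using \<eta> r by auto
    then have "\<rho> p (?\<xi> \<eta>) \<le> \<beta> * norm (?u0 - \<eta>)" using up[of ?u0 \<eta>] \<xi>p by simp
    also have "\<dots> \<le> \<beta> * r" using \<eta> \<beta> by (simp add: dist_norm)
    finally have "\<rho> x (?\<xi> \<eta>) \<le> \<rho> x p + \<beta> * r"
      using rho_triangle[of x "?\<xi> \<eta>" p] by simp
    then have "1 + 2 * \<rho> x (?\<xi> \<eta>) / \<delta> \<le> 1 + 2 * (\<rho> x p + \<beta> * r) / \<delta>"
      using \<delta> by (simp add: divide_right_mono)
    also have "\<dots> \<le> (1 + 2 / \<delta> + 2 * \<beta> * r / \<delta>) * (1 + \<rho> x p)"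
      using \<delta> \<beta> r by (simp add: field_simps)
    finally have "K * (1 + 2 * \<rho> x (?\<xi> \<eta>) / \<delta>) \<le> K * (1 + 2 / \<delta> + 2 * \<beta> * r / \<delta>) * (1 + \<rho> x p)"
      using K by simp
    also have "\<dots> \<le> K' * (1 + \<rho> x p)" by (intro mult_right_mono) (auto simp: K'_def)
    finally have "K * (1 + 2 * \<rho> x (?\<xi> \<eta>) / \<delta>) * (norm h)\<^sup>2 \<le> K' * (1 + \<rho> x p) * (norm h)\<^sup>2"
      by (rule mult_right_mono) simp
    then show "(\<rho> x (?\<xi> (\<eta> + h)))\<^sup>2 + (\<rho> x (?\<xi> (\<eta> - h)))\<^sup>2 \<le>
         2 * (\<rho> x (?\<xi> \<eta>))\<^sup>2 + K' * (1 + \<rho> x p) * (norm h)\<^sup>2"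
      using far[OF \<eta> h, of x] by linarith
  next
    fix x u v assume uv: "u \<in> cball ?u0 (2 * r)" "v \<in> cball ?u0 (2 * r)"
    have "\<bar>\<rho> x (?\<xi> u) - \<rho> x (?\<xi> v)\<bar> \<le> \<beta> * norm (u - v)"
      using rho_diff_le[of x "?\<xi> u" "?\<xi> v"] up[OF uv] by simp
    also have "\<dots> \<le> K' * norm (u - v)" by (intro mult_right_mono) (auto simp: K'_def)
    finally show "\<bar>\<rho> x (?\<xi> u) - \<rho> x (?\<xi> v)\<bar> \<le> K' * norm (u - v)" .
  qed
qed

text \<open>The metric has coordinate matrices for the charts of \<open>A\<close> only, so the
  estimate is pulled back along a transition map. This map preserves midpoints up to order
  \<open>(norm h)^2\<close>, and the Lipschitz bound of the distance absorbs the error.\<close>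

lemma rho_sq_semiconcave_manifold_chart:
  assumes mc: "manifold_chart A (U, \<phi>)" and p: "p \<in> U"
  obtains r K where "r > 0" "K > 0" "cball (\<phi> p) (2 * r) \<subseteq> \<phi> ` U"
    "\<And>x \<theta> h. \<theta> \<in> cball (\<phi> p) r \<Longrightarrow> norm h \<le> r \<Longrightarrow>
       (\<rho> x (inv_into U \<phi> (\<theta> + h)))\<^sup>2 + (\<rho> x (inv_into U \<phi> (\<theta> - h)))\<^sup>2 \<le>
         2 * (\<rho> x (inv_into U \<phi> \<theta>))\<^sup>2 + K * (1 + \<rho> x p) * (norm h)\<^sup>2"
    "\<And>x u v. u \<in> cball (\<phi> p) (2 * r) \<Longrightarrow> v \<in> cball (\<phi> p) (2 * r) \<Longrightarrow>
       \<bar>\<rho> x (inv_into U \<phi> u) - \<rho> x (inv_into U \<phi> v)\<bar> \<le> K * norm (u - v)"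
proof -
  obtain c where c: "c \<in> A" "p \<in> fst c" using chart_exists by blast
  have t\<phi>: "topological_chart (U, \<phi>)" and st: "smooth_transition (U, \<phi>) c"
    using mc c(1) unfolding manifold_chart_def by auto
  note tc = chart_topological[OF c(1)]
  let ?u0 = "snd c p" and ?\<xi> = "chart_inv c" and ?\<zeta> = "inv_into U \<phi>" and ?\<mu> = "\<phi> p"
  let ?\<tau> = "snd c \<circ> ?\<zeta>" and ?W = "\<phi> ` (U \<inter> fst c)"
  have sm: "smooth_on ?W ?\<tau>" using st by (simp add: smooth_transition_def case_prod_beta)
  have opW: "open ?W"
    using topological_chart_open_image[OF t\<phi>, of "U \<inter> fst c"] topological_chart_open(1)[OF t\<phi>] topological_chart_open(1)[OF tc]
    by (simp add: open_Int)
  have \<mu>W: "?\<mu> \<in> ?W" using p c(2) by blast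
  have \<zeta>: "?\<zeta> \<theta> = ?\<xi> (?\<tau> \<theta>)" "\<theta> \<in> \<phi> ` U" if "\<theta> \<in> ?W" for \<theta>
    using that topological_chart_inv[OF t\<phi>] topological_chart_inv[OF tc] by auto
  have \<tau>\<mu>: "?\<tau> ?\<mu> = ?u0" using topological_chart_inv(1)[OF t\<phi>, of p] p by simp
  show thesis
  proof (rule rho_sq_semiconcave[OF c])
  fix r1 K assume r1: "r1 > 0" and K: "K > 0" "cball ?u0 (2 * r1) \<subseteq> snd c ` fst c"
    and sc: "\<And>x \<eta> h. \<eta> \<in> cball ?u0 r1 \<Longrightarrow> norm h \<le> r1 \<Longrightarrow>
       (\<rho> x (?\<xi> (\<eta> + h)))\<^sup>2 + (\<rho> x (?\<xi> (\<eta> - h)))\<^sup>2 \<le> 2 * (\<rho> x (?\<xi> \<eta>))\<^sup>2 + K * (1 + \<rho> x p) * (norm h)\<^sup>2"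
    and lip: "\<And>x u v. u \<in> cball ?u0 (2 * r1) \<Longrightarrow> v \<in> cball ?u0 (2 * r1) \<Longrightarrow>
       \<bar>\<rho> x (?\<xi> u) - \<rho> x (?\<xi> v)\<bar> \<le> K * norm (u - v)"
  show thesis
  proof (rule smooth_on_second_difference[OF sm opW \<mu>W])
  fix r2 L assume r2: "r2 > 0" "L > 0" and domW: "cball ?\<mu> r2 \<subseteq> ?W"
    and lip\<tau>: "\<And>x y. x \<in> cball ?\<mu> r2 \<Longrightarrow> y \<in> cball ?\<mu> r2 \<Longrightarrow> norm (?\<tau> x - ?\<tau> y) \<le> L * norm (x - y)"
    and sd\<tau>: "\<And>x h. x + h \<in> cball ?\<mu> r2 \<Longrightarrow> x - h \<in> cball ?\<mu> r2 \<Longrightarrow>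
        norm (?\<tau> (x + h) + ?\<tau> (x - h) - 2 *\<^sub>R ?\<tau> x) \<le> L * (norm h)\<^sup>2"
  define r where "r = min (r2 / 2) (r1 / (2 * L))"
  have r: "r > 0" "2 * r \<le> r2" "L * (2 * r) \<le> r1" using r1 r2 by (auto simp: r_def min_def field_simps)
  have big: "\<theta> \<in> cball ?\<mu> r2" if "\<theta> \<in> cball ?\<mu> (2 * r)" for \<theta> using that r by auto
  have inW: "\<theta> \<in> ?W" if "\<theta> \<in> cball ?\<mu> (2 * r)" for \<theta> using big[OF that] domW by blast
  have img: "?\<tau> \<theta> \<in> cball ?u0 r1" if "\<theta> \<in> cball ?\<mu> (2 * r)" for \<theta>
  proof -
    have "norm (?\<tau> ?\<mu> - ?\<tau> \<theta>) \<le> L * norm (?\<mu> - \<theta>)"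
      using r r2 big[OF that] by (intro lip\<tau>) auto
    also have "\<dots> \<le> L * (2 * r)" using that r2 by (simp add: dist_norm)
    also have "\<dots> \<le> r1" by (rule r(3))
    finally show ?thesis unfolding \<tau>\<mu> by (simp add: dist_norm)
  qed
  define K' where "K' = K * L + (K * L * (2 + 2 * K * r1) + K * L\<^sup>2)"
  have "K * L > 0" using K r2 by simp
  have K': "K' > 0" "K * L \<le> K'" using K r1 r2 \<open>K * L > 0\<close> by (auto simp: K'_def add_pos_nonneg)
  show thesis
  proof (rule that[OF r(1) K'(1)])
    show "cball ?\<mu> (2 * r) \<subseteq> \<phi> ` U" using inW \<zeta>(2) by blast
  next
    fix x u v assume uv: "u \<in> cball ?\<mu> (2 * r)" "v \<in> cball ?\<mu> (2 * r)"
    have "\<bar>\<rho> x (?\<xi> (?\<tau> u)) - \<rho> x (?\<xi> (?\<tau> v))\<bar> \<le> K * norm (?\<tau> u - ?\<tau> v)"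
      using img[OF uv(1)] img[OF uv(2)] r1 by (intro lip) auto
    also have "\<dots> \<le> K * (L * norm (u - v))" using K by (intro mult_left_mono lip\<tau> big uv) auto
    also have "\<dots> \<le> K' * norm (u - v)" using mult_right_mono[OF K'(2), of "norm (u - v)"] by (simp add: mult_ac)
    finally show "\<bar>\<rho> x (?\<zeta> u) - \<rho> x (?\<zeta> v)\<bar> \<le> K' * norm (u - v)"
      unfolding \<zeta>(1)[OF inW[OF uv(1)], symmetric] \<zeta>(1)[OF inW[OF uv(2)], symmetric] .
  next
    fix x and \<theta> h :: "real ^ 'd" assume \<theta>: "\<theta> \<in> cball ?\<mu> r" and h: "norm h \<le> r"
    have mem: "\<theta> + h \<in> cball ?\<mu> (2 * r)" "\<theta> - h \<in> cball ?\<mu> (2 * r)" "\<theta> \<in> cball ?\<mu> (2 * r)"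
      using \<theta> h r(1) norm_triangle_ineq4[of "?\<mu> - \<theta>" h] norm_triangle_ineq[of "?\<mu> - \<theta>" h]
      by (simp_all add: dist_norm diff_diff_eq diff_diff_eq2 diff_add_eq)
    define a b where "a = ?\<tau> (\<theta> + h)" and "b = ?\<tau> (\<theta> - h)"
    \<comment> \<open>Midpoint and half difference of the two image points. Semiconcavity in the
      atlas chart applies to these, and \<open>m\<close> differs from the image of
      \<open>\<theta>\<close> only to second order.\<close>
    define m k where "m = (1/2) *\<^sub>R (a + b)" and "k = (1/2) *\<^sub>R (a - b)"
    have "m + k = (1/2) *\<^sub>R ((a + b) + (a - b))" "m - k = (1/2) *\<^sub>R ((a + b) - (a - b))"
      by (simp_all only: m_def k_def scaleR_add_right[symmetric] scaleR_diff_right[symmetric])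
    moreover have "(a + b) + (a - b) = 2 *\<^sub>R a" "(a + b) - (a - b) = 2 *\<^sub>R b" by (simp_all add: scaleR_2)
    ultimately have mk: "m + k = a" "m - k = b" by simp_all
    have ab: "a \<in> cball ?u0 r1" "b \<in> cball ?u0 r1" using img mem by (auto simp: a_def b_def)
    have m: "m \<in> cball ?u0 r1"
      using convexD[OF convex_cball ab, of "1/2" "1/2"] by (simp add: m_def scaleR_add_right)
    have "norm (a - b) \<le> L * norm ((\<theta> + h) - (\<theta> - h))"
      unfolding a_def b_def by (intro lip\<tau> big mem)
    also have "(\<theta> + h) - (\<theta> - h) = 2 *\<^sub>R h" by (simp add: scaleR_2)
    finally have nk: "norm k \<le> L * norm h" by (simp add: k_def)
    also have "\<dots> \<le> L * (2 * r)" using h r r2 by (intro mult_left_mono) auto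
    finally have "norm k \<le> r1" using r(3) by linarith
    have "norm (a + b - 2 *\<^sub>R ?\<tau> \<theta>) \<le> L * (norm h)\<^sup>2"
      unfolding a_def b_def by (intro sd\<tau> big mem)
    moreover have "a + b - 2 *\<^sub>R ?\<tau> \<theta> = 2 *\<^sub>R (m - ?\<tau> \<theta>)" by (simp add: m_def scaleR_diff_right)
    ultimately have nm: "norm (m - ?\<tau> \<theta>) \<le> L * (norm h)\<^sup>2 / 2" by simp
    let ?m = "\<rho> x (?\<xi> m)" and ?t = "\<rho> x (?\<xi> (?\<tau> \<theta>))"
    have bd: "\<rho> x (?\<xi> u) \<le> \<rho> x p + K * r1" if u: "u \<in> cball ?u0 r1" for u
    proof -
      have "\<bar>\<rho> x (?\<xi> u) - \<rho> x (?\<xi> ?u0)\<bar> \<le> K * norm (u - ?u0)"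
        using u r1 by (intro lip) auto
      also have "\<dots> \<le> K * r1" using u K by (simp add: dist_norm norm_minus_commute)
      finally show ?thesis using topological_chart_inv(1)[OF tc c(2)] by simp
    qed
    have "\<bar>?m - ?t\<bar> \<le> K * norm (m - ?\<tau> \<theta>)" using m img[OF mem(3)] r1 by (intro lip) auto
    also have "\<dots> \<le> K * (L * (norm h)\<^sup>2 / 2)" using nm K by (intro mult_left_mono) auto
    finally have d: "\<bar>?m - ?t\<bar> \<le> K * L * (norm h)\<^sup>2 / 2" by simp
    have "2 * ?m\<^sup>2 - 2 * ?t\<^sup>2 = 2 * ((?m - ?t) * (?m + ?t))" by (simp add: power2_eq_square algebra_simps)
    also have "\<dots> \<le> 2 * ((K * L * (norm h)\<^sup>2 / 2) * ((\<rho> x p + K * r1) + (\<rho> x p + K * r1)))"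
      using abs_le_D1[OF d] bd[OF m] bd[OF img[OF mem(3)]] K r2
      by (intro mult_left_mono[of _ _ 2] mult_mono add_mono) auto
    also have "\<dots> \<le> (K * L * (2 + 2 * K * r1)) * (1 + \<rho> x p) * (norm h)\<^sup>2"
    proof -
      have "(\<rho> x p + K * r1) + (\<rho> x p + K * r1) \<le> (2 + 2 * K * r1) * (1 + \<rho> x p)"
        using K r1 by (simp add: algebra_simps)
      then have "K * L * (norm h)\<^sup>2 * ((\<rho> x p + K * r1) + (\<rho> x p + K * r1)) \<le> K * L * (norm h)\<^sup>2 * ((2 + 2 * K * r1) * (1 + \<rho> x p))"
        using K r2 by (intro mult_left_mono) auto
      then show ?thesis by (simp add: mult_ac)
    qed
    finally have 1: "2 * ?m\<^sup>2 \<le> 2 * ?t\<^sup>2 + (K * L * (2 + 2 * K * r1)) * (1 + \<rho> x p) * (norm h)\<^sup>2" by simp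
    have "(\<rho> x (?\<xi> a))\<^sup>2 + (\<rho> x (?\<xi> b))\<^sup>2 \<le> 2 * ?m\<^sup>2 + K * (1 + \<rho> x p) * (norm k)\<^sup>2"
      using sc[OF m \<open>norm k \<le> r1\<close>, of x] by (simp add: mk)
    also have "\<dots> \<le> 2 * ?m\<^sup>2 + K * (1 + \<rho> x p) * (L * norm h)\<^sup>2"
      using nk K by (intro add_mono mult_left_mono power_mono) auto
    also have "\<dots> \<le> 2 * ?t\<^sup>2 + (K * L * (2 + 2 * K * r1) + K * L\<^sup>2) * (1 + \<rho> x p) * (norm h)\<^sup>2"
      using 1 by (simp add: power_mult_distrib algebra_simps)
    also have "\<dots> \<le> 2 * ?t\<^sup>2 + K' * (1 + \<rho> x p) * (norm h)\<^sup>2"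
      using \<open>K * L > 0\<close> by (intro add_mono mult_right_mono) (auto simp: K'_def)
    finally show "(\<rho> x (?\<zeta> (\<theta> + h)))\<^sup>2 + (\<rho> x (?\<zeta> (\<theta> - h)))\<^sup>2 \<le>
         2 * (\<rho> x (?\<zeta> \<theta>))\<^sup>2 + K' * (1 + \<rho> x p) * (norm h)\<^sup>2"
      unfolding a_def b_def \<zeta>(1)[OF inW[OF mem(1)], symmetric] \<zeta>(1)[OF inW[OF mem(2)], symmetric]
        \<zeta>(1)[OF inW[OF mem(3)], symmetric] .
  qed
  qed
  qed
qed

end

section \<open>Gaussian measures and weak convergence\<close>

text \<open>The product form lets Fourier transforms factor into one-dimensional ones;
  \<open>gauss_density_eq\<close> has the radial form.\<close>

definition gauss_density :: "'a::euclidean_space \<Rightarrow> real" where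
  "gauss_density x = (\<Prod>b\<in>Basis. std_normal_density (x \<bullet> b))"

definition std_gauss :: "'a::euclidean_space measure" where
  "std_gauss = density lborel (\<lambda>x. ennreal (gauss_density x))"

lemma sum_Basis_inner_sq: "(\<Sum>b\<in>Basis. - (x \<bullet> b)\<^sup>2 / 2) = - (norm (x::'a::euclidean_space))\<^sup>2 / 2"
proof -
  have "(norm x)\<^sup>2 = (\<Sum>b\<in>Basis. (x \<bullet> b)\<^sup>2)"
    by (subst power2_norm_eq_inner, subst euclidean_inner) (simp add: power2_eq_square)
  then show ?thesis by (simp add: sum_negf sum_divide_distrib)
qed

lemma gauss_density_eq:
  "gauss_density (x :: 'a::euclidean_space) = exp (- (norm x)\<^sup>2 / 2) / sqrt ((2 * pi) ^ DIM('a))"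
proof -
  have "gauss_density x = (\<Prod>b\<in>Basis. exp (- (x \<bullet> b)\<^sup>2 / 2) / sqrt (2 * pi))"
    by (simp add: gauss_density_def std_normal_density_def)
  also have "\<dots> = exp (\<Sum>b\<in>Basis. - (x \<bullet> b)\<^sup>2 / 2) / sqrt (2 * pi) ^ DIM('a)"
    by (simp add: prod_dividef exp_sum)
  also have "(\<Sum>b\<in>Basis. - (x \<bullet> b)\<^sup>2 / 2) = - (norm x)\<^sup>2 / 2"
    by (rule sum_Basis_inner_sq)
  finally show ?thesis unfolding real_sqrt_power .
qed

lemma gauss_density_nonneg [simp]: "gauss_density x \<ge> 0"
  by (simp add: gauss_density_def prod_nonneg)

lemma gauss_density_measurable [measurable]: "gauss_density \<in> borel_measurable borel"
  unfolding gauss_density_eq[abs_def] by measurable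

lemma sets_std_gauss [simp, measurable_cong]: "sets std_gauss = sets borel"
  by (simp add: std_gauss_def)

lemma space_std_gauss [simp]: "space std_gauss = UNIV"
  by (simp add: std_gauss_def)

lemma lborel_integral_prod_Basis:
  fixes f :: "'a::euclidean_space \<Rightarrow> real \<Rightarrow> complex"
  assumes "\<And>b. b \<in> Basis \<Longrightarrow> integrable lborel (f b)"
  shows "integrable lborel (\<lambda>x. \<Prod>b\<in>Basis. f b (x \<bullet> b))"
    "(LINT x|lborel. (\<Prod>b\<in>Basis. f b (x \<bullet> b))) = (\<Prod>b\<in>Basis. LINT t|lborel. f b t)"
proof -
  interpret product_sigma_finite "\<lambda>_::'a. lborel :: real measure" ..
  let ?T = "\<lambda>f. \<Sum>b\<in>Basis. f b *\<^sub>R (b::'a)" and ?P = "Pi\<^sub>M Basis (\<lambda>_::'a. lborel :: real measure)"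
  have T[measurable]: "?T \<in> borel_measurable ?P" by measurable
  have [measurable]: "f b \<in> borel_measurable borel" if "b \<in> Basis" for b
    using borel_measurable_integrable[OF assms[OF that]] by simp
  have m: "(\<lambda>x. \<Prod>b\<in>Basis. f b (x \<bullet> b)) \<in> borel_measurable borel" by measurable
  have coord: "?T g \<bullet> b = g b" if "b \<in> Basis" for g and b :: 'a
    using that by (simp add: inner_sum_left inner_Basis if_distrib cong: if_cong)
  have eq: "(\<Prod>b\<in>Basis. f b (?T g \<bullet> b)) = (\<Prod>b\<in>Basis. f b (g b))" for g
    by (intro prod.cong refl) (simp only: coord)
  have int: "integrable ?P (\<lambda>g. \<Prod>b\<in>Basis. f b (g b))"
    by (intro product_integrable_prod assms) auto
  show "integrable lborel (\<lambda>x. \<Prod>b\<in>Basis. f b (x \<bullet> b))"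
    using int by (subst lborel_eq, subst integrable_distr_eq[OF T m]) (simp only: eq)
  have "(LINT x|lborel. (\<Prod>b\<in>Basis. f b (x \<bullet> b))) = (LINT g|?P. (\<Prod>b\<in>Basis. f b (g b)))"
    by (subst lborel_eq, subst integral_distr[OF T m]) (simp only: eq)
  also have "\<dots> = (\<Prod>b\<in>Basis. LINT t|lborel. f b t)"
    by (intro product_integral_prod assms) auto
  finally show "(LINT x|lborel. (\<Prod>b\<in>Basis. f b (x \<bullet> b))) = (\<Prod>b\<in>Basis. LINT t|lborel. f b t)" .
qed

lemma gauss_density_fourier:
  fixes t :: "'a::euclidean_space"
  shows "integrable lborel (\<lambda>x. gauss_density x *\<^sub>R iexp (t \<bullet> x))"
    "(LINT x|lborel. gauss_density x *\<^sub>R iexp (t \<bullet> x)) = complex_of_real (exp (- (norm t)\<^sup>2 / 2))"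
proof -
  let ?f = "\<lambda>b s. std_normal_density s *\<^sub>R iexp ((t \<bullet> b) * s)"
  have eq: "gauss_density x *\<^sub>R iexp (t \<bullet> x) = (\<Prod>b\<in>Basis. ?f b (x \<bullet> b))" for x
  proof -
    have "iexp (t \<bullet> x) = exp (\<Sum>b\<in>Basis. \<i> * complex_of_real ((t \<bullet> b) * (x \<bullet> b)))"
      by (subst euclidean_inner) (simp add: sum_distrib_left)
    also have "\<dots> = (\<Prod>b\<in>Basis. iexp ((t \<bullet> b) * (x \<bullet> b)))" by (simp add: exp_sum)
    finally show ?thesis by (simp add: gauss_density_def scaleR_conv_of_real prod.distrib)
  qed
  have int: "integrable lborel (?f b)" for b
    by (rule Bochner_Integration.integrable_bound[of _ "std_normal_density"])
      (auto simp: integrable_normal_density)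
  have char1: "(LINT s|lborel. ?f b s) = complex_of_real (exp (- (t \<bullet> b)\<^sup>2 / 2))" for b
  proof -
    have "char std_normal_distribution (t \<bullet> b) = (LINT s|lborel. ?f b s)"
      unfolding char_def by (subst integral_density) auto
    then show ?thesis by (simp add: char_std_normal_distribution)
  qed
  show "integrable lborel (\<lambda>x. gauss_density x *\<^sub>R iexp (t \<bullet> x))"
    unfolding eq using int by (intro lborel_integral_prod_Basis)
  have "(LINT x|lborel. gauss_density x *\<^sub>R iexp (t \<bullet> x)) = (\<Prod>b\<in>Basis. complex_of_real (exp (- (t \<bullet> b)\<^sup>2 / 2)))"
    unfolding eq char1[symmetric] using int by (intro lborel_integral_prod_Basis)
  also have "\<dots> = complex_of_real (exp (\<Sum>b\<in>Basis. - (t \<bullet> b)\<^sup>2 / 2))" by (simp add: exp_sum)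
  also have "(\<Sum>b\<in>Basis. - (t \<bullet> b)\<^sup>2 / 2) = - (norm t)\<^sup>2 / 2"
    by (rule sum_Basis_inner_sq)
  finally show "(LINT x|lborel. gauss_density x *\<^sub>R iexp (t \<bullet> x)) = complex_of_real (exp (- (norm t)\<^sup>2 / 2))" .
qed

lemma integral_gauss_density:
  "integrable lborel (gauss_density :: 'a::euclidean_space \<Rightarrow> real)" "(LINT x|lborel. gauss_density (x::'a)) = 1"
proof -
  have "integrable lborel (\<lambda>x::'a. Re (gauss_density x *\<^sub>R iexp (0 \<bullet> x)))"
    by (intro integrable_Re gauss_density_fourier)
  then show i: "integrable lborel (gauss_density :: 'a \<Rightarrow> real)" by simp
  have "complex_of_real (LINT x|lborel. gauss_density (x::'a)) = (LINT x|lborel. gauss_density x *\<^sub>R iexp (0 \<bullet> (x::'a)))"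
    by (simp add: scaleR_conv_of_real)
  also have "\<dots> = 1" unfolding gauss_density_fourier by simp
  finally show "(LINT x|lborel. gauss_density (x::'a)) = 1" using of_real_eq_1_iff by blast
qed

lemma nn_integral_gauss_density: "(\<integral>\<^sup>+x. ennreal (gauss_density (x::'a::euclidean_space)) \<partial>lborel) = 1"
  using nn_integral_eq_integral[OF integral_gauss_density(1)[where 'a='a]] integral_gauss_density(2)[where 'a='a]
  by simp

lemma prob_space_std_gauss: "prob_space (std_gauss :: 'a::euclidean_space measure)"
  by (rule prob_spaceI) (simp add: std_gauss_def emeasure_density nn_integral_gauss_density)

lemma char_std_gauss:
  "(LINT x|std_gauss. iexp (t \<bullet> x)) = complex_of_real (exp (- (norm (t::'a::euclidean_space))\<^sup>2 / 2))"
  unfolding std_gauss_def gauss_density_fourier(2)[symmetric]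
  by (subst integral_density) auto

section \<open>Convergence of characteristic functions and Gaussian smoothing\<close>

lemma nn_integral_lborel_affine:
  fixes f :: "'a::euclidean_space \<Rightarrow> ennreal"
  assumes [measurable]: "f \<in> borel_measurable borel" and "c > 0"
  shows "(\<integral>\<^sup>+x. f x \<partial>lborel) = ennreal (c ^ DIM('a)) * (\<integral>\<^sup>+x. f (t + c *\<^sub>R x) \<partial>lborel)"
proof -
  have "(\<integral>\<^sup>+x. f x \<partial>lborel) =
      (\<integral>\<^sup>+x. f x \<partial>density (distr lborel borel (\<lambda>x. t + c *\<^sub>R x)) (\<lambda>_. ennreal (\<bar>c\<bar> ^ DIM('a))))"
    using \<open>c > 0\<close> by (subst lborel_affine[of c t]) auto
  also have "\<dots> = (\<integral>\<^sup>+x. ennreal (c ^ DIM('a)) * f (t + c *\<^sub>R x) \<partial>lborel)"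
    using \<open>c > 0\<close> by (simp add: nn_integral_density nn_integral_distr)
  also have "\<dots> = ennreal (c ^ DIM('a)) * (\<integral>\<^sup>+x. f (t + c *\<^sub>R x) \<partial>lborel)"
    by (rule nn_integral_cmult) measurable
  finally show ?thesis .
qed

lemma nn_integral_std_gauss:
  "f \<in> borel_measurable borel \<Longrightarrow>
    (\<integral>\<^sup>+x. f x \<partial>std_gauss) = (\<integral>\<^sup>+x. ennreal (gauss_density x) * f x \<partial>lborel)"
  unfolding std_gauss_def by (subst nn_integral_density) auto

text \<open>The density of \<open>Y + s \<xi>\<close> up to the factor \<open>s\<^sup>d\<close> (and a constant), where \<open>Y\<close> has distribution \<open>M\<close> and
  \<open>\<xi>\<close> is an independent standard normal vector.\<close>

definition smoothed_density :: "real \<Rightarrow> 'a::euclidean_space measure \<Rightarrow> 'a \<Rightarrow> real" where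
  "smoothed_density s M w = (LINT y|M. gauss_density ((1 / s) *\<^sub>R (w - y)))"

lemma gauss_density_le: "gauss_density (x::'a::euclidean_space) \<le> gauss_density (0::'a)"
  by (simp add: gauss_density_eq divide_right_mono)

text \<open>The Gaussian density is its own Fourier transform up to a constant, so that a
  convolution with it can be expressed by characteristic functions.\<close>

lemma gauss_density_char:
  "complex_of_real (gauss_density (u::'a::euclidean_space)) = complex_of_real (gauss_density (0::'a)) * (LINT x|std_gauss. iexp (u \<bullet> x))"
  unfolding char_std_gauss by (simp add: gauss_density_eq)

text \<open>The last equation is Fourier inversion for the smoothed law: after Fubini's theorem the
  inner integral over \<open>M\<close> is the characteristic function of \<open>M\<close>.\<close>

lemma smoothed_density:
  fixes s :: real and M :: "'a::euclidean_space measure"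
  assumes "prob_space M" and M[measurable_cong]: "sets M = sets borel"
  shows "smoothed_density s M \<in> borel_measurable borel"
    "smoothed_density s M w \<ge> 0"
    "complex_of_real (smoothed_density s M w) = complex_of_real (gauss_density (0::'a)) *
       (LINT x|std_gauss. iexp ((1 / s) * (w \<bullet> x)) * (LINT y|M. iexp (((- 1 / s) *\<^sub>R x) \<bullet> y)))"
proof -
  interpret prob_space M by fact
  show "smoothed_density s M \<in> borel_measurable borel"
    unfolding smoothed_density_def[abs_def]
    by (rule borel_measurable_lebesgue_integral) measurable
  show "smoothed_density s M w \<ge> 0"
    unfolding smoothed_density_def by (intro integral_nonneg_AE) auto
  interpret S: prob_space "std_gauss :: 'a measure" by (rule prob_space_std_gauss)
  interpret P: pair_prob_space "std_gauss :: 'a measure" M ..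
  have int: "integrable (std_gauss \<Otimes>\<^sub>M M) (\<lambda>(x, y). iexp ((1 / s) * ((w - y) \<bullet> x)))"
    by (rule P.integrable_const_bound[where B=1]) (auto simp: case_prod_beta)
  have "complex_of_real (smoothed_density s M w) = (LINT y|M. complex_of_real (gauss_density ((1 / s) *\<^sub>R (w - y))))"
    by (simp add: smoothed_density_def)
  also have "\<dots> = (LINT y|M. complex_of_real (gauss_density (0::'a)) * (LINT x|std_gauss. iexp ((1 / s) * ((w - y) \<bullet> x))))"
    by (subst gauss_density_char) simp
  also have "\<dots> = complex_of_real (gauss_density (0::'a)) * (LINT y|M. (LINT x|std_gauss. iexp ((1 / s) * ((w - y) \<bullet> x))))"
    by simp
  also have "(LINT y|M. (LINT x|std_gauss. iexp ((1 / s) * ((w - y) \<bullet> x)))) =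
      (LINT x|std_gauss. (LINT y|M. iexp ((1 / s) * ((w - y) \<bullet> x))))"
    by (rule P.Fubini_integral[OF int])
  also have "\<dots> = (LINT x|std_gauss. iexp ((1 / s) * (w \<bullet> x)) * (LINT y|M. iexp (((- 1 / s) *\<^sub>R x) \<bullet> y)))"
  proof (rule Bochner_Integration.integral_cong[OF refl])
    fix x :: 'a
    have "(LINT y|M. iexp ((1 / s) * ((w - y) \<bullet> x))) =
        (LINT y|M. iexp ((1 / s) * (w \<bullet> x)) * iexp (((- 1 / s) *\<^sub>R x) \<bullet> y))"
      by (intro Bochner_Integration.integral_cong refl)
        (simp add: inner_diff_left inner_commute[of x] algebra_simps diff_divide_distrib flip: exp_add)
    then show "(LINT y|M. iexp ((1 / s) * ((w - y) \<bullet> x))) =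
        iexp ((1 / s) * (w \<bullet> x)) * (LINT y|M. iexp (((- 1 / s) *\<^sub>R x) \<bullet> y))"
      by simp
  qed
  finally show "complex_of_real (smoothed_density s M w) = complex_of_real (gauss_density (0::'a)) *
       (LINT x|std_gauss. iexp ((1 / s) * (w \<bullet> x)) * (LINT y|M. iexp (((- 1 / s) *\<^sub>R x) \<bullet> y)))" .
qed

text \<open>For fixed \<open>y\<close>, substituting \<open>w = y + s x\<close> turns the integral
  against the smoothed density into an average of \<open>f\<close> over Gaussian perturbations of
  \<open>y\<close>; the Jacobian is the power of \<open>s\<close>.\<close>

lemma nn_integral_smoothed_density:
  fixes s :: real and M :: "'a::euclidean_space measure" and f :: "'a \<Rightarrow> ennreal"
  assumes "prob_space M" and M[measurable_cong]: "sets M = sets borel" and s: "s > 0"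
    and f[measurable]: "f \<in> borel_measurable borel"
  shows "(\<integral>\<^sup>+w. ennreal (smoothed_density s M w) * f w \<partial>lborel) =
    ennreal (s ^ DIM('a)) * (\<integral>\<^sup>+y. (\<integral>\<^sup>+x. f (y + s *\<^sub>R x) \<partial>std_gauss) \<partial>M)"
proof -
  interpret prob_space M by fact
  interpret P: pair_sigma_finite lborel M by (standard)
  have d: "ennreal (smoothed_density s M w) = (\<integral>\<^sup>+y. ennreal (gauss_density ((1 / s) *\<^sub>R (w - y))) \<partial>M)" for w
    unfolding smoothed_density_def
    by (rule nn_integral_eq_integral[symmetric], rule integrable_const_bound[where B="gauss_density (0::'a)"])
      (auto simp: gauss_density_le)
  have "(\<integral>\<^sup>+w. ennreal (smoothed_density s M w) * f w \<partial>lborel) =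
     (\<integral>\<^sup>+w. (\<integral>\<^sup>+y. ennreal (gauss_density ((1 / s) *\<^sub>R (w - y))) * f w \<partial>M) \<partial>lborel)"
    unfolding d by (intro nn_integral_cong nn_integral_multc[symmetric]) measurable
  also have "\<dots> = (\<integral>\<^sup>+y. (\<integral>\<^sup>+w. ennreal (gauss_density ((1 / s) *\<^sub>R (w - y))) * f w \<partial>lborel) \<partial>M)"
    by (rule P.Fubini'[symmetric]) measurable
  also have "\<dots> = (\<integral>\<^sup>+y. ennreal (s ^ DIM('a)) * (\<integral>\<^sup>+x. f (y + s *\<^sub>R x) \<partial>std_gauss) \<partial>M)"
  proof (intro nn_integral_cong)
    fix y
    show "(\<integral>\<^sup>+w. ennreal (gauss_density ((1 / s) *\<^sub>R (w - y))) * f w \<partial>lborel) =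
        ennreal (s ^ DIM('a)) * (\<integral>\<^sup>+x. f (y + s *\<^sub>R x) \<partial>std_gauss)"
      using s by (subst nn_integral_lborel_affine[OF _ s, of _ y]) (auto simp: nn_integral_std_gauss)
  qed
  also have "\<dots> = ennreal (s ^ DIM('a)) * (\<integral>\<^sup>+y. (\<integral>\<^sup>+x. f (y + s *\<^sub>R x) \<partial>std_gauss) \<partial>M)"
  proof (rule nn_integral_cmult)
    interpret S: prob_space "std_gauss :: 'a measure" by (rule prob_space_std_gauss)
    show "(\<lambda>y. \<integral>\<^sup>+x. f (y + s *\<^sub>R x) \<partial>std_gauss) \<in> borel_measurable M"
      by (rule S.borel_measurable_nn_integral) measurable
  qed
  finally show ?thesis .
qed

lemma smoothed_density_tendsto:
  fixes M :: "nat \<Rightarrow> 'a::euclidean_space measure"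
  assumes M: "\<And>n. prob_space (M n)" "\<And>n. sets (M n) = sets borel" and N: "prob_space N" "sets N = sets borel"
    and char: "\<And>t. (\<lambda>n. LINT y|M n. iexp (t \<bullet> y)) \<longlonglongrightarrow> (LINT y|N. iexp (t \<bullet> y))"
  shows "(\<lambda>n. smoothed_density s (M n) w) \<longlonglongrightarrow> smoothed_density s N w"
proof -
  interpret S: prob_space "std_gauss :: 'a measure" by (rule prob_space_std_gauss)
  have meas: "(\<lambda>x. iexp ((1 / s) * (w \<bullet> x)) * (LINT y|K. iexp (((- 1 / s) *\<^sub>R x) \<bullet> y))) \<in> borel_measurable std_gauss"
    if K: "prob_space K" "sets K = sets borel" for K :: "'a measure"
  proof -
    interpret K: prob_space K by fact
    note [measurable_cong] = K(2)
    have "(\<lambda>x::'a. LINT y|K. iexp (((- 1 / s) *\<^sub>R x) \<bullet> y)) \<in> borel_measurable std_gauss"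
      by (rule K.borel_measurable_lebesgue_integral) measurable
    then show ?thesis by measurable
  qed
  have "(\<lambda>n. complex_of_real (gauss_density (0::'a)) *
       (LINT x|std_gauss. iexp ((1 / s) * (w \<bullet> x)) * (LINT y|M n. iexp (((- 1 / s) *\<^sub>R x) \<bullet> y))))
    \<longlonglongrightarrow> complex_of_real (gauss_density (0::'a)) *
       (LINT x|std_gauss. iexp ((1 / s) * (w \<bullet> x)) * (LINT y|N. iexp (((- 1 / s) *\<^sub>R x) \<bullet> y)))"
  proof (intro tendsto_mult tendsto_const integral_dominated_convergence[where w="\<lambda>_. 1"])
    show "AE x in std_gauss. norm (iexp ((1 / s) * (w \<bullet> x)) * (LINT y|M n. iexp (((- 1 / s) *\<^sub>R x) \<bullet> y))) \<le> 1" for n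
    proof (rule AE_I2)
      fix x
      interpret K: prob_space "M n" by (rule M)
      note [measurable_cong] = M(2)
      have "norm (LINT y|M n. iexp (((- 1 / s) *\<^sub>R x) \<bullet> y)) \<le> (LINT y|M n. norm (iexp (((- 1 / s) *\<^sub>R x) \<bullet> y)))"
        by (rule integral_norm_bound)
      also have "\<dots> = 1" by (simp add: K.prob_space)
      finally show "norm (iexp ((1 / s) * (w \<bullet> x)) * (LINT y|M n. iexp (((- 1 / s) *\<^sub>R x) \<bullet> y))) \<le> 1"
        by (simp add: norm_mult)
    qed
    show "AE x in std_gauss. (\<lambda>n. iexp ((1 / s) * (w \<bullet> x)) * (LINT y|M n. iexp (((- 1 / s) *\<^sub>R x) \<bullet> y)))
       \<longlonglongrightarrow> iexp ((1 / s) * (w \<bullet> x)) * (LINT y|N. iexp (((- 1 / s) *\<^sub>R x) \<bullet> y))"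
      by (intro AE_I2 tendsto_mult tendsto_const char)
  qed (rule meas[OF N] meas[OF M] | simp)+
  then have "(\<lambda>n. complex_of_real (smoothed_density s (M n) w)) \<longlonglongrightarrow> complex_of_real (smoothed_density s N w)"
    by (simp only: smoothed_density(3)[OF M] smoothed_density(3)[OF N])
  then show ?thesis by (simp only: tendsto_of_real_iff)
qed

lemma smoothed_expectation:
  fixes K :: "'a::euclidean_space measure"
  assumes K: "prob_space K" "sets K = sets borel" and s: "s > 0"
    and f[measurable]: "f \<in> borel_measurable borel" and f0: "\<And>x. 0 \<le> f x" "\<And>x. f x \<le> B"
  shows "integrable lborel (smoothed_density s K)"
    "(\<integral>\<^sup>+w. ennreal (smoothed_density s K w) \<partial>lborel) = ennreal (s ^ DIM('a))"
    "(LINT w|lborel. smoothed_density s K w * f w) = s ^ DIM('a) * (LINT y|K. (LINT x|std_gauss. f (y + s *\<^sub>R x)))"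
proof -
  interpret K: prob_space K by fact
  note [measurable_cong] = K(2)
  note [measurable] = smoothed_density(1)[OF K]
  interpret S: prob_space "std_gauss :: 'a measure" by (rule prob_space_std_gauss)
  show n1: "(\<integral>\<^sup>+w. ennreal (smoothed_density s K w) \<partial>lborel) = ennreal (s ^ DIM('a))"
    using nn_integral_smoothed_density[OF K s, of "\<lambda>_. 1"] S.emeasure_space_1 K.emeasure_space_1 by simp
  then show "integrable lborel (smoothed_density s K)"
    using smoothed_density(2)[OF K] by (intro integrableI_nonneg) auto
  have inner: "(\<integral>\<^sup>+x. ennreal (f (y + s *\<^sub>R x)) \<partial>std_gauss) = ennreal (LINT x|std_gauss. f (y + s *\<^sub>R x))" for y
    using f0 by (intro nn_integral_eq_integral S.integrable_const_bound[where B=B]) auto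
  have inner_le: "(LINT x|std_gauss. f (y + s *\<^sub>R x)) \<le> B" "0 \<le> (LINT x|std_gauss. f (y + s *\<^sub>R x))" for y
    using f0 by (auto intro!: S.integral_le_const S.integrable_const_bound[where B=B] integral_nonneg_AE)
  have [measurable]: "(\<lambda>y. LINT x|std_gauss. f (y + s *\<^sub>R x)) \<in> borel_measurable K"
    by (rule S.borel_measurable_lebesgue_integral) measurable
  have iK: "integrable K (\<lambda>y. LINT x|std_gauss. f (y + s *\<^sub>R x))"
    using inner_le by (intro K.integrable_const_bound[where B=B]) (auto simp: abs_le_iff intro: order_trans)
  have "(LINT w|lborel. smoothed_density s K w * f w) =
      enn2real (\<integral>\<^sup>+w. ennreal (smoothed_density s K w * f w) \<partial>lborel)"
    using smoothed_density(2)[OF K] f0 by (intro integral_eq_nn_integral) auto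
  also have "(\<integral>\<^sup>+w. ennreal (smoothed_density s K w * f w) \<partial>lborel) =
      ennreal (s ^ DIM('a)) * (\<integral>\<^sup>+y. (\<integral>\<^sup>+x. ennreal (f (y + s *\<^sub>R x)) \<partial>std_gauss) \<partial>K)"
    using smoothed_density(2)[OF K] by (subst nn_integral_smoothed_density[OF K s, symmetric]) (auto simp: ennreal_mult')
  also have "(\<integral>\<^sup>+y. (\<integral>\<^sup>+x. ennreal (f (y + s *\<^sub>R x)) \<partial>std_gauss) \<partial>K) =
      ennreal (LINT y|K. (LINT x|std_gauss. f (y + s *\<^sub>R x)))"
    unfolding inner using inner_le by (intro nn_integral_eq_integral iK) auto
  also have "enn2real (ennreal (s ^ DIM('a)) * ennreal (LINT y|K. (LINT x|std_gauss. f (y + s *\<^sub>R x)))) =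
      s ^ DIM('a) * (LINT y|K. (LINT x|std_gauss. f (y + s *\<^sub>R x)))"
    using s inner_le by (simp add: enn2real_mult integral_nonneg_AE)
  finally show "(LINT w|lborel. smoothed_density s K w * f w) = s ^ DIM('a) * (LINT y|K. (LINT x|std_gauss. f (y + s *\<^sub>R x)))" .
qed

text \<open>Scheffe's lemma: nonnegative densities of equal total mass that converge pointwise
  converge in mean, hence so do the expectations of bounded functions.\<close>

lemma smoothed_expectation_tendsto:
  fixes M :: "nat \<Rightarrow> 'a::euclidean_space measure" and f :: "'a \<Rightarrow> real"
  assumes M: "\<And>n. prob_space (M n)" "\<And>n. sets (M n) = sets borel" and N: "prob_space N" "sets N = sets borel"
    and char: "\<And>t. (\<lambda>n. LINT y|M n. iexp (t \<bullet> y)) \<longlonglongrightarrow> (LINT y|N. iexp (t \<bullet> y))"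
    and s: "s > 0"
    and f[measurable]: "f \<in> borel_measurable borel" and f0: "\<And>x. 0 \<le> f x" "\<And>x. f x \<le> B"
  shows "(\<lambda>n. LINT y|M n. (LINT x|std_gauss. f (y + s *\<^sub>R x))) \<longlonglongrightarrow> (LINT y|N. (LINT x|std_gauss. f (y + s *\<^sub>R x)))"
proof -
  let ?p = "\<lambda>n. smoothed_density s (M n)" and ?q = "smoothed_density s N"
  have [measurable]: "?p n \<in> borel_measurable borel" "?q \<in> borel_measurable borel" for n
    using smoothed_density(1)[OF M] smoothed_density(1)[OF N] by auto
  have ip: "integrable lborel (?p n)" "integrable lborel ?q" for n
    by (rule smoothed_expectation(1)[OF M s f f0]) (rule smoothed_expectation(1)[OF N s f f0])
  have nn: "\<And>n w. 0 \<le> ?p n w" "\<And>w. 0 \<le> ?q w"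
    by (rule smoothed_density(2)[OF M]) (rule smoothed_density(2)[OF N])
  have pf': "integrable lborel (\<lambda>w. g w * f w)" if g: "integrable lborel g" for g :: "'a \<Rightarrow> real"
  proof (rule Bochner_Integration.integrable_bound[OF integrable_mult_left[OF g, of B]])
    show "(\<lambda>w. g w * f w) \<in> borel_measurable lborel" using borel_measurable_integrable[OF g] by simp
    have "\<bar>f w\<bar> \<le> \<bar>B\<bar>" for w using f0[of w] by simp
    then show "AE w in lborel. norm (g w * f w) \<le> norm (g w * B)"
      by (auto simp: abs_mult intro!: mult_left_mono)
  qed
  note pf = pf'[OF ip(1)] pf'[OF ip(2)]
  have "(\<lambda>n. \<integral>\<^sup>+w. norm (?p n w - ?q w) \<partial>lborel) \<longlonglongrightarrow> 0"
  proof (rule Scheffe_lemma2)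
    show "AE w in lborel. (\<lambda>n. ?p n w) \<longlonglongrightarrow> ?q w"
      using smoothed_density_tendsto[OF M N char] by auto
    show "(\<integral>\<^sup>+w. norm (?p n w) \<partial>lborel) \<le> (\<integral>\<^sup>+w. norm (?q w) \<partial>lborel)" for n
      using smoothed_expectation(2)[OF M s f f0, of n] smoothed_expectation(2)[OF N s f f0] nn by simp
  qed (use ip in auto)
  then have "(\<lambda>n. enn2real (\<integral>\<^sup>+w. norm (?p n w - ?q w) \<partial>lborel)) \<longlonglongrightarrow> enn2real 0"
    by (intro tendsto_enn2real) auto
  moreover have "enn2real (\<integral>\<^sup>+w. norm (?p n w - ?q w) \<partial>lborel) = (LINT w|lborel. norm (?p n w - ?q w))" for n
    by (rule integral_eq_nn_integral[symmetric]) auto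
  ultimately have L1: "(\<lambda>n. B * (LINT w|lborel. norm (?p n w - ?q w))) \<longlonglongrightarrow> 0"
    by (auto intro: tendsto_mult_right_zero)
  have "(\<lambda>n. (LINT w|lborel. ?p n w * f w) - (LINT w|lborel. ?q w * f w)) \<longlonglongrightarrow> 0"
  proof (rule Lim_null_comparison[OF _ L1], rule always_eventually, rule allI)
    fix n
    have "(LINT w|lborel. ?p n w * f w) - (LINT w|lborel. ?q w * f w) = (LINT w|lborel. (?p n w - ?q w) * f w)"
      using pf by (simp add: left_diff_distrib)
    also have "norm \<dots> \<le> (LINT w|lborel. norm ((?p n w - ?q w) * f w))" by (rule integral_norm_bound)
    also have "\<dots> \<le> (LINT w|lborel. B * norm (?p n w - ?q w))"
    proof (rule integral_mono)
      show "integrable lborel (\<lambda>w. norm ((?p n w - ?q w) * f w))"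
        using pf by (simp add: left_diff_distrib)
      show "integrable lborel (\<lambda>w. B * norm (?p n w - ?q w))" using ip by simp
      fix w
      show "norm ((?p n w - ?q w) * f w) \<le> B * norm (?p n w - ?q w)"
        using f0[of w] mult_left_mono[of "f w" B "\<bar>?p n w - ?q w\<bar>"] by (simp add: abs_mult mult.commute)
    qed
    also have "\<dots> = B * (LINT w|lborel. norm (?p n w - ?q w))" by simp
    finally show "norm ((LINT w|lborel. ?p n w * f w) - (LINT w|lborel. ?q w * f w)) \<le> B * (LINT w|lborel. norm (?p n w - ?q w))" .
  qed
  then have "(\<lambda>n. LINT w|lborel. ?p n w * f w) \<longlonglongrightarrow> (LINT w|lborel. ?q w * f w)"
    by (simp add: LIM_zero_iff)
  then have "(\<lambda>n. s ^ DIM('a) * (LINT y|M n. (LINT x|std_gauss. f (y + s *\<^sub>R x)))) \<longlonglongrightarrow>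
      s ^ DIM('a) * (LINT y|N. (LINT x|std_gauss. f (y + s *\<^sub>R x)))"
    unfolding smoothed_expectation(3)[OF M s f f0] smoothed_expectation(3)[OF N s f f0] .
  then show ?thesis using s by (subst (asm) tendsto_mult_left_iff) auto
qed

text \<open>Smoothing at a small scale changes the expectation of a bounded Lipschitz function by
  little, uniformly over all probability measures, and at each fixed scale the smoothed expectations
  converge.\<close>

lemma char_tendsto_imp_Lipschitz_tendsto:
  fixes M :: "nat \<Rightarrow> 'a::euclidean_space measure" and f :: "'a \<Rightarrow> real"
  assumes M: "\<And>n. prob_space (M n)" "\<And>n. sets (M n) = sets borel" and N: "prob_space N" "sets N = sets borel"
    and char: "\<And>t. (\<lambda>n. LINT y|M n. iexp (t \<bullet> y)) \<longlonglongrightarrow> (LINT y|N. iexp (t \<bullet> y))"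
    and B: "\<And>x. \<bar>f x\<bar> \<le> B" and L: "\<And>x y. \<bar>f x - f y\<bar> \<le> L * norm (x - y)"
  shows "(\<lambda>n. LINT y|M n. f y) \<longlonglongrightarrow> (LINT y|N. f y)"
proof -
  interpret S: prob_space "std_gauss :: 'a measure" by (rule prob_space_std_gauss)
  have "0 \<le> B" using B[of undefined] by linarith
  have "L \<ge> 0"
  proof -
    obtain b :: 'a where "b \<in> Basis" using nonempty_Basis by blast
    then show ?thesis using L[of b 0] abs_ge_zero[of "f b - f 0"] by simp
  qed
  have "continuous_on UNIV f"
  proof (rule continuous_onI)
    fix x e assume "(e::real) > 0"
    show "\<exists>d>0. \<forall>x'\<in>UNIV. dist x' x < d \<longrightarrow> dist (f x') (f x) \<le> e"
    proof (intro exI[of _ "e / (L + 1)"] conjI ballI impI)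
      fix x' assume "dist x' x < e / (L + 1)"
      then have "L * norm (x' - x) \<le> (L + 1) * (e / (L + 1))" using \<open>L \<ge> 0\<close>
        by (intro mult_mono) (auto simp: dist_norm)
      then show "dist (f x') (f x) \<le> e" using L[of x' x] \<open>L \<ge> 0\<close> by (simp add: dist_real_def)
    qed (use \<open>e > 0\<close> \<open>L \<ge> 0\<close> in auto)
  qed
  then have f[measurable]: "f \<in> borel_measurable borel" by (rule borel_measurable_continuous_onI)
  define sg where "sg k = 1 / real (Suc k)" for k
  have sg: "sg k > 0" for k by (simp add: sg_def)
  \<comment> \<open>Taking the minimum with \<open>2 * B\<close> keeps the integrand bounded, so
    that a constant dominates it.\<close>
  define \<delta> where "\<delta> k = (LINT x|std_gauss. min (L * sg k * norm (x::'a)) (2 * B))" for k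
  have "\<delta> \<longlonglongrightarrow> (LINT x|(std_gauss::'a measure). (0::real))"
    unfolding \<delta>_def
  proof (rule integral_dominated_convergence[where w="\<lambda>_. 2 * B"])
    show "AE x in std_gauss. (\<lambda>k. min (L * sg k * norm (x::'a)) (2 * B)) \<longlonglongrightarrow> 0"
    proof (rule AE_I2)
      fix x :: 'a
      have "sg \<longlonglongrightarrow> 0" unfolding sg_def using LIMSEQ_Suc[OF lim_1_over_n] by simp
      then have "(\<lambda>k. min (L * sg k * norm x) (2 * B)) \<longlonglongrightarrow> min (L * 0 * norm x) (2 * B)"
        by (intro tendsto_intros)
      then show "(\<lambda>k. min (L * sg k * norm x) (2 * B)) \<longlonglongrightarrow> 0" using \<open>0 \<le> B\<close> by simp
    qed
    show "AE x in std_gauss. norm (min (L * sg k * norm (x::'a)) (2 * B)) \<le> 2 * B" for k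
      using \<open>0 \<le> B\<close> \<open>0 \<le> L\<close> sg[of k] by (auto simp: min_def abs_mult)
  qed auto
  then have \<delta>0: "\<delta> \<longlonglongrightarrow> 0" by simp
  define E where "E K k = (LINT y|K. (LINT x|std_gauss. f (y + sg k *\<^sub>R x)))" for K k
  have close: "\<bar>E K k - (LINT y|K. f y)\<bar> \<le> \<delta> k"
    if K: "prob_space K" "sets K = sets borel" for K :: "'a measure" and k
  proof -
    interpret K: prob_space K by fact
    note [measurable_cong] = K(2)
    have iS: "integrable std_gauss (\<lambda>x. f (y + sg k *\<^sub>R x))" for y
      using B by (intro S.integrable_const_bound[where B=B]) auto
    have [measurable]: "(\<lambda>y. LINT x|std_gauss. f (y + sg k *\<^sub>R x)) \<in> borel_measurable K"
      by (rule S.borel_measurable_lebesgue_integral) measurable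
    have pt: "\<bar>(LINT x|std_gauss. f (y + sg k *\<^sub>R x)) - f y\<bar> \<le> \<delta> k" for y
    proof -
      have "(LINT x|std_gauss. f (y + sg k *\<^sub>R x)) - f y = (LINT x|std_gauss. f (y + sg k *\<^sub>R x) - f y)"
        using iS[of y] S.prob_space by simp
      also have "\<bar>\<dots>\<bar> \<le> (LINT x|std_gauss. \<bar>f (y + sg k *\<^sub>R x) - f y\<bar>)" by (rule integral_abs_bound)
      also have "\<dots> \<le> \<delta> k" unfolding \<delta>_def
      proof (rule integral_mono)
        show "integrable std_gauss (\<lambda>x. \<bar>f (y + sg k *\<^sub>R x) - f y\<bar>)" using iS[of y] by simp
        show "integrable std_gauss (\<lambda>x::'a. min (L * sg k * norm x) (2 * B))"
          using \<open>0 \<le> B\<close> \<open>0 \<le> L\<close> sg[of k]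
          by (intro S.integrable_const_bound[where B="2 * B"]) (auto simp: min_def abs_mult)
        fix x
        show "\<bar>f (y + sg k *\<^sub>R x) - f y\<bar> \<le> min (L * sg k * norm x) (2 * B)"
          using L[of "y + sg k *\<^sub>R x" y] B[of "y + sg k *\<^sub>R x"] B[of y] sg[of k] by (auto simp: mult.assoc)
      qed
      finally show ?thesis .
    qed
    have "\<bar>LINT x|std_gauss. f (y + sg k *\<^sub>R x)\<bar> \<le> B + \<delta> k" for y
      using pt[of y] B[of y] by linarith
    then have iK: "integrable K (\<lambda>y. LINT x|std_gauss. f (y + sg k *\<^sub>R x))"
      by (intro K.integrable_const_bound[where B="B + \<delta> k"]) auto
    have intf: "integrable K f" using B by (intro K.integrable_const_bound[where B=B]) auto
    have "E K k - (LINT y|K. f y) = (LINT y|K. (LINT x|std_gauss. f (y + sg k *\<^sub>R x)) - f y)"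
      unfolding E_def using iK intf by simp
    also have "\<bar>\<dots>\<bar> \<le> (LINT y|K. \<bar>(LINT x|std_gauss. f (y + sg k *\<^sub>R x)) - f y\<bar>)" by (rule integral_abs_bound)
    also have "\<dots> \<le> \<delta> k" using iK intf pt by (intro K.integral_le_const) auto
    finally show ?thesis .
  qed
  have Elim: "(\<lambda>n. E (M n) k) \<longlonglongrightarrow> E N k" for k
  proof -
    have iS: "integrable std_gauss (\<lambda>x. f (y + sg k *\<^sub>R x))" for y
      using B by (intro S.integrable_const_bound[where B=B]) auto
    have shift: "(LINT y|K. (LINT x|std_gauss. f (y + sg k *\<^sub>R x) + B)) = E K k + B"
      if K: "prob_space K" "sets K = sets borel" for K :: "'a measure"
    proof -
      interpret K: prob_space K by fact
      note [measurable_cong] = K(2)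
      have [measurable]: "(\<lambda>y. LINT x|std_gauss. f (y + sg k *\<^sub>R x)) \<in> borel_measurable K"
        by (rule S.borel_measurable_lebesgue_integral) measurable
      have "\<bar>LINT x|std_gauss. f (y + sg k *\<^sub>R x)\<bar> \<le> B" for y
      proof -
        have "\<bar>LINT x|std_gauss. f (y + sg k *\<^sub>R x)\<bar> \<le> (LINT x|std_gauss. \<bar>f (y + sg k *\<^sub>R x)\<bar>)"
          by (rule integral_abs_bound)
        also have "\<dots> \<le> B" using iS[of y] B by (intro S.integral_le_const) auto
        finally show ?thesis .
      qed
      then have iK: "integrable K (\<lambda>y. LINT x|std_gauss. f (y + sg k *\<^sub>R x))"
        by (intro K.integrable_const_bound[where B=B]) auto
      have "(LINT x|std_gauss. f (y + sg k *\<^sub>R x) + B) = (LINT x|std_gauss. f (y + sg k *\<^sub>R x)) + B" for y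
        using iS[of y] S.prob_space by simp
      then show ?thesis unfolding E_def using iK K.prob_space by simp
    qed
    \<comment> \<open>Convergence of smoothed expectations is available for nonnegative functions,
      so \<open>B\<close> is added here and subtracted afterwards.\<close>
    have "(\<lambda>n. LINT y|M n. (LINT x|std_gauss. f (y + sg k *\<^sub>R x) + B)) \<longlonglongrightarrow>
        (LINT y|N. (LINT x|std_gauss. f (y + sg k *\<^sub>R x) + B))"
    proof (rule smoothed_expectation_tendsto[OF M N char sg, where B="2 * B" and f="\<lambda>x. f x + B"])
      show "0 \<le> f x + B" "f x + B \<le> 2 * B" for x using B[of x] by (auto simp: abs_le_iff)
    qed auto
    then have "(\<lambda>n. E (M n) k + B) \<longlonglongrightarrow> E N k + B" using shift M N by simp
    from tendsto_diff[OF this tendsto_const[of B]] show ?thesis by simp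
  qed
  show ?thesis
  proof (rule LIMSEQ_I)
    fix e :: real assume "e > 0"
    obtain k where k: "\<bar>\<delta> k\<bar> < e / 3" using LIMSEQ_D[OF \<delta>0, of "e / 3"] \<open>e > 0\<close> by auto
    obtain n0 where n0: "\<And>n. n \<ge> n0 \<Longrightarrow> \<bar>E (M n) k - E N k\<bar> < e / 3"
      using LIMSEQ_D[OF Elim[of k], of "e / 3"] \<open>e > 0\<close> by auto
    show "\<exists>no. \<forall>n\<ge>no. norm ((LINT y|M n. f y) - (LINT y|N. f y)) < e"
    proof (intro exI[of _ n0] allI impI)
      fix n assume "n \<ge> n0"
      then show "norm ((LINT y|M n. f y) - (LINT y|N. f y)) < e"
        using n0[of n] k close[OF M, of n k] close[OF N, of k] unfolding real_norm_def by linarith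
    qed
  qed
qed

text \<open>\<open>g\<close> is the infimal convolution of \<open>f\<close> with the cone of slope
  \<open>k\<close>, the largest \<open>k\<close>-Lipschitz function below \<open>f\<close>.\<close>

lemma Lipschitz_minorant:
  fixes f :: "'a::real_normed_vector \<Rightarrow> real" and k :: real
  assumes B: "\<And>x. \<bar>f x\<bar> \<le> B" and k: "k \<ge> 0"
  defines "g \<equiv> \<lambda>x. INF y. f y + k * norm (x - y)"
  shows "g x \<le> f x" "\<bar>g x\<bar> \<le> B" "\<bar>g x - g y\<bar> \<le> k * norm (x - y)"
    "\<And>l. (\<And>y. l \<le> f y + k * norm (x - y)) \<Longrightarrow> l \<le> g x"
proof -
  have bdd: "bdd_below (range (\<lambda>y. f y + k * norm (x - y)))" for x
  proof (rule bdd_belowI2)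
    fix y show "- B \<le> f y + k * norm (x - y)" using B[of y] k mult_nonneg_nonneg[OF k norm_ge_zero[of "x - y"]] by linarith
  qed
  have low: "g x \<le> f y + k * norm (x - y)" for x y
    unfolding g_def by (rule cINF_lower[OF bdd]) simp
  show gr: "l \<le> g x" if "\<And>y. l \<le> f y + k * norm (x - y)" for l x
    unfolding g_def using that by (intro cINF_greatest) auto
  show 1: "g x \<le> f x" for x using low[of x x] by simp
  have "- B \<le> g x"
  proof (rule gr)
    fix y show "- B \<le> f y + k * norm (x - y)" using B[of y] mult_nonneg_nonneg[OF k norm_ge_zero[of "x - y"]] by linarith
  qed
  then show "\<bar>g x\<bar> \<le> B" using 1[of x] B[of x] by linarith
  have "g x - k * norm (x - y) \<le> g y" for x y
  proof (rule gr)
    fix z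
    have "k * norm (x - z) \<le> k * (norm (x - y) + norm (y - z))"
      using norm_triangle_ineq[of "x - y" "y - z"] k by (intro mult_left_mono) auto
    then show "g x - k * norm (x - y) \<le> f z + k * norm (y - z)" using low[of x z] by (simp add: algebra_simps)
  qed
  from this[of x y] this[of y x] show "\<bar>g x - g y\<bar> \<le> k * norm (x - y)" by (simp add: norm_minus_commute)
qed

text \<open>The Lipschitz minorants of \<open>f\<close> converge to \<open>f\<close> pointwise, and
  their expectations give the lower half of the limit. The upper half is the lower half for
  \<open>- f\<close>.\<close>

lemma weakly_converges_if_Lipschitz:
  fixes M :: "nat \<Rightarrow> 'a::euclidean_space measure"
  assumes M: "\<And>n. prob_space (M n)" "\<And>n. sets (M n) = sets borel" and N: "prob_space N" "sets N = sets borel"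
    and lip: "\<And>f B L. (\<And>x. \<bar>f x\<bar> \<le> B) \<Longrightarrow> (\<And>x y. \<bar>f x - f y\<bar> \<le> L * norm (x - y)) \<Longrightarrow>
       (\<lambda>n. LINT y|M n. f y) \<longlonglongrightarrow> (LINT y|N. f y :: real)"
  shows "weakly_converges M N"
proof -
  have int: "integrable K f" if K: "prob_space K" "sets K = sets borel" and f: "f \<in> borel_measurable borel" "\<And>x. \<bar>f x\<bar> \<le> B"
    for K :: "'a measure" and f :: "'a \<Rightarrow> real" and B
  proof -
    interpret prob_space K by fact
    show ?thesis by (rule integrable_const_bound[where B=B]) (use f K in auto)
  qed
  have lower: "\<forall>\<^sub>F n in sequentially. (LINT y|N. f y) - e < (LINT y|M n. f y)"
    if f: "continuous_on UNIV f" "\<And>x. \<bar>f x\<bar> \<le> B" and e: "e > 0" for f :: "'a \<Rightarrow> real" and B e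
  proof -
    define g where "g k x = (INF y. f y + real k * norm (x - y))" for k x
    have g: "g k x \<le> f x" "\<bar>g k x\<bar> \<le> B" "\<bar>g k x - g k y\<bar> \<le> real k * norm (x - y)"
      "\<And>l. (\<And>y. l \<le> f y + real k * norm (x - y)) \<Longrightarrow> l \<le> g k x" for k x y
      using Lipschitz_minorant[where f=f and B=B and k="real k", OF f(2) of_nat_0_le_iff] unfolding g_def by blast+
    have gc: "continuous_on UNIV (g k)" for k
    proof (rule continuous_onI)
      fix x e assume "(e::real) > 0"
      show "\<exists>d>0. \<forall>x'\<in>UNIV. dist x' x < d \<longrightarrow> dist (g k x') (g k x) \<le> e"
      proof (intro exI[of _ "e / (real k + 1)"] conjI ballI impI)
        fix x' assume "dist x' x < e / (real k + 1)"
        then have "real k * norm (x' - x) \<le> (real k + 1) * (e / (real k + 1))"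
          by (intro mult_mono) (auto simp: dist_norm)
        then show "dist (g k x') (g k x) \<le> e" using g(3)[of k x' x] by (simp add: dist_real_def)
      qed (use \<open>e > 0\<close> in auto)
    qed
    have gm[measurable]: "g k \<in> borel_measurable borel" for k using gc by (rule borel_measurable_continuous_onI)
    have fm[measurable]: "f \<in> borel_measurable borel" using f(1) by (rule borel_measurable_continuous_onI)
    have glim: "(\<lambda>k. g k x) \<longlonglongrightarrow> f x" for x
    proof (rule LIMSEQ_I)
      fix r :: real assume "r > 0"
      obtain d where d: "d > 0" "\<And>y. dist y x < d \<Longrightarrow> dist (f y) (f x) < r / 2"
        using f(1) \<open>r > 0\<close> unfolding continuous_on_iff by (metis UNIV_I half_gt_zero)
      \<comment> \<open>Beyond distance \<open>d\<close> the penalty \<open>k * d\<close> exceeds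
        the oscillation \<open>2 * B\<close> of \<open>f\<close>, so the infimum is decided near
        \<open>x\<close>.\<close>
      obtain k0 :: nat where k0: "real k0 > 2 * B / d" using reals_Archimedean2 by blast
      show "\<exists>no. \<forall>k\<ge>no. norm (g k x - f x) < r"
      proof (intro exI[of _ k0] allI impI)
        fix k assume "k0 \<le> k"
        have "f x - r / 2 \<le> g k x"
        proof (rule g(4))
          fix y
          show "f x - r / 2 \<le> f y + real k * norm (x - y)"
          proof (cases "dist y x < d")
            case True
            have "0 \<le> real k * norm (x - y)" by simp
            with d(2)[OF True] show ?thesis unfolding dist_real_def by linarith
          next
            case False
            then have "2 * B \<le> real k0 * d" using k0 d(1) by (simp add: field_simps)
            also have "\<dots> \<le> real k * norm (x - y)"
              using False \<open>k0 \<le> k\<close> d(1) by (intro mult_mono) (auto simp: dist_norm norm_minus_commute)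
            finally show ?thesis using f(2)[of x] f(2)[of y] \<open>r > 0\<close> by linarith
          qed
        qed
        then show "norm (g k x - f x) < r" using g(1)[of k x] \<open>r > 0\<close> by (simp add: abs_if)
      qed
    qed
    have "(\<lambda>k. LINT y|N. g k y) \<longlonglongrightarrow> (LINT y|N. f y)"
    proof (rule integral_dominated_convergence[where w="\<lambda>_. B"])
      show "integrable N (\<lambda>_. B)" by (rule int[OF N, where B="\<bar>B\<bar>"]) auto
    qed (use g(2) glim N in auto)
    then obtain k where k: "\<bar>(LINT y|N. g k y) - (LINT y|N. f y)\<bar> < e / 2"
      using e LIMSEQ_D[of _ _ "e / 2"] by (metis half_gt_zero order_refl real_norm_def)
    have "(\<lambda>n. LINT y|M n. g k y) \<longlonglongrightarrow> (LINT y|N. g k y)"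
      by (rule lip[of "g k" B "real k"]) (rule g)+
    then have "\<forall>\<^sub>F n in sequentially. (LINT y|N. g k y) - e / 2 < (LINT y|M n. g k y)"
      using e by (intro order_tendstoD) auto
    then show ?thesis
    proof eventually_elim
      case (elim n)
      have "(LINT y|M n. g k y) \<le> (LINT y|M n. f y)"
        by (intro integral_mono int[OF M, where B=B] g f) auto
      then show ?case using elim k by linarith
    qed
  qed
  show ?thesis unfolding weakly_converges_def
  proof (intro allI impI)
    fix f :: "'a \<Rightarrow> real" assume f: "continuous_on UNIV f \<and> bounded (range f)"
    then obtain B where B: "\<And>x. \<bar>f x\<bar> \<le> B" unfolding bounded_iff by auto
    show "(\<lambda>n. LINT x|M n. f x) \<longlonglongrightarrow> (LINT x|N. f x)"
    proof (rule LIMSEQ_I)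
      fix e :: real assume "e > 0"
      have "\<forall>\<^sub>F n in sequentially. (LINT y|N. f y) - e < (LINT y|M n. f y)"
        using f B \<open>e > 0\<close> by (intro lower) auto
      moreover have "\<forall>\<^sub>F n in sequentially. (LINT y|N. - f y) - e < (LINT y|M n. - f y)"
        using f B \<open>e > 0\<close> by (intro lower) (auto intro: continuous_intros)
      ultimately have "\<forall>\<^sub>F n in sequentially. norm ((LINT x|M n. f x) - (LINT x|N. f x)) < e"
        by eventually_elim auto
      then show "\<exists>no. \<forall>n\<ge>no. norm ((LINT x|M n. f x) - (LINT x|N. f x)) < e"
        unfolding eventually_sequentially .
    qed
  qed
qed

text \<open>The Cramer--Wold device: the scalar central limit theorem applies to the projections
  \<open>t \<bullet> Y i\<close>, whose variance is the square of \<open>norm t\<close>, and the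
  limiting characteristic function is read off at \<open>norm t\<close>.\<close>

lemma (in prob_space) std_multivariate_clt_char:
  fixes Y :: "nat \<Rightarrow> 'a \<Rightarrow> 'b::euclidean_space"
  assumes indep: "indep_vars (\<lambda>_. borel) Y UNIV"
    and distr: "\<And>i. distr M borel (Y i) = D"
    and sq: "\<And>i v. integrable M (\<lambda>\<omega>. (v \<bullet> Y i \<omega>)\<^sup>2)"
    and mean: "\<And>i v. expectation (\<lambda>\<omega>. v \<bullet> Y i \<omega>) = 0"
    and cov: "\<And>i v. expectation (\<lambda>\<omega>. (v \<bullet> Y i \<omega>)\<^sup>2) = (norm v)\<^sup>2"
  shows "(\<lambda>n. LINT \<omega>|M. iexp (t \<bullet> ((1 / sqrt (real n)) *\<^sub>R (\<Sum>i<n. Y i \<omega>)))) \<longlonglongrightarrow>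
     complex_of_real (exp (- (norm t)\<^sup>2 / 2))"
proof (cases "t = 0")
  case True
  then show ?thesis by (simp add: prob_space)
next
  case False
  have Ym[measurable]: "Y i \<in> borel_measurable M" for i
    using indep unfolding indep_vars_def by auto
  define X where "X i \<omega> = t \<bullet> Y i \<omega>" for i \<omega>
  have Xm[measurable]: "X i \<in> borel_measurable M" for i unfolding X_def by measurable
  have "indep_vars (\<lambda>_. borel) X UNIV"
    unfolding X_def by (rule indep_vars_compose2[OF indep]) auto
  moreover have "expectation (X i) = 0" "integrable M (\<lambda>\<omega>. (X i \<omega>)\<^sup>2)" for i
    using mean sq by (auto simp: X_def[abs_def])
  moreover have "variance (X i) = (norm t)\<^sup>2" for i
    using mean[of t i] cov[of t i] by (simp add: X_def[abs_def])
  moreover have "distr M borel (X i) = distr D borel (\<lambda>y. t \<bullet> y)" for i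
    unfolding distr[of i, symmetric] X_def by (subst distr_distr) (auto simp: o_def)
  ultimately have "weak_conv_m (\<lambda>n. distr M borel (\<lambda>\<omega>. (\<Sum>i<n. X i \<omega>) / sqrt (n * (norm t)\<^sup>2))) std_normal_distribution"
    using False by (intro central_limit_theorem_zero_mean[where \<sigma>="norm t" and \<mu>="distr D borel (\<lambda>y. t \<bullet> y)"]) auto
  then have "(\<lambda>n. char (distr M borel (\<lambda>\<omega>. (\<Sum>i<n. X i \<omega>) / sqrt (n * (norm t)\<^sup>2))) (norm t)) \<longlonglongrightarrow>
      char std_normal_distribution (norm t)"
    by (intro levy_continuity1 real_distribution_distr real_dist_normal_dist) auto
  moreover have "char (distr M borel (\<lambda>\<omega>. (\<Sum>i<n. X i \<omega>) / sqrt (n * (norm t)\<^sup>2))) (norm t) =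
      (LINT \<omega>|M. iexp (t \<bullet> ((1 / sqrt (real n)) *\<^sub>R (\<Sum>i<n. Y i \<omega>))))" for n
  proof -
    have "norm t * ((\<Sum>i<n. X i \<omega>) / sqrt (n * (norm t)\<^sup>2)) = t \<bullet> ((1 / sqrt (real n)) *\<^sub>R (\<Sum>i<n. Y i \<omega>))" for \<omega>
      using False by (simp add: X_def real_sqrt_mult inner_sum_right)
    then show ?thesis unfolding char_def by (subst integral_distr) auto
  qed
  ultimately show ?thesis by (simp add: char_std_normal_distribution)
qed

text \<open>\<open>g\<close> is constant on lines in direction \<open>i\<close>, so the shear
  translates each such line; Fubini's theorem and translation invariance give the claim.\<close>

lemma nn_integral_lborel_shift_coordinate:
  fixes i :: "'a::euclidean_space" and f :: "'a \<Rightarrow> ennreal" and g :: "'a \<Rightarrow> real"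
  assumes i: "i \<in> Basis" and [measurable]: "f \<in> borel_measurable borel" "g \<in> borel_measurable borel"
    and g: "\<And>x r. g (x + r *\<^sub>R i) = g x"
  shows "(\<integral>\<^sup>+x. f (x + g x *\<^sub>R i) \<partial>lborel) = (\<integral>\<^sup>+x. f x \<partial>lborel)"
proof -
  interpret product_sigma_finite "\<lambda>_::'a. lborel :: real measure" ..
  let ?T = "\<lambda>F. \<Sum>b\<in>Basis. F b *\<^sub>R (b::'a)" and ?P = "\<lambda>I. Pi\<^sub>M I (\<lambda>_::'a. lborel :: real measure)"
  let ?I = "Basis - {i}"
  have BI: "insert i ?I = Basis" using i by auto
  have T[measurable]: "?T \<in> borel_measurable (?P Basis)" by measurable
  have split: "(\<integral>\<^sup>+x. h x \<partial>lborel) = (\<integral>\<^sup>+F. (\<integral>\<^sup>+y. h ((\<Sum>b\<in>?I. F b *\<^sub>R b) + y *\<^sub>R i) \<partial>lborel) \<partial>?P ?I)"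
    if [measurable]: "h \<in> borel_measurable borel" for h :: "'a \<Rightarrow> ennreal"
  proof -
    have "(\<integral>\<^sup>+x. h x \<partial>lborel) = (\<integral>\<^sup>+F. h (?T F) \<partial>?P Basis)"
      by (subst lborel_eq, subst nn_integral_distr) auto
    also have "\<dots> = (\<integral>\<^sup>+F. (\<integral>\<^sup>+y. h (?T (F(i := y))) \<partial>lborel) \<partial>?P ?I)"
    proof -
      have "(\<lambda>F. h (?T F)) \<in> borel_measurable (?P (insert i ?I))" unfolding BI by measurable
      from product_nn_integral_insert[OF _ _ this] show ?thesis unfolding BI by simp
    qed
    also have "\<dots> = (\<integral>\<^sup>+F. (\<integral>\<^sup>+y. h ((\<Sum>b\<in>?I. F b *\<^sub>R b) + y *\<^sub>R i) \<partial>lborel) \<partial>?P ?I)"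
    proof -
      have "?T (F(i := y)) = (\<Sum>b\<in>?I. F b *\<^sub>R b) + y *\<^sub>R i" for F y
        using i by (subst sum.remove[OF finite_Basis i]) (auto simp: add.commute intro!: sum.cong)
      then show ?thesis by (simp only:)
    qed
    finally show ?thesis .
  qed
  have "(\<integral>\<^sup>+x. f (x + g x *\<^sub>R i) \<partial>lborel) = (\<integral>\<^sup>+F. (\<integral>\<^sup>+y.
      f ((\<Sum>b\<in>?I. F b *\<^sub>R b) + y *\<^sub>R i + g ((\<Sum>b\<in>?I. F b *\<^sub>R b) + y *\<^sub>R i) *\<^sub>R i) \<partial>lborel) \<partial>?P ?I)"
    by (rule split) measurable
  also have "\<dots> = (\<integral>\<^sup>+F. (\<integral>\<^sup>+y. f ((\<Sum>b\<in>?I. F b *\<^sub>R b) + (g (\<Sum>b\<in>?I. F b *\<^sub>R b) + 1 * y) *\<^sub>R i) \<partial>lborel) \<partial>?P ?I)"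
  proof -
    have "x + y *\<^sub>R i + g (x + y *\<^sub>R i) *\<^sub>R i = x + (g x + 1 * y) *\<^sub>R i" for x y
      by (simp only: g) (simp add: scaleR_add_left)
    then show ?thesis by (simp only:)
  qed
  also have "\<dots> = (\<integral>\<^sup>+F. (\<integral>\<^sup>+y. f ((\<Sum>b\<in>?I. F b *\<^sub>R b) + y *\<^sub>R i) \<partial>lborel) \<partial>?P ?I)"
  proof (rule nn_integral_cong)
    fix F :: "'a \<Rightarrow> real"
    let ?s = "\<Sum>b\<in>?I. F b *\<^sub>R b"
    have "(\<lambda>y. f (?s + y *\<^sub>R i)) \<in> borel_measurable borel" by measurable
    from nn_integral_real_affine[OF this, of 1 "g ?s"]
    show "(\<integral>\<^sup>+y. f (?s + (g ?s + 1 * y) *\<^sub>R i) \<partial>lborel) = (\<integral>\<^sup>+y. f (?s + y *\<^sub>R i) \<partial>lborel)" by simp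
  qed
  also have "\<dots> = (\<integral>\<^sup>+x. f x \<partial>lborel)" by (rule split[symmetric]) measurable
  finally show ?thesis .
qed

lemma lborel_distr_permute:
  fixes p :: "'n::finite \<Rightarrow> 'n"
  assumes p: "bij p"
  shows "distr lborel borel (\<lambda>x::real^'n. \<chi> i. x $ p i) = lborel"
proof (rule lborel_eqI[symmetric])
  have m: "(\<lambda>x::real^'n. \<chi> i. x $ p i) \<in> borel_measurable borel"
    by (intro borel_measurable_continuous_onI continuous_intros)
  fix l u :: "real^'n" assume lu: "\<And>b. b \<in> Basis \<Longrightarrow> l \<bullet> b \<le> u \<bullet> b"
  then have lu': "l $ i \<le> u $ i" for i
    using lu[of "axis i 1"] by (auto simp: Basis_vec_def inner_axis)
  let ?l = "\<chi> i. l $ inv p i" and ?u = "\<chi> i. u $ inv p i"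
  have eq: "(\<lambda>x. \<chi> i. x $ p i) -` box l u = box ?l ?u"
  proof -
    have "(\<forall>i. l $ i < x $ p i \<and> x $ p i < u $ i) \<longleftrightarrow> (\<forall>i. l $ inv p i < x $ i \<and> x $ i < u $ inv p i)" for x
      using p by (metis bij_inv_eq_iff)
    then show ?thesis by (auto simp: mem_box_cart)
  qed
  have B: "(\<Prod>b\<in>Basis. w \<bullet> b) = (\<Prod>i\<in>UNIV. w $ i)" for w :: "real^'n"
  proof -
    have BB: "(Basis :: (real^'n) set) = (\<lambda>i. axis i 1) ` UNIV" by (auto simp: Basis_vec_def)
    have inj: "inj (\<lambda>i::'n. axis i (1::real))" by (auto simp: inj_on_def axis_eq_axis)
    show ?thesis unfolding BB prod.reindex[OF inj] by (simp add: inner_axis)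
  qed
  have "emeasure (distr lborel borel (\<lambda>x::real^'n. \<chi> i. x $ p i)) (box l u) = emeasure lborel (box ?l ?u)"
    using m by (subst emeasure_distr) (auto simp: eq)
  also have "\<dots> = ennreal (\<Prod>b\<in>Basis. (?u - ?l) \<bullet> b)"
    by (intro emeasure_lborel_box) (auto simp: Basis_vec_def inner_axis lu')
  also have "(\<Prod>b\<in>Basis. (?u - ?l) \<bullet> b) = (\<Prod>i\<in>UNIV. (u - l) $ inv p i)"
    unfolding B by simp
  also have "\<dots> = (\<Prod>i\<in>UNIV. (u - l) $ i)"
    by (rule prod.reindex_bij_betw[OF bij_imp_bij_inv[OF p]])
  finally show "emeasure (distr lborel borel (\<lambda>x::real^'n. \<chi> i. x $ p i)) (box l u) = (\<Prod>b\<in>Basis. (u - l) \<bullet> b)"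
    unfolding B .
qed simp

text \<open>The library proves the change of variables formula only for index types in
  the class \<open>wellorder\<close>.\<close>

lemma nn_integral_lborel_linear:
  fixes T :: "real^'n::finite \<Rightarrow> real^'n"
  assumes "linear T" "det (matrix T) \<noteq> 0" "f \<in> borel_measurable borel"
  shows "(\<integral>\<^sup>+x. f x \<partial>lborel) = ennreal \<bar>det (matrix T)\<bar> * (\<integral>\<^sup>+x. f (T x) \<partial>lborel)"
proof -
  define P where "P T \<longleftrightarrow> det (matrix T) \<noteq> 0 \<longrightarrow> (\<forall>f\<in>borel_measurable borel.
     (\<integral>\<^sup>+x. f x \<partial>lborel) = ennreal \<bar>det (matrix T)\<bar> * (\<integral>\<^sup>+x. f (T x) \<partial>lborel))" for T :: "real^'n \<Rightarrow> real^'n"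
  have "P T"
  \<comment> \<open>The cases are composition, a vanishing component, diagonal scaling, exchange of
    two coordinates, and a shear. The second one is vacuous because its determinant is 0.\<close>
  proof (induction rule: induct_linear_elementary[OF \<open>linear T\<close>])
    case (1 S T)
    have det: "det (matrix (S \<circ> T)) = det (matrix S) * det (matrix T)"
      using 1 by (simp add: matrix_compose det_mul)
    show ?case unfolding P_def
    proof (intro impI ballI)
      fix f :: "real^'n \<Rightarrow> ennreal" assume nz: "det (matrix (S \<circ> T)) \<noteq> 0" and f: "f \<in> borel_measurable borel"
      have "(\<lambda>x. f (S x)) \<in> borel_measurable borel"
        using f 1(1) by (intro measurable_compose[OF _ f] borel_measurable_continuous_onI linear_continuous_on linear_conv_bounded_linear[THEN iffD1])
      then have "(\<integral>\<^sup>+x. f (S x) \<partial>lborel) = ennreal \<bar>det (matrix T)\<bar> * (\<integral>\<^sup>+x. f (S (T x)) \<partial>lborel)"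
        using 1(4) nz unfolding P_def det by simp
      moreover have "(\<integral>\<^sup>+x. f x \<partial>lborel) = ennreal \<bar>det (matrix S)\<bar> * (\<integral>\<^sup>+x. f (S x) \<partial>lborel)"
        using 1(3) nz f unfolding P_def det by simp
      ultimately show "(\<integral>\<^sup>+x. f x \<partial>lborel) = ennreal \<bar>det (matrix (S \<circ> T))\<bar> * (\<integral>\<^sup>+x. f ((S \<circ> T) x) \<partial>lborel)"
        unfolding det by (simp add: abs_mult ennreal_mult mult.assoc)
    qed
  next
    case (2 T i)
    have "row i (matrix T) = 0"
      using 2(2)[of "axis _ 1"] by (simp add: row_def matrix_def vec_eq_iff)
    then show ?case unfolding P_def by (simp add: det_zero_row)
  next
    case (3 c)
    let ?T = "\<lambda>x::real^'n. \<chi> i. c i * x $ i"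
    have mat: "matrix ?T = (\<chi> i j. if i = j then c i else 0)"
      by (simp add: matrix_def axis_def vec_eq_iff)
    have det: "det (matrix ?T) = (\<Prod>i\<in>UNIV. c i)"
      unfolding mat by (subst det_diagonal) auto
    show ?case unfolding P_def
    proof (intro impI ballI)
      fix f :: "real^'n \<Rightarrow> ennreal" assume nz: "det (matrix ?T) \<noteq> 0" and f[measurable]: "f \<in> borel_measurable borel"
      have c: "c i \<noteq> 0" for i using nz unfolding det by simp
      define c' where "c' b = (\<Sum>i\<in>UNIV. c i * (b $ i))" for b :: "real^'n"
      have c': "c' (axis i 1) = c i" for i
        unfolding c'_def axis_def by (simp add: if_distrib cong: if_cong)
      have BB: "(Basis :: (real^'n) set) = (\<lambda>i. axis i 1) ` UNIV" by (auto simp: Basis_vec_def)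
      have inj: "inj (\<lambda>i::'n. axis i (1::real))" by (auto simp: inj_on_def axis_eq_axis)
      have T: "0 + (\<Sum>j\<in>Basis. (c' j * (x \<bullet> j)) *\<^sub>R j) = ?T x" for x
      proof -
        have "(\<Sum>j\<in>Basis. (c' j * (x \<bullet> j)) *\<^sub>R j) = (\<Sum>i\<in>UNIV. (c i * x $ i) *\<^sub>R axis i 1)"
          unfolding BB sum.reindex[OF inj] by (simp add: c' inner_axis)
        then show ?thesis by (simp add: vec_eq_iff axis_def if_distrib cong: if_cong)
      qed
      have pr: "(\<Prod>j\<in>Basis. \<bar>c' j\<bar>) = \<bar>det (matrix ?T)\<bar>"
        unfolding BB det prod.reindex[OF inj] by (simp add: c' abs_prod)
      have Tm[measurable]: "?T \<in> borel_measurable borel"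
        by (intro borel_measurable_continuous_onI continuous_intros)
      have "lborel = density (distr lborel borel (\<lambda>x. 0 + (\<Sum>j\<in>Basis. (c' j * (x \<bullet> j)) *\<^sub>R j)))
          (\<lambda>x. ennreal (\<Prod>j\<in>Basis. \<bar>c' j\<bar>))"
        by (rule lborel_affine_euclidean) (auto simp: BB c' c)
      then have "lborel = density (distr lborel borel ?T) (\<lambda>x. ennreal \<bar>det (matrix ?T)\<bar>)"
        unfolding T pr .
      then have "(\<integral>\<^sup>+x. f x \<partial>lborel) = (\<integral>\<^sup>+x. f x \<partial>density (distr lborel borel ?T) (\<lambda>x. ennreal \<bar>det (matrix ?T)\<bar>))"
        by simp
      also have "\<dots> = (\<integral>\<^sup>+x. ennreal \<bar>det (matrix ?T)\<bar> * f (?T x) \<partial>lborel)"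
        by (simp add: nn_integral_density nn_integral_distr)
      also have "\<dots> = ennreal \<bar>det (matrix ?T)\<bar> * (\<integral>\<^sup>+x. f (?T x) \<partial>lborel)"
        by (rule nn_integral_cmult) measurable
      finally show "(\<integral>\<^sup>+x. f x \<partial>lborel) = ennreal \<bar>det (matrix ?T)\<bar> * (\<integral>\<^sup>+x. f (?T x) \<partial>lborel)" .
    qed
  next
    case (4 m n)
    let ?p = "Transposition.transpose m n" let ?T = "\<lambda>x::real^'n. \<chi> i. x $ ?p i"
    have "matrix ?T = (\<chi> i. (mat 1 :: real^'n^'n) $ ?p i)"
      by (simp add: matrix_def axis_def mat_def vec_eq_iff)
    then have "det (matrix ?T) = of_int (sign ?p)"
      by (simp add: det_permute_rows permutes_swap_id)
    then have det: "\<bar>det (matrix ?T)\<bar> = 1" by (simp add: sign_def)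
    have m[measurable]: "?T \<in> borel_measurable borel"
      by (intro borel_measurable_continuous_onI continuous_intros)
    show ?case unfolding P_def det
    proof (intro impI ballI)
      fix f :: "real^'n \<Rightarrow> ennreal" assume [measurable]: "f \<in> borel_measurable borel"
      have "(\<integral>\<^sup>+x. f x \<partial>lborel) = (\<integral>\<^sup>+x. f x \<partial>distr lborel borel ?T)"
        by (subst lborel_distr_permute) auto
      also have "\<dots> = (\<integral>\<^sup>+x. f (?T x) \<partial>lborel)" by (rule nn_integral_distr) auto
      finally show "(\<integral>\<^sup>+x. f x \<partial>lborel) = ennreal 1 * (\<integral>\<^sup>+x. f (?T x) \<partial>lborel)" by simp
    qed
  next
    case (5 m n)
    let ?T = "\<lambda>x::real^'n. \<chi> i. if i = m then x $ m + x $ n else x $ i"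
    have T: "?T x = x + (x $ n) *\<^sub>R axis m 1" for x
      by (simp add: vec_eq_iff axis_def)
    have "matrix ?T = (\<chi> i. if i = m then row m (mat 1 :: real^'n^'n) + 1 *s row n (mat 1) else row i (mat 1))"
      by (simp add: matrix_def axis_def mat_def row_def vec_eq_iff)
    also have "det \<dots> = det (mat 1 :: real^'n^'n)"
      by (rule det_row_operation[OF \<open>m \<noteq> n\<close>])
    finally have det: "\<bar>det (matrix ?T)\<bar> = 1" by simp
    show ?case unfolding P_def det
    proof (intro impI ballI)
      fix f :: "real^'n \<Rightarrow> ennreal" assume [measurable]: "f \<in> borel_measurable borel"
      have "(\<integral>\<^sup>+x. f (x + (x $ n) *\<^sub>R axis m 1) \<partial>lborel) = (\<integral>\<^sup>+x. f x \<partial>lborel)"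
        using \<open>m \<noteq> n\<close> by (intro nn_integral_lborel_shift_coordinate) (auto simp: axis_def Basis_vec_def)
      then show "(\<integral>\<^sup>+x. f x \<partial>lborel) = ennreal 1 * (\<integral>\<^sup>+x. f (?T x) \<partial>lborel)" unfolding T by simp
    qed
  qed
  then show ?thesis using assms by (simp add: P_def)
qed

section \<open>Normal laws as linear images of the standard normal law\<close>

lemma invertible_matrix_inv:
  assumes "invertible A"
  shows "A ** matrix_inv A = mat 1" "matrix_inv A ** A = mat 1"
  using someI_ex[OF assms[unfolded invertible_def]] by (auto simp: matrix_inv_def)

lemma matrix_inv_unique:
  fixes A :: "'a::semiring_1^'n^'m"
  assumes "A ** B = mat 1" "B ** A = mat 1"
  shows "matrix_inv A = B"
proof -
  have "invertible A" using assms unfolding invertible_def by blast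
  then have "matrix_inv A = (matrix_inv A ** A) ** B"
    by (simp add: assms matrix_mul_assoc[symmetric])
  also have "\<dots> = B" using invertible_matrix_inv[OF \<open>invertible A\<close>] by simp
  finally show ?thesis .
qed

text \<open>Substituting \<open>B *v x\<close> turns the quadratic form of the inverse of
  \<open>\<Gamma>\<close> into the squared norm, and the square root of \<open>det \<Gamma>\<close>
  is the Jacobian of the substitution.\<close>

lemma multivariate_normal_eq_distr:
  fixes \<Gamma> B :: "real^'n::finite^'n"
  assumes B: "invertible B" and \<Gamma>: "\<Gamma> = B ** transpose B"
  shows "multivariate_normal 0 \<Gamma> = distr std_gauss borel (\<lambda>x. B *v x)"
proof (rule measure_eqI)
  show "sets (multivariate_normal 0 \<Gamma>) = sets (distr std_gauss borel ((*v) B))"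
    by (simp add: multivariate_normal_def)
  let ?d = "\<lambda>x. exp (- ((x - 0) \<bullet> (matrix_inv \<Gamma> *v (x - 0))) / 2) / sqrt ((2 * pi) ^ CARD('n) * det \<Gamma>)"
  have Bm[measurable]: "(*v) E \<in> borel_measurable borel" for E :: "real^'n^'n"
    by (intro borel_measurable_continuous_onI matrix_vector_mult_linear_continuous_on)
  have dm[measurable]: "?d \<in> borel_measurable borel"
    by measurable
  have detB: "det B \<noteq> 0" using B by (simp add: invertible_det_nz)
  have mat: "matrix ((*v) B) = B" by simp
  have iB: "matrix_inv B ** B = mat 1" "B ** matrix_inv B = mat 1"
    using invertible_matrix_inv[OF B] by auto
  have inv: "matrix_inv \<Gamma> = transpose (matrix_inv B) ** matrix_inv B"
  proof (rule matrix_inv_unique)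
    have t: "transpose B ** transpose (matrix_inv B) = mat 1" "transpose (matrix_inv B) ** transpose B = mat 1"
      using iB by (simp_all add: matrix_transpose_mul[symmetric])
    show "\<Gamma> ** (transpose (matrix_inv B) ** matrix_inv B) = mat 1"
      unfolding \<Gamma> using t iB by (metis matrix_mul_assoc matrix_mul_rid)
    show "(transpose (matrix_inv B) ** matrix_inv B) ** \<Gamma> = mat 1"
      unfolding \<Gamma> using t iB by (metis matrix_mul_assoc matrix_mul_rid)
  qed
  have q: "(B *v x) \<bullet> (matrix_inv \<Gamma> *v (B *v x)) = (norm x)\<^sup>2" for x
  proof -
    have "(B *v x) \<bullet> (matrix_inv \<Gamma> *v (B *v x)) = (matrix_inv B *v (B *v x)) \<bullet> (matrix_inv B *v (B *v x))"
      unfolding inv matrix_vector_mul_assoc[symmetric] by (metis dot_lmul_matrix vector_transpose_matrix)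
    also have "matrix_inv B *v (B *v x) = x" using iB by (simp add: matrix_vector_mul_assoc)
    finally show ?thesis by (simp add: power2_norm_eq_inner)
  qed
  have "sqrt (det \<Gamma>) = \<bar>det B\<bar>" by (simp add: \<Gamma> det_mul flip: power2_eq_square)
  then have dB: "\<bar>det B\<bar> * ?d (B *v x) = gauss_density x" for x
    using detB by (simp add: q gauss_density_eq real_sqrt_mult)
  fix S assume "S \<in> sets (multivariate_normal 0 \<Gamma>)"
  then have [measurable]: "S \<in> sets borel" by (simp add: multivariate_normal_def)
  have "emeasure (multivariate_normal 0 \<Gamma>) S = (\<integral>\<^sup>+x. ennreal (?d x) * indicator S x \<partial>lborel)"
    unfolding multivariate_normal_def by (rule emeasure_density) auto
  also have "\<dots> = ennreal \<bar>det B\<bar> * (\<integral>\<^sup>+x. ennreal (?d (B *v x)) * indicator S (B *v x) \<partial>lborel)"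
    using nn_integral_lborel_linear[OF matrix_vector_mul_linear[of B], of "\<lambda>x. ennreal (?d x) * indicator S x"] detB mat by simp
  also have "\<dots> = (\<integral>\<^sup>+x. ennreal \<bar>det B\<bar> * (ennreal (?d (B *v x)) * indicator S (B *v x)) \<partial>lborel)"
    by (rule nn_integral_cmult[symmetric]) measurable
  also have "\<dots> = (\<integral>\<^sup>+x. ennreal (gauss_density x) * indicator S (B *v x) \<partial>lborel)"
    by (simp only: dB[symmetric] ennreal_mult'[OF abs_ge_zero] mult.assoc)
  also have "\<dots> = (\<integral>\<^sup>+x. indicator S (B *v x) \<partial>std_gauss)"
    by (rule nn_integral_std_gauss[symmetric]) measurable
  also have "\<dots> = emeasure (distr std_gauss borel ((*v) B)) S"
  proof -
    have "emeasure (distr std_gauss borel ((*v) B)) S = (\<integral>\<^sup>+x. indicator S x \<partial>distr std_gauss borel ((*v) B))"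
      by simp
    then show ?thesis by (simp only: nn_integral_distr[OF Bm[unfolded measurable_cong_sets[OF sets_std_gauss[symmetric] refl]]])
        (subst nn_integral_distr, auto)
  qed
  finally show "emeasure (multivariate_normal 0 \<Gamma>) S = emeasure (distr std_gauss borel ((*v) B)) S" .
qed

text \<open>Gram--Schmidt for the inner product given by \<open>\<Gamma>\<close>, with finite
  induction over the index type; the orthonormal vectors are the rows of \<open>W\<close>.\<close>

lemma whitening_exists:
  fixes \<Gamma> :: "real^'n::finite^'n"
  assumes sym: "transpose \<Gamma> = \<Gamma>" and pos: "\<And>v. v \<noteq> 0 \<Longrightarrow> v \<bullet> (\<Gamma> *v v) > 0"
  obtains W :: "real^'n^'n" where "W ** \<Gamma> ** transpose W = mat 1"
proof -
  have swap: "x \<bullet> (\<Gamma> *v y) = y \<bullet> (\<Gamma> *v x)" for x y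
    by (metis sym dot_lmul_matrix vector_transpose_matrix inner_commute)
  have "\<exists>w::'n \<Rightarrow> real^'n. \<forall>i\<in>I. \<forall>j\<in>I. w i \<bullet> (\<Gamma> *v w j) = (if i = j then 1 else 0)" for I :: "'n set"
  proof (induction I rule: finite_induct[OF finite])
    case (2 k I)
    then obtain w :: "'n \<Rightarrow> real^'n" where w: "\<And>i j. i \<in> I \<Longrightarrow> j \<in> I \<Longrightarrow> w i \<bullet> (\<Gamma> *v w j) = (if i = j then 1 else 0)"
      by blast
    \<comment> \<open>Fewer vectors than the dimension leave a nonzero \<open>a\<close> orthogonal
      to all of them, that is, \<open>\<Gamma>\<close>-orthogonal to the vectors found so
      far.\<close>
    have "dim ((\<lambda>i. \<Gamma> *v w i) ` I) \<le> card ((\<lambda>i. \<Gamma> *v w i) ` I)" by (rule dim_le_card') simp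
    also have "\<dots> \<le> card I" by (rule card_image_le) simp
    also have "\<dots> < CARD('n)" using 2(2) by (intro psubset_card_mono) auto
    finally obtain a where a: "a \<noteq> 0" "span ((\<lambda>i. \<Gamma> *v w i) ` I) \<subseteq> {x. a \<bullet> x = 0}"
      using lowdim_subset_hyperplane[of "(\<lambda>i. \<Gamma> *v w i) ` I"] by auto
    have a0: "a \<bullet> (\<Gamma> *v w i) = 0" if "i \<in> I" for i
      using a(2) that by (auto intro: span_base)
    define s where "s = a \<bullet> (\<Gamma> *v a)"
    have s: "s > 0" using pos[OF a(1)] by (simp add: s_def)
    define v where "v = (1 / sqrt s) *\<^sub>R a"
    have v1: "v \<bullet> (\<Gamma> *v v) = 1" using s by (simp add: v_def matrix_vector_mult_scaleR flip: s_def)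
    have v0: "v \<bullet> (\<Gamma> *v w i) = 0" "w i \<bullet> (\<Gamma> *v v) = 0" if "i \<in> I" for i
      using a0[OF that] swap[of "w i" v] by (simp_all add: v_def)
    show ?case
      by (intro exI[of _ "w(k := v)"] ballI) (use 2(2) w v1 v0 in \<open>auto split: if_splits\<close>)
  qed auto
  from this[of UNIV] obtain w :: "'n \<Rightarrow> real^'n" where w: "\<And>i j. w i \<bullet> (\<Gamma> *v w j) = (if i = j then 1 else 0)"
    by auto
  let ?W = "\<chi> i. w i"
  have "(?W ** \<Gamma> ** transpose ?W) $ i $ j = (mat 1 :: real^'n^'n) $ i $ j" for i j
  proof -
    have "(?W ** \<Gamma> ** transpose ?W) $ i $ j = w i \<bullet> (\<Gamma> *v w j)"
      by (simp add: matrix_matrix_mult_def matrix_vector_mult_def transpose_def inner_vec_def sum_distrib_left sum_distrib_right mult.assoc)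
        (rule sum.swap)
    then show ?thesis by (simp add: w mat_def)
  qed
  then have "?W ** \<Gamma> ** transpose ?W = mat 1" by (simp add: vec_eq_iff)
  then show thesis by (rule that)
qed

section \<open>Independent samples and consistency\<close>

context prob_space
begin

text \<open>\<open>likely e A\<close>: for all large \<open>n\<close>, the event \<open>A n\<close> has outer probability at least \<open>1 - e\<close>. Minimizers
  of random functions can be treated without discussing their measurability.\<close>

definition likely :: "real \<Rightarrow> (nat \<Rightarrow> 'a \<Rightarrow> bool) \<Rightarrow> bool" where
  "likely e A \<longleftrightarrow> (\<exists>n0. \<forall>n\<ge>n0. \<exists>E\<in>events. prob E \<le> e \<and> (\<forall>\<omega>\<in>space M - E. A n \<omega>))"

lemma likelyI:
  assumes "\<And>n. n \<ge> n0 \<Longrightarrow> E n \<in> events" "\<And>n. n \<ge> n0 \<Longrightarrow> prob (E n) \<le> e"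
    "\<And>n \<omega>. n \<ge> n0 \<Longrightarrow> \<omega> \<in> space M \<Longrightarrow> \<omega> \<notin> E n \<Longrightarrow> A n \<omega>"
  shows "likely e A"
  unfolding likely_def using assms by (intro exI[of _ n0] allI impI bexI[of _ "E _"]) auto

lemma likely_mono:
  assumes "likely e A" "\<And>n \<omega>. n \<ge> N \<Longrightarrow> \<omega> \<in> space M \<Longrightarrow> A n \<omega> \<Longrightarrow> B n \<omega>" "e \<le> e'"
  shows "likely e' B"
proof -
  obtain n1 where "\<And>n. n \<ge> n1 \<Longrightarrow> \<exists>E\<in>events. prob E \<le> e \<and> (\<forall>\<omega>\<in>space M - E. A n \<omega>)"
    using assms(1) unfolding likely_def by blast
  then have "\<exists>E\<in>events. prob E \<le> e' \<and> (\<forall>\<omega>\<in>space M - E. B n \<omega>)" if "n \<ge> max N n1" for n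
    using that assms(2)[of n] assms(3) by (meson DiffD1 max.boundedE order_trans)
  then show ?thesis unfolding likely_def by blast
qed

lemma likely_conj:
  assumes "likely e A" "likely e' B"
  shows "likely (e + e') (\<lambda>n \<omega>. A n \<omega> \<and> B n \<omega>)"
proof -
  obtain n1 where 1: "\<And>n. n \<ge> n1 \<Longrightarrow> \<exists>E\<in>events. prob E \<le> e \<and> (\<forall>\<omega>\<in>space M - E. A n \<omega>)"
    using assms(1) unfolding likely_def by blast
  obtain n2 where 2: "\<And>n. n \<ge> n2 \<Longrightarrow> \<exists>E\<in>events. prob E \<le> e' \<and> (\<forall>\<omega>\<in>space M - E. B n \<omega>)"
    using assms(2) unfolding likely_def by blast
  have "\<exists>E\<in>events. prob E \<le> e + e' \<and> (\<forall>\<omega>\<in>space M - E. A n \<omega> \<and> B n \<omega>)" if n: "n \<ge> max n1 n2" for n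
  proof -
    obtain E where E: "E \<in> events" "prob E \<le> e" "\<forall>\<omega>\<in>space M - E. A n \<omega>" using 1[of n] n by auto
    obtain E' where E': "E' \<in> events" "prob E' \<le> e'" "\<forall>\<omega>\<in>space M - E'. B n \<omega>" using 2[of n] n by auto
    have "prob (E \<union> E') \<le> e + e'" using measure_Un_le[OF E(1) E'(1)] E(2) E'(2) by simp
    then show ?thesis using E E' by (intro bexI[of _ "E \<union> E'"]) auto
  qed
  then show ?thesis unfolding likely_def by blast
qed

text \<open>Each single event is available for every positive \<open>e\<close>, so the allowance can
  be halved at each insertion.\<close>

lemma likely_ball_finite:
  assumes "finite V" "V \<noteq> {} \<Longrightarrow> e > 0" "e \<ge> 0" "\<And>v e. v \<in> V \<Longrightarrow> e > 0 \<Longrightarrow> likely e (A v)"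
  shows "likely e (\<lambda>n \<omega>. \<forall>v\<in>V. A v n \<omega>)"
  using assms
proof (induction V arbitrary: e rule: finite_induct)
  case empty
  then show ?case by (intro likelyI[of 0 "\<lambda>_. {}"]) auto
next
  case (insert v V)
  have "likely (e / 2 + e / 2) (\<lambda>n \<omega>. A v n \<omega> \<and> (\<forall>v\<in>V. A v n \<omega>))"
    using insert.prems by (intro likely_conj insert.IH insert.prems) auto
  then show ?case by (rule likely_mono[where N=0]) auto
qed

lemma likely_markov:
  assumes Y: "\<And>n. integrable M (Y n)" "\<And>n \<omega>. \<omega> \<in> space M \<Longrightarrow> 0 \<le> Y n \<omega>"
    and E: "\<And>n. n \<ge> n0 \<Longrightarrow> expectation (Y n) \<le> B" and e: "e > 0" and t: "t > 0" "B \<le> e * t"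
  shows "likely e (\<lambda>n \<omega>. Y n \<omega> < t)"
proof (rule likelyI[of n0 "\<lambda>n. {\<omega>\<in>space M. Y n \<omega> \<ge> t}"])
  fix n assume n: "n \<ge> n0"
  show "{\<omega>\<in>space M. Y n \<omega> \<ge> t} \<in> events" using Y(1)[of n] by measurable
  have "prob {\<omega>\<in>space M. Y n \<omega> \<ge> t} \<le> expectation (Y n) / t"
    using Y t by (intro integral_Markov_inequality_measure[OF _ sets.top]) auto
  also have "\<dots> \<le> e" using E[OF n] t by (simp add: pos_divide_le_eq)
  finally show "prob {\<omega>\<in>space M. Y n \<omega> \<ge> t} \<le> e" .
qed auto

end

section \<open>Second moments of sums over an independent sample\<close>

locale iid_sample = prob_space M for M :: "'w measure" +
  fixes X :: "nat \<Rightarrow> 'w \<Rightarrow> 'a::topological_space" and Q :: "'a measure"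
  assumes indep: "indep_vars (\<lambda>_. borel) X UNIV"
    and distr_X: "\<And>i. distr M borel (X i) = Q"
begin

lemma X_measurable [measurable]: "X i \<in> borel_measurable M"
  using indep unfolding indep_vars_def by auto

lemma sets_Q [simp, measurable_cong]: "sets Q = sets borel"
  unfolding distr_X[of 0, symmetric] by simp

lemma space_Q [simp]: "space Q = UNIV"
  unfolding distr_X[of 0, symmetric] by simp

lemma prob_space_Q: "prob_space Q"
  unfolding distr_X[of 0, symmetric] by (rule prob_space_distr) simp

lemma integrable_X_iff:
  fixes g :: "'a \<Rightarrow> real"
  assumes "g \<in> borel_measurable borel"
  shows "integrable M (\<lambda>\<omega>. g (X i \<omega>)) \<longleftrightarrow> integrable Q g"
  unfolding distr_X[of i, symmetric] by (rule integrable_distr_eq[OF X_measurable assms, symmetric])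

lemma expectation_X:
  fixes g :: "'a \<Rightarrow> real"
  assumes "g \<in> borel_measurable borel"
  shows "expectation (\<lambda>\<omega>. g (X i \<omega>)) = integral\<^sup>L Q g"
  unfolding distr_X[of i, symmetric] by (rule integral_distr[OF X_measurable assms, symmetric])

lemma integrable_if_square_integrable:
  fixes g :: "'a \<Rightarrow> real"
  assumes "g \<in> borel_measurable borel" "integrable Q (\<lambda>x. (g x)\<^sup>2)"
  shows "integrable Q g"
proof -
  interpret Q: prob_space Q by (rule prob_space_Q)
  have "g \<in> borel_measurable Q" using assms(1) by (simp add: measurable_cong_sets[OF sets_Q refl])
  then show ?thesis using assms(2) by (rule Q.square_integrable_imp_integrable)
qed

text \<open>The mixed terms vanish by independence and centering; the diagonal remains.\<close>

lemma second_moment_centered_sum: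
  fixes g :: "'a \<Rightarrow> real"
  assumes g[measurable]: "g \<in> borel_measurable borel" and sq: "integrable Q (\<lambda>x. (g x)\<^sup>2)" and mean: "integral\<^sup>L Q g = 0"
  shows "integrable M (\<lambda>\<omega>. (\<Sum>i<n. g (X i \<omega>))\<^sup>2)"
    "expectation (\<lambda>\<omega>. (\<Sum>i<n. g (X i \<omega>))\<^sup>2) = real n * (LINT x|Q. (g x)\<^sup>2)"
proof -
  have i1: "integrable M (\<lambda>\<omega>. g (X i \<omega>))" for i
    using integrable_if_square_integrable[OF g sq] integrable_X_iff[OF g] by blast
  have i2: "integrable M (\<lambda>\<omega>. (g (X i \<omega>))\<^sup>2)" for i
    using sq integrable_X_iff[of "\<lambda>x. (g x)\<^sup>2" i] by simp
  have e2: "expectation (\<lambda>\<omega>. (g (X i \<omega>))\<^sup>2) = (LINT x|Q. (g x)\<^sup>2)" for i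
    using expectation_X[of "\<lambda>x. (g x)\<^sup>2" i] by simp
  have e1: "expectation (\<lambda>\<omega>. g (X i \<omega>)) = 0" for i
    using expectation_X[OF g] mean by simp
  have "indep_vars (\<lambda>_. borel) (\<lambda>i \<omega>. g (X i \<omega>)) UNIV"
    by (rule indep_vars_compose2[OF indep]) simp
  then have iv: "indep_vars (\<lambda>_. borel) (\<lambda>i \<omega>. g (X i \<omega>)) I" for I
    by (rule indep_vars_subset) simp
  have prod: "integrable M (\<lambda>\<omega>. g (X i \<omega>) * g (X j \<omega>)) \<and> expectation (\<lambda>\<omega>. g (X i \<omega>) * g (X j \<omega>)) = 0"
    if "i \<noteq> j" for i j
  proof -
    have eq: "(\<Prod>k\<in>{i, j}. g (X k \<omega>)) = g (X i \<omega>) * g (X j \<omega>)" for \<omega> using that by simp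
    have "integrable M (\<lambda>\<omega>. \<Prod>k\<in>{i, j}. g (X k \<omega>))"
      by (rule indep_vars_integrable[OF _ iv i1]) simp
    moreover have "expectation (\<lambda>\<omega>. \<Prod>k\<in>{i, j}. g (X k \<omega>)) = (\<Prod>k\<in>{i, j}. expectation (\<lambda>\<omega>. g (X k \<omega>)))"
      by (rule indep_vars_lebesgue_integral[OF _ iv i1]) simp
    ultimately show ?thesis unfolding eq by (simp add: e1 card_gt_0_iff)
  qed
  have int: "integrable M (\<lambda>\<omega>. g (X i \<omega>) * g (X j \<omega>))" for i j
    using prod[of i j] i2[of i] by (cases "i = j") (auto simp: power2_eq_square)
  have val: "expectation (\<lambda>\<omega>. g (X i \<omega>) * g (X j \<omega>)) = (if i = j then (LINT x|Q. (g x)\<^sup>2) else 0)" for i j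
    using prod[of i j] e2[of i] by (auto simp: power2_eq_square)
  have sq_eq: "(\<Sum>i<n. g (X i \<omega>))\<^sup>2 = (\<Sum>i<n. \<Sum>j<n. g (X i \<omega>) * g (X j \<omega>))" for \<omega>
    by (simp add: power2_eq_square sum_product)
  show "integrable M (\<lambda>\<omega>. (\<Sum>i<n. g (X i \<omega>))\<^sup>2)"
    unfolding sq_eq using int by auto
  show "expectation (\<lambda>\<omega>. (\<Sum>i<n. g (X i \<omega>))\<^sup>2) = real n * (LINT x|Q. (g x)\<^sup>2)"
    unfolding sq_eq using int by (simp add: val)
qed

text \<open>The second moment stands in for the smaller variance because it is what Lipschitz bounds
  on \<open>g\<close> control directly.\<close>

lemma chebyshev_sum:
  fixes g :: "'a \<Rightarrow> real" and n :: nat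
  assumes g[measurable]: "g \<in> borel_measurable borel" and sq: "integrable Q (\<lambda>x. (g x)\<^sup>2)" and t: "t > 0"
  defines "E \<equiv> {\<omega>\<in>space M. \<bar>(\<Sum>i<n. g (X i \<omega>)) - real n * integral\<^sup>L Q g\<bar> \<ge> t}"
  shows "E \<in> events" "prob E \<le> real n * (LINT x|Q. (g x)\<^sup>2) / t\<^sup>2"
proof -
  interpret Q: prob_space Q by (rule prob_space_Q)
  show "E \<in> events" unfolding E_def by measurable
  define m where "m = integral\<^sup>L Q g"
  let ?g = "\<lambda>x. g x - m"
  have gi: "integrable Q g" by (rule integrable_if_square_integrable[OF g sq])
  have gsq: "integrable Q (\<lambda>x. (?g x)\<^sup>2)"
    unfolding power2_diff using gi sq by auto
  have mean: "integral\<^sup>L Q ?g = 0" using gi Q.prob_space by (simp add: m_def)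
  have "(LINT x|Q. (?g x)\<^sup>2) = (LINT x|Q. (g x)\<^sup>2) - m\<^sup>2"
    using Q.variance_eq[OF gi sq] by (simp add: m_def)
  then have le: "(LINT x|Q. (?g x)\<^sup>2) \<le> (LINT x|Q. (g x)\<^sup>2)" by simp
  have Eeq: "E = {\<omega>\<in>space M. (\<Sum>i<n. ?g (X i \<omega>))\<^sup>2 \<ge> t\<^sup>2}"
    unfolding E_def using t by (simp add: sum_subtractf m_def flip: abs_le_square_iff)
  have "prob E \<le> expectation (\<lambda>\<omega>. (\<Sum>i<n. ?g (X i \<omega>))\<^sup>2) / t\<^sup>2"
    unfolding Eeq using second_moment_centered_sum(1)[of ?g n] gsq mean t
    by (intro integral_Markov_inequality_measure[OF _ sets.top]) auto
  also have "expectation (\<lambda>\<omega>. (\<Sum>i<n. ?g (X i \<omega>))\<^sup>2) = real n * (LINT x|Q. (?g x)\<^sup>2)"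
    using gsq mean by (intro second_moment_centered_sum) auto
  also have "\<dots> / t\<^sup>2 \<le> real n * (LINT x|Q. (g x)\<^sup>2) / t\<^sup>2"
    using le by (intro divide_right_mono mult_left_mono) auto
  finally show "prob E \<le> real n * (LINT x|Q. (g x)\<^sup>2) / t\<^sup>2" .
qed

lemma likely_weak_law:
  fixes g :: "'a \<Rightarrow> real"
  assumes "g \<in> borel_measurable borel" "integrable Q (\<lambda>x. (g x)\<^sup>2)" "t > 0" "e > 0"
  shows "likely e (\<lambda>n \<omega>. \<bar>(\<Sum>i<n. g (X i \<omega>)) - real n * integral\<^sup>L Q g\<bar> \<le> real n * t)"
proof -
  let ?s = "LINT x|Q. (g x)\<^sup>2"
  have s: "?s \<ge> 0" by simp
  obtain n0 :: nat where n0: "real n0 > ?s / (e * t\<^sup>2)" using reals_Archimedean2 by blast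
  show ?thesis
  proof (rule likelyI[of "max 1 n0" "\<lambda>n. {\<omega>\<in>space M. \<bar>(\<Sum>i<n. g (X i \<omega>)) - real n * integral\<^sup>L Q g\<bar> \<ge> real n * t}"])
    fix n assume n: "max 1 n0 \<le> n"
    then have "real n * t > 0" using \<open>t > 0\<close> by simp
    from chebyshev_sum[OF assms(1,2) this]
    show "{\<omega>\<in>space M. \<bar>(\<Sum>i<n. g (X i \<omega>)) - real n * integral\<^sup>L Q g\<bar> \<ge> real n * t} \<in> events" by blast
    have "prob {\<omega>\<in>space M. \<bar>(\<Sum>i<n. g (X i \<omega>)) - real n * integral\<^sup>L Q g\<bar> \<ge> real n * t} \<le> real n * ?s / (real n * t)\<^sup>2"
      by (rule chebyshev_sum[OF assms(1,2) \<open>real n * t > 0\<close>])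
    also have "\<dots> = ?s / (real n * t\<^sup>2)" using n by (simp add: power2_eq_square)
    also have "\<dots> \<le> e"
    proof -
      have "?s / (e * t\<^sup>2) \<le> real n" using n n0 by simp
      then show ?thesis using \<open>t > 0\<close> \<open>e > 0\<close> n by (simp add: field_simps)
    qed
    finally show "prob {\<omega>\<in>space M. \<bar>(\<Sum>i<n. g (X i \<omega>)) - real n * integral\<^sup>L Q g\<bar> \<ge> real n * t} \<le> e" .
  qed auto
qed

end

text \<open>Collects what the metric structure contributes to the asymptotics: compact closed balls
  around \<open>p\<close>, continuity, a finite second moment, and uniqueness of the
  minimizer.\<close>

locale frechet_sample = iid_sample M X Q
  for M :: "'w measure" and X :: "nat \<Rightarrow> 'w \<Rightarrow> 'a::topological_space" and Q +
  fixes \<rho> :: "'a \<Rightarrow> 'a \<Rightarrow> real" and p :: 'a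
  assumes \<rho>_nonneg: "\<And>x y. \<rho> x y \<ge> 0"
    and \<rho>_sym: "\<And>x y. \<rho> x y = \<rho> y x"
    and \<rho>_triangle: "\<And>x y z. \<rho> x z \<le> \<rho> x y + \<rho> y z"
    and \<rho>_self: "\<And>x. \<rho> x x = 0"
    and \<rho>_continuous: "\<And>x. continuous_on UNIV (\<rho> x)"
    and \<rho>_compact: "\<And>R. compact {y. \<rho> p y \<le> R}"
    and \<rho>_square_integrable: "integrable Q (\<lambda>x. (\<rho> x p)\<^sup>2)"
    and unique_minimum: "\<And>y. y \<noteq> p \<Longrightarrow> (LINT x|Q. (\<rho> x p)\<^sup>2) < (LINT x|Q. (\<rho> x y)\<^sup>2)"
begin

lemma \<rho>_measurable [measurable]: "(\<lambda>x. \<rho> x y) \<in> borel_measurable borel"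
  unfolding \<rho>_sym[of _ y] by (rule borel_measurable_continuous_onI[OF \<rho>_continuous])

lemma \<rho>_diff_le: "\<bar>\<rho> x y - \<rho> x z\<bar> \<le> \<rho> y z"
  using \<rho>_triangle[of x y z] \<rho>_triangle[of x z y] \<rho>_sym[of y z] by linarith

lemma \<rho>_sq_diff_le: "\<bar>(\<rho> x y)\<^sup>2 - (\<rho> x z)\<^sup>2\<bar> \<le> \<rho> y z * (\<rho> x y + \<rho> x z)"
proof -
  have "(\<rho> x y)\<^sup>2 - (\<rho> x z)\<^sup>2 = (\<rho> x y - \<rho> x z) * (\<rho> x y + \<rho> x z)"
    by (simp add: power2_eq_square algebra_simps)
  then have "\<bar>(\<rho> x y)\<^sup>2 - (\<rho> x z)\<^sup>2\<bar> = \<bar>\<rho> x y - \<rho> x z\<bar> * (\<rho> x y + \<rho> x z)"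
    using \<rho>_nonneg by (simp add: abs_mult)
  also have "\<dots> \<le> \<rho> y z * (\<rho> x y + \<rho> x z)"
    using \<rho>_nonneg by (intro mult_right_mono \<rho>_diff_le add_nonneg_nonneg) auto
  finally show ?thesis .
qed

lemma \<rho>_integrable: "integrable Q (\<lambda>x. \<rho> x p)"
  by (rule integrable_if_square_integrable[OF \<rho>_measurable \<rho>_square_integrable])

text \<open>All functions treated below grow at most linearly in the distance from \<open>p\<close>,
  so its second moment dominates their squares.\<close>

lemma square_integrable_if_bounded:
  assumes g[measurable]: "g \<in> borel_measurable borel" and b: "\<And>x. \<bar>g x\<bar> \<le> a + b * \<rho> x p" and "a \<ge> 0" "b \<ge> 0"
  shows "integrable Q (\<lambda>x. (g x :: real)\<^sup>2)"
proof (rule Bochner_Integration.integrable_bound)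
  interpret Q: prob_space Q by (rule prob_space_Q)
  show "integrable Q (\<lambda>x. 2 * a\<^sup>2 + 2 * b\<^sup>2 * (\<rho> x p)\<^sup>2)"
    using \<rho>_square_integrable by auto
  show "AE x in Q. norm ((g x)\<^sup>2) \<le> norm (2 * a\<^sup>2 + 2 * b\<^sup>2 * (\<rho> x p)\<^sup>2)"
  proof (rule AE_I2)
    fix x
    have "(g x)\<^sup>2 \<le> (a + b * \<rho> x p)\<^sup>2" using b[of x] by (metis abs_ge_zero power2_abs power_mono)
    also have "\<dots> \<le> 2 * a\<^sup>2 + 2 * b\<^sup>2 * (\<rho> x p)\<^sup>2"
      using zero_le_power2[of "a - b * \<rho> x p"] by (simp add: power2_eq_square algebra_simps)
    finally show "norm ((g x)\<^sup>2) \<le> norm (2 * a\<^sup>2 + 2 * b\<^sup>2 * (\<rho> x p)\<^sup>2)" by simp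
  qed
qed simp

lemma \<rho>_sq_diff_bound: "\<bar>(\<rho> x y)\<^sup>2 - (\<rho> x p)\<^sup>2\<bar> \<le> (\<rho> y p)\<^sup>2 + 2 * \<rho> y p * \<rho> x p"
proof -
  have "\<rho> x y + \<rho> x p \<le> \<rho> y p + 2 * \<rho> x p"
    using \<rho>_triangle[of x y p] \<rho>_sym[of p y] by simp
  then have "\<rho> y p * (\<rho> x y + \<rho> x p) \<le> \<rho> y p * (\<rho> y p + 2 * \<rho> x p)"
    using \<rho>_nonneg by (rule mult_left_mono)
  then show ?thesis using \<rho>_sq_diff_le[of x y p] by (simp add: power2_eq_square algebra_simps)
qed

lemma \<rho>_sq_diff_square_integrable: "integrable Q (\<lambda>x. ((\<rho> x y)\<^sup>2 - (\<rho> x p)\<^sup>2)\<^sup>2)"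
  using \<rho>_nonneg by (intro square_integrable_if_bounded[OF _ \<rho>_sq_diff_bound]) auto

lemma \<rho>_sq_integrable: "integrable Q (\<lambda>x. (\<rho> x y)\<^sup>2)"
proof -
  have "integrable Q (\<lambda>x. (\<rho> x y)\<^sup>2 - (\<rho> x p)\<^sup>2)"
    by (rule integrable_if_square_integrable[OF _ \<rho>_sq_diff_square_integrable]) simp
  from Bochner_Integration.integrable_add[OF this \<rho>_square_integrable] show ?thesis by simp
qed

text \<open>The modulus of continuity and the semiconcavity constant of the empirical function
  depend on the average sample distance; this confines that average to a fixed bound.\<close>

lemma tight_mean_distance:
  assumes e: "e > 0"
  obtains t where "t > 0" "likely e (\<lambda>n \<omega>. (\<Sum>i<n. \<rho> (X i \<omega>) p) < real n * t)"
proof -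
  define b where "b = (LINT x|Q. \<rho> x p)"
  have b: "b \<ge> 0" unfolding b_def using \<rho>_nonneg by (intro integral_nonneg_AE) auto
  define t where "t = b / e + 1"
  have t: "t > 0" "b \<le> e * t" using b e by (auto simp: t_def field_simps add_pos_nonneg)
  have i: "integrable M (\<lambda>\<omega>. \<rho> (X i \<omega>) p)" for i
    using \<rho>_integrable integrable_X_iff[OF \<rho>_measurable] by blast
  have "likely e (\<lambda>n \<omega>. (\<Sum>i<n. \<rho> (X i \<omega>) p) / real n < t)"
  proof (rule likely_markov[of _ 0 b, OF _ _ _ e t])
    show "integrable M (\<lambda>\<omega>. (\<Sum>i<n. \<rho> (X i \<omega>) p) / real n)" for n using i by auto
    show "0 \<le> (\<Sum>i<n. \<rho> (X i \<omega>) p) / real n" for n \<omega> using \<rho>_nonneg by (intro divide_nonneg_nonneg sum_nonneg) auto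
    show "expectation (\<lambda>\<omega>. (\<Sum>i<n. \<rho> (X i \<omega>) p) / real n) \<le> b" for n
      using i expectation_X[OF \<rho>_measurable[of p]] b by (cases "n = 0") (auto simp: b_def)
  qed
  then have "likely e (\<lambda>n \<omega>. (\<Sum>i<n. \<rho> (X i \<omega>) p) < real n * t)"
    by (rule likely_mono[where N=1]) (auto simp: field_simps)
  with t(1) show thesis by (rule that)
qed

text \<open>Far points are excluded all at once by the triangle inequality. The remaining ones form
  a compact set, where the weak law at finitely many centres and a bound on the oscillation around
  them suffice.\<close>

lemma consistency:
  assumes "open N" "p \<in> N" and e: "e > 0"
  shows "likely e (\<lambda>n \<omega>. \<forall>y. y \<notin> N \<longrightarrow> (\<Sum>i<n. (\<rho> (X i \<omega>) p)\<^sup>2) < (\<Sum>i<n. (\<rho> (X i \<omega>) y)\<^sup>2))"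
proof -
  obtain t where t: "t > 0" and lt: "likely (e / 2) (\<lambda>n \<omega>. (\<Sum>i<n. \<rho> (X i \<omega>) p) < real n * t)"
    using tight_mean_distance[of "e / 2"] e by auto
  define D where "D y = (LINT x|Q. (\<rho> x y)\<^sup>2 - (\<rho> x p)\<^sup>2)" for y
  have D: "D y > 0" if "y \<noteq> p" for y
    using unique_minimum[OF that] \<rho>_sq_integrable by (simp add: D_def)
  define C where "C = {y. \<rho> p y \<le> 2 * t} - N"
  \<comment> \<open>With average distance below \<open>t\<close> and points within
    \<open>2 * t\<close> of \<open>p\<close>, a move by \<open>D y / (24 * t)\<close> changes the
    empirical average by at most \<open>D y / 4\<close>, less than the \<open>D y / 2\<close> that
    the weak law leaves at the centre.\<close>
  define U where "U y = {y'. \<rho> y y' < D y / (24 * t)}" for y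
  have "compact C" unfolding C_def by (intro compact_diff \<rho>_compact \<open>open N\<close>)
  moreover have "open (U y)" for y
    unfolding U_def by (intro open_Collect_less \<rho>_continuous continuous_on_const)
  moreover have "C \<subseteq> (\<Union>y\<in>C. U y)"
  proof
    fix y assume "y \<in> C"
    then have "y \<noteq> p" using \<open>p \<in> N\<close> by (auto simp: C_def)
    then have "y \<in> U y" using D[of y] t by (simp add: U_def \<rho>_self)
    then show "y \<in> (\<Union>y\<in>C. U y)" using \<open>y \<in> C\<close> by blast
  qed
  ultimately obtain V where V: "V \<subseteq> C" "finite V" "C \<subseteq> (\<Union>y\<in>V. U y)"
    by (rule compactE_image)
  have "likely (e / 2) (\<lambda>n \<omega>. \<forall>y\<in>V. \<bar>(\<Sum>i<n. (\<rho> (X i \<omega>) y)\<^sup>2 - (\<rho> (X i \<omega>) p)\<^sup>2) - real n * D y\<bar> \<le> real n * (D y / 2))"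
  proof (rule likely_ball_finite[OF V(2)])
    fix y e' assume "y \<in> V" "(e'::real) > 0"
    then have "y \<noteq> p" using V(1) \<open>p \<in> N\<close> by (auto simp: C_def)
    show "likely e' (\<lambda>n \<omega>. \<bar>(\<Sum>i<n. (\<rho> (X i \<omega>) y)\<^sup>2 - (\<rho> (X i \<omega>) p)\<^sup>2) - real n * D y\<bar> \<le> real n * (D y / 2))"
      unfolding D_def using D[OF \<open>y \<noteq> p\<close>] \<open>e' > 0\<close>
      by (intro likely_weak_law[of "\<lambda>x. (\<rho> x y)\<^sup>2 - (\<rho> x p)\<^sup>2"] \<rho>_sq_diff_square_integrable) (auto simp: D_def)
  qed (use e in auto)
  from likely_conj[OF lt this]
  show ?thesis
  proof (rule likely_mono[where N=1])
    fix n \<omega> assume n: "1 \<le> n" and "\<omega> \<in> space M" and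
      *: "(\<Sum>i<n. \<rho> (X i \<omega>) p) < real n * t \<and>
       (\<forall>y\<in>V. \<bar>(\<Sum>i<n. (\<rho> (X i \<omega>) y)\<^sup>2 - (\<rho> (X i \<omega>) p)\<^sup>2) - real n * D y\<bar> \<le> real n * (D y / 2))"
    show "\<forall>y. y \<notin> N \<longrightarrow> (\<Sum>i<n. (\<rho> (X i \<omega>) p)\<^sup>2) < (\<Sum>i<n. (\<rho> (X i \<omega>) y)\<^sup>2)"
    proof (intro allI impI)
      fix y assume "y \<notin> N"
      let ?S = "\<lambda>y. \<Sum>i<n. (\<rho> (X i \<omega>) y)\<^sup>2 - (\<rho> (X i \<omega>) p)\<^sup>2"
      have "?S y > 0"
      proof (cases "\<rho> p y \<le> 2 * t")
        \<comment> \<open>By the reverse triangle inequality the sum is at least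
          \<open>\<rho> p y\<close> times \<open>n * \<rho> p y\<close> minus twice the total sample
          distance, which is positive once \<open>\<rho> p y\<close> exceeds
          \<open>2 * t\<close>.\<close>
        case False
        have "(\<rho> x y)\<^sup>2 - (\<rho> x p)\<^sup>2 \<ge> (\<rho> p y)\<^sup>2 - 2 * \<rho> p y * \<rho> x p" for x
        proof -
          have "\<bar>\<rho> p y - \<rho> x p\<bar> \<le> \<rho> x y"
            using \<rho>_triangle[of p y x] \<rho>_triangle[of x p y] \<rho>_triangle[of p x y] \<rho>_triangle[of x y p] \<rho>_sym by (smt (verit))
          then have "\<bar>\<rho> p y - \<rho> x p\<bar>\<^sup>2 \<le> (\<rho> x y)\<^sup>2" by (rule power_mono) simp
          then show ?thesis by (simp add: power2_eq_square algebra_simps)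
        qed
        then have "(\<Sum>i<n. (\<rho> p y)\<^sup>2 - 2 * \<rho> p y * \<rho> (X i \<omega>) p) \<le> ?S y" by (intro sum_mono)
        moreover have "(\<Sum>i<n. (\<rho> p y)\<^sup>2 - 2 * \<rho> p y * \<rho> (X i \<omega>) p) = \<rho> p y * (real n * \<rho> p y - 2 * (\<Sum>i<n. \<rho> (X i \<omega>) p))"
          by (simp add: sum_subtractf sum_distrib_left[symmetric] power2_eq_square algebra_simps)
        moreover have "\<dots> > 0"
        proof (rule mult_pos_pos)
          show "\<rho> p y > 0" using False t by simp
          have "real n * (2 * t) \<le> real n * \<rho> p y" using False by (intro mult_left_mono) auto
          then show "0 < real n * \<rho> p y - 2 * (\<Sum>i<n. \<rho> (X i \<omega>) p)" using * by simp
        qed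
        ultimately show ?thesis by simp
      next
        case True
        then have "y \<in> C" using \<open>y \<notin> N\<close> by (simp add: C_def)
        then obtain v where v: "v \<in> V" "\<rho> v y < D v / (24 * t)" using V(3) by (auto simp: U_def)
        have vC: "\<rho> p v \<le> 2 * t" "v \<noteq> p" using v(1) V(1) \<open>p \<in> N\<close> by (auto simp: C_def)
        have "\<bar>?S v - real n * D v\<bar> \<le> real n * (D v / 2)" using * v(1) by blast
        then have "real n * D v - ?S v \<le> real n * D v / 2" by linarith
        then have "?S v \<ge> real n * (D v / 2)" by (simp add: field_simps)
        moreover have "?S v - ?S y \<le> (\<Sum>i<n. D v / (24 * t) * (2 * \<rho> (X i \<omega>) p + 4 * t))"
          unfolding sum_subtractf[symmetric]
        proof (rule sum_mono)
          fix i
          have "((\<rho> (X i \<omega>) v)\<^sup>2 - (\<rho> (X i \<omega>) p)\<^sup>2) - ((\<rho> (X i \<omega>) y)\<^sup>2 - (\<rho> (X i \<omega>) p)\<^sup>2) \<le> \<rho> v y * (\<rho> (X i \<omega>) v + \<rho> (X i \<omega>) y)"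
            using \<rho>_sq_diff_le[of "X i \<omega>" v y] by simp
          also have "\<dots> \<le> D v / (24 * t) * (2 * \<rho> (X i \<omega>) p + 4 * t)"
            using v(2) vC True \<rho>_nonneg \<rho>_triangle[of "X i \<omega>" v p] \<rho>_triangle[of "X i \<omega>" y p] D[OF vC(2)] t
            by (intro mult_mono) (auto intro: add_nonneg_nonneg)
          finally show "((\<rho> (X i \<omega>) v)\<^sup>2 - (\<rho> (X i \<omega>) p)\<^sup>2) - ((\<rho> (X i \<omega>) y)\<^sup>2 - (\<rho> (X i \<omega>) p)\<^sup>2) \<le> D v / (24 * t) * (2 * \<rho> (X i \<omega>) p + 4 * t)" .
        qed
        moreover have "(\<Sum>i<n. D v / (24 * t) * (2 * \<rho> (X i \<omega>) p + 4 * t)) < real n * (D v / 2)"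
        proof -
          have "(\<Sum>i<n. D v / (24 * t) * (2 * \<rho> (X i \<omega>) p + 4 * t)) = D v / (24 * t) * (2 * (\<Sum>i<n. \<rho> (X i \<omega>) p) + real n * (4 * t))"
            unfolding sum_distrib_left[symmetric] sum.distrib by simp
          also have "\<dots> \<le> D v / (24 * t) * (real n * (6 * t))"
            using conjunct1[OF *] D[OF vC(2)] t by (intro mult_left_mono) (auto simp: mult.commute[of t])
          also have "\<dots> = real n * (D v / 4)" using t by simp
          also have "\<dots> < real n * (D v / 2)" using n D[OF vC(2)] by simp
          finally show ?thesis .
        qed
        ultimately show ?thesis by linarith
      qed
      then show "(\<Sum>i<n. (\<rho> (X i \<omega>) p)\<^sup>2) < (\<Sum>i<n. (\<rho> (X i \<omega>) y)\<^sup>2)" by (simp add: sum_subtractf)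
    qed
  qed simp
qed

end

section \<open>Semiconcave functions\<close>

text \<open>At the leftmost point where a negative minimum is attained, two symmetric points average
  to strictly more than the minimum, against midpoint concavity.\<close>

lemma midpoint_concave_segment:
  fixes \<phi> :: "real \<Rightarrow> real"
  assumes cont: "continuous_on {0..1} \<phi>" and "\<phi> 0 = 0" "\<phi> 1 = 0"
    and mid: "\<And>s t. s \<in> {0..1} \<Longrightarrow> t \<in> {0..1} \<Longrightarrow> (\<phi> s + \<phi> t) / 2 \<le> \<phi> ((s + t) / 2)"
    and t: "t \<in> {0..1}"
  shows "0 \<le> \<phi> t"
proof (rule ccontr)
  assume "\<not> 0 \<le> \<phi> t"
  obtain a where a: "a \<in> {0..1}" "\<And>s. s \<in> {0..1} \<Longrightarrow> \<phi> a \<le> \<phi> s"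
    using continuous_attains_inf[OF compact_Icc _ cont] by auto
  define m where "m = \<phi> a"
  have "m < 0" using a(2)[OF t] \<open>\<not> 0 \<le> \<phi> t\<close> by (simp add: m_def)
  define T where "T = {0..1} \<inter> \<phi> -` {m}"
  have "closed T" unfolding T_def by (rule continuous_closed_preimage[OF cont]) auto
  moreover have "a \<in> T" using a by (simp add: T_def m_def)
  moreover have bdd: "bdd_below T" by (auto simp: T_def)
  ultimately have "Inf T \<in> T" by (intro closed_contains_Inf) auto
  define s where "s = Inf T"
  have s: "s \<in> {0..1}" "\<phi> s = m" using \<open>Inf T \<in> T\<close> by (auto simp: s_def T_def)
  have "s \<noteq> 0" "s \<noteq> 1" using s(2) assms(2,3) \<open>m < 0\<close> by auto
  define d where "d = min s (1 - s)"
  have d: "d > 0" "s - d \<in> {0..1}" "s + d \<in> {0..1}" using s(1) \<open>s \<noteq> 0\<close> \<open>s \<noteq> 1\<close> by (auto simp: d_def)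
  have "s - d \<notin> T" using cInf_lower[OF _ bdd, of "s - d"] d(1) by (auto simp: s_def)
  then have "\<phi> (s - d) \<noteq> m" using d(2) by (simp add: T_def)
  then have "\<phi> (s - d) > m" using a(2)[OF d(2)] by (simp add: m_def)
  moreover have "\<phi> (s + d) \<ge> m" using a(2)[OF d(3)] by (simp add: m_def)
  moreover have "(\<phi> (s - d) + \<phi> (s + d)) / 2 \<le> \<phi> s" using mid[OF d(2,3)] by simp
  ultimately show False using s(2) by simp
qed

lemma midpoint_concave_imp_concave_on:
  fixes g :: "'a::real_normed_vector \<Rightarrow> real"
  assumes S: "convex S" and cont: "continuous_on S g"
    and mid: "\<And>x y. x \<in> S \<Longrightarrow> y \<in> S \<Longrightarrow> (g x + g y) / 2 \<le> g ((1 / 2) *\<^sub>R (x + y))"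
  shows "concave_on S g"
  unfolding concave_on_iff
proof (intro conjI ballI allI impI S)
  fix x y and u v :: real assume x: "x \<in> S" and y: "y \<in> S" and uv: "0 \<le> u" "0 \<le> v" "u + v = 1"
  define \<phi> where "\<phi> t = g ((1 - t) *\<^sub>R x + t *\<^sub>R y) - ((1 - t) * g x + t * g y)" for t
  have mem: "(1 - t) *\<^sub>R x + t *\<^sub>R y \<in> S" if "t \<in> {0..1}" for t
    using that S x y by (simp add: convexD_alt)
  have "0 \<le> \<phi> v"
  proof (rule midpoint_concave_segment[of \<phi> v])
    show "continuous_on {0..1} \<phi>" unfolding \<phi>_def
      by (intro continuous_intros continuous_on_compose2[OF cont]) (use mem in auto)
    show "(\<phi> s + \<phi> t) / 2 \<le> \<phi> ((s + t) / 2)" if "s \<in> {0..1}" "t \<in> {0..1}" for s t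
    proof -
      have "(1 / 2) *\<^sub>R (((1 - s) *\<^sub>R x + s *\<^sub>R y) + ((1 - t) *\<^sub>R x + t *\<^sub>R y)) =
          ((1 / 2) * ((1 - s) + (1 - t))) *\<^sub>R x + ((1 / 2) * (s + t)) *\<^sub>R y"
        by (simp only: scaleR_add_right scaleR_scaleR[symmetric] scaleR_add_left) (simp add: ac_simps)
      also have "(1 / 2) * ((1 - s) + (1 - t)) = 1 - (s + t) / 2" by (simp add: field_simps)
      finally show ?thesis
        using mid[OF mem[OF that(1)] mem[OF that(2)]] by (simp add: \<phi>_def field_simps)
    qed
  qed (use uv in \<open>auto simp: \<phi>_def\<close>)
  moreover have "u = 1 - v" using uv by simp
  ultimately show "u * g x + v * g y \<le> g (u *\<^sub>R x + v *\<^sub>R y)" by (simp add: \<phi>_def)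
qed

lemma concave_on_convex_hull_lower_bound:
  assumes "concave_on C g" "convex hull V \<subseteq> C" "\<And>v. v \<in> V \<Longrightarrow> c \<le> g v" "x \<in> convex hull V"
  shows "c \<le> g x"
proof -
  have "convex_on (convex hull V) (\<lambda>x. - g x)"
    using assms(1,2) unfolding concave_on_def by (rule convex_on_subset) simp
  then have "\<forall>x\<in>convex hull V. - g x \<le> - c"
    using assms(3) by (intro convex_on_convex_hull_bound) auto
  with assms(4) show ?thesis by auto
qed

text \<open>The symmetric second difference involves no derivative, and under summation the
  constants simply add, which is how the empirical function inherits it.\<close>

definition semiconcave_on :: "'a::real_inner set \<Rightarrow> real \<Rightarrow> ('a \<Rightarrow> real) \<Rightarrow> bool" where
  "semiconcave_on S k f \<longleftrightarrow> (\<forall>x h. x + h \<in> S \<longrightarrow> x - h \<in> S \<longrightarrow> f (x + h) + f (x - h) \<le> 2 * f x + k * (norm h)\<^sup>2)"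

lemma semiconcave_on_sum:
  assumes "\<And>i. i \<in> I \<Longrightarrow> semiconcave_on S (k i) (f i)"
  shows "semiconcave_on S (\<Sum>i\<in>I. k i) (\<lambda>x. \<Sum>i\<in>I. f i x)"
  unfolding semiconcave_on_def
proof (intro allI impI)
  fix x h assume "x + h \<in> S" "x - h \<in> S"
  then have "(\<Sum>i\<in>I. f i (x + h) + f i (x - h)) \<le> (\<Sum>i\<in>I. 2 * f i x + k i * (norm h)\<^sup>2)"
    using assms unfolding semiconcave_on_def by (intro sum_mono) blast
  then show "(\<Sum>i\<in>I. f i (x + h)) + (\<Sum>i\<in>I. f i (x - h)) \<le> 2 * (\<Sum>i\<in>I. f i x) + (\<Sum>i\<in>I. k i) * (norm h)\<^sup>2"
    by (simp add: sum.distrib sum_distrib_left sum_distrib_right)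
qed

text \<open>By the parallelogram identity, subtracting the quadratic cancels the term in
  \<open>norm h\<close> exactly. The centre \<open>a\<close> is left free, so that the correction
  can be made to vanish at a point of interest.\<close>

lemma semiconcave_on_imp_concave_on:
  fixes f :: "'a::real_inner \<Rightarrow> real"
  assumes sc: "semiconcave_on S k f" and "convex S" "continuous_on S f"
  shows "concave_on S (\<lambda>x. f x - k / 2 * (norm (x - a))\<^sup>2)"
proof (rule midpoint_concave_imp_concave_on[OF \<open>convex S\<close>])
  show "continuous_on S (\<lambda>x. f x - k / 2 * (norm (x - a))\<^sup>2)"
    by (intro continuous_intros assms)
  fix x y assume xy: "x \<in> S" "y \<in> S"
  define m h where "m = (1 / 2) *\<^sub>R (x + y)" and "h = (1 / 2) *\<^sub>R (x - y)"
  have "m + h = (1 / 2) *\<^sub>R ((x + y) + (x - y))" "m - h = (1 / 2) *\<^sub>R ((x + y) - (x - y))"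
    by (simp_all only: m_def h_def scaleR_add_right[symmetric] scaleR_diff_right[symmetric])
  moreover have "(x + y) + (x - y) = 2 *\<^sub>R x" "(x + y) - (x - y) = 2 *\<^sub>R y" by (simp_all add: scaleR_2)
  ultimately have mh: "m + h = x" "m - h = y" by simp_all
  have "f x + f y \<le> 2 * f m + k * (norm h)\<^sup>2"
    using sc[unfolded semiconcave_on_def, rule_format, of m h] xy by (simp add: mh)
  moreover have "(norm (x - a))\<^sup>2 + (norm (y - a))\<^sup>2 = 2 * (norm (m - a))\<^sup>2 + 2 * (norm h)\<^sup>2"
  proof -
    have "(norm ((m - a) + h))\<^sup>2 + (norm ((m - a) - h))\<^sup>2 = 2 * (norm (m - a))\<^sup>2 + 2 * (norm h)\<^sup>2"
      unfolding power2_norm_eq_inner by (simp add: inner_diff_left inner_diff_right inner_add_left inner_add_right)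
    moreover have "(m - a) + h = x - a" "(m - a) - h = y - a" using mh by auto
    ultimately show ?thesis by simp
  qed
  then have "k / 2 * ((norm (x - a))\<^sup>2 + (norm (y - a))\<^sup>2) = k / 2 * (2 * (norm (m - a))\<^sup>2 + 2 * (norm h)\<^sup>2)"
    by (rule arg_cong)
  then have "k / 2 * (norm (x - a))\<^sup>2 + k / 2 * (norm (y - a))\<^sup>2 = k * (norm (m - a))\<^sup>2 + k * (norm h)\<^sup>2"
    unfolding distrib_left by simp
  ultimately show "(f x - k / 2 * (norm (x - a))\<^sup>2 + (f y - k / 2 * (norm (y - a))\<^sup>2)) / 2
      \<le> f ((1 / 2) *\<^sub>R (x + y)) - k / 2 * (norm ((1 / 2) *\<^sub>R (x + y) - a))\<^sup>2"
    unfolding m_def[symmetric] by (simp add: field_simps)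
qed

text \<open>The device by which finitely many values control all points: the quadratic correction,
  centred at \<open>x\<close>, vanishes at \<open>x\<close> and is at most
  \<open>k / 2 * \<epsilon>^2\<close> at the vertices.\<close>

lemma semiconcave_on_lower_bound:
  fixes f :: "'a::real_inner \<Rightarrow> real"
  assumes sc: "semiconcave_on S k f" and "convex S" "continuous_on S f" and "k \<ge> 0" "\<epsilon> \<ge> 0"
    and V: "V \<subseteq> S" "x \<in> convex hull (V \<inter> cball x \<epsilon>)" and lb: "\<And>v. v \<in> V \<Longrightarrow> norm (v - x) \<le> \<epsilon> \<Longrightarrow> c \<le> f v"
  shows "c - k / 2 * \<epsilon>\<^sup>2 \<le> f x"
proof -
  have "convex hull (V \<inter> cball x \<epsilon>) \<subseteq> S" using V(1) \<open>convex S\<close> by (intro hull_minimal) auto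
  moreover have "c - k / 2 * \<epsilon>\<^sup>2 \<le> f v - k / 2 * (norm (v - x))\<^sup>2" if "v \<in> V \<inter> cball x \<epsilon>" for v
    using that lb[of v] \<open>k \<ge> 0\<close>
    by (intro diff_mono mult_left_mono power_mono) (auto simp: dist_norm norm_minus_commute)
  ultimately have "c - k / 2 * \<epsilon>\<^sup>2 \<le> f x - k / 2 * (norm (x - x))\<^sup>2"
    by (intro concave_on_convex_hull_lower_bound[OF semiconcave_on_imp_concave_on[OF assms(1-3)] _ _ V(2)]) auto
  then show ?thesis by simp
qed

text \<open>Finitely many small cubes cover \<open>S\<close>. Their corners form the net, and each
  point lies in the hull of the corners of its own cube.\<close>

lemma finite_convex_hull_net:
  fixes S :: "'a::euclidean_space set"
  assumes "compact S" "\<epsilon> > 0"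
  obtains V where "finite V" "\<And>x. x \<in> S \<Longrightarrow> x \<in> convex hull (V \<inter> cball x \<epsilon>)" "\<And>v. v \<in> V \<Longrightarrow> \<exists>x\<in>S. norm (v - x) \<le> \<epsilon>"
proof -
  \<comment> \<open>Half the side of the cubes; summed over the coordinates it gives
    \<open>\<epsilon> / 2\<close>, which bounds the distance from the centre.\<close>
  define d where "d = \<epsilon> / (2 * real DIM('a))"
  have d: "d > 0" using assms(2) by (simp add: d_def)
  let ?d = "\<Sum>i\<in>Basis. d *\<^sub>R (i::'a)"
  have di: "?d \<bullet> i = d" if "i \<in> Basis" for i
    using that by (simp add: inner_sum_left inner_Basis if_distrib cong: if_cong)
  have cb: "cbox (x - ?d) (x + ?d) \<subseteq> cball x (\<epsilon> / 2)" for x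
  proof
    fix y assume y: "y \<in> cbox (x - ?d) (x + ?d)"
    have "norm (y - x) \<le> (\<Sum>i\<in>Basis. \<bar>(y - x) \<bullet> i\<bar>)" by (rule norm_le_l1)
    also have "\<dots> \<le> (\<Sum>i\<in>(Basis::'a set). d)"
    proof (rule sum_mono)
      fix i :: 'a assume "i \<in> Basis"
      then show "\<bar>(y - x) \<bullet> i\<bar> \<le> d"
        using y di[of i] by (force simp: mem_box inner_diff_left inner_add_left abs_le_iff)
    qed
    also have "\<dots> = \<epsilon> / 2" by (simp add: d_def)
    finally show "y \<in> cball x (\<epsilon> / 2)" by (simp add: dist_norm norm_minus_commute)
  qed
  have "\<exists>s. finite s \<and> cbox (x - ?d) (x + ?d) = convex hull s" for x
    by (rule cube_convex_hull[OF d, of x]) (intro exI conjI)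
  then have "\<exists>s. \<forall>x. finite (s x) \<and> cbox (x - ?d) (x + ?d) = convex hull (s x)" by (intro choice allI)
  then obtain s where s0: "\<forall>x. finite (s x) \<and> cbox (x - ?d) (x + ?d) = convex hull (s x)" ..
  note s = s0[rule_format, THEN conjunct1] s0[rule_format, THEN conjunct2]
  have centre: "x \<in> box (x - ?d) (x + ?d)" for x
    using d di by (simp add: mem_box inner_diff_left inner_add_left)
  then have "S \<subseteq> (\<Union>x\<in>S. box (x - ?d) (x + ?d))" by blast
  then obtain T where T: "T \<subseteq> S" "finite T" "S \<subseteq> (\<Union>x\<in>T. box (x - ?d) (x + ?d))"
    using compactE_image[OF assms(1), of S "\<lambda>x. box (x - ?d) (x + ?d)"] open_box by blast
  have ss: "s x \<subseteq> cball x (\<epsilon> / 2)" for x using cb[of x] hull_subset[of "s x" convex] unfolding s(2) by blast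
  show thesis
  proof (rule that[of "\<Union>x\<in>T. s x"])
    show "finite (\<Union>x\<in>T. s x)" using T(2) s(1) by blast
    show "x \<in> convex hull ((\<Union>x\<in>T. s x) \<inter> cball x \<epsilon>)" if "x \<in> S" for x
    proof -
      obtain y where y: "y \<in> T" "x \<in> box (y - ?d) (y + ?d)" using T(3) \<open>x \<in> S\<close> by blast
      then have xc: "x \<in> cbox (y - ?d) (y + ?d)" using box_subset_cbox by blast
      then have "dist y x \<le> \<epsilon> / 2" using cb[of y] by auto
      then have "cball y (\<epsilon> / 2) \<subseteq> cball x \<epsilon>" by (simp add: cball_subset_cball_iff)
      then have "s y \<subseteq> cball x \<epsilon>" using ss[of y] by blast
      then have "s y \<subseteq> (\<Union>x\<in>T. s x) \<inter> cball x \<epsilon>" using y(1) by blast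
      then show ?thesis using xc hull_mono unfolding s(2) by blast
    qed
    show "\<exists>x\<in>S. norm (v - x) \<le> \<epsilon>" if v: "v \<in> (\<Union>x\<in>T. s x)" for v
    proof -
      obtain x where x: "x \<in> T" "v \<in> s x" using v by blast
      then have "norm (v - x) \<le> \<epsilon> / 2" using ss[of x] by (auto simp: dist_norm norm_minus_commute)
      then show ?thesis using x T(1) \<open>\<epsilon> > 0\<close> by (intro bexI[of _ x]) auto
    qed
  qed
qed

text \<open>One-sided, because a semiconcave function has this limit even at kinks, such as those of
  the squared distance at cut points.\<close>

definition dir_deriv :: "('a::real_normed_vector \<Rightarrow> real) \<Rightarrow> 'a \<Rightarrow> 'a \<Rightarrow> real" where
  "dir_deriv f a h = Lim (at_right 0) (\<lambda>t. (f (a + t *\<^sub>R h) - f a) / t)"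

lemma filterlim_mult_at_right_0:
  assumes "(c::real) > 0"
  shows "filterlim (\<lambda>t. c * t) (at_right 0) (at_right 0)"
proof -
  have "((\<lambda>t. c * t) \<longlongrightarrow> c * 0) (at_right 0)" by (intro tendsto_intros)
  moreover have "eventually (\<lambda>t. c * t \<in> {0<..}) (at_right (0::real))"
    unfolding eventually_at_right_field using assms by (intro exI[of _ 1]) auto
  ultimately show ?thesis by (simp add: filterlim_at eventually_conj_iff)
      (auto simp: eventually_at_right_field intro!: exI[of _ 1] assms)
qed

section \<open>One-sided directional derivatives of Lipschitz semiconcave functions\<close>

locale lipschitz_semiconcave =
  fixes f :: "'a::euclidean_space \<Rightarrow> real" and a :: 'a and r k L :: real
  assumes r: "r > 0" and semiconcave: "semiconcave_on (cball a r) k f"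
    and lipschitz: "\<And>x y. x \<in> cball a r \<Longrightarrow> y \<in> cball a r \<Longrightarrow> \<bar>f x - f y\<bar> \<le> L * norm (x - y)"
begin

lemma continuous: "continuous_on (cball a r) f"
proof (rule continuous_onI)
  fix x e assume x: "x \<in> cball a r" and "(e::real) > 0"
  show "\<exists>d>0. \<forall>x'\<in>cball a r. dist x' x < d \<longrightarrow> dist (f x') (f x) \<le> e"
  proof (intro exI[of _ "e / (\<bar>L\<bar> + 1)"] conjI ballI impI)
    fix x' assume x': "x' \<in> cball a r" and "dist x' x < e / (\<bar>L\<bar> + 1)"
    have "\<bar>f x' - f x\<bar> \<le> L * norm (x' - x)" by (rule lipschitz[OF x' x])
    also have "\<dots> \<le> (\<bar>L\<bar> + 1) * norm (x' - x)" by (intro mult_right_mono) auto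
    also have "\<dots> \<le> (\<bar>L\<bar> + 1) * (e / (\<bar>L\<bar> + 1))"
      using \<open>dist x' x < e / (\<bar>L\<bar> + 1)\<close> by (intro mult_left_mono) (auto simp: dist_norm)
    also have "\<dots> = e" by simp
    finally show "dist (f x') (f x) \<le> e" by (simp add: dist_real_def)
  qed (use \<open>e > 0\<close> in auto)
qed

lemma small_radius: obtains \<tau> where "\<tau> > 0" "\<And>t. 0 \<le> t \<Longrightarrow> t \<le> \<tau> \<Longrightarrow> a + t *\<^sub>R h \<in> cball a r"
proof (rule that[of "r / (norm h + 1)"])
  show "r / (norm h + 1) > 0" using r by (simp add: add_nonneg_pos)
  fix t assume t: "0 \<le> t" "t \<le> r / (norm h + 1)"
  then have "t * norm h \<le> r / (norm h + 1) * (norm h + 1)" by (intro mult_mono) auto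
  also have "\<dots> = r" using norm_ge_zero[of h] by (simp add: add_nonneg_eq_0_iff)
  finally show "a + t *\<^sub>R h \<in> cball a r" using t by (simp add: dist_norm)
qed

text \<open>After subtraction of the quadratic the function is concave, so its difference quotients
  increase as \<open>t\<close> decreases, and the Lipschitz bound keeps them bounded. The quadratic
  contributes nothing in the limit.\<close>

lemma dir_deriv_tendsto: "((\<lambda>t. (f (a + t *\<^sub>R h) - f a) / t) \<longlongrightarrow> dir_deriv f a h) (at_right 0)"
proof -
  obtain \<tau> where \<tau>: "\<tau> > 0" "\<And>t. 0 \<le> t \<Longrightarrow> t \<le> \<tau> \<Longrightarrow> a + t *\<^sub>R h \<in> cball a r" using small_radius by blast
  define g where "g x = f x - k / 2 * (norm (x - a))\<^sup>2" for x
  have conc: "concave_on (cball a r) g"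
    unfolding g_def by (rule semiconcave_on_imp_concave_on[OF semiconcave convex_cball continuous])
  define q where "q t = (g (a + t *\<^sub>R h) - g a) / t" for t
  have q: "(f (a + t *\<^sub>R h) - f a) / t = q t + k / 2 * (norm h)\<^sup>2 * t" if "t > 0" for t
    using that by (simp add: q_def g_def field_simps power2_eq_square)
  have mono: "q t \<le> q s" if st: "0 < s" "s \<le> t" "t \<le> \<tau>" for s t
  proof -
    have "(1 - s / t) * g a + (s / t) * g (a + t *\<^sub>R h) \<le> g ((1 - s / t) *\<^sub>R a + (s / t) *\<^sub>R (a + t *\<^sub>R h))"
      using st \<tau>(2)[of t] r
      by (intro conc[unfolded concave_on_iff, THEN conjunct2, rule_format]) auto
    also have "(1 - s / t) *\<^sub>R a + (s / t) *\<^sub>R (a + t *\<^sub>R h) = a + s *\<^sub>R h"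
      using st by (simp add: scaleR_diff_left scaleR_add_right)
    finally have "(s / t) * (g (a + t *\<^sub>R h) - g a) \<le> g (a + s *\<^sub>R h) - g a" by (simp add: algebra_simps)
    then show ?thesis using st by (simp add: q_def field_simps)
  qed
  have bound: "q t \<le> \<bar>L\<bar> * norm h + \<bar>k\<bar> * (norm h)\<^sup>2 * \<tau>" if t: "0 < t" "t \<le> \<tau>" for t
  proof -
    have "f (a + t *\<^sub>R h) - f a \<le> L * (t * norm h)"
      using lipschitz[OF \<tau>(2)[of t], of a] t r by simp
    also have "\<dots> \<le> \<bar>L\<bar> * (t * norm h)" using t by (intro mult_right_mono) auto
    finally have "(f (a + t *\<^sub>R h) - f a) / t \<le> \<bar>L\<bar> * norm h" using t by (simp add: field_simps)
    moreover have "- (k / 2 * (norm h)\<^sup>2 * t) \<le> \<bar>k\<bar> * (norm h)\<^sup>2 * \<tau>"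
    proof -
      have "- (k / 2 * (norm h)\<^sup>2 * t) \<le> \<bar>k / 2 * (norm h)\<^sup>2 * t\<bar>" by simp
      also have "\<dots> = \<bar>k\<bar> / 2 * (norm h)\<^sup>2 * t" using t by (simp add: abs_mult)
      also have "\<dots> \<le> \<bar>k\<bar> * (norm h)\<^sup>2 * \<tau>" using t by (intro mult_mono) auto
      finally show ?thesis .
    qed
    ultimately show ?thesis using q[OF t(1)] by linarith
  qed
  define D where "D = (SUP t\<in>{0<..\<tau>}. q t)"
  have bdd: "bdd_above (q ` {0<..\<tau>})"
    by (rule bdd_aboveI2[where M="\<bar>L\<bar> * norm h + \<bar>k\<bar> * (norm h)\<^sup>2 * \<tau>"]) (use bound in auto)
  have "(q \<longlongrightarrow> D) (at_right 0)"
  proof (rule tendstoI)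
    fix e :: real assume "e > 0"
    have "D - e < (SUP t\<in>{0<..\<tau>}. q t)" using \<open>e > 0\<close> by (simp add: D_def)
    then obtain t0 where t0: "t0 \<in> {0<..\<tau>}" "D - e < q t0"
      using \<tau>(1) bdd by (subst (asm) less_cSUP_iff) auto
    have "dist (q t) D < e" if "t > 0" "t < t0" for t
    proof -
      have "q t0 \<le> q t" using that t0 by (intro mono) auto
      moreover have "q t \<le> D" unfolding D_def using that t0 by (intro cSUP_upper bdd) auto
      ultimately show ?thesis using t0(2) by (simp add: dist_real_def)
    qed
    then show "\<forall>\<^sub>F t in at_right 0. dist (q t) D < e"
      unfolding eventually_at_right_field using t0(1) by (intro exI[of _ t0]) auto
  qed
  then have "((\<lambda>t. q t + k / 2 * (norm h)\<^sup>2 * t) \<longlongrightarrow> D + k / 2 * (norm h)\<^sup>2 * 0) (at_right 0)"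
    by (intro tendsto_intros)
  then have "((\<lambda>t. q t + k / 2 * (norm h)\<^sup>2 * t) \<longlongrightarrow> D) (at_right 0)" by simp
  moreover have "\<forall>\<^sub>F t in at_right 0. q t + k / 2 * (norm h)\<^sup>2 * t = (f (a + t *\<^sub>R h) - f a) / t"
    unfolding eventually_at_right_field using q by (intro exI[of _ 1]) auto
  ultimately have "((\<lambda>t. (f (a + t *\<^sub>R h) - f a) / t) \<longlongrightarrow> D) (at_right 0)"
    by (rule Lim_transform_eventually)
  moreover from tendsto_Lim[OF _ this] have "dir_deriv f a h = D" by (simp add: dir_deriv_def)
  ultimately show ?thesis by simp
qed

lemma dir_deriv_eqI:
  "((\<lambda>t. (f (a + t *\<^sub>R h) - f a) / t) \<longlongrightarrow> D) (at_right 0) \<Longrightarrow> dir_deriv f a h = D"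
  unfolding dir_deriv_def by (rule tendsto_Lim) simp_all

lemma dir_deriv_zero [simp]: "dir_deriv f a 0 = 0"
  by (rule dir_deriv_eqI) simp

lemma dir_deriv_scale:
  assumes "c \<ge> 0"
  shows "dir_deriv f a (c *\<^sub>R h) = c * dir_deriv f a h"
proof (cases "c = 0")
  case False
  with assms have "c > 0" by simp
  have "((\<lambda>t. c * ((f (a + (c * t) *\<^sub>R h) - f a) / (c * t))) \<longlongrightarrow> c * dir_deriv f a h) (at_right 0)"
    by (intro tendsto_mult tendsto_const filterlim_compose[OF dir_deriv_tendsto filterlim_mult_at_right_0[OF \<open>c > 0\<close>]])
  then show ?thesis using False by (intro dir_deriv_eqI) (simp add: mult.commute[of c])
qed simp

lemma dir_deriv_le: "\<bar>dir_deriv f a h\<bar> \<le> L * norm h"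
proof -
  obtain \<tau> where \<tau>: "\<tau> > 0" "\<And>t. 0 \<le> t \<Longrightarrow> t \<le> \<tau> \<Longrightarrow> a + t *\<^sub>R h \<in> cball a r" using small_radius by blast
  have "((\<lambda>t. \<bar>(f (a + t *\<^sub>R h) - f a) / t\<bar>) \<longlongrightarrow> \<bar>dir_deriv f a h\<bar>) (at_right 0)"
    by (intro tendsto_rabs dir_deriv_tendsto)
  moreover have "\<forall>\<^sub>F t in at_right 0. \<bar>(f (a + t *\<^sub>R h) - f a) / t\<bar> \<le> L * norm h"
    unfolding eventually_at_right_field
  proof (intro exI[of _ \<tau>] conjI allI impI \<tau>(1))
    fix t assume t: "0 < t" "t < \<tau>"
    have "\<bar>f (a + t *\<^sub>R h) - f a\<bar> \<le> L * norm ((a + t *\<^sub>R h) - a)" using \<tau>(2)[of t] t r by (intro lipschitz) auto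
    then show "\<bar>(f (a + t *\<^sub>R h) - f a) / t\<bar> \<le> L * norm h" using t by (simp add: abs_divide field_simps)
  qed
  ultimately show ?thesis by (rule tendsto_upperbound) simp
qed

text \<open>Semiconcavity at the midpoint of \<open>a + 2 t h\<close> and \<open>a + 2 t h'\<close>:
  the error is of order \<open>t^2\<close> and disappears after division by
  \<open>t\<close>.\<close>

lemma dir_deriv_superadditive: "dir_deriv f a h + dir_deriv f a h' \<le> dir_deriv f a (h + h')"
proof -
  let ?q = "\<lambda>h t. (f (a + t *\<^sub>R h) - f a) / t"
  obtain \<tau> where \<tau>: "\<tau> > 0" "\<And>t. 0 \<le> t \<Longrightarrow> t \<le> \<tau> \<Longrightarrow> a + t *\<^sub>R h \<in> cball a r" using small_radius by blast
  obtain \<tau>' where \<tau>': "\<tau>' > 0" "\<And>t. 0 \<le> t \<Longrightarrow> t \<le> \<tau>' \<Longrightarrow> a + t *\<^sub>R h' \<in> cball a r" using small_radius by blast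
  have "((\<lambda>t. ?q h (2 * t) + ?q h' (2 * t)) \<longlongrightarrow> dir_deriv f a h + dir_deriv f a h') (at_right 0)"
    by (intro tendsto_add filterlim_compose[OF dir_deriv_tendsto filterlim_mult_at_right_0]) auto
  moreover have "((\<lambda>t. ?q (h + h') t + k / 2 * (norm (h - h'))\<^sup>2 * t) \<longlongrightarrow> dir_deriv f a (h + h') + k / 2 * (norm (h - h'))\<^sup>2 * 0) (at_right 0)"
    by (intro tendsto_intros dir_deriv_tendsto)
  moreover have "\<forall>\<^sub>F t in at_right 0. ?q h (2 * t) + ?q h' (2 * t) \<le> ?q (h + h') t + k / 2 * (norm (h - h'))\<^sup>2 * t"
    unfolding eventually_at_right_field
  proof (intro exI[of _ "min \<tau> \<tau>' / 2"] conjI allI impI)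
    fix t assume t: "0 < t" "t < min \<tau> \<tau>' / 2"
    let ?x = "a + t *\<^sub>R (h + h')" and ?y = "t *\<^sub>R (h - h')"
    have "?x + ?y = a + (t *\<^sub>R (h + h') + t *\<^sub>R (h - h'))" "?x - ?y = a + (t *\<^sub>R (h + h') - t *\<^sub>R (h - h'))"
      by (simp_all add: add.assoc)
    moreover have "t *\<^sub>R (h + h') + t *\<^sub>R (h - h') = (2 * t) *\<^sub>R h" "t *\<^sub>R (h + h') - t *\<^sub>R (h - h') = (2 * t) *\<^sub>R h'"
      by (simp_all add: scaleR_2 scaleR_add_right[symmetric] scaleR_diff_right[symmetric] mult.commute[of 2] scaleR_scaleR[symmetric] del: scaleR_scaleR)
    ultimately have xy: "?x + ?y = a + (2 * t) *\<^sub>R h" "?x - ?y = a + (2 * t) *\<^sub>R h'" by simp_all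
    have "f (?x + ?y) + f (?x - ?y) \<le> 2 * f ?x + k * (norm ?y)\<^sup>2"
      using semiconcave[unfolded semiconcave_on_def, rule_format, of ?x ?y] \<tau>(2)[of "2 * t"] \<tau>'(2)[of "2 * t"] t
      unfolding xy by auto
    then have "f (a + (2 * t) *\<^sub>R h) + f (a + (2 * t) *\<^sub>R h') \<le> 2 * f ?x + k * t\<^sup>2 * (norm (h - h'))\<^sup>2"
      unfolding xy by (simp add: power_mult_distrib mult.assoc)
    then have "(f (a + (2 * t) *\<^sub>R h) - f a) + (f (a + (2 * t) *\<^sub>R h') - f a) \<le> 2 * (f ?x - f a) + k * t\<^sup>2 * (norm (h - h'))\<^sup>2"
      by simp
    then have "((f (a + (2 * t) *\<^sub>R h) - f a) + (f (a + (2 * t) *\<^sub>R h') - f a)) / (2 * t) \<le>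
        (2 * (f ?x - f a) + k * t\<^sup>2 * (norm (h - h'))\<^sup>2) / (2 * t)"
      using t by (intro divide_right_mono) auto
    also have "\<dots> = ?q (h + h') t + k / 2 * (norm (h - h'))\<^sup>2 * t"
      using t by (simp add: field_simps power2_eq_square)
    finally show "?q h (2 * t) + ?q h' (2 * t) \<le> ?q (h + h') t + k / 2 * (norm (h - h'))\<^sup>2 * t"
      by (simp only: add_divide_distrib)
  qed (use \<tau>(1) \<tau>'(1) in auto)
  ultimately have "dir_deriv f a h + dir_deriv f a h' \<le> dir_deriv f a (h + h') + k / 2 * (norm (h - h'))\<^sup>2 * 0"
    by (intro tendsto_le[of "at_right 0"]) auto
  then show ?thesis by simp
qed

lemma dir_deriv_sum_le: "finite B \<Longrightarrow> (\<Sum>b\<in>B. dir_deriv f a (g b)) \<le> dir_deriv f a (\<Sum>b\<in>B. g b)"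
proof (induction B rule: finite_induct)
  case (insert b B)
  then show ?case using dir_deriv_superadditive[of "g b" "\<Sum>b\<in>B. g b"] by simp
qed simp

lemma dir_deriv_neg_le: "dir_deriv f a h + dir_deriv f a (- h) \<le> 0"
  using dir_deriv_superadditive[of h "- h"] by simp

text \<open>Superadditivity and positive homogeneity, with oddness on the basis, bound the
  derivative below by a linear form at \<open>h\<close> and at \<open>- h\<close>;
  \<open>dir_deriv_neg_le\<close> then forces equality.\<close>

lemma dir_deriv_linear:
  assumes "\<And>b. b \<in> Basis \<Longrightarrow> dir_deriv f a b + dir_deriv f a (- b) = 0"
  shows "dir_deriv f a h = (\<Sum>b\<in>Basis. (h \<bullet> b) * dir_deriv f a b)"
proof -
  have b: "dir_deriv f a (c *\<^sub>R b) = c * dir_deriv f a b" if "b \<in> Basis" for b c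
  proof (cases "c \<ge> 0")
    case False
    then have "dir_deriv f a ((- c) *\<^sub>R (- b)) = (- c) * dir_deriv f a (- b)" by (intro dir_deriv_scale) simp
    moreover have "dir_deriv f a (- b) = - dir_deriv f a b" using assms[OF that] by simp
    ultimately show ?thesis by simp
  qed (rule dir_deriv_scale)
  have ge: "(\<Sum>b\<in>Basis. (h \<bullet> b) * dir_deriv f a b) \<le> dir_deriv f a h" for h
    using dir_deriv_sum_le[of Basis "\<lambda>b. (h \<bullet> b) *\<^sub>R b"] b by (simp add: euclidean_representation)
  from ge[of "- h"] have "- (\<Sum>b\<in>Basis. (h \<bullet> b) * dir_deriv f a b) \<le> dir_deriv f a (- h)"
    by (simp add: sum_negf)
  with ge[of h] dir_deriv_neg_le[of h] show ?thesis by linarith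
qed

lemma has_field_derivative_iff_dir_deriv:
  "((\<lambda>t. f (a + t *\<^sub>R h)) has_field_derivative D) (at 0) \<longleftrightarrow> dir_deriv f a h = D \<and> dir_deriv f a (- h) = - D"
proof -
  have "((\<lambda>t. f (a + t *\<^sub>R h)) has_field_derivative D) (at 0) \<longleftrightarrow>
      ((\<lambda>t. (f (a + t *\<^sub>R h) - f a) / t) \<longlongrightarrow> D) (at 0)"
    by (simp add: DERIV_def)
  also have "\<dots> \<longleftrightarrow> ((\<lambda>t. (f (a + t *\<^sub>R h) - f a) / t) \<longlongrightarrow> D) (at_right 0) \<and>
      ((\<lambda>t. (f (a + t *\<^sub>R h) - f a) / t) \<longlongrightarrow> D) (at_left 0)"
    by (auto simp: filterlim_at_split)
  also have "((\<lambda>t. (f (a + t *\<^sub>R h) - f a) / t) \<longlongrightarrow> D) (at_left 0) \<longleftrightarrow>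
      ((\<lambda>t. - ((f (a + t *\<^sub>R (- h)) - f a) / t)) \<longlongrightarrow> D) (at_right 0)"
    by (subst at_left_minus) (simp add: filterlim_filtermap)
  also have "\<dots> \<longleftrightarrow> ((\<lambda>t. (f (a + t *\<^sub>R (- h)) - f a) / t) \<longlongrightarrow> - D) (at_right 0)"
    by (subst tendsto_minus_cancel_left[symmetric]) simp
  also have "\<dots> \<longleftrightarrow> dir_deriv f a (- h) = - D"
    using dir_deriv_tendsto[of "- h"] dir_deriv_eqI[of "- h" "- D"] by auto
  also have "((\<lambda>t. (f (a + t *\<^sub>R h) - f a) / t) \<longlongrightarrow> D) (at_right 0) \<longleftrightarrow> dir_deriv f a h = D"
    using dir_deriv_tendsto[of h] dir_deriv_eqI[of h D] by auto
  finally show ?thesis .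
qed

text \<open>\<open>deriv\<close> is a choice term. Where no derivative exists its predicate is false
  throughout, so the value is one fixed number, the same for all functions. This makes the gradient
  measurable in the sample point even where it has no meaning.\<close>

lemma deriv_along_eq:
  "deriv (\<lambda>t. f (a + t *\<^sub>R h)) 0 =
    (if dir_deriv f a h + dir_deriv f a (- h) = 0 then dir_deriv f a h else (SOME D. False))"
proof (cases "dir_deriv f a h + dir_deriv f a (- h) = 0")
  case True
  then have "((\<lambda>t. f (a + t *\<^sub>R h)) has_field_derivative dir_deriv f a h) (at 0)"
    by (subst has_field_derivative_iff_dir_deriv) auto
  then show ?thesis using True by (simp add: DERIV_imp_deriv)
next
  case False
  then have "\<not> ((\<lambda>t. f (a + t *\<^sub>R h)) has_field_derivative D) (at 0)" for D
    by (subst has_field_derivative_iff_dir_deriv) auto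
  then show ?thesis using False by (simp add: deriv_def)
qed

text \<open>Sequences are the form required for measurability of limits and for dominated
  convergence.\<close>

lemma dir_deriv_LIMSEQ:
  assumes s: "s \<longlonglongrightarrow> 0" "\<And>n. s n > (0::real)"
  shows "(\<lambda>n. (f (a + s n *\<^sub>R h) - f a) / s n) \<longlonglongrightarrow> dir_deriv f a h"
proof (rule filterlim_compose[OF dir_deriv_tendsto])
  show "filterlim s (at_right 0) sequentially"
    using s(1) unfolding filterlim_at by (auto simp: s(2) less_imp_neq[OF s(2), symmetric] intro!: always_eventually)
qed

end

section \<open>Linearization of the empirical Frechet function\<close>

locale frechet_chart = frechet_sample M X Q \<rho> p
  for M :: "'w measure" and X :: "nat \<Rightarrow> 'w \<Rightarrow> 'a::topological_space" and Q \<rho> p +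
  fixes \<xi> :: "real ^ 'd::finite \<Rightarrow> 'a" and \<mu> :: "real ^ 'd" and r K :: real
  assumes \<xi>_\<mu>: "\<xi> \<mu> = p" and r_pos: "r > 0" and K_pos: "K > 0"
    and dist_sq_semiconcave: "\<And>x. semiconcave_on (cball \<mu> r) (K * (1 + \<rho> x p)) (\<lambda>\<theta>. (\<rho> x (\<xi> \<theta>))\<^sup>2)"
    and dist_lipschitz: "\<And>x u v. u \<in> cball \<mu> r \<Longrightarrow> v \<in> cball \<mu> r \<Longrightarrow>
      \<bar>\<rho> x (\<xi> u) - \<rho> x (\<xi> v)\<bar> \<le> K * norm (u - v)"
begin

definition f :: "'a \<Rightarrow> real ^ 'd \<Rightarrow> real" where "f x \<theta> = (\<rho> x (\<xi> \<theta>))\<^sup>2"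

text \<open>The increment of a square is the increment of the distance times a sum of two distances,
  each of which is at most \<open>\<rho> x p + K * r\<close> on the ball.\<close>

definition lip :: "'a \<Rightarrow> real" where "lip x = K * (2 * \<rho> x p + 2 * K * r)"

definition F :: "real ^ 'd \<Rightarrow> real" where "F \<theta> = (LINT x|Q. f x \<theta>)"

text \<open>Formed with \<open>deriv\<close> so that it agrees with \<open>Psi\<close> everywhere,
  also at points without a derivative.\<close>

definition \<psi> :: "'a \<Rightarrow> real ^ 'd" where "\<psi> x = (\<chi> i. deriv (\<lambda>t. f x (\<mu> + t *\<^sub>R axis i 1)) 0)"

lemma f_measurable [measurable]: "(\<lambda>x. f x \<theta>) \<in> borel_measurable borel"
  unfolding f_def by measurable

lemma lip_measurable [measurable]: "lip \<in> borel_measurable borel"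
  unfolding lip_def[abs_def] by measurable

lemma lip_pos: "lip x > 0"
  using K_pos r_pos \<rho>_nonneg[of x p] by (auto simp: lip_def intro!: mult_pos_pos add_nonneg_pos)

lemma \<mu>_in: "\<mu> \<in> cball \<mu> r"
  using r_pos by simp

lemma dist_le: "\<theta> \<in> cball \<mu> r \<Longrightarrow> \<rho> x (\<xi> \<theta>) \<le> \<rho> x p + K * r"
proof -
  assume \<theta>: "\<theta> \<in> cball \<mu> r"
  have "\<bar>\<rho> x (\<xi> \<theta>) - \<rho> x (\<xi> \<mu>)\<bar> \<le> K * norm (\<theta> - \<mu>)" by (rule dist_lipschitz[OF \<theta> \<mu>_in])
  also have "\<dots> \<le> K * r" using \<theta> K_pos by (simp add: dist_norm norm_minus_commute)
  finally show ?thesis by (simp add: \<xi>_\<mu>)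
qed

lemma f_lipschitz:
  assumes "u \<in> cball \<mu> r" "v \<in> cball \<mu> r"
  shows "\<bar>f x u - f x v\<bar> \<le> lip x * norm (u - v)"
proof -
  have "f x u - f x v = (\<rho> x (\<xi> u) - \<rho> x (\<xi> v)) * (\<rho> x (\<xi> u) + \<rho> x (\<xi> v))"
    by (simp add: f_def power2_eq_square algebra_simps)
  then have "\<bar>f x u - f x v\<bar> = \<bar>\<rho> x (\<xi> u) - \<rho> x (\<xi> v)\<bar> * (\<rho> x (\<xi> u) + \<rho> x (\<xi> v))"
    using \<rho>_nonneg by (simp add: abs_mult)
  also have "\<dots> \<le> (K * norm (u - v)) * (2 * \<rho> x p + 2 * K * r)"
    using dist_lipschitz[OF assms] dist_le[OF assms(1), of x] dist_le[OF assms(2), of x] \<rho>_nonneg K_pos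
    by (intro mult_mono) auto
  finally show ?thesis by (simp add: lip_def mult_ac)
qed

sublocale S: lipschitz_semiconcave "f x" \<mu> r "K * (1 + \<rho> x p)" "lip x" for x
proof
  show "semiconcave_on (cball \<mu> r) (K * (1 + \<rho> x p)) (f x)"
    using dist_sq_semiconcave[of x] by (simp add: f_def[abs_def])
qed (use r_pos f_lipschitz in auto)

lemma lip_square_integrable: "integrable Q (\<lambda>x. (lip x)\<^sup>2)"
proof (rule square_integrable_if_bounded)
  show "\<bar>lip x\<bar> \<le> 2 * K\<^sup>2 * r + 2 * K * \<rho> x p" for x
    using lip_pos[of x] by (simp add: lip_def power2_eq_square algebra_simps)
qed (use K_pos r_pos in auto)

lemma lip_integrable: "integrable Q lip"
  by (rule integrable_if_square_integrable[OF lip_measurable lip_square_integrable])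

lemma f_integrable: "integrable Q (\<lambda>x. f x \<theta>)"
  unfolding f_def by (rule \<rho>_sq_integrable)

text \<open>Global in \<open>\<theta>\<close>: wherever \<open>\<theta>\<close> lies,
  \<open>\<xi> \<theta>\<close> is some point of the space, and \<open>p\<close> is minimal among
  all points.\<close>

lemma F_minimum: "F \<mu> \<le> F \<theta>"
  using unique_minimum[of "\<xi> \<theta>"] by (cases "\<xi> \<theta> = p") (auto simp: F_def f_def \<xi>_\<mu>)

lemma dir_deriv_measurable [measurable]: "(\<lambda>x. dir_deriv (f x) \<mu> h) \<in> borel_measurable borel"
proof (rule borel_measurable_LIMSEQ_real)
  have lim: "(\<lambda>n. 1 / real (Suc n)) \<longlonglongrightarrow> 0" using LIMSEQ_Suc[OF lim_1_over_n] by simp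
  show "(\<lambda>n. (f x (\<mu> + (1 / real (Suc n)) *\<^sub>R h) - f x \<mu>) / (1 / real (Suc n))) \<longlonglongrightarrow> dir_deriv (f x) \<mu> h" for x
    by (rule S.dir_deriv_LIMSEQ[OF lim]) simp
qed measurable

lemma dir_deriv_square_integrable: "integrable Q (\<lambda>x. (dir_deriv (f x) \<mu> h)\<^sup>2)"
proof (rule square_integrable_if_bounded[OF dir_deriv_measurable])
  show "\<bar>dir_deriv (f x) \<mu> h\<bar> \<le> 2 * K\<^sup>2 * r * norm h + (2 * K * norm h) * \<rho> x p" for x
    using S.dir_deriv_le[of x h] by (simp add: lip_def power2_eq_square algebra_simps)
qed (use K_pos r_pos in auto)

lemma dir_deriv_integrable: "integrable Q (\<lambda>x. dir_deriv (f x) \<mu> h)"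
  by (rule integrable_if_square_integrable[OF dir_deriv_measurable dir_deriv_square_integrable])

text \<open>The difference quotients of \<open>F\<close> at its minimum are nonnegative, and the
  Lipschitz constants dominate, so that the limit passes under the integral.\<close>

lemma integral_dir_deriv_nonneg: "(LINT x|Q. dir_deriv (f x) \<mu> h) \<ge> 0"
proof -
  obtain \<tau> where \<tau>: "\<tau> > 0" "\<And>t. 0 \<le> t \<Longrightarrow> t \<le> \<tau> \<Longrightarrow> \<mu> + t *\<^sub>R h \<in> cball \<mu> r" using S.small_radius by blast
  define s where "s n = \<tau> / real (Suc n)" for n
  have s: "s n > 0" "s n \<le> \<tau>" for n using \<tau>(1) by (auto simp: s_def field_simps)
  have "(\<lambda>n. \<tau> * (1 / real (Suc n))) \<longlonglongrightarrow> \<tau> * 0"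
    using LIMSEQ_Suc[OF lim_1_over_n] by (intro tendsto_mult tendsto_const) simp
  then have s0: "s \<longlonglongrightarrow> 0" by (simp add: s_def[abs_def])
  have "(\<lambda>n. LINT x|Q. (f x (\<mu> + s n *\<^sub>R h) - f x \<mu>) / s n) \<longlonglongrightarrow> (LINT x|Q. dir_deriv (f x) \<mu> h)"
  proof (rule integral_dominated_convergence[where w="\<lambda>x. lip x * norm h"])
    show "integrable Q (\<lambda>x. lip x * norm h)" using lip_integrable by simp
    show "AE x in Q. (\<lambda>n. (f x (\<mu> + s n *\<^sub>R h) - f x \<mu>) / s n) \<longlonglongrightarrow> dir_deriv (f x) \<mu> h"
      using S.dir_deriv_LIMSEQ[OF s0 s(1)] by simp
    show "AE x in Q. norm ((f x (\<mu> + s n *\<^sub>R h) - f x \<mu>) / s n) \<le> lip x * norm h" for n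
    proof (rule AE_I2)
      fix x
      have "\<bar>f x (\<mu> + s n *\<^sub>R h) - f x \<mu>\<bar> \<le> lip x * norm (\<mu> + s n *\<^sub>R h - \<mu>)"
        using \<tau>(2)[of "s n"] s[of n] by (intro f_lipschitz \<mu>_in) auto
      then show "norm ((f x (\<mu> + s n *\<^sub>R h) - f x \<mu>) / s n) \<le> lip x * norm h"
        using s(1)[of n] by (simp add: abs_divide field_simps)
    qed
  qed measurable
  moreover have "(LINT x|Q. (f x (\<mu> + s n *\<^sub>R h) - f x \<mu>) / s n) \<ge> 0" for n
  proof -
    have "(LINT x|Q. (f x (\<mu> + s n *\<^sub>R h) - f x \<mu>) / s n) = (F (\<mu> + s n *\<^sub>R h) - F \<mu>) / s n"
      using f_integrable by (simp add: F_def)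
    then show ?thesis using F_minimum s(1)[of n] by simp
  qed
  ultimately show ?thesis by (intro LIMSEQ_le_const[of _ _ 0]) blast+
qed

text \<open>One-sided directional derivatives exist by semiconcavity and satisfy \<open>D h + D (- h) \<le> 0\<close>;
  since their means are nonnegative at a minimum, equality holds almost everywhere.\<close>

lemma AE_dir_deriv_sum: "AE x in Q. dir_deriv (f x) \<mu> h + dir_deriv (f x) \<mu> (- h) = 0"
  and integral_dir_deriv: "(LINT x|Q. dir_deriv (f x) \<mu> h) = 0"
proof -
  let ?g = "\<lambda>x. - (dir_deriv (f x) \<mu> h + dir_deriv (f x) \<mu> (- h))"
  have g: "?g x \<ge> 0" for x using S.dir_deriv_neg_le[of x h] by simp
  have gi: "integrable Q ?g" using dir_deriv_integrable by (intro Bochner_Integration.integrable_minus Bochner_Integration.integrable_add)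
  have eq: "integral\<^sup>L Q ?g = - ((LINT x|Q. dir_deriv (f x) \<mu> h) + (LINT x|Q. dir_deriv (f x) \<mu> (- h)))"
    using dir_deriv_integrable by simp
  have "integral\<^sup>L Q ?g \<ge> 0" using g by (intro integral_nonneg_AE) auto
  then have 0: "(LINT x|Q. dir_deriv (f x) \<mu> h) = 0" "(LINT x|Q. dir_deriv (f x) \<mu> (- h)) = 0"
    using integral_dir_deriv_nonneg[of h] integral_dir_deriv_nonneg[of "- h"] unfolding eq by linarith+
  then have "integral\<^sup>L Q ?g = 0" unfolding eq by simp
  then have "AE x in Q. ?g x = 0"
    using integral_nonneg_eq_0_iff_AE[OF gi] g by auto
  then show "AE x in Q. dir_deriv (f x) \<mu> h + dir_deriv (f x) \<mu> (- h) = 0" by auto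
  show "(LINT x|Q. dir_deriv (f x) \<mu> h) = 0" by (rule 0)
qed

lemma \<psi>_nth: "\<psi> x $ i = (if dir_deriv (f x) \<mu> (axis i 1) + dir_deriv (f x) \<mu> (- axis i 1) = 0
    then dir_deriv (f x) \<mu> (axis i 1) else (SOME D. False))"
  unfolding \<psi>_def by (simp add: S.deriv_along_eq)

lemma \<psi>_measurable [measurable]: "\<psi> \<in> borel_measurable borel"
proof -
  have c: "(\<lambda>x. \<psi> x $ i) \<in> borel_measurable borel" for i
    unfolding \<psi>_nth by (intro measurable_If measurable_const dir_deriv_measurable) measurable
  have "(\<lambda>x. \<psi> x \<bullet> b) \<in> borel_measurable borel" if b: "b \<in> Basis" for b
  proof -
    obtain i where "b = axis i 1" using b by (auto simp: Basis_vec_def)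
    then show ?thesis using c[of i] by (simp add: inner_axis)
  qed
  then show ?thesis by (subst borel_measurable_euclidean_space) blast
qed

text \<open>The finitely many coordinate directions have a common null set; off it the one-sided
  derivative is linear, so this one null set serves all \<open>h\<close>.\<close>

lemma AE_\<psi>: "AE x in Q. \<forall>h. h \<bullet> \<psi> x = dir_deriv (f x) \<mu> h"
proof -
  have "AE x in Q. \<forall>i::'d. dir_deriv (f x) \<mu> (axis i 1) + dir_deriv (f x) \<mu> (- axis i 1) = 0"
    by (subst AE_all_countable) (auto intro: AE_dir_deriv_sum)
  then show ?thesis
  proof eventually_elim
    case (elim x)
    have B: "dir_deriv (f x) \<mu> b + dir_deriv (f x) \<mu> (- b) = 0" if "b \<in> Basis" for b
      using elim that by (auto simp: Basis_vec_def)
    show ?case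
    proof
      fix h
      have "h \<bullet> \<psi> x = (\<Sum>b\<in>Basis. (h \<bullet> b) * (\<psi> x \<bullet> b))" by (rule euclidean_inner)
      also have "\<dots> = (\<Sum>b\<in>Basis. (h \<bullet> b) * dir_deriv (f x) \<mu> b)"
        using elim by (intro sum.cong refl) (auto simp: Basis_vec_def inner_axis \<psi>_nth)
      also have "\<dots> = dir_deriv (f x) \<mu> h" by (rule S.dir_deriv_linear[OF B, symmetric])
      finally show "h \<bullet> \<psi> x = dir_deriv (f x) \<mu> h" .
    qed
  qed
qed

lemma \<psi>_square_integrable: "integrable Q (\<lambda>x. (h \<bullet> \<psi> x)\<^sup>2)"
proof (rule integrable_cong_AE_imp[OF dir_deriv_square_integrable])
  show "AE x in Q. (dir_deriv (f x) \<mu> h)\<^sup>2 = (h \<bullet> \<psi> x)\<^sup>2"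
    using AE_\<psi> by eventually_elim simp
qed measurable

lemma \<psi>_mean: "(LINT x|Q. h \<bullet> \<psi> x) = 0"
proof -
  have "(LINT x|Q. h \<bullet> \<psi> x) = (LINT x|Q. dir_deriv (f x) \<mu> h)"
    using AE_\<psi> by (intro integral_cong_AE) (auto elim: eventually_mono)
  then show ?thesis by (simp add: integral_dir_deriv)
qed

text \<open>Its sum over the sample is \<open>sqrt n\<close> times the error
  \<open>Gn n h - h \<bullet> Sn n\<close>. By Chebyshev's inequality the fluctuation of that error
  vanishes as soon as the second moment of \<open>Rem\<close> does.\<close>

definition Rem :: "real ^ 'd \<Rightarrow> nat \<Rightarrow> 'a \<Rightarrow> real" where
  "Rem h n x = sqrt (real n) * (f x (\<mu> + (1 / sqrt (real n)) *\<^sub>R h) - f x \<mu>) - h \<bullet> \<psi> x"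

lemma Rem_measurable [measurable]: "Rem h n \<in> borel_measurable borel"
  unfolding Rem_def by measurable

lemma eventually_in_chart: "\<exists>n0\<ge>1. \<forall>n\<ge>n0. \<mu> + (1 / sqrt (real n)) *\<^sub>R h \<in> cball \<mu> r"
proof -
  obtain n0 :: nat where n0: "real n0 > (norm h / r)\<^sup>2" using reals_Archimedean2 by blast
  have "\<mu> + (1 / sqrt (real n)) *\<^sub>R h \<in> cball \<mu> r" if n: "n \<ge> max 1 n0" for n
  proof -
    have "(norm h / r)\<^sup>2 \<le> real n" using n n0 by simp
    then have "norm h / r \<le> sqrt (real n)" by (rule real_le_rsqrt)
    then show ?thesis using n r_pos by (simp add: dist_norm field_simps)
  qed
  then show ?thesis by (intro exI[of _ "max 1 n0"]) auto
qed

lemma Rem_square_integrable: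
  assumes n: "n \<ge> 1" "\<mu> + (1 / sqrt (real n)) *\<^sub>R h \<in> cball \<mu> r"
  shows "AE x in Q. (Rem h n x)\<^sup>2 \<le> (2 * norm h)\<^sup>2 * (lip x)\<^sup>2" "integrable Q (\<lambda>x. (Rem h n x)\<^sup>2)"
proof -
  show *: "AE x in Q. (Rem h n x)\<^sup>2 \<le> (2 * norm h)\<^sup>2 * (lip x)\<^sup>2"
    using AE_\<psi>
  proof eventually_elim
    case (elim x)
    have "\<bar>f x (\<mu> + (1 / sqrt (real n)) *\<^sub>R h) - f x \<mu>\<bar> \<le> lip x * norm (\<mu> + (1 / sqrt (real n)) *\<^sub>R h - \<mu>)"
      by (rule f_lipschitz[OF n(2) \<mu>_in])
    then have "\<bar>sqrt (real n) * (f x (\<mu> + (1 / sqrt (real n)) *\<^sub>R h) - f x \<mu>)\<bar> \<le> lip x * norm h"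
      using n(1) unfolding abs_mult by (simp add: field_simps)
    moreover have "\<bar>h \<bullet> \<psi> x\<bar> \<le> lip x * norm h" using elim S.dir_deriv_le[of x h] by simp
    ultimately have "\<bar>Rem h n x\<bar> \<le> 2 * norm h * lip x" unfolding Rem_def by (simp add: mult.commute)
    then have "\<bar>Rem h n x\<bar>\<^sup>2 \<le> (2 * norm h * lip x)\<^sup>2" by (rule power_mono) simp
    then show ?case by (simp add: power_mult_distrib)
  qed
  show "integrable Q (\<lambda>x. (Rem h n x)\<^sup>2)"
    by (rule Bochner_Integration.integrable_bound[OF integrable_mult_right[OF lip_square_integrable, of "(2 * norm h)\<^sup>2"]])
      (use * in auto)
qed

text \<open>Differentiability in quadratic mean: almost sure convergence of the difference
  quotients, dominated by the squared Lipschitz constants.\<close>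

lemma Rem_L2_tendsto: "(\<lambda>n. LINT x|Q. (Rem h n x)\<^sup>2) \<longlonglongrightarrow> 0"
proof -
  obtain n0 where n0: "n0 \<ge> 1" "\<And>n. n \<ge> n0 \<Longrightarrow> \<mu> + (1 / sqrt (real n)) *\<^sub>R h \<in> cball \<mu> r"
    using eventually_in_chart by blast
  have "(\<lambda>n. LINT x|Q. (Rem h (n + n0) x)\<^sup>2) \<longlonglongrightarrow> (LINT x|Q. (0::real))"
  proof (rule integral_dominated_convergence[where w="\<lambda>x. (2 * norm h)\<^sup>2 * (lip x)\<^sup>2"])
    show "integrable Q (\<lambda>x. (2 * norm h)\<^sup>2 * (lip x)\<^sup>2)" using lip_square_integrable by simp
    show "AE x in Q. norm ((Rem h (n + n0) x)\<^sup>2) \<le> (2 * norm h)\<^sup>2 * (lip x)\<^sup>2" for n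
      using Rem_square_integrable(1)[of "n + n0" h] n0(1) n0(2)[of "n + n0"] by simp
    show "AE x in Q. (\<lambda>n. (Rem h (n + n0) x)\<^sup>2) \<longlonglongrightarrow> 0"
      using AE_\<psi>
    proof eventually_elim
      case (elim x)
      define s where "s n = 1 / sqrt (real (n + n0))" for n
      have s: "s n > 0" for n using n0(1) by (simp add: s_def)
      have "s \<longlonglongrightarrow> 0" unfolding s_def
        by (intro tendsto_divide_0[OF tendsto_const] filterlim_at_top_imp_at_infinity
            filterlim_compose[OF sqrt_at_top] filterlim_compose[OF filterlim_real_sequentially] filterlim_add_const_nat_at_top)
      have "(\<lambda>n. (f x (\<mu> + s n *\<^sub>R h) - f x \<mu>) / s n - h \<bullet> \<psi> x) \<longlonglongrightarrow> dir_deriv (f x) \<mu> h - h \<bullet> \<psi> x"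
        by (intro tendsto_diff tendsto_const S.dir_deriv_LIMSEQ[OF \<open>s \<longlonglongrightarrow> 0\<close> s])
      then have "(\<lambda>n. Rem h (n + n0) x) \<longlonglongrightarrow> 0"
        using elim n0(1) by (simp add: Rem_def s_def mult.commute)
      then have "(\<lambda>n. (Rem h (n + n0) x)\<^sup>2) \<longlonglongrightarrow> 0\<^sup>2" by (rule tendsto_power)
      then show ?case by simp
    qed
  qed measurable
  then have "(\<lambda>n. LINT x|Q. (Rem h (n + n0) x)\<^sup>2) \<longlonglongrightarrow> 0" by simp
  then show ?thesis by (rule LIMSEQ_offset)
qed

definition Gn :: "nat \<Rightarrow> real ^ 'd \<Rightarrow> 'w \<Rightarrow> real" where
  "Gn n h \<omega> = (\<Sum>i<n. f (X i \<omega>) (\<mu> + (1 / sqrt (real n)) *\<^sub>R h) - f (X i \<omega>) \<mu>)"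

definition Sn :: "nat \<Rightarrow> 'w \<Rightarrow> real ^ 'd" where
  "Sn n \<omega> = (1 / sqrt (real n)) *\<^sub>R (\<Sum>i<n. \<psi> (X i \<omega>))"

text \<open>As \<open>\<psi>\<close> is centered, the mean of the error is the deterministic
  increment of \<open>F\<close>, with limit \<open>c\<close>; the fluctuation vanishes by
  \<open>Rem_L2_tendsto\<close>. This is for one fixed \<open>h\<close>, and the finite net extends
  its use to random points.\<close>

lemma linearization:
  assumes lim: "(\<lambda>n. real n * (F (\<mu> + (1 / sqrt (real n)) *\<^sub>R h) - F \<mu>)) \<longlonglongrightarrow> c" and d: "\<delta> > 0" and e: "e > 0"
  shows "likely e (\<lambda>n \<omega>. \<bar>Gn n h \<omega> - h \<bullet> Sn n \<omega> - c\<bar> \<le> \<delta>)"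
proof -
  obtain n0 where n0: "n0 \<ge> 1" "\<And>n. n \<ge> n0 \<Longrightarrow> \<mu> + (1 / sqrt (real n)) *\<^sub>R h \<in> cball \<mu> r"
    using eventually_in_chart by blast
  obtain n1 where n1: "\<And>n. n \<ge> n1 \<Longrightarrow> \<bar>real n * (F (\<mu> + (1 / sqrt (real n)) *\<^sub>R h) - F \<mu>) - c\<bar> < \<delta> / 2"
    using LIMSEQ_D[OF lim, of "\<delta> / 2"] d by auto
  obtain n2 where n2: "\<And>n. n \<ge> n2 \<Longrightarrow> (LINT x|Q. (Rem h n x)\<^sup>2) < e * (\<delta> / 2)\<^sup>2"
    using LIMSEQ_D[OF Rem_L2_tendsto[of h], of "e * (\<delta> / 2)\<^sup>2"] d e by auto
  let ?N = "max n0 (max n1 n2)"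
  let ?E = "\<lambda>n. {\<omega>\<in>space M. \<bar>(\<Sum>i<n. Rem h n (X i \<omega>)) - real n * integral\<^sup>L Q (Rem h n)\<bar> \<ge> sqrt (real n) * (\<delta> / 2)}"
  show ?thesis
  proof (rule likelyI[of ?N ?E])
    fix n assume n: "?N \<le> n"
    then have n1': "n \<ge> 1" "sqrt (real n) > 0" using n0(1) by auto
    have sq: "integrable Q (\<lambda>x. (Rem h n x)\<^sup>2)" using n n0 by (intro Rem_square_integrable) auto
    have t: "sqrt (real n) * (\<delta> / 2) > 0" using n1' d by simp
    show "?E n \<in> events" by (rule chebyshev_sum(1)[OF Rem_measurable sq t])
    have "prob (?E n) \<le> real n * (LINT x|Q. (Rem h n x)\<^sup>2) / (sqrt (real n) * (\<delta> / 2))\<^sup>2"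
      by (rule chebyshev_sum(2)[OF Rem_measurable sq t])
    also have "\<dots> = (LINT x|Q. (Rem h n x)\<^sup>2) / (\<delta> / 2)\<^sup>2"
      using n1' by (simp only: power_mult_distrib real_sqrt_pow2[OF of_nat_0_le_iff]) simp
    also have "\<dots> \<le> e" using n2[of n] n d by (simp add: pos_divide_le_eq)
    finally show "prob (?E n) \<le> e" .
    fix \<omega> assume "\<omega> \<in> space M" "\<omega> \<notin> ?E n"
    then have E: "\<bar>(\<Sum>i<n. Rem h n (X i \<omega>)) - real n * integral\<^sup>L Q (Rem h n)\<bar> < sqrt (real n) * (\<delta> / 2)" by auto
    have "integral\<^sup>L Q (Rem h n) = sqrt (real n) * (F (\<mu> + (1 / sqrt (real n)) *\<^sub>R h) - F \<mu>) - 0"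
      unfolding Rem_def[abs_def] using f_integrable \<psi>_mean[of h] integrable_if_square_integrable[OF _ \<psi>_square_integrable[of h]]
      by (simp add: F_def)
    then have "real n * integral\<^sup>L Q (Rem h n) = sqrt (real n) * (real n * (F (\<mu> + (1 / sqrt (real n)) *\<^sub>R h) - F \<mu>))" by simp
    moreover have "(\<Sum>i<n. Rem h n (X i \<omega>)) = sqrt (real n) * (Gn n h \<omega> - h \<bullet> Sn n \<omega>)"
      using n1' by (simp add: Rem_def Gn_def Sn_def sum_subtractf sum_distrib_left inner_sum_right right_diff_distrib)
    ultimately have "\<bar>sqrt (real n) * ((Gn n h \<omega> - h \<bullet> Sn n \<omega>) - real n * (F (\<mu> + (1 / sqrt (real n)) *\<^sub>R h) - F \<mu>))\<bar> < sqrt (real n) * (\<delta> / 2)"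
      using E by (simp only: right_diff_distrib)
    then have "sqrt (real n) * \<bar>(Gn n h \<omega> - h \<bullet> Sn n \<omega>) - real n * (F (\<mu> + (1 / sqrt (real n)) *\<^sub>R h) - F \<mu>)\<bar> < sqrt (real n) * (\<delta> / 2)"
      using n1' by (simp only: abs_mult abs_of_pos)
    then have "\<bar>(Gn n h \<omega> - h \<bullet> Sn n \<omega>) - real n * (F (\<mu> + (1 / sqrt (real n)) *\<^sub>R h) - F \<mu>)\<bar> < \<delta> / 2"
      using n1' by simp
    with n1[of n] n show "\<bar>Gn n h \<omega> - h \<bullet> Sn n \<omega> - c\<bar> \<le> \<delta>" by (simp add: abs_if split: if_splits)
  qed
qed

text \<open>Chebyshev's inequality in each coordinate with allowance \<open>e / d\<close>. Here
  \<open>s\<close> bounds all coordinate variances, its summand 1 keeps it positive, and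
  \<open>t\<close> solves \<open>s / t^2 = e / d\<close>.\<close>

lemma Sn_tight:
  assumes e: "e > 0"
  obtains B where "B > 0" "likely e (\<lambda>n \<omega>. norm (Sn n \<omega>) \<le> B)"
proof -
  define s where "s = (\<Sum>i\<in>UNIV. (LINT x|Q. (axis i 1 \<bullet> \<psi> x)\<^sup>2)) + 1"
  have s: "(LINT x|Q. (axis i 1 \<bullet> \<psi> x)\<^sup>2) \<le> s" for i
    unfolding s_def using member_le_sum[of i UNIV "\<lambda>i. LINT x|Q. (axis i 1 \<bullet> \<psi> x)\<^sup>2"] by auto
  have s0: "s > 0" unfolding s_def by (intro add_nonneg_pos sum_nonneg) auto
  define d where "d = real CARD('d)"
  have d: "d > 0" by (simp add: d_def)
  define t where "t = sqrt (s * d / e)"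
  have t: "t > 0" "t\<^sup>2 = s * d / e" using s0 d e by (auto simp: t_def)
  have co: "likely (e / d) (\<lambda>n \<omega>. \<bar>Sn n \<omega> $ i\<bar> \<le> t)" for i
  proof (rule likelyI[of 1 "\<lambda>n. {\<omega>\<in>space M. \<bar>(\<Sum>j<n. axis i 1 \<bullet> \<psi> (X j \<omega>)) - real n * (LINT x|Q. axis i 1 \<bullet> \<psi> x)\<bar> \<ge> sqrt (real n) * t}"])
    fix n :: nat assume n: "1 \<le> n"
    let ?E = "{\<omega>\<in>space M. \<bar>(\<Sum>j<n. axis i 1 \<bullet> \<psi> (X j \<omega>)) - real n * (LINT x|Q. axis i 1 \<bullet> \<psi> x)\<bar> \<ge> sqrt (real n) * t}"
    have pos: "sqrt (real n) * t > 0" using n t by simp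
    have m: "(\<lambda>x. axis i 1 \<bullet> \<psi> x) \<in> borel_measurable borel" by measurable
    show "?E \<in> events" by (rule chebyshev_sum(1)[OF m \<psi>_square_integrable pos])
    have "prob ?E \<le> real n * (LINT x|Q. (axis i 1 \<bullet> \<psi> x)\<^sup>2) / (sqrt (real n) * t)\<^sup>2"
      by (rule chebyshev_sum(2)[OF m \<psi>_square_integrable pos])
    also have "\<dots> = (LINT x|Q. (axis i 1 \<bullet> \<psi> x)\<^sup>2) / t\<^sup>2" using n by (simp add: power_mult_distrib)
    also have "\<dots> \<le> s / t\<^sup>2" using s[of i] by (intro divide_right_mono) auto
    also have "\<dots> = e / d" using s0 d e by (simp add: t)
    finally show "prob ?E \<le> e / d" .
    fix \<omega> assume "\<omega> \<in> space M" "\<omega> \<notin> ?E"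
    then have "\<bar>\<Sum>j<n. axis i 1 \<bullet> \<psi> (X j \<omega>)\<bar> \<le> t * sqrt (real n)" by (simp add: \<psi>_mean mult.commute)
    then have "\<bar>\<Sum>j<n. axis i 1 \<bullet> \<psi> (X j \<omega>)\<bar> / sqrt (real n) \<le> t" using n by (simp add: pos_divide_le_eq)
    moreover have "\<bar>Sn n \<omega> $ i\<bar> = \<bar>\<Sum>j<n. axis i 1 \<bullet> \<psi> (X j \<omega>)\<bar> / sqrt (real n)"
      by (simp add: Sn_def inner_axis' sum_component abs_divide)
    ultimately show "\<bar>Sn n \<omega> $ i\<bar> \<le> t" by simp
  qed
  have "likely (\<Sum>i\<in>I. e / d) (\<lambda>n \<omega>. \<forall>i\<in>I. \<bar>Sn n \<omega> $ i\<bar> \<le> t)" for I :: "'d set"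
  proof (induction I rule: finite_induct[OF finite])
    case 1
    show ?case by (rule likelyI[of 0 "\<lambda>_. {}"]) auto
  next
    case (2 i I)
    have "likely (e / d + (\<Sum>i\<in>I. e / d)) (\<lambda>n \<omega>. \<bar>Sn n \<omega> $ i\<bar> \<le> t \<and> (\<forall>i\<in>I. \<bar>Sn n \<omega> $ i\<bar> \<le> t))"
      by (rule likely_conj[OF co 2(3)])
    then show ?case by (rule likely_mono[where N=0]) (use 2 in \<open>auto simp: d_def field_simps\<close>)
  qed
  from this[of UNIV] have "likely e (\<lambda>n \<omega>. \<forall>i. \<bar>Sn n \<omega> $ i\<bar> \<le> t)" using d by (simp add: d_def)
  then have "likely e (\<lambda>n \<omega>. norm (Sn n \<omega>) \<le> d * t)"
  proof (rule likely_mono[where N=0])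
    fix n \<omega> assume *: "\<forall>i. \<bar>Sn n \<omega> $ i\<bar> \<le> t"
    have "norm (Sn n \<omega>) \<le> (\<Sum>i\<in>UNIV. \<bar>Sn n \<omega> $ i\<bar>)" by (rule norm_le_l1_cart)
    also have "\<dots> \<le> (\<Sum>i\<in>(UNIV::'d set). t)" using * by (intro sum_mono) auto
    finally show "norm (Sn n \<omega>) \<le> d * t" by (simp add: d_def)
  qed simp
  then show thesis using that[of "d * t"] d t by auto
qed

end

section \<open>Rate of convergence and asymptotics of minimizers\<close>

lemma exists_dyadic_shell:
  fixes y :: real
  assumes "y \<ge> 1"
  obtains j where "2 ^ j \<le> y" "y \<le> 2 ^ Suc j"
proof -
  obtain m :: nat where "y < 2 ^ m" using real_arch_pow[of 2 y] by auto
  define j where "j = (LEAST j. y \<le> 2 ^ Suc j)"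
  have "y \<le> 2 ^ Suc m" using \<open>y < 2 ^ m\<close> zero_le_power[of "2::real" m] unfolding power_Suc by linarith
  then have 1: "y \<le> 2 ^ Suc j" unfolding j_def by (rule LeastI)
  have 2: "2 ^ j \<le> y"
  proof (cases j)
    case (Suc i)
    then have "\<not> y \<le> 2 ^ Suc i" using not_less_Least[of i "\<lambda>j. y \<le> 2 ^ Suc j"] by (simp add: j_def)
    then show ?thesis using Suc by simp
  qed (use assms in simp)
  from 2 1 show thesis by (rule that)
qed

lemma sum_quarter_powers_le: "(\<Sum>j<J. (1 / 4 :: real) ^ j) \<le> 2"
proof -
  have "(\<Sum>j<J. (1 / 4 :: real) ^ j) \<le> (\<Sum>j. (1 / 4) ^ j)"
    by (intro sum_le_suminf summable_geometric) auto
  also have "\<dots> = 4 / 3" by (subst suminf_geometric) auto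
  finally show ?thesis by simp
qed

context frechet_chart
begin

text \<open>The empirical sum has semiconcavity constant at most \<open>n * K * (1 + t)\<close>, and
  rescaling by \<open>s\<close> multiplies it by \<open>s^2\<close>. At
  \<open>s = 1 / sqrt n\<close> the loss is thus free of \<open>n\<close>, and at larger scales it
  grows exactly as the quadratic gain does.\<close>

lemma scaled_lower_bound:
  assumes s: "s > 0" "\<And>v. v \<in> V \<Longrightarrow> \<mu> + s *\<^sub>R v \<in> cball \<mu> r" and x: "x \<in> convex hull (V \<inter> cball x \<epsilon>)" and "\<epsilon> \<ge> 0"
    and t: "(\<Sum>i<n. \<rho> (X i \<omega>) p) \<le> real n * t"
    and lb: "\<And>v. v \<in> V \<Longrightarrow> norm (v - x) \<le> \<epsilon> \<Longrightarrow> c \<le> (\<Sum>i<n. f (X i \<omega>) (\<mu> + s *\<^sub>R v) - f (X i \<omega>) \<mu>)"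
  shows "c - s\<^sup>2 * real n * (K * (1 + t)) / 2 * \<epsilon>\<^sup>2 \<le> (\<Sum>i<n. f (X i \<omega>) (\<mu> + s *\<^sub>R x) - f (X i \<omega>) \<mu>)"
proof -
  let ?T = "\<lambda>v. \<mu> + s *\<^sub>R v"
  define k where "k = (\<Sum>i<n. K * (1 + \<rho> (X i \<omega>) p))"
  have k0: "k \<ge> 0" unfolding k_def using K_pos \<rho>_nonneg by (intro sum_nonneg mult_nonneg_nonneg add_nonneg_nonneg) auto
  have "k = K * (real n + (\<Sum>i<n. \<rho> (X i \<omega>) p))"
    by (simp add: k_def sum_distrib_left[symmetric] sum.distrib)
  also have "\<dots> \<le> K * (real n + real n * t)" using K_pos t by (intro mult_left_mono) auto
  finally have kt: "k \<le> real n * (K * (1 + t))" by (simp add: algebra_simps)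
  have sc: "semiconcave_on (cball \<mu> r) k (\<lambda>\<theta>. \<Sum>i<n. f (X i \<omega>) \<theta> - f (X i \<omega>) \<mu>)"
    unfolding k_def
  proof (rule semiconcave_on_sum)
    fix i
    show "semiconcave_on (cball \<mu> r) (K * (1 + \<rho> (X i \<omega>) p)) (\<lambda>\<theta>. f (X i \<omega>) \<theta> - f (X i \<omega>) \<mu>)"
      using S.semiconcave[of "X i \<omega>"] unfolding semiconcave_on_def by (force simp: algebra_simps)
  qed
  have "c - k / 2 * (s * \<epsilon>)\<^sup>2 \<le> (\<Sum>i<n. f (X i \<omega>) (?T x) - f (X i \<omega>) \<mu>)"
  proof (rule semiconcave_on_lower_bound[OF sc convex_cball _ k0])
    show "continuous_on (cball \<mu> r) (\<lambda>\<theta>. \<Sum>i<n. f (X i \<omega>) \<theta> - f (X i \<omega>) \<mu>)"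
      by (intro continuous_intros S.continuous)
    show "?T ` V \<subseteq> cball \<mu> r" using s(2) by blast
    have "?T ` (V \<inter> cball x \<epsilon>) \<subseteq> ?T ` V \<inter> cball (?T x) (s * \<epsilon>)"
      using s(1) by (auto simp: dist_norm simp flip: scaleR_diff_right)
    moreover have "?T x \<in> convex hull (?T ` (V \<inter> cball x \<epsilon>))"
      unfolding convex_hull_affinity using x by blast
    ultimately show "?T x \<in> convex hull (?T ` V \<inter> cball (?T x) (s * \<epsilon>))" using hull_mono by blast
    show "s * \<epsilon> \<ge> 0" using s(1) \<open>\<epsilon> \<ge> 0\<close> by simp
    fix w assume "w \<in> ?T ` V" "norm (w - ?T x) \<le> s * \<epsilon>"
    then obtain v where v: "v \<in> V" "w = ?T v" "norm (?T v - ?T x) \<le> s * \<epsilon>" by blast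
    then have "norm (v - x) \<le> \<epsilon>" using s(1) by (simp flip: scaleR_diff_right)
    then show "c \<le> (\<Sum>i<n. f (X i \<omega>) w - f (X i \<omega>) \<mu>)" using lb v by blast
  qed
  moreover have "k / 2 * (s * \<epsilon>)\<^sup>2 \<le> s\<^sup>2 * real n * (K * (1 + t)) / 2 * \<epsilon>\<^sup>2"
    using mult_right_mono[OF kt, of "(s * \<epsilon>)\<^sup>2 / 2"] by (simp add: power_mult_distrib mult_ac)
  ultimately show ?thesis by linarith
qed

end

locale frechet_expansion = frechet_chart M X Q \<rho> p \<xi> \<mu> r K
  for M :: "'w measure" and X :: "nat \<Rightarrow> 'w \<Rightarrow> 'a::topological_space" and Q \<rho> p
    and \<xi> :: "real ^ 'd::finite \<Rightarrow> 'a" and \<mu> r K +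
  fixes \<Lambda> :: "real ^ 'd ^ 'd" and \<beta> :: real
  assumes expansion: "\<And>\<epsilon>. \<epsilon> > 0 \<Longrightarrow> \<exists>\<delta>>0. \<forall>h. norm h \<le> \<delta> \<longrightarrow> \<bar>F (\<mu> + h) - F \<mu> - h \<bullet> (\<Lambda> *v h) / 2\<bar> \<le> \<epsilon> * (norm h)\<^sup>2"
    and symmetric: "transpose \<Lambda> = \<Lambda>"
    and coercive: "\<beta> > 0" "\<And>h. \<beta> * (norm h)\<^sup>2 \<le> h \<bullet> (\<Lambda> *v h)"
begin

lemma scaled_expansion: "(\<lambda>n. real n * (F (\<mu> + (1 / sqrt (real n)) *\<^sub>R h) - F \<mu>)) \<longlonglongrightarrow> h \<bullet> (\<Lambda> *v h) / 2"
proof (rule LIMSEQ_I)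
  fix e :: real assume "e > 0"
  define \<epsilon> where "\<epsilon> = e / (2 * ((norm h)\<^sup>2 + 1))"
  have \<epsilon>: "\<epsilon> > 0" "\<epsilon> * (norm h)\<^sup>2 < e"
    using \<open>e > 0\<close> by (auto simp: \<epsilon>_def add_nonneg_pos divide_simps)
  obtain \<delta> where \<delta>: "\<delta> > 0" "\<And>h. norm h \<le> \<delta> \<Longrightarrow> \<bar>F (\<mu> + h) - F \<mu> - h \<bullet> (\<Lambda> *v h) / 2\<bar> \<le> \<epsilon> * (norm h)\<^sup>2"
    using expansion[OF \<epsilon>(1)] by blast
  obtain N :: nat where N: "real N > (norm h / \<delta>)\<^sup>2" using reals_Archimedean2 by blast
  show "\<exists>N. \<forall>n\<ge>N. norm (real n * (F (\<mu> + (1 / sqrt (real n)) *\<^sub>R h) - F \<mu>) - h \<bullet> (\<Lambda> *v h) / 2) < e"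
  proof (intro exI[of _ "max 1 N"] allI impI)
    fix n assume n: "max 1 N \<le> n"
    let ?h = "(1 / sqrt (real n)) *\<^sub>R h"
    have "(norm h / \<delta>)\<^sup>2 \<le> real n" using N n by simp
    then have "norm h / \<delta> \<le> sqrt (real n)" by (rule real_le_rsqrt)
    then have "norm ?h \<le> \<delta>" using n \<delta>(1) by (simp add: field_simps)
    from \<delta>(2)[OF this] have "\<bar>F (\<mu> + ?h) - F \<mu> - ?h \<bullet> (\<Lambda> *v ?h) / 2\<bar> \<le> \<epsilon> * (norm ?h)\<^sup>2" .
    then have "real n * \<bar>F (\<mu> + ?h) - F \<mu> - ?h \<bullet> (\<Lambda> *v ?h) / 2\<bar> \<le> real n * (\<epsilon> * (norm ?h)\<^sup>2)"
      by (rule mult_left_mono) simp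
    also have "real n * (\<epsilon> * (norm ?h)\<^sup>2) = \<epsilon> * (norm h)\<^sup>2"
      using n by (simp add: power_mult_distrib power_divide)
    also have "real n * \<bar>F (\<mu> + ?h) - F \<mu> - ?h \<bullet> (\<Lambda> *v ?h) / 2\<bar> =
        \<bar>real n * (F (\<mu> + ?h) - F \<mu> - ?h \<bullet> (\<Lambda> *v ?h) / 2)\<bar>"
      by (simp add: abs_mult)
    also have "real n * (F (\<mu> + ?h) - F \<mu> - ?h \<bullet> (\<Lambda> *v ?h) / 2) = real n * (F (\<mu> + ?h) - F \<mu>) - h \<bullet> (\<Lambda> *v h) / 2"
    proof -
      have "?h \<bullet> (\<Lambda> *v ?h) = (1 / real n) * (h \<bullet> (\<Lambda> *v h))"
        using n by (simp add: matrix_vector_mult_scaleR)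
      then show ?thesis using n by (simp add: field_simps)
    qed
    finally show "norm (real n * (F (\<mu> + ?h) - F \<mu>) - h \<bullet> (\<Lambda> *v h) / 2) < e" using \<epsilon>(2) by simp
  qed
qed

lemma quadratic_growth:
  obtains r0 where "r0 > 0" "r0 \<le> r" "\<And>h. norm h \<le> r0 \<Longrightarrow> \<beta> / 4 * (norm h)\<^sup>2 \<le> F (\<mu> + h) - F \<mu>"
proof -
  obtain \<delta> where \<delta>: "\<delta> > 0" "\<And>h. norm h \<le> \<delta> \<Longrightarrow> \<bar>F (\<mu> + h) - F \<mu> - h \<bullet> (\<Lambda> *v h) / 2\<bar> \<le> \<beta> / 4 * (norm h)\<^sup>2"
    using expansion[of "\<beta> / 4"] coercive(1) by auto
  show thesis
  proof (rule that[of "min \<delta> r"])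
    fix h :: "real ^ 'd" assume "norm h \<le> min \<delta> r"
    then have "\<bar>F (\<mu> + h) - F \<mu> - h \<bullet> (\<Lambda> *v h) / 2\<bar> \<le> \<beta> / 4 * (norm h)\<^sup>2" by (intro \<delta>(2)) simp
    then have "h \<bullet> (\<Lambda> *v h) / 2 - \<beta> / 4 * (norm h)\<^sup>2 \<le> F (\<mu> + h) - F \<mu>" by linarith
    then show "\<beta> / 4 * (norm h)\<^sup>2 \<le> F (\<mu> + h) - F \<mu>" using coercive(2)[of h] by (simp add: field_simps)
  qed (use \<delta>(1) r_pos in auto)
qed

text \<open>Quadratic growth and \<open>norm v \<ge> 1 / 2\<close> make the mean at least
  \<open>n s^2 \<beta> / 16\<close>, and a deviation of half of this is allowed. The second moment
  is at most \<open>9 s^2 L\<close> since \<open>norm v \<le> 3\<close>, so Chebyshev's bound decays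
  as \<open>1 / (n s^2)\<close>.\<close>

lemma net_point_event:
  fixes n :: nat
  assumes r0: "\<And>h. norm h \<le> r0 \<Longrightarrow> \<beta> / 4 * (norm h)\<^sup>2 \<le> F (\<mu> + h) - F \<mu>" "r0 \<le> r"
    and s: "s > 0" "3 * s \<le> r0" and v: "norm v \<le> 3" "1 / 2 \<le> norm v" and n: "n \<ge> 1"
  defines "L \<equiv> (LINT x|Q. (lip x)\<^sup>2)"
  shows "\<exists>E\<in>events. prob E \<le> 9 * 32\<^sup>2 * L / (\<beta>\<^sup>2 * (real n * s\<^sup>2)) \<and>
    (\<forall>\<omega>\<in>space M - E. real n * s\<^sup>2 * (\<beta> / 32) \<le> (\<Sum>i<n. f (X i \<omega>) (\<mu> + s *\<^sub>R v) - f (X i \<omega>) \<mu>))"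
proof -
  let ?g = "\<lambda>x. f x (\<mu> + s *\<^sub>R v) - f x \<mu>"
  let ?t = "real n * s\<^sup>2 * (\<beta> / 32)"
  let ?E = "{\<omega>\<in>space M. \<bar>(\<Sum>i<n. ?g (X i \<omega>)) - real n * integral\<^sup>L Q ?g\<bar> \<ge> ?t}"
  have "s * norm v \<le> s * 3" using s v(1) by (intro mult_left_mono) auto
  then have "s * norm v \<le> r0" using s(2) by linarith
  then have sv: "norm (s *\<^sub>R v) \<le> r0" using s(1) by simp
  then have in_r: "\<mu> + s *\<^sub>R v \<in> cball \<mu> r" using r0(2) by (simp add: dist_norm)
  have t: "?t > 0" using n s coercive(1) by simp
  have m: "?g \<in> borel_measurable borel" by measurable
  have gle: "(?g x)\<^sup>2 \<le> 9 * s\<^sup>2 * (lip x)\<^sup>2" for x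
  proof -
    have "\<bar>?g x\<bar> \<le> lip x * norm (\<mu> + s *\<^sub>R v - \<mu>)" by (rule f_lipschitz[OF in_r \<mu>_in])
    also have "\<dots> \<le> lip x * (3 * s)" using s v lip_pos[of x] by (intro mult_left_mono) auto
    finally have "\<bar>?g x\<bar>\<^sup>2 \<le> (lip x * (3 * s))\<^sup>2" by (rule power_mono) simp
    then show ?thesis by (simp add: power_mult_distrib mult_ac)
  qed
  have sq: "integrable Q (\<lambda>x. (?g x)\<^sup>2)"
    by (rule Bochner_Integration.integrable_bound[OF integrable_mult_right[OF lip_square_integrable, of "9 * s\<^sup>2"]])
      (use gle in \<open>auto simp: abs_mult\<close>)
  have "(LINT x|Q. (?g x)\<^sup>2) \<le> (LINT x|Q. 9 * s\<^sup>2 * (lip x)\<^sup>2)"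
    using sq lip_square_integrable gle by (intro integral_mono) auto
  also have "\<dots> = 9 * s\<^sup>2 * L" by (simp add: L_def)
  finally have gL: "(LINT x|Q. (?g x)\<^sup>2) \<le> 9 * s\<^sup>2 * L" .
  have mean: "real n * integral\<^sup>L Q ?g \<ge> 2 * ?t"
  proof -
    have "(1 / 2)\<^sup>2 \<le> (norm v)\<^sup>2" using v(2) by (intro power_mono) auto
    then have "s\<^sup>2 * (\<beta> / 16) \<le> s\<^sup>2 * (\<beta> / 4 * (norm v)\<^sup>2)"
      using coercive(1) by (intro mult_left_mono) (auto simp: power2_eq_square)
    also have "\<dots> = \<beta> / 4 * (norm (s *\<^sub>R v))\<^sup>2" by (simp add: power_mult_distrib)
    also have "\<dots> \<le> F (\<mu> + s *\<^sub>R v) - F \<mu>" by (rule r0(1)[OF sv])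
    also have "\<dots> = integral\<^sup>L Q ?g" using f_integrable by (simp add: F_def)
    finally have "real n * (s\<^sup>2 * (\<beta> / 16)) \<le> real n * integral\<^sup>L Q ?g" by (rule mult_left_mono) simp
    then show ?thesis by (simp add: mult.commute mult.left_commute)
  qed
  show ?thesis
  proof (rule bexI[of _ ?E], intro conjI ballI)
    show "?E \<in> events" by (rule chebyshev_sum(1)[OF m sq t])
    have "prob ?E \<le> real n * (LINT x|Q. (?g x)\<^sup>2) / ?t\<^sup>2" by (rule chebyshev_sum(2)[OF m sq t])
    also have "\<dots> \<le> real n * (9 * s\<^sup>2 * L) / ?t\<^sup>2" using gL by (intro divide_right_mono mult_left_mono) auto
    also have "\<dots> = 9 * 32\<^sup>2 * L / (\<beta>\<^sup>2 * (real n * s\<^sup>2))"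
      using n s coercive(1) by (simp add: power2_eq_square field_simps)
    finally show "prob ?E \<le> 9 * 32\<^sup>2 * L / (\<beta>\<^sup>2 * (real n * s\<^sup>2))" .
    fix \<omega> assume "\<omega> \<in> space M - ?E"
    then have "\<bar>(\<Sum>i<n. ?g (X i \<omega>)) - real n * integral\<^sup>L Q ?g\<bar> < ?t" by auto
    with mean show "?t \<le> (\<Sum>i<n. ?g (X i \<omega>))" by linarith
  qed
qed

text \<open>Peeling: the complement of a ball of radius \<open>B / sqrt n\<close> is cut into dyadic shells whose
  exceptional events have geometrically decreasing probabilities.\<close>

lemma minimizer_rate:
  obtains r1 where "r1 > 0" "r1 \<le> r"
    "\<And>e. e > 0 \<Longrightarrow> \<exists>B>0. likely e (\<lambda>n \<omega>. \<forall>\<theta>\<in>cball \<mu> r1.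
      (\<Sum>i<n. f (X i \<omega>) \<theta>) \<le> (\<Sum>i<n. f (X i \<omega>) \<mu>) \<longrightarrow> sqrt (real n) * norm (\<theta> - \<mu>) \<le> B)"
proof -
  obtain r0 where r0: "r0 > 0" "r0 \<le> r" "\<And>h. norm h \<le> r0 \<Longrightarrow> \<beta> / 4 * (norm h)\<^sup>2 \<le> F (\<mu> + h) - F \<mu>"
    using quadratic_growth by blast
  \<comment> \<open>Net vectors have norm up to 3, so a shell of scale at most \<open>r1\<close>
    uses the growth bound up to radius \<open>3 * r1\<close>.\<close>
  define r1 where "r1 = r0 / 3"
  have r1: "r1 > 0" "3 * r1 \<le> r0" "r1 \<le> r" using r0 by (auto simp: r1_def)
  have main: "\<exists>B>0. likely e (\<lambda>n \<omega>. \<forall>\<theta>\<in>cball \<mu> r1.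
      (\<Sum>i<n. f (X i \<omega>) \<theta>) \<le> (\<Sum>i<n. f (X i \<omega>) \<mu>) \<longrightarrow> sqrt (real n) * norm (\<theta> - \<mu>) \<le> B)"
    if e: "e > 0" for e
  proof -
    obtain t where t: "t > 0" and lt: "likely (e / 2) (\<lambda>n \<omega>. (\<Sum>i<n. \<rho> (X i \<omega>) p) < real n * t)"
      using tight_mean_distance[of "e / 2"] e by auto
    define \<kappa> where "\<kappa> = K * (1 + t)"
    have \<kappa>: "\<kappa> > 0" using K_pos t by (simp add: \<kappa>_def)
    \<comment> \<open>The bound \<open>1 / 2\<close> keeps the net of the shell between the norms
      \<open>1 / 2\<close> and 3. The other bound makes the semiconcavity loss
      \<open>\<kappa> * \<epsilon>^2 / 2\<close> at most \<open>\<beta> / 64\<close>, half of the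
      gain \<open>\<beta> / 32\<close>.\<close>
    define \<epsilon> where "\<epsilon> = min (1 / 2) (sqrt (\<beta> / (32 * \<kappa>)))"
    have \<epsilon>: "\<epsilon> > 0" "\<epsilon> \<le> 1 / 2" using coercive(1) \<kappa> by (auto simp: \<epsilon>_def)
    have "\<epsilon>\<^sup>2 \<le> (sqrt (\<beta> / (32 * \<kappa>)))\<^sup>2" using \<epsilon>(1) by (intro power_mono) (auto simp: \<epsilon>_def)
    then have \<epsilon>2: "\<kappa> * \<epsilon>\<^sup>2 \<le> \<beta> / 32" using \<kappa> coercive(1) by (simp add: field_simps)
    let ?S = "{h :: real ^ 'd. 1 \<le> norm h \<and> norm h \<le> 2}"
    have "?S = cball 0 2 \<inter> {h. 1 \<le> norm h}" by auto
    moreover have "closed {h :: real ^ 'd. 1 \<le> norm h}" by (intro closed_Collect_le continuous_intros)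
    ultimately have "compact ?S" by (simp only: compact_Int_closed compact_cball)
    obtain V where V: "finite V" "\<And>x. x \<in> ?S \<Longrightarrow> x \<in> convex hull (V \<inter> cball x \<epsilon>)"
        "\<And>v. v \<in> V \<Longrightarrow> \<exists>x\<in>?S. norm (v - x) \<le> \<epsilon>"
    proof (rule finite_convex_hull_net[OF \<open>compact ?S\<close> \<epsilon>(1)])
      fix V assume "finite V" "\<And>x. x \<in> ?S \<Longrightarrow> x \<in> convex hull (V \<inter> cball x \<epsilon>)" "\<And>v. v \<in> V \<Longrightarrow> \<exists>x\<in>?S. norm (v - x) \<le> \<epsilon>"
      then show thesis by (rule that)
    qed
    have Vn: "norm v \<le> 3" "1 / 2 \<le> norm v" if v: "v \<in> V" for v
    proof -
      obtain x where "x \<in> ?S" "norm (v - x) \<le> \<epsilon>" using V(3)[OF v] by blast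
      then show "norm v \<le> 3" "1 / 2 \<le> norm v"
        using \<epsilon>(2) norm_triangle_ineq2[of v x] norm_triangle_ineq2[of x v] norm_minus_commute[of v x] by auto
    qed
    define c where "c = 9 * 32\<^sup>2 * (LINT x|Q. (lip x)\<^sup>2) / \<beta>\<^sup>2"
    have c: "c \<ge> 0" by (simp add: c_def)
    \<comment> \<open>Over all net points and shells the probabilities sum to at most
      \<open>2 * c * card V / B^2\<close>, which this choice makes at most \<open>e / 2\<close>; the
      summand 1 keeps \<open>B\<close> positive.\<close>
    define B where "B = sqrt (4 * (c * real (card V) + 1) / e)"
    have B: "B > 0" "B\<^sup>2 = 4 * (c * real (card V) + 1) / e" using c e by (auto simp: B_def add_nonneg_pos)
    have "likely (e / 2) (\<lambda>n \<omega>. \<forall>j. \<forall>v\<in>V. 2 ^ j * B / sqrt (real n) \<le> r1 \<longrightarrow>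
        real n * (2 ^ j * B / sqrt (real n))\<^sup>2 * (\<beta> / 32) \<le>
        (\<Sum>i<n. f (X i \<omega>) (\<mu> + (2 ^ j * B / sqrt (real n)) *\<^sub>R v) - f (X i \<omega>) \<mu>))"
      unfolding likely_def
    proof (intro exI[of _ "1::nat"] allI impI)
      fix n :: nat assume n: "1 \<le> n"
      define s where "s j = 2 ^ j * B / sqrt (real n)" for j :: nat
      have s0: "s j > 0" for j using B n by (simp add: s_def)
      have ns: "real n * (s j)\<^sup>2 = 4 ^ j * B\<^sup>2" for j
      proof -
        have "(2 ^ j)\<^sup>2 = (4 ^ j :: real)" by (simp add: power2_eq_square flip: power_mult_distrib)
        then show ?thesis using n by (simp add: s_def power_divide power_mult_distrib)
      qed
      \<comment> \<open>Only shells of scale at most \<open>r1\<close> matter, finitely many for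
        each \<open>n\<close>. The geometric series bounds their total probability independently of
        \<open>J\<close>, hence of \<open>n\<close>.\<close>
      obtain J :: nat where J: "r1 * sqrt (real n) / B < 2 ^ J" using real_arch_pow[of 2] by auto
      have jJ: "j < J" if "s j \<le> r1" for j
      proof (rule ccontr)
        assume "\<not> j < J"
        then have "(2::real) ^ J \<le> 2 ^ j" by (intro power_increasing) auto
        then have "r1 * sqrt (real n) / B < 2 ^ j" using J by linarith
        then have "r1 < s j" using B n by (simp add: s_def field_simps)
        then show False using that by simp
      qed
      have "\<exists>E\<in>events. prob E \<le> c / (4 ^ j * B\<^sup>2) \<and> (\<forall>\<omega>\<in>space M - E. s j \<le> r1 \<longrightarrow>
          real n * (s j)\<^sup>2 * (\<beta> / 32) \<le> (\<Sum>i<n. f (X i \<omega>) (\<mu> + s j *\<^sub>R v) - f (X i \<omega>) \<mu>))" if v: "v \<in> V" for j v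
      proof (cases "s j \<le> r1")
        case True
        then have "3 * s j \<le> r0" using r1 by simp
        from net_point_event[OF r0(3,2) s0 this Vn[OF v] n]
        show ?thesis using True by (simp add: c_def ns)
      qed (auto intro!: bexI[of _ "{}"] simp: c)
      then have "\<forall>j. \<forall>v\<in>V. \<exists>E. E \<in> events \<and> prob E \<le> c / (4 ^ j * B\<^sup>2) \<and> (\<forall>\<omega>\<in>space M - E. s j \<le> r1 \<longrightarrow>
          real n * (s j)\<^sup>2 * (\<beta> / 32) \<le> (\<Sum>i<n. f (X i \<omega>) (\<mu> + s j *\<^sub>R v) - f (X i \<omega>) \<mu>))"
        by blast
      then have "\<exists>E. \<forall>j. \<forall>v\<in>V. E j v \<in> events \<and> prob (E j v) \<le> c / (4 ^ j * B\<^sup>2) \<and> (\<forall>\<omega>\<in>space M - E j v. s j \<le> r1 \<longrightarrow>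
          real n * (s j)\<^sup>2 * (\<beta> / 32) \<le> (\<Sum>i<n. f (X i \<omega>) (\<mu> + s j *\<^sub>R v) - f (X i \<omega>) \<mu>))"
        by (intro choice allI bchoice) blast
      then obtain E where E: "\<forall>j. \<forall>v\<in>V. E j v \<in> events \<and> prob (E j v) \<le> c / (4 ^ j * B\<^sup>2) \<and> (\<forall>\<omega>\<in>space M - E j v. s j \<le> r1 \<longrightarrow>
          real n * (s j)\<^sup>2 * (\<beta> / 32) \<le> (\<Sum>i<n. f (X i \<omega>) (\<mu> + s j *\<^sub>R v) - f (X i \<omega>) \<mu>))" ..
      let ?E = "\<Union>(j, v)\<in>{..<J} \<times> V. E j v"
      have fin: "finite ({..<J} \<times> V)" using V(1) by simp
      have "?E \<in> events" using E V(1) by (intro sets.finite_UN fin) auto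
      moreover have "prob ?E \<le> e / 2"
      proof -
        have "prob ?E \<le> (\<Sum>(j, v)\<in>{..<J} \<times> V. prob (E j v))"
          unfolding case_prod_unfold using E by (intro finite_measure_subadditive_finite[OF fin]) auto
        also have "\<dots> \<le> (\<Sum>(j, v)\<in>{..<J} \<times> V. c / B\<^sup>2 * (1 / 4) ^ j)"
          using E by (intro sum_mono) (auto simp: power_divide mult.commute[of "B\<^sup>2"])
        also have "\<dots> = (\<Sum>j<J. \<Sum>v\<in>V. c / B\<^sup>2 * (1 / 4) ^ j)"
          by (rule sum.cartesian_product[symmetric])
        also have "\<dots> = c / B\<^sup>2 * real (card V) * (\<Sum>j<J. (1 / 4) ^ j)"
          unfolding sum_distrib_left by (simp add: mult_ac)
        also have "\<dots> \<le> c / B\<^sup>2 * real (card V) * 2"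
          using c by (intro mult_left_mono sum_quarter_powers_le) auto
        also have "\<dots> \<le> e / 2"
        proof -
          define m where "m = c * real (card V)"
          have m: "m \<ge> 0" using c by (simp add: m_def)
          have "m / (4 * (m + 1) / e) * 2 = e / 2 * (m / (m + 1))" using e m by (simp add: field_simps)
          also have "\<dots> \<le> e / 2 * 1" using e m by (intro mult_left_mono) auto
          finally have "m / (4 * (m + 1) / e) * 2 \<le> e / 2" by simp
          moreover have "c / B\<^sup>2 * real (card V) * 2 = m / B\<^sup>2 * 2" by (simp add: m_def)
          ultimately show ?thesis unfolding B(2) by (simp only: m_def[symmetric])
        qed
        finally show ?thesis .
      qed
      moreover have "\<forall>\<omega>\<in>space M - ?E. \<forall>j. \<forall>v\<in>V. s j \<le> r1 \<longrightarrow>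
          real n * (s j)\<^sup>2 * (\<beta> / 32) \<le> (\<Sum>i<n. f (X i \<omega>) (\<mu> + s j *\<^sub>R v) - f (X i \<omega>) \<mu>)"
      proof (intro ballI allI impI)
        fix \<omega> j v assume "\<omega> \<in> space M - ?E" "v \<in> V" "s j \<le> r1"
        then have "\<omega> \<in> space M - E j v" using jJ by auto
        then show "real n * (s j)\<^sup>2 * (\<beta> / 32) \<le> (\<Sum>i<n. f (X i \<omega>) (\<mu> + s j *\<^sub>R v) - f (X i \<omega>) \<mu>)"
          using E \<open>v \<in> V\<close> \<open>s j \<le> r1\<close> by blast
      qed
      ultimately show "\<exists>E\<in>events. prob E \<le> e / 2 \<and> (\<forall>\<omega>\<in>space M - E. \<forall>j. \<forall>v\<in>V. 2 ^ j * B / sqrt (real n) \<le> r1 \<longrightarrow>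
        real n * (2 ^ j * B / sqrt (real n))\<^sup>2 * (\<beta> / 32) \<le>
        (\<Sum>i<n. f (X i \<omega>) (\<mu> + (2 ^ j * B / sqrt (real n)) *\<^sub>R v) - f (X i \<omega>) \<mu>))"
        unfolding s_def by blast
    qed
    from likely_conj[OF lt this]
    have "likely e (\<lambda>n \<omega>. \<forall>\<theta>\<in>cball \<mu> r1.
      (\<Sum>i<n. f (X i \<omega>) \<theta>) \<le> (\<Sum>i<n. f (X i \<omega>) \<mu>) \<longrightarrow> sqrt (real n) * norm (\<theta> - \<mu>) \<le> B)"
    proof (rule likely_mono[where N=1], intro ballI impI)
      fix n \<omega> \<theta> assume n: "1 \<le> n" and \<theta>: "\<theta> \<in> cball \<mu> r1" "(\<Sum>i<n. f (X i \<omega>) \<theta>) \<le> (\<Sum>i<n. f (X i \<omega>) \<mu>)"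
        and *: "(\<Sum>i<n. \<rho> (X i \<omega>) p) < real n * t \<and> (\<forall>j. \<forall>v\<in>V. 2 ^ j * B / sqrt (real n) \<le> r1 \<longrightarrow>
        real n * (2 ^ j * B / sqrt (real n))\<^sup>2 * (\<beta> / 32) \<le>
        (\<Sum>i<n. f (X i \<omega>) (\<mu> + (2 ^ j * B / sqrt (real n)) *\<^sub>R v) - f (X i \<omega>) \<mu>))"
      show "sqrt (real n) * norm (\<theta> - \<mu>) \<le> B"
      proof (rule ccontr)
        assume "\<not> sqrt (real n) * norm (\<theta> - \<mu>) \<le> B"
        then have "sqrt (real n) * norm (\<theta> - \<mu>) / B \<ge> 1" using B by simp
        then obtain j where j: "2 ^ j \<le> sqrt (real n) * norm (\<theta> - \<mu>) / B" "sqrt (real n) * norm (\<theta> - \<mu>) / B \<le> 2 ^ Suc j"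
          using exists_dyadic_shell by blast
        \<comment> \<open>The scale of the shell that contains \<open>\<theta>\<close>; after
          rescaling, \<open>x\<close> has norm between 1 and 2, where the net lives.\<close>
        define s where "s = 2 ^ j * B / sqrt (real n)"
        define x where "x = (1 / s) *\<^sub>R (\<theta> - \<mu>)"
        have s: "s > 0" using B n by (simp add: s_def)
        have sx: "s \<le> norm (\<theta> - \<mu>)" "norm (\<theta> - \<mu>) \<le> 2 * s" using j B n by (auto simp: s_def field_simps)
        have sr: "s \<le> r1" using sx(1) \<theta>(1) by (simp add: dist_norm norm_minus_commute)
        have "norm x = norm (\<theta> - \<mu>) / s" using s by (simp add: x_def)
        then have x: "x \<in> ?S" using sx s by (simp add: pos_le_divide_eq pos_divide_le_eq)
        have \<theta>x: "\<mu> + s *\<^sub>R x = \<theta>" using s by (simp add: x_def)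
        have "real n * s\<^sup>2 * (\<beta> / 32) - s\<^sup>2 * real n * (K * (1 + t)) / 2 * \<epsilon>\<^sup>2 \<le> (\<Sum>i<n. f (X i \<omega>) (\<mu> + s *\<^sub>R x) - f (X i \<omega>) \<mu>)"
        proof (rule scaled_lower_bound[OF s _ V(2)[OF x]])
          show "\<mu> + s *\<^sub>R v \<in> cball \<mu> r" if "v \<in> V" for v
          proof -
            have "s * norm v \<le> r1 * 3" using sr s Vn(1)[OF that] r1 by (intro mult_mono) auto
            then show ?thesis using r1 r0 s by (simp add: dist_norm)
          qed
          show "real n * s\<^sup>2 * (\<beta> / 32) \<le> (\<Sum>i<n. f (X i \<omega>) (\<mu> + s *\<^sub>R v) - f (X i \<omega>) \<mu>)" if "v \<in> V" for v
            using * that sr unfolding s_def by blast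
        qed (use * \<epsilon> in auto)
        moreover have "s\<^sup>2 * real n * (K * (1 + t)) / 2 * \<epsilon>\<^sup>2 < real n * s\<^sup>2 * (\<beta> / 32)"
        proof -
          have "s\<^sup>2 * real n * (K * (1 + t)) / 2 * \<epsilon>\<^sup>2 = s\<^sup>2 * real n * (\<kappa> * \<epsilon>\<^sup>2 / 2)" by (simp add: \<kappa>_def)
          also have "\<dots> \<le> s\<^sup>2 * real n * (\<beta> / 64)" using \<epsilon>2 by (intro mult_left_mono) auto
          also have "\<dots> < real n * s\<^sup>2 * (\<beta> / 32)" using s n coercive(1) by simp
          finally show ?thesis .
        qed
        ultimately have "(\<Sum>i<n. f (X i \<omega>) \<theta> - f (X i \<omega>) \<mu>) > 0" unfolding \<theta>x by linarith
        then show False using \<theta>(2) by (simp add: sum_subtractf)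
      qed
    qed simp
    with B(1) show ?thesis by blast
  qed
  from r1(1,3) main show thesis by (rule that)
qed

text \<open>Completing the square around the stationary point \<open>h\<close>.\<close>

lemma quadratic_at_minimizer:
  assumes h: "\<Lambda> *v h = - S"
  shows "v \<bullet> S + v \<bullet> (\<Lambda> *v v) / 2 = h \<bullet> S + h \<bullet> (\<Lambda> *v h) / 2 + (v - h) \<bullet> (\<Lambda> *v (v - h)) / 2"
proof -
  have "h \<bullet> (\<Lambda> *v v) = v \<bullet> (\<Lambda> *v h)"
    using dot_lmul_matrix[of h \<Lambda> v] transpose_matrix_vector[of \<Lambda> h] symmetric by (simp add: inner_commute)
  then show ?thesis
    by (simp add: h matrix_vector_mult_diff_distrib inner_diff_left inner_diff_right inner_add_right field_simps)
qed

text \<open>The rescaled empirical Frechet function is uniformly close to a quadratic form with linear part \<open>Sn\<close>,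
  so its minimizer is close to the minimizer \<open>- \<Lambda>\<inverse> Sn\<close> of that form.\<close>

lemma minimizer_near_linearization:
  obtains r1 where "r1 > 0"
    "\<And>e \<eta>. e > 0 \<Longrightarrow> \<eta> > 0 \<Longrightarrow> likely e (\<lambda>n \<omega>. \<forall>\<theta>\<in>cball \<mu> r1. \<forall>h.
      (\<forall>\<theta>'. (\<Sum>i<n. f (X i \<omega>) \<theta>) \<le> (\<Sum>i<n. f (X i \<omega>) \<theta>')) \<longrightarrow> \<Lambda> *v h = - Sn n \<omega> \<longrightarrow>
      norm (sqrt (real n) *\<^sub>R (\<theta> - \<mu>) - h) \<le> \<eta>)"
proof -
  obtain r1 where r1: "r1 > 0" "r1 \<le> r"
    "\<And>e. e > 0 \<Longrightarrow> \<exists>B>0. likely e (\<lambda>n \<omega>. \<forall>\<theta>\<in>cball \<mu> r1.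
      (\<Sum>i<n. f (X i \<omega>) \<theta>) \<le> (\<Sum>i<n. f (X i \<omega>) \<mu>) \<longrightarrow> sqrt (real n) * norm (\<theta> - \<mu>) \<le> B)"
  proof (rule minimizer_rate)
    fix r1 assume "r1 > 0" "r1 \<le> r" "\<And>e. e > 0 \<Longrightarrow> \<exists>B>0. likely e (\<lambda>n \<omega>. \<forall>\<theta>\<in>cball \<mu> r1.
      (\<Sum>i<n. f (X i \<omega>) \<theta>) \<le> (\<Sum>i<n. f (X i \<omega>) \<mu>) \<longrightarrow> sqrt (real n) * norm (\<theta> - \<mu>) \<le> B)"
    then show thesis by (rule that)
  qed
  have main: "likely e (\<lambda>n \<omega>. \<forall>\<theta>\<in>cball \<mu> r1. \<forall>h.
      (\<forall>\<theta>'. (\<Sum>i<n. f (X i \<omega>) \<theta>) \<le> (\<Sum>i<n. f (X i \<omega>) \<theta>')) \<longrightarrow> \<Lambda> *v h = - Sn n \<omega> \<longrightarrow>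
      norm (sqrt (real n) *\<^sub>R (\<theta> - \<mu>) - h) \<le> \<eta>)" if e: "e > 0" and \<eta>: "\<eta> > 0" for e \<eta>
  proof -
    have e4: "e / 4 > 0" using e by simp
    obtain B0 where B0: "B0 > 0" "likely (e / 4) (\<lambda>n \<omega>. \<forall>\<theta>\<in>cball \<mu> r1.
      (\<Sum>i<n. f (X i \<omega>) \<theta>) \<le> (\<Sum>i<n. f (X i \<omega>) \<mu>) \<longrightarrow> sqrt (real n) * norm (\<theta> - \<mu>) \<le> B0)"
      using r1(3)[OF e4] by blast
    obtain B1 where B1: "B1 > 0" "likely (e / 4) (\<lambda>n \<omega>. norm (Sn n \<omega>) \<le> B1)"
      using Sn_tight[OF e4] by blast
    obtain t where t: "t > 0" and lt: "likely (e / 4) (\<lambda>n \<omega>. (\<Sum>i<n. \<rho> (X i \<omega>) p) < real n * t)"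
      using tight_mean_distance[OF e4] by blast
    \<comment> \<open>The radius of a fixed ball that contains the rescaled minimizer and, by
      coercivity, the random minimizer \<open>h\<close> of the quadratic form.\<close>
    define R where "R = max B0 (B1 / \<beta>)"
    have R: "R > 0" using B0 by (simp add: R_def)
    define \<kappa> where "\<kappa> = K * (1 + t)"
    have \<kappa>: "\<kappa> > 0" using K_pos t by (simp add: \<kappa>_def)
    define L where "L = onorm ((*v) \<Lambda>) + 1"
    have L0: "L > 0" using onorm_pos_le[OF matrix_vector_mul_bounded_linear[of \<Lambda>]] by (simp add: L_def)
    have L: "v \<bullet> (\<Lambda> *v v) \<le> L * (norm v)\<^sup>2" for v
    proof -
      have "v \<bullet> (\<Lambda> *v v) \<le> norm v * norm (\<Lambda> *v v)" by (rule norm_cauchy_schwarz)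
      also have "\<dots> \<le> norm v * (L * norm v)"
      proof (rule mult_left_mono)
        have "norm (\<Lambda> *v v) \<le> onorm ((*v) \<Lambda>) * norm v" by (rule onorm[OF matrix_vector_mul_bounded_linear])
        then show "norm (\<Lambda> *v v) \<le> L * norm v"
          using norm_ge_zero[of v] unfolding L_def distrib_right by linarith
      qed simp
      finally show ?thesis by (simp add: power2_eq_square mult_ac)
    qed
    \<comment> \<open>With \<open>\<delta>\<close> below, the errors
      \<open>2 * \<delta> + (\<kappa> + L) * \<epsilon>^2 / 2\<close> are at most
      \<open>3 * \<beta> * \<eta>^2 / 64\<close>, less than the gap
      \<open>\<beta> * \<eta>^2 / 8\<close>. The bound \<open>\<eta> / 2\<close> keeps the net
      vectors around a far point away from \<open>h\<close>.\<close>
    define \<epsilon> where "\<epsilon> = min (\<eta> / 2) (sqrt (\<beta> * \<eta>\<^sup>2 / (32 * (\<kappa> + L))))"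
    have \<epsilon>: "\<epsilon> > 0" "\<epsilon> \<le> \<eta> / 2" using coercive(1) \<kappa> L0 \<eta> by (auto simp: \<epsilon>_def)
    have "\<epsilon>\<^sup>2 \<le> (sqrt (\<beta> * \<eta>\<^sup>2 / (32 * (\<kappa> + L))))\<^sup>2" using \<epsilon>(1) by (intro power_mono) (auto simp: \<epsilon>_def)
    also have "\<dots> = \<beta> * \<eta>\<^sup>2 / (32 * (\<kappa> + L))" using \<kappa> coercive(1) L0 by (intro real_sqrt_pow2) simp
    finally have \<epsilon>2: "(\<kappa> + L) * \<epsilon>\<^sup>2 \<le> \<beta> * \<eta>\<^sup>2 / 32" using \<kappa> L0 by (simp add: field_simps)
    define \<delta> where "\<delta> = \<beta> * \<eta>\<^sup>2 / 64"
    have \<delta>: "\<delta> > 0" using coercive(1) \<eta> by (simp add: \<delta>_def)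
    obtain V :: "(real ^ 'd) set" where V: "finite V" "\<And>x. x \<in> cball 0 R \<Longrightarrow> x \<in> convex hull (V \<inter> cball x \<epsilon>)"
        "\<And>v. v \<in> V \<Longrightarrow> \<exists>x\<in>cball 0 R. norm (v - x) \<le> \<epsilon>"
    proof (rule finite_convex_hull_net[OF compact_cball \<epsilon>(1)])
      fix V :: "(real ^ 'd) set" assume "finite V" "\<And>x. x \<in> cball 0 R \<Longrightarrow> x \<in> convex hull (V \<inter> cball x \<epsilon>)" "\<And>v. v \<in> V \<Longrightarrow> \<exists>x\<in>cball 0 R. norm (v - x) \<le> \<epsilon>"
      then show thesis by (rule that)
    qed
    have VR: "norm v \<le> R + \<epsilon>" if v: "v \<in> V" for v
    proof -
      obtain x where "x \<in> cball 0 R" "norm (v - x) \<le> \<epsilon>" using V(3)[OF v] by blast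
      then show ?thesis using norm_triangle_ineq2[of v x] by simp
    qed
    obtain N :: nat where N: "((R + \<epsilon>) / r)\<^sup>2 < real N" using reals_Archimedean2 by blast
    have lV: "likely (e / 4) (\<lambda>n \<omega>. \<forall>v\<in>V. \<bar>Gn n v \<omega> - v \<bullet> Sn n \<omega> - v \<bullet> (\<Lambda> *v v) / 2\<bar> \<le> \<delta>)"
      by (rule likely_ball_finite[OF V(1)]) (use e linearization[OF scaled_expansion \<delta>] in auto)
    from likely_conj[OF likely_conj[OF B0(2) B1(2)] likely_conj[OF lt lV]]
    show ?thesis
    proof (rule likely_mono[where N="max 1 N"], intro ballI allI impI)
      fix n \<omega> \<theta> h
      assume n: "max 1 N \<le> n" and \<theta>: "\<theta> \<in> cball \<mu> r1" and min: "\<forall>\<theta>'. (\<Sum>i<n. f (X i \<omega>) \<theta>) \<le> (\<Sum>i<n. f (X i \<omega>) \<theta>')"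
        and h: "\<Lambda> *v h = - Sn n \<omega>"
        and *: "((\<forall>\<theta>\<in>cball \<mu> r1. (\<Sum>i<n. f (X i \<omega>) \<theta>) \<le> (\<Sum>i<n. f (X i \<omega>) \<mu>) \<longrightarrow> sqrt (real n) * norm (\<theta> - \<mu>) \<le> B0) \<and>
          norm (Sn n \<omega>) \<le> B1) \<and> (\<Sum>i<n. \<rho> (X i \<omega>) p) < real n * t \<and>
          (\<forall>v\<in>V. \<bar>Gn n v \<omega> - v \<bullet> Sn n \<omega> - v \<bullet> (\<Lambda> *v v) / 2\<bar> \<le> \<delta>)"
      define x where "x = sqrt (real n) *\<^sub>R (\<theta> - \<mu>)"
      define s where "s = 1 / sqrt (real n)"
      have s: "s > 0" "s\<^sup>2 * real n = 1" using n by (auto simp: s_def power_divide)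
      have \<theta>x: "\<mu> + s *\<^sub>R x = \<theta>" using n by (simp add: x_def s_def)
      have "norm x \<le> B0" using * \<theta> min by (simp add: x_def)
      then have xR: "x \<in> cball 0 R" by (simp add: R_def)
      have hR: "h \<in> cball 0 R"
      proof (cases "h = 0")
        case False
        have "\<beta> * (norm h)\<^sup>2 \<le> h \<bullet> (\<Lambda> *v h)" by (rule coercive(2))
        also have "\<dots> \<le> norm h * norm (- Sn n \<omega>)" unfolding h by (rule norm_cauchy_schwarz)
        also have "\<dots> \<le> norm h * B1" using * by (intro mult_left_mono) auto
        finally have "norm h * (\<beta> * norm h) \<le> norm h * B1" by (simp add: power2_eq_square mult_ac)
        then have "\<beta> * norm h \<le> B1" using False by simp
        then have "norm h \<le> B1 / \<beta>" using coercive(1) by (simp add: field_simps)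
        then show ?thesis by (simp add: R_def)
      qed (use R in simp)
      have Vr: "\<mu> + s *\<^sub>R v \<in> cball \<mu> r" if v: "v \<in> V" for v
      proof -
        have "((R + \<epsilon>) / r)\<^sup>2 \<le> real n" using N n by simp
        then have "(R + \<epsilon>) / r \<le> sqrt (real n)" by (rule real_le_rsqrt)
        then have "R + \<epsilon> \<le> r * sqrt (real n)" using r_pos by (simp add: field_simps)
        then have "norm v \<le> r * sqrt (real n)" using VR[OF v] by simp
        then show ?thesis using n by (simp add: s_def dist_norm field_simps)
      qed
      define q where "q v = v \<bullet> Sn n \<omega> + v \<bullet> (\<Lambda> *v v) / 2" for v
      have q: "q v = q h + (v - h) \<bullet> (\<Lambda> *v (v - h)) / 2" for v
        unfolding q_def by (rule quadratic_at_minimizer[OF h])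
      have Gq: "\<bar>Gn n v \<omega> - q v\<bar> \<le> \<delta>" if "v \<in> V" for v
        using * that unfolding q_def diff_diff_add by blast
      \<comment> \<open>The linearization holds at the fixed net points, while \<open>h\<close> is
        random. The comparison is therefore made with a net point next to \<open>h\<close>, at the
        cost \<open>L / 2 * \<epsilon>^2\<close>.\<close>
      have upper: "Gn n x \<omega> \<le> q h + L / 2 * \<epsilon>\<^sup>2 + \<delta>"
      proof -
        have "V \<inter> cball h \<epsilon> \<noteq> {}" using V(2)[OF hR] by auto
        then obtain v where v: "v \<in> V" "norm (v - h) \<le> \<epsilon>" by (auto simp: dist_norm norm_minus_commute)
        have "Gn n x \<omega> \<le> Gn n v \<omega>"
          unfolding Gn_def s_def[symmetric] \<theta>x using min by (simp add: sum_subtractf)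
        moreover have "(v - h) \<bullet> (\<Lambda> *v (v - h)) \<le> L * \<epsilon>\<^sup>2"
          by (rule order_trans[OF L mult_left_mono[OF power_mono[OF v(2)]]]) (use L0 in auto)
        ultimately show ?thesis using Gq[OF v(1)] q[of v] by (simp add: abs_le_iff field_simps)
      qed
      show "norm (sqrt (real n) *\<^sub>R (\<theta> - \<mu>) - h) \<le> \<eta>"
      proof (rule ccontr)
        assume "\<not> norm (sqrt (real n) *\<^sub>R (\<theta> - \<mu>) - h) \<le> \<eta>"
        then have far: "norm (x - h) > \<eta>" by (simp add: x_def)
        \<comment> \<open>The net vectors around \<open>x\<close> are still at distance
          \<open>\<eta> / 2\<close> from \<open>h\<close>, so coercivity raises the form there by
          \<open>\<beta> * \<eta>^2 / 8\<close>; semiconcavity carries this lower bound over to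
          \<open>x\<close>.\<close>
        have "(q h + \<beta> * \<eta>\<^sup>2 / 8 - \<delta>) - s\<^sup>2 * real n * (K * (1 + t)) / 2 * \<epsilon>\<^sup>2 \<le> (\<Sum>i<n. f (X i \<omega>) (\<mu> + s *\<^sub>R x) - f (X i \<omega>) \<mu>)"
        proof (rule scaled_lower_bound[OF s(1) Vr V(2)[OF xR]])
          fix v assume v: "v \<in> V" "norm (v - x) \<le> \<epsilon>"
          have "norm (x - h) \<le> norm (v - x) + norm (v - h)"
            using norm_triangle_ineq[of "x - v" "v - h"] by (simp add: norm_minus_commute)
          then have "\<eta> / 2 \<le> norm (v - h)" using far v(2) \<epsilon>(2) by simp
          then have "(\<eta> / 2)\<^sup>2 \<le> (norm (v - h))\<^sup>2" using \<eta> by (intro power_mono) auto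
          then have "\<beta> * (\<eta> / 2)\<^sup>2 \<le> \<beta> * (norm (v - h))\<^sup>2" using coercive(1) by (intro mult_left_mono) auto
          also have "\<dots> \<le> (v - h) \<bullet> (\<Lambda> *v (v - h))" by (rule coercive(2))
          finally have "q h + \<beta> * \<eta>\<^sup>2 / 8 \<le> q v" using q[of v] by (simp add: power_divide)
          then have "q h + \<beta> * \<eta>\<^sup>2 / 8 - \<delta> \<le> Gn n v \<omega>" using Gq[OF v(1)] by (simp add: abs_le_iff)
          then show "q h + \<beta> * \<eta>\<^sup>2 / 8 - \<delta> \<le> (\<Sum>i<n. f (X i \<omega>) (\<mu> + s *\<^sub>R v) - f (X i \<omega>) \<mu>)"
            by (simp add: Gn_def s_def)
        qed (use * \<epsilon> in auto)
        also have "\<dots> = Gn n x \<omega>" by (simp add: Gn_def s_def)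
        also note upper
        finally have "\<beta> * \<eta>\<^sup>2 / 8 \<le> 2 * \<delta> + (\<kappa> + L) * \<epsilon>\<^sup>2 / 2" unfolding s(2) by (simp add: \<kappa>_def field_simps)
        moreover have "\<beta> * \<eta>\<^sup>2 > 0" using \<eta> coercive(1) by simp
        ultimately show False using \<epsilon>2 unfolding \<delta>_def by linarith
      qed
    qed (use e in simp)
  qed
  from r1(1) main show thesis by (rule that)
qed

end

section \<open>Hessians at a minimum\<close>

lemma has_derivative_grad:
  fixes f :: "real ^ 'd::finite \<Rightarrow> real"
  assumes "f differentiable (at x)"
  shows "(f has_derivative (\<lambda>v. v \<bullet> grad f x)) (at x)"
proof -
  obtain f' where f': "(f has_derivative f') (at x)" using assms by (auto simp: differentiable_def)
  interpret f': bounded_linear f' by (rule has_derivative_bounded_linear[OF f'])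
  have p: "partial_deriv r f x = f' (axis r 1)" for r
  proof -
    have "((\<lambda>t::real. x + t *\<^sub>R axis r 1) has_derivative (\<lambda>t. t *\<^sub>R axis r 1)) (at 0)"
      by (auto intro!: derivative_eq_intros)
    then have "((\<lambda>t::real. f (x + t *\<^sub>R axis r 1)) has_derivative (\<lambda>t. f' (t *\<^sub>R axis r 1))) (at 0)"
      by (rule has_derivative_compose) (simp add: f')
    then have "((\<lambda>t::real. f (x + t *\<^sub>R axis r 1)) has_field_derivative f' (axis r 1)) (at 0)"
      by (rule has_derivative_imp_has_field_derivative) (simp add: f'.scaleR)
    then show ?thesis unfolding partial_deriv_def by (rule DERIV_imp_deriv)
  qed
  have "f' v = v \<bullet> grad f x" for v
  proof -
    have "f' v = f' (\<Sum>r\<in>UNIV. (v $ r) *\<^sub>R axis r 1)"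
      using basis_expansion[of v] by (simp add: scalar_mult_eq_scaleR)
    also have "\<dots> = v \<bullet> grad f x" by (simp add: f'.sum f'.scaleR inner_vec_def grad_def p)
    finally show ?thesis .
  qed
  then have "f' = (\<lambda>v. v \<bullet> grad f x)" by (rule ext)
  with f' show ?thesis by simp
qed

lemma has_hessianD:
  assumes "has_hessian f H x" and "\<epsilon> > 0"
  shows "\<exists>\<delta>>0. \<forall>h. norm h \<le> \<delta> \<longrightarrow> (f has_derivative (\<lambda>v. v \<bullet> grad f (x + h))) (at (x + h)) \<and>
    norm (grad f (x + h) - grad f x - H *v h) \<le> \<epsilon> * norm h"
proof -
  obtain d1 where d1: "d1 > 0" "\<And>y. dist y x < d1 \<Longrightarrow> f differentiable (at y)"
    using assms(1) unfolding has_hessian_def eventually_nhds_metric by blast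
  have "(grad f has_derivative (\<lambda>v. H *v v)) (at x)" using assms(1) unfolding has_hessian_def by blast
  from this[unfolded has_derivative_at_alt, THEN conjunct2, rule_format, OF \<open>\<epsilon> > 0\<close>]
  obtain d2 where d2: "d2 > 0" "\<And>y. norm (y - x) < d2 \<Longrightarrow> norm (grad f y - grad f x - H *v (y - x)) \<le> \<epsilon> * norm (y - x)"
    by blast
  show ?thesis
  proof (intro exI[of _ "min d1 d2 / 2"] conjI allI impI)
    fix h :: "real ^ 'a" assume h: "norm h \<le> min d1 d2 / 2"
    have "norm h < d1" "norm h < d2" using h d1(1) d2(1) by linarith+
    then show "(f has_derivative (\<lambda>v. v \<bullet> grad f (x + h))) (at (x + h))"
      using d1(2)[of "x + h"] by (intro has_derivative_grad) (simp add: dist_norm)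
    show "norm (grad f (x + h) - grad f x - H *v h) \<le> \<epsilon> * norm h"
      using d2(2)[of "x + h"] \<open>norm h < d2\<close> by simp
  qed (use d1(1) d2(1) in auto)
qed

text \<open>Mean value theorem along the segment for \<open>f\<close> minus its quadratic part;
  differentiability of the gradient at the single point \<open>x\<close> controls the derivative
  there.\<close>

lemma has_hessian_expansion:
  assumes H: "has_hessian f H x" and crit: "grad f x = 0" and \<epsilon>: "\<epsilon> > 0"
  shows "\<exists>\<delta>>0. \<forall>h. norm h \<le> \<delta> \<longrightarrow> \<bar>f (x + h) - f x - h \<bullet> (H *v h) / 2\<bar> \<le> \<epsilon> * (norm h)\<^sup>2"
proof -
  obtain \<delta> where \<delta>: "\<delta> > 0" "\<And>h. norm h \<le> \<delta> \<Longrightarrow> (f has_derivative (\<lambda>v. v \<bullet> grad f (x + h))) (at (x + h))"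
    "\<And>h. norm h \<le> \<delta> \<Longrightarrow> norm (grad f (x + h) - grad f x - H *v h) \<le> \<epsilon> * norm h"
    using has_hessianD[OF H \<epsilon>] by blast
  have "\<bar>f (x + h) - f x - h \<bullet> (H *v h) / 2\<bar> \<le> \<epsilon> * (norm h)\<^sup>2" if h: "norm h \<le> \<delta>" for h
  proof -
    define \<phi> where "\<phi> t = f (x + t *\<^sub>R h) - t\<^sup>2 / 2 * (h \<bullet> (H *v h))" for t
    have th: "norm (t *\<^sub>R h) \<le> \<delta>" if "0 \<le> t" "t \<le> 1" for t
      using mult_right_mono[OF that(2), of "norm h"] that h by simp
    have d: "(\<phi> has_real_derivative h \<bullet> (grad f (x + t *\<^sub>R h) - H *v (t *\<^sub>R h))) (at t)" if t: "0 \<le> t" "t \<le> 1" for t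
    proof -
      have "((\<lambda>t. x + t *\<^sub>R h) has_derivative (\<lambda>t. t *\<^sub>R h)) (at t)"
        by (auto intro!: derivative_eq_intros)
      from has_derivative_compose[OF this \<delta>(2)[OF th[OF t]]]
      have "((\<lambda>t. f (x + t *\<^sub>R h)) has_real_derivative h \<bullet> grad f (x + t *\<^sub>R h)) (at t)"
        by (rule has_derivative_imp_has_field_derivative) simp
      then show ?thesis unfolding \<phi>_def
        by (auto intro!: derivative_eq_intros simp: inner_diff_right matrix_vector_mult_scaleR)
    qed
    obtain t where t: "0 < t" "t < 1" "\<phi> 1 - \<phi> 0 = (1 - 0) * (h \<bullet> (grad f (x + t *\<^sub>R h) - H *v (t *\<^sub>R h)))"
      using MVT2[of 0 1 \<phi> "\<lambda>t. h \<bullet> (grad f (x + t *\<^sub>R h) - H *v (t *\<^sub>R h))"] d by auto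
    have "\<bar>\<phi> 1 - \<phi> 0\<bar> \<le> norm h * norm (grad f (x + t *\<^sub>R h) - H *v (t *\<^sub>R h))"
      unfolding t(3) by (simp add: Cauchy_Schwarz_ineq2)
    also have "\<dots> \<le> norm h * (\<epsilon> * norm (t *\<^sub>R h))"
      using \<delta>(3)[OF th[of t]] t crit by (intro mult_left_mono) auto
    also have "\<dots> \<le> norm h * (\<epsilon> * norm h)"
      using t \<epsilon> by (intro mult_left_mono) (auto simp: mult_left_le_one_le)
    finally show ?thesis by (simp add: \<phi>_def power2_eq_square mult_ac)
  qed
  with \<delta>(1) show ?thesis by blast
qed

text \<open>Mean value theorem in direction \<open>h\<close> for the increment of \<open>f\<close>
  in direction \<open>k\<close>. The mixed difference is symmetric in \<open>h\<close> and
  \<open>k\<close>, which is the source of the symmetry of the Hessian.\<close>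

lemma has_hessian_mixed_difference:
  assumes H: "has_hessian f H x" and \<epsilon>: "\<epsilon> > 0"
  obtains \<delta> where "\<delta> > 0" "\<And>h k. norm h + norm k \<le> \<delta> \<Longrightarrow>
    \<bar>(f (x + h + k) - f (x + h) - f (x + k) + f x) - h \<bullet> (H *v k)\<bar> \<le> \<epsilon> * norm h * (norm h + norm k)"
proof -
  obtain \<delta> where \<delta>: "\<delta> > 0" "\<And>h. norm h \<le> \<delta> \<Longrightarrow> (f has_derivative (\<lambda>v. v \<bullet> grad f (x + h))) (at (x + h))"
    "\<And>h. norm h \<le> \<delta> \<Longrightarrow> norm (grad f (x + h) - grad f x - H *v h) \<le> \<epsilon> / 2 * norm h"
    using has_hessianD[OF H half_gt_zero[OF \<epsilon>]] by blast
  have "\<bar>(f (x + h + k) - f (x + h) - f (x + k) + f x) - h \<bullet> (H *v k)\<bar> \<le> \<epsilon> * norm h * (norm h + norm k)"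
    if hk: "norm h + norm k \<le> \<delta>" for h k
  proof -
    define \<phi> where "\<phi> t = f (x + (t *\<^sub>R h + k)) - f (x + t *\<^sub>R h) - t * (h \<bullet> (H *v k))" for t
    let ?D = "\<lambda>t. h \<bullet> (grad f (x + (t *\<^sub>R h + k)) - grad f (x + t *\<^sub>R h) - H *v k)"
    have th: "norm (t *\<^sub>R h) \<le> norm h" "norm (t *\<^sub>R h + k) \<le> norm h + norm k" if "0 \<le> t" "t \<le> 1" for t
    proof -
      show *: "norm (t *\<^sub>R h) \<le> norm h" using that by (simp add: mult_left_le_one_le)
      show "norm (t *\<^sub>R h + k) \<le> norm h + norm k" using norm_triangle_ineq[of "t *\<^sub>R h" k] * by linarith
    qed
    have th\<delta>: "norm (t *\<^sub>R h) \<le> \<delta>" "norm (t *\<^sub>R h + k) \<le> \<delta>" if "0 \<le> t" "t \<le> 1" for t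
      using th[OF that] hk norm_ge_zero[of k] by linarith+
    have d: "(\<phi> has_real_derivative ?D t) (at t)" if t: "0 \<le> t" "t \<le> 1" for t
    proof -
      have "((\<lambda>t. x + t *\<^sub>R h) has_derivative (\<lambda>t. t *\<^sub>R h)) (at t)" "((\<lambda>t. x + (t *\<^sub>R h + k)) has_derivative (\<lambda>t. t *\<^sub>R h)) (at t)"
        by (auto intro!: derivative_eq_intros)
      note * = has_derivative_compose[OF this(1) \<delta>(2)[OF th\<delta>(1)[OF t]]] has_derivative_compose[OF this(2) \<delta>(2)[OF th\<delta>(2)[OF t]]]
      have "((\<lambda>t. f (x + t *\<^sub>R h)) has_real_derivative h \<bullet> grad f (x + t *\<^sub>R h)) (at t)"
        by (rule has_derivative_imp_has_field_derivative[OF *(1)]) simp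
      moreover have "((\<lambda>t. f (x + (t *\<^sub>R h + k))) has_real_derivative h \<bullet> grad f (x + (t *\<^sub>R h + k))) (at t)"
        by (rule has_derivative_imp_has_field_derivative[OF *(2)]) simp
      ultimately show ?thesis unfolding \<phi>_def
        by (auto intro!: derivative_eq_intros simp: inner_diff_right)
    qed
    obtain t where t: "0 < t" "t < 1" "\<phi> 1 - \<phi> 0 = (1 - 0) * ?D t"
      using MVT2[of 0 1 \<phi> ?D] d by auto
    have "\<bar>\<phi> 1 - \<phi> 0\<bar> \<le> norm h * norm (grad f (x + (t *\<^sub>R h + k)) - grad f (x + t *\<^sub>R h) - H *v k)"
      unfolding t(3) by (simp add: Cauchy_Schwarz_ineq2)
    also have "\<dots> \<le> norm h * (\<epsilon> * (norm h + norm k))"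
    proof (rule mult_left_mono)
      have "grad f (x + (t *\<^sub>R h + k)) - grad f (x + t *\<^sub>R h) - H *v k =
          (grad f (x + (t *\<^sub>R h + k)) - grad f x - H *v (t *\<^sub>R h + k)) - (grad f (x + t *\<^sub>R h) - grad f x - H *v (t *\<^sub>R h))"
        by (simp add: matrix_vector_right_distrib)
      also have "norm \<dots> \<le> \<epsilon> / 2 * norm (t *\<^sub>R h + k) + \<epsilon> / 2 * norm (t *\<^sub>R h)"
        using t by (intro norm_triangle_le_diff add_mono \<delta>(3) th\<delta>) auto
      also have "\<dots> \<le> \<epsilon> / 2 * (norm h + norm k) + \<epsilon> / 2 * (norm h + norm k)"
        using th[of t] t \<epsilon> by (intro add_mono mult_left_mono) (auto intro: order_trans)
      finally show "norm (grad f (x + (t *\<^sub>R h + k)) - grad f (x + t *\<^sub>R h) - H *v k) \<le> \<epsilon> * (norm h + norm k)"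
        by (simp add: field_simps)
    qed simp
    also have "\<phi> 1 - \<phi> 0 = (f (x + h + k) - f (x + h) - f (x + k) + f x) - h \<bullet> (H *v k)"
      by (simp add: \<phi>_def add.assoc)
    finally show ?thesis by (simp add: mult_ac)
  qed
  with \<delta>(1) show thesis by (rule that)
qed

text \<open>Scaled by \<open>s\<close>, both bilinear expressions approximate the same mixed
  difference up to \<open>\<epsilon> s^2\<close>, so a fixed discrepancy, which scales as
  \<open>s^2\<close> as well, is impossible for small \<open>\<epsilon>\<close>.\<close>

lemma has_hessian_symmetric:
  assumes H: "has_hessian f H x"
  shows "transpose H = H"
proof -
  have sym: "u \<bullet> (H *v v) = v \<bullet> (H *v u)" for u v
  proof (rule ccontr)
    define c where "c = norm u + norm v + 1"
    have c: "c > 0" by (simp add: c_def add_nonneg_pos)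
    assume "u \<bullet> (H *v v) \<noteq> v \<bullet> (H *v u)"
    then have gap: "\<bar>u \<bullet> (H *v v) - v \<bullet> (H *v u)\<bar> > 0" by simp
    define \<epsilon> where "\<epsilon> = \<bar>u \<bullet> (H *v v) - v \<bullet> (H *v u)\<bar> / (2 * c\<^sup>2)"
    have "\<epsilon> > 0" using gap c by (simp add: \<epsilon>_def)
    then obtain \<delta> where \<delta>: "\<delta> > 0" "\<And>h k. norm h + norm k \<le> \<delta> \<Longrightarrow>
        \<bar>(f (x + h + k) - f (x + h) - f (x + k) + f x) - h \<bullet> (H *v k)\<bar> \<le> \<epsilon> * norm h * (norm h + norm k)"
      using has_hessian_mixed_difference[OF H] by blast
    define s where "s = \<delta> / c"
    have s: "s > 0" using \<delta>(1) c by (simp add: s_def)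
    have n: "norm (s *\<^sub>R u) + norm (s *\<^sub>R v) \<le> \<delta>"
    proof -
      have "s * (norm u + norm v) \<le> s * c" using s by (intro mult_left_mono) (auto simp: c_def)
      moreover have "s * c = \<delta>" using c by (simp add: s_def)
      ultimately show ?thesis using s by (simp add: distrib_left)
    qed
    let ?D = "f (x + s *\<^sub>R u + s *\<^sub>R v) - f (x + s *\<^sub>R u) - f (x + s *\<^sub>R v) + f x"
    have 1: "\<bar>?D - (s *\<^sub>R u) \<bullet> (H *v (s *\<^sub>R v))\<bar> \<le> \<epsilon> * norm (s *\<^sub>R u) * (norm (s *\<^sub>R u) + norm (s *\<^sub>R v))"
      by (rule \<delta>(2)[OF n])
    have D: "?D = f (x + s *\<^sub>R v + s *\<^sub>R u) - f (x + s *\<^sub>R v) - f (x + s *\<^sub>R u) + f x" by (simp add: add_ac)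
    have 2: "\<bar>?D - (s *\<^sub>R v) \<bullet> (H *v (s *\<^sub>R u))\<bar> \<le> \<epsilon> * norm (s *\<^sub>R v) * (norm (s *\<^sub>R v) + norm (s *\<^sub>R u))"
      unfolding D using n by (intro \<delta>(2)) (simp only: add.commute)
    have "\<bar>(s *\<^sub>R u) \<bullet> (H *v (s *\<^sub>R v)) - (s *\<^sub>R v) \<bullet> (H *v (s *\<^sub>R u))\<bar> \<le>
        \<epsilon> * norm (s *\<^sub>R u) * (norm (s *\<^sub>R u) + norm (s *\<^sub>R v)) + \<epsilon> * norm (s *\<^sub>R v) * (norm (s *\<^sub>R v) + norm (s *\<^sub>R u))"
      using 1 2 by linarith
    also have "\<dots> = s\<^sup>2 * (\<epsilon> * (norm u + norm v)\<^sup>2)" using s by (simp add: power2_eq_square algebra_simps)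
    also have "(s *\<^sub>R u) \<bullet> (H *v (s *\<^sub>R v)) - (s *\<^sub>R v) \<bullet> (H *v (s *\<^sub>R u)) = s\<^sup>2 * (u \<bullet> (H *v v) - v \<bullet> (H *v u))"
      by (simp add: matrix_vector_mult_scaleR power2_eq_square algebra_simps)
    also have "\<bar>\<dots>\<bar> = s\<^sup>2 * \<bar>u \<bullet> (H *v v) - v \<bullet> (H *v u)\<bar>" by (simp add: abs_mult)
    finally have "\<bar>u \<bullet> (H *v v) - v \<bullet> (H *v u)\<bar> \<le> \<epsilon> * (norm u + norm v)\<^sup>2" using s by simp
    also have "\<dots> \<le> \<epsilon> * c\<^sup>2" using \<open>\<epsilon> > 0\<close> by (intro mult_left_mono power_mono) (auto simp: c_def)
    also have "\<dots> = \<bar>u \<bullet> (H *v v) - v \<bullet> (H *v u)\<bar> / 2" using c by (simp add: \<epsilon>_def)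
    finally show False using gap by simp
  qed
  have "H $ i $ j = H $ j $ i" for i j
    using sym[of "axis i 1" "axis j 1"] by (simp add: inner_axis' matrix_vector_mult_basis column_def)
  then show ?thesis by (simp add: transpose_def vec_eq_iff)
qed

lemma symmetric_matrix_inner:
  fixes H :: "real ^ 'd::finite ^ 'd"
  assumes "transpose H = H"
  shows "u \<bullet> (H *v v) = v \<bullet> (H *v u)"
  using dot_lmul_matrix[of u H v] transpose_matrix_vector[of H u] assms by (simp add: inner_commute)

text \<open>If the form vanishes at \<open>h\<close>, moving from \<open>h\<close> by
  \<open>- t\<close> times \<open>w = H *v h\<close> changes it by
  \<open>t * (t * a - 2 * (w \<bullet> w))\<close>, which is negative for small positive
  \<open>t\<close> unless \<open>w = 0\<close>.\<close>

lemma psd_invertible_imp_positive_definite: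
  fixes H :: "real ^ 'd::finite ^ 'd"
  assumes sym: "transpose H = H" and psd: "\<And>h. 0 \<le> h \<bullet> (H *v h)" and inv: "invertible H" and "h \<noteq> 0"
  shows "0 < h \<bullet> (H *v h)"
proof (rule ccontr)
  assume "\<not> 0 < h \<bullet> (H *v h)"
  then have 0: "h \<bullet> (H *v h) = 0" using psd[of h] by linarith
  define w where "w = H *v h"
  define a where "a = w \<bullet> (H *v w)"
  have a: "a \<ge> 0" using psd[of w] by (simp add: a_def)
  have "w = 0"
  proof (rule ccontr)
    assume "w \<noteq> 0"
    \<comment> \<open>The summand 1 keeps the denominator positive, and the choice ensures
      \<open>t * a \<le> w \<bullet> w\<close>.\<close>
    define t where "t = (w \<bullet> w) / (a + 1)"
    have t: "t > 0" using a \<open>w \<noteq> 0\<close> by (simp add: t_def)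
    have "t * a \<le> t * (a + 1)" using t by (intro mult_left_mono) auto
    also have "\<dots> = w \<bullet> w" using a by (simp add: t_def)
    finally have ta: "t * a \<le> w \<bullet> w" .
    have "(h - t *\<^sub>R w) \<bullet> (H *v (h - t *\<^sub>R w)) = t * (t * a - 2 * (w \<bullet> w))"
      using symmetric_matrix_inner[OF sym, of h w] 0
      by (simp add: a_def w_def[symmetric] matrix_vector_mult_diff_distrib matrix_vector_mult_scaleR inner_diff_left inner_diff_right algebra_simps)
    then have "0 \<le> t * (t * a - 2 * (w \<bullet> w))" using psd[of "h - t *\<^sub>R w"] by simp
    then have "2 * (w \<bullet> w) \<le> t * a" using t by (simp add: zero_le_mult_iff)
    then show False using ta \<open>w \<noteq> 0\<close> inner_gt_zero_iff[of w] by linarith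
  qed
  obtain H' where "H' ** H = mat 1" using inv unfolding invertible_def by blast
  then have "h = H' *v w" by (simp add: w_def matrix_vector_mul_assoc)
  then show False using \<open>w = 0\<close> \<open>h \<noteq> 0\<close> by simp
qed

lemma positive_definite_coercive:
  fixes H :: "real ^ 'd::finite ^ 'd"
  assumes pd: "\<And>h. h \<noteq> 0 \<Longrightarrow> 0 < h \<bullet> (H *v h)"
  obtains c where "c > 0" "\<And>h. c * (norm h)\<^sup>2 \<le> h \<bullet> (H *v h)"
proof -
  have "continuous_on (sphere 0 1) (\<lambda>h. h \<bullet> (H *v h))"
    by (intro continuous_intros linear_continuous_on matrix_vector_mul_bounded_linear)
  moreover have "sphere (0 :: real ^ 'd) 1 \<noteq> {}" by simp
  ultimately obtain m where m: "m \<in> sphere 0 1" "\<And>h. h \<in> sphere 0 1 \<Longrightarrow> m \<bullet> (H *v m) \<le> h \<bullet> (H *v h)"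
    using continuous_attains_inf[OF compact_sphere] by blast
  show thesis
  proof (rule that[of "m \<bullet> (H *v m)"])
    show "m \<bullet> (H *v m) > 0" using m(1) by (intro pd) auto
    fix h :: "real ^ 'd"
    show "m \<bullet> (H *v m) * (norm h)\<^sup>2 \<le> h \<bullet> (H *v h)"
    proof (cases "h = 0")
      case False
      have "m \<bullet> (H *v m) \<le> ((1 / norm h) *\<^sub>R h) \<bullet> (H *v ((1 / norm h) *\<^sub>R h))" using False by (intro m(2)) simp
      also have "\<dots> = (h \<bullet> (H *v h)) / (norm h)\<^sup>2" by (simp add: matrix_vector_mult_scaleR power2_eq_square)
      finally show ?thesis using False by (simp add: pos_le_divide_eq)
    qed simp
  qed
qed

text \<open>The second order necessary condition makes the matrix semidefinite, and nonsingularity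
  makes it definite.\<close>

lemma has_hessian_minimum:
  assumes H: "has_hessian f H x" and inv: "invertible H" and min: "\<And>y. f x \<le> f y"
  shows "grad f x = 0" "\<And>h. h \<noteq> 0 \<Longrightarrow> 0 < h \<bullet> (H *v h)"
proof -
  have "(f has_derivative (\<lambda>v. v \<bullet> grad f x)) (at x)"
    using H unfolding has_hessian_def by (intro has_derivative_grad) (auto dest: eventually_nhds_x_imp_x)
  from differential_zero_maxmin[OF UNIV_I open_UNIV this]
  have "(\<lambda>v. v \<bullet> grad f x) = (\<lambda>v. 0)" using min by blast
  then have "grad f x \<bullet> grad f x = 0" by metis
  then show crit: "grad f x = 0" by simp
  have psd: "0 \<le> h \<bullet> (H *v h)" for h
  proof (rule ccontr)
    assume neg: "\<not> 0 \<le> h \<bullet> (H *v h)"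
    then have "h \<noteq> 0" by auto
    \<comment> \<open>The error then eats up half of the negative second order term, so the
      increment along \<open>h\<close> would stay negative.\<close>
    define \<epsilon> where "\<epsilon> = - (h \<bullet> (H *v h)) / (4 * (norm h)\<^sup>2)"
    have "\<epsilon> > 0" using neg \<open>h \<noteq> 0\<close> by (simp add: \<epsilon>_def divide_simps)
    from has_hessian_expansion[OF H crit this]
    obtain \<delta> where \<delta>: "\<delta> > 0" "\<And>h. norm h \<le> \<delta> \<Longrightarrow> \<bar>f (x + h) - f x - h \<bullet> (H *v h) / 2\<bar> \<le> \<epsilon> * (norm h)\<^sup>2" by blast
    define s where "s = \<delta> / norm h"
    have s: "s > 0" "norm (s *\<^sub>R h) \<le> \<delta>" using \<delta>(1) \<open>h \<noteq> 0\<close> by (auto simp: s_def)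
    have "0 \<le> (s *\<^sub>R h) \<bullet> (H *v (s *\<^sub>R h)) / 2 + \<epsilon> * (norm (s *\<^sub>R h))\<^sup>2"
      using \<delta>(2)[OF s(2)] min[of "x + s *\<^sub>R h"] by linarith
    also have "\<dots> = s\<^sup>2 * (h \<bullet> (H *v h) / 2 + \<epsilon> * (norm h)\<^sup>2)"
      by (simp add: matrix_vector_mult_scaleR power2_eq_square algebra_simps)
    also have "h \<bullet> (H *v h) / 2 + \<epsilon> * (norm h)\<^sup>2 = h \<bullet> (H *v h) / 4" using \<open>h \<noteq> 0\<close> by (simp add: \<epsilon>_def)
    finally show False using s(1) neg by (simp add: zero_le_mult_iff)
  qed
  show "0 < h \<bullet> (H *v h)" if "h \<noteq> 0" for h
    by (rule psd_invertible_imp_positive_definite[OF has_hessian_symmetric[OF H] psd inv that])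
qed

section \<open>The central limit theorem for intrinsic means\<close>

text \<open>Slutsky's argument for bounded Lipschitz test functions: off an event of small
  probability the values differ by at most \<open>\<bar>L\<bar> * \<eta>\<close>, on it by at most
  \<open>2 * B\<close>.\<close>

lemma (in prob_space) expectation_Lipschitz_diff_tendsto_0:
  fixes Y Z :: "nat \<Rightarrow> 'a \<Rightarrow> 'b::{real_normed_vector, second_countable_topology}" and g :: "'b \<Rightarrow> real"
  assumes Y: "\<And>n. Y n \<in> borel_measurable M" and Z: "\<And>n. Z n \<in> borel_measurable M"
    and close: "\<And>e \<eta>. e > 0 \<Longrightarrow> \<eta> > 0 \<Longrightarrow> likely e (\<lambda>n \<omega>. norm (Y n \<omega> - Z n \<omega>) \<le> \<eta>)"
    and g: "g \<in> borel_measurable borel" "\<And>x. \<bar>g x\<bar> \<le> B" "\<And>x y. \<bar>g x - g y\<bar> \<le> L * norm (x - y)"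
  shows "(\<lambda>n. expectation (\<lambda>\<omega>. g (Y n \<omega>)) - expectation (\<lambda>\<omega>. g (Z n \<omega>))) \<longlonglongrightarrow> 0"
proof (rule LIMSEQ_I)
  fix e :: real assume e: "e > 0"
  have B: "B \<ge> 0" using g(2)[of undefined] by linarith
  have int: "integrable M (\<lambda>\<omega>. g (W \<omega>))" if "W \<in> borel_measurable M" for W
    by (rule integrable_const_bound[where B=B]) (use g that in auto)
  define \<eta> where "\<eta> = e / (4 * (\<bar>L\<bar> + 1))"
  define d where "d = e / (8 * (B + 1))"
  have pos: "\<eta> > 0" "d > 0" using e B by (auto simp: \<eta>_def d_def)
  have L\<eta>: "\<bar>L\<bar> * \<eta> \<le> e / 4"
  proof -
    have "\<bar>L\<bar> * \<eta> \<le> (\<bar>L\<bar> + 1) * \<eta>" using pos by (intro mult_right_mono) auto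
    also have "\<dots> = e / 4" by (simp add: \<eta>_def nonzero_divide_eq_eq abs_add_one_gt_zero[THEN less_imp_neq, symmetric] add.commute)
    finally show ?thesis .
  qed
  have Bd: "2 * B * d \<le> e / 4"
  proof -
    have "2 * B * d \<le> 2 * (B + 1) * d" using pos by (intro mult_right_mono) auto
    also have "\<dots> = e / 4" using B by (simp add: d_def nonzero_divide_eq_eq algebra_simps)
    finally show ?thesis .
  qed
  obtain n0 where n0: "\<And>n. n \<ge> n0 \<Longrightarrow> \<exists>E\<in>events. prob E \<le> d \<and> (\<forall>\<omega>\<in>space M - E. norm (Y n \<omega> - Z n \<omega>) \<le> \<eta>)"
    using close[OF pos(2,1)] unfolding likely_def by blast
  show "\<exists>n0. \<forall>n\<ge>n0. norm (expectation (\<lambda>\<omega>. g (Y n \<omega>)) - expectation (\<lambda>\<omega>. g (Z n \<omega>)) - 0) < e"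
  proof (intro exI[of _ n0] allI impI)
    fix n assume "n0 \<le> n"
    then obtain E where E: "E \<in> events" "prob E \<le> d" "\<And>\<omega>. \<omega> \<in> space M \<Longrightarrow> \<omega> \<notin> E \<Longrightarrow> norm (Y n \<omega> - Z n \<omega>) \<le> \<eta>"
      using n0[of n] by blast
    have iE: "integrable M (indicator E :: _ \<Rightarrow> real)" using E(1) by (intro integrable_real_indicator) (auto simp: emeasure_eq_measure)
    have "\<bar>expectation (\<lambda>\<omega>. g (Y n \<omega>)) - expectation (\<lambda>\<omega>. g (Z n \<omega>))\<bar> = \<bar>expectation (\<lambda>\<omega>. g (Y n \<omega>) - g (Z n \<omega>))\<bar>"
      using int Y Z by simp
    also have "\<dots> \<le> expectation (\<lambda>\<omega>. \<bar>g (Y n \<omega>) - g (Z n \<omega>)\<bar>)"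
      by (rule integral_abs_bound)
    also have "\<dots> \<le> expectation (\<lambda>\<omega>. \<bar>L\<bar> * \<eta> + 2 * B * indicator E \<omega>)"
    proof (rule integral_mono)
      show "integrable M (\<lambda>\<omega>. \<bar>g (Y n \<omega>) - g (Z n \<omega>)\<bar>)" using int Y Z by simp
      show "integrable M (\<lambda>\<omega>. \<bar>L\<bar> * \<eta> + 2 * B * indicator E \<omega>)" using iE by simp
      fix \<omega> assume "\<omega> \<in> space M"
      show "\<bar>g (Y n \<omega>) - g (Z n \<omega>)\<bar> \<le> \<bar>L\<bar> * \<eta> + 2 * B * indicator E \<omega>"
      proof (cases "\<omega> \<in> E")
        case True
        then show ?thesis using g(2)[of "Y n \<omega>"] g(2)[of "Z n \<omega>"] pos(1) by (simp add: abs_le_iff) (smt (verit) mult_nonneg_nonneg)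
      next
        case False
        have "\<bar>g (Y n \<omega>) - g (Z n \<omega>)\<bar> \<le> L * norm (Y n \<omega> - Z n \<omega>)" by (rule g(3))
        also have "\<dots> \<le> \<bar>L\<bar> * norm (Y n \<omega> - Z n \<omega>)" by (intro mult_right_mono) auto
        also have "\<dots> \<le> \<bar>L\<bar> * \<eta>" using E(3)[OF \<open>\<omega> \<in> space M\<close> False] by (intro mult_left_mono) auto
        finally show ?thesis using False by simp
      qed
    qed
    also have "\<dots> = \<bar>L\<bar> * \<eta> + 2 * B * prob E" using iE E(1) by (simp add: prob_space)
    also have "\<dots> \<le> e / 4 + 2 * B * d" using L\<eta> E(2) B by (intro add_mono mult_left_mono) auto
    also have "\<dots> < e" using Bd e by simp
    finally show "norm (expectation (\<lambda>\<omega>. g (Y n \<omega>)) - expectation (\<lambda>\<omega>. g (Z n \<omega>)) - 0) < e" by simp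
  qed
qed

lemma invertible_if_right_inverse:
  fixes A :: "real ^ 'd::finite ^ 'd"
  shows "A ** B = mat 1 \<Longrightarrow> invertible A"
  unfolding invertible_def using matrix_left_right_inverse by blast

lemma inner_matrix_transpose:
  fixes A :: "real ^ 'd::finite ^ 'd"
  shows "u \<bullet> (A *v v) = (transpose A *v u) \<bullet> v"
  using dot_lmul_matrix[of u A v] transpose_matrix_vector[of A u] by simp

context frechet_expansion
begin

lemma invertible_\<Lambda>: "invertible \<Lambda>"
proof -
  have "inj ((*v) \<Lambda>)"
  proof (rule injI)
    fix x y assume "\<Lambda> *v x = \<Lambda> *v y"
    then have "\<Lambda> *v (x - y) = 0" by (simp add: matrix_vector_mult_diff_distrib)
    then have "\<beta> * (norm (x - y))\<^sup>2 \<le> 0" using coercive(2)[of "x - y"] by simp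
    then show "x = y" using coercive(1) by (simp add: mult_le_0_iff)
  qed
  then obtain B where "B ** \<Lambda> = mat 1" using matrix_left_invertible_injective by blast
  then show ?thesis unfolding invertible_def using matrix_left_right_inverse by blast
qed

text \<open>The rescaled minimizer is close to \<open>- (J *v Sn n)\<close> in probability. With
  \<open>W\<close> whitening the limit covariance \<open>\<Gamma>\<close> and \<open>B\<close> its
  inverse, the claim reduces to convergence of standardized sums to the standard normal law,
  followed by the linear map \<open>B\<close>.\<close>

lemma minimizer_clt:
  fixes \<theta> :: "nat \<Rightarrow> 'w \<Rightarrow> real ^ 'd" and C :: "real ^ 'd ^ 'd"
  assumes C: "\<And>i j. C $ i $ j = (LINT x|Q. \<psi> x $ i * \<psi> x $ j)" "invertible C"
    and \<theta>_measurable: "\<And>n. n \<ge> 1 \<Longrightarrow> \<theta> n \<in> borel_measurable M"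
    and \<theta>: "\<And>s e. s > 0 \<Longrightarrow> e > 0 \<Longrightarrow> likely e (\<lambda>n \<omega>. \<theta> n \<omega> \<in> cball \<mu> s \<and>
      (\<forall>\<theta>'. (\<Sum>i<n. f (X i \<omega>) (\<theta> n \<omega>)) \<le> (\<Sum>i<n. f (X i \<omega>) \<theta>')))"
  shows "weakly_converges (\<lambda>n. distr M borel (\<lambda>\<omega>. sqrt (real n) *\<^sub>R (\<theta> n \<omega> - \<mu>)))
    (multivariate_normal 0 (matrix_inv \<Lambda> ** C ** matrix_inv (transpose \<Lambda>)))"
proof -
  define J where "J = matrix_inv \<Lambda>"
  have J: "\<Lambda> ** J = mat 1" "J ** \<Lambda> = mat 1" using invertible_matrix_inv[OF invertible_\<Lambda>] by (auto simp: J_def)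
  have Jsym: "transpose J = J"
  proof -
    have "transpose (J ** \<Lambda>) = mat 1" "transpose (\<Lambda> ** J) = mat 1" unfolding J by simp_all
    then have "\<Lambda> ** transpose J = mat 1" "transpose J ** \<Lambda> = mat 1" by (simp_all add: matrix_transpose_mul symmetric)
    then have "matrix_inv \<Lambda> = transpose J" by (rule matrix_inv_unique)
    then show ?thesis by (simp add: J_def)
  qed
  define \<Gamma> where "\<Gamma> = J ** C ** J"
  have quad: "integrable Q (\<lambda>x. \<psi> x $ i * \<psi> x $ j)" for i j
  proof -
    have "integrable Q (\<lambda>x. ((axis i 1 + axis j 1) \<bullet> \<psi> x)\<^sup>2 - (axis i 1 \<bullet> \<psi> x)\<^sup>2 - (axis j 1 \<bullet> \<psi> x)\<^sup>2)"
      by (intro Bochner_Integration.integrable_diff \<psi>_square_integrable)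
    then have "integrable Q (\<lambda>x. 2 * (\<psi> x $ i * \<psi> x $ j))"
      by (simp add: inner_axis' inner_add_left power2_eq_square algebra_simps)
    then show ?thesis by simp
  qed
  have Ch: "h \<bullet> (C *v h) = (LINT x|Q. (h \<bullet> \<psi> x)\<^sup>2)" for h
  proof -
    have "(h \<bullet> \<psi> x)\<^sup>2 = (\<Sum>i\<in>UNIV. \<Sum>j\<in>UNIV. (h $ i * h $ j) * (\<psi> x $ i * \<psi> x $ j))" for x
      by (simp add: power2_eq_square inner_vec_def sum_product mult_ac)
    then have "(LINT x|Q. (h \<bullet> \<psi> x)\<^sup>2) = (\<Sum>i\<in>UNIV. \<Sum>j\<in>UNIV. (h $ i * h $ j) * C $ i $ j)"
      using quad by (simp add: C(1))
    then show ?thesis by (simp add: inner_vec_def matrix_vector_mult_def sum_distrib_left mult_ac)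
  qed
  have Csym: "transpose C = C" by (simp add: transpose_def vec_eq_iff C(1) mult.commute)
  have Cpos: "0 < h \<bullet> (C *v h)" if "h \<noteq> 0" for h
    by (rule psd_invertible_imp_positive_definite[OF Csym _ C(2) that]) (simp add: Ch)
  have \<Gamma>sym: "transpose \<Gamma> = \<Gamma>"
    by (simp add: \<Gamma>_def matrix_transpose_mul Jsym Csym matrix_mul_assoc)
  have \<Gamma>pos: "0 < v \<bullet> (\<Gamma> *v v)" if "v \<noteq> 0" for v
  proof -
    have "J *v v \<noteq> 0"
    proof
      assume "J *v v = 0"
      then have "\<Lambda> *v (J *v v) = 0" by simp
      then show False using \<open>v \<noteq> 0\<close> by (simp add: matrix_vector_mul_assoc J)
    qed
    moreover have "v \<bullet> (\<Gamma> *v v) = (J *v v) \<bullet> (C *v (J *v v))"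
      using inner_matrix_transpose[of v J "C *v (J *v v)"]
      by (simp add: \<Gamma>_def Jsym matrix_vector_mul_assoc[symmetric])
    ultimately show ?thesis using Cpos by simp
  qed
  obtain W :: "real ^ 'd ^ 'd" where W: "W ** \<Gamma> ** transpose W = mat 1"
    using whitening_exists[OF \<Gamma>sym \<Gamma>pos] by blast
  have "invertible W" by (rule invertible_if_right_inverse[of _ "\<Gamma> ** transpose W"]) (simp add: W matrix_mul_assoc)
  define B where "B = matrix_inv W"
  have B: "W ** B = mat 1" "B ** W = mat 1" using invertible_matrix_inv[OF \<open>invertible W\<close>] by (auto simp: B_def)
  have "invertible B" using B unfolding invertible_def by blast
  have "transpose W ** transpose B = mat 1" using B(2) matrix_transpose_mul[of B W] by simp
  then have "\<Gamma> = (B ** W) ** \<Gamma> ** (transpose W ** transpose B)" by (simp add: B)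
  also have "\<dots> = B ** (W ** \<Gamma> ** transpose W) ** transpose B" by (simp add: matrix_mul_assoc)
  finally have \<Gamma>B: "\<Gamma> = B ** transpose B" by (simp add: W)
  have normal: "multivariate_normal 0 \<Gamma> = distr std_gauss borel ((*v) B)"
    by (rule multivariate_normal_eq_distr[OF \<open>invertible B\<close> \<Gamma>B])
  define D where "D = W ** J"
  \<comment> \<open>Sign and factor are such that \<open>Y i\<close> has identity covariance and
    \<open>B\<close> maps the normalized sum of the \<open>Y i\<close> to
    \<open>- (J *v Sn n)\<close>.\<close>
  define Y where "Y i \<omega> = - (D *v \<psi> (X i \<omega>))" for i \<omega>
  have Dm[measurable]: "(*v) E \<in> borel_measurable borel" for E :: "real ^ 'd ^ 'd"
    by (intro borel_measurable_continuous_onI linear_continuous_on matrix_vector_mul_bounded_linear)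
  have Ym[measurable]: "Y i \<in> borel_measurable M" for i unfolding Y_def by measurable
  have vY: "v \<bullet> Y i \<omega> = - ((transpose D *v v) \<bullet> \<psi> (X i \<omega>))" for v i \<omega>
    by (simp add: Y_def inner_matrix_transpose)
  have char: "(\<lambda>n. LINT \<omega>|M. iexp (t \<bullet> ((1 / sqrt (real n)) *\<^sub>R (\<Sum>i<n. Y i \<omega>)))) \<longlonglongrightarrow>
     complex_of_real (exp (- (norm t)\<^sup>2 / 2))" for t
  proof (rule std_multivariate_clt_char)
    show "indep_vars (\<lambda>_. borel) Y UNIV"
      unfolding Y_def by (rule indep_vars_compose2[OF indep, of "\<lambda>i x. - (D *v \<psi> x)"]) measurable
    show "distr M borel (Y i) = distr Q borel (\<lambda>x. - (D *v \<psi> x))" for i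
      unfolding distr_X[of i, symmetric] by (subst distr_distr) (auto simp: Y_def[abs_def] o_def)
    fix i v
    show "integrable M (\<lambda>\<omega>. (v \<bullet> Y i \<omega>)\<^sup>2)"
      unfolding vY using integrable_X_iff[of "\<lambda>x. ((transpose D *v v) \<bullet> \<psi> x)\<^sup>2" i] \<psi>_square_integrable by simp
    show "expectation (\<lambda>\<omega>. v \<bullet> Y i \<omega>) = 0"
      unfolding vY using expectation_X[of "\<lambda>x. (transpose D *v v) \<bullet> \<psi> x" i] \<psi>_mean by simp
    have "expectation (\<lambda>\<omega>. (v \<bullet> Y i \<omega>)\<^sup>2) = (transpose D *v v) \<bullet> (C *v (transpose D *v v))"
      unfolding vY Ch using expectation_X[of "\<lambda>x. ((transpose D *v v) \<bullet> \<psi> x)\<^sup>2" i] by simp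
    also have "\<dots> = v \<bullet> ((D ** C ** transpose D) *v v)"
      by (simp add: inner_matrix_transpose[of v D] flip: matrix_vector_mul_assoc)
    also have "D ** C ** transpose D = mat 1"
      using W by (simp add: D_def \<Gamma>_def matrix_transpose_mul Jsym matrix_mul_assoc)
    finally show "expectation (\<lambda>\<omega>. (v \<bullet> Y i \<omega>)\<^sup>2) = (norm v)\<^sup>2" by (simp add: power2_norm_eq_inner)
  qed
  define Z where "Z n \<omega> = (1 / sqrt (real n)) *\<^sub>R (\<Sum>i<n. Y i \<omega>)" for n \<omega>
  have Zm[measurable]: "Z n \<in> borel_measurable M" for n unfolding Z_def by measurable
  define T where "T n \<omega> = sqrt (real n) *\<^sub>R (\<theta> n \<omega> - \<mu>)" for n \<omega>
  have Tm[measurable]: "T n \<in> borel_measurable M" for n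
  \<comment> \<open>Measurability of the estimator is given from \<open>n = 1\<close> on; at
    \<open>n = 0\<close> the factor \<open>sqrt 0\<close> makes \<open>T\<close> constant.\<close>
  proof (cases "n = 0")
    case False
    then have [measurable]: "\<theta> n \<in> borel_measurable M" using \<theta>_measurable by simp
    show ?thesis unfolding T_def[abs_def] by measurable
  qed (simp add: T_def[abs_def])
  have BZ: "B *v Z n \<omega> = - (J *v Sn n \<omega>)" for n \<omega>
  proof -
    have "Z n \<omega> = - (D *v Sn n \<omega>)"
      by (simp add: Z_def Y_def Sn_def sum_negf matrix_vector_mult_scaleR)
        (simp add: linear_sum[OF matrix_vector_mul_linear])
    then have "B *v Z n \<omega> = - ((B ** D) *v Sn n \<omega>)" by (simp add: matrix_vector_mul_assoc linear_neg[OF matrix_vector_mul_linear])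
    also have "B ** D = J" by (simp add: D_def matrix_mul_assoc B)
    finally show ?thesis .
  qed
  have close: "likely e (\<lambda>n \<omega>. norm (T n \<omega> - B *v Z n \<omega>) \<le> \<eta>)" if "e > 0" "\<eta> > 0" for e \<eta>
  proof -
    obtain r1 where r1: "r1 > 0" "\<And>e \<eta>. e > 0 \<Longrightarrow> \<eta> > 0 \<Longrightarrow> likely e (\<lambda>n \<omega>. \<forall>\<theta>\<in>cball \<mu> r1. \<forall>h.
      (\<forall>\<theta>'. (\<Sum>i<n. f (X i \<omega>) \<theta>) \<le> (\<Sum>i<n. f (X i \<omega>) \<theta>')) \<longrightarrow> \<Lambda> *v h = - Sn n \<omega> \<longrightarrow>
      norm (sqrt (real n) *\<^sub>R (\<theta> - \<mu>) - h) \<le> \<eta>)"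
      using minimizer_near_linearization by blast
    have "e / 2 > 0" using \<open>e > 0\<close> by simp
    from likely_conj[OF r1(2)[OF this \<open>\<eta> > 0\<close>] \<theta>[OF r1(1) this]]
    show ?thesis
    proof (rule likely_mono[where N=0])
      fix n \<omega>
      assume *: "(\<forall>\<theta>\<in>cball \<mu> r1. \<forall>h. (\<forall>\<theta>'. (\<Sum>i<n. f (X i \<omega>) \<theta>) \<le> (\<Sum>i<n. f (X i \<omega>) \<theta>')) \<longrightarrow> \<Lambda> *v h = - Sn n \<omega> \<longrightarrow>
        norm (sqrt (real n) *\<^sub>R (\<theta> - \<mu>) - h) \<le> \<eta>) \<and> \<theta> n \<omega> \<in> cball \<mu> r1 \<and>
        (\<forall>\<theta>'. (\<Sum>i<n. f (X i \<omega>) (\<theta> n \<omega>)) \<le> (\<Sum>i<n. f (X i \<omega>) \<theta>'))"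
      have "\<Lambda> *v (B *v Z n \<omega>) = - Sn n \<omega>"
        by (simp add: BZ linear_neg[OF matrix_vector_mul_linear] matrix_vector_mul_assoc J)
      then show "norm (T n \<omega> - B *v Z n \<omega>) \<le> \<eta>" using * unfolding T_def by blast
    qed simp
  qed
  have "weakly_converges (\<lambda>n. distr M borel (T n)) (multivariate_normal 0 \<Gamma>)"
  proof (rule weakly_converges_if_Lipschitz)
    show "prob_space (distr M borel (T n))" for n by (rule prob_space_distr) simp
    show "sets (distr M borel (T n)) = sets borel" for n by simp
    show "prob_space (multivariate_normal 0 \<Gamma>)" unfolding normal
      by (rule prob_space.prob_space_distr[OF prob_space_std_gauss]) (simp add: std_gauss_def)
    show "sets (multivariate_normal 0 \<Gamma>) = sets borel" by (simp add: normal)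
    fix g :: "real ^ 'd \<Rightarrow> real" and b L assume g: "\<And>x. \<bar>g x\<bar> \<le> b" "\<And>x y. \<bar>g x - g y\<bar> \<le> L * norm (x - y)"
    have "\<bar>L\<bar>-lipschitz_on UNIV g"
    proof (rule lipschitz_onI)
      show "dist (g x) (g y) \<le> \<bar>L\<bar> * dist x y" for x y
        using g(2)[of x y] mult_right_mono[OF abs_ge_self[of L], of "norm (x - y)"] by (simp add: dist_norm)
    qed simp
    then have gm[measurable]: "g \<in> borel_measurable borel"
      by (intro borel_measurable_continuous_onI lipschitz_on_continuous_on)
    have "(\<lambda>n. LINT y|distr M borel (Z n). g (B *v y)) \<longlonglongrightarrow> (LINT y|std_gauss. g (B *v y))"
    proof (rule char_tendsto_imp_Lipschitz_tendsto)
      show "prob_space (distr M borel (Z n))" for n by (rule prob_space_distr) simp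
      show "sets (distr M borel (Z n)) = sets borel" for n by simp
      show "prob_space (std_gauss :: (real ^ 'd) measure)" by (rule prob_space_std_gauss)
      show "sets (std_gauss :: (real ^ 'd) measure) = sets borel" by (simp add: std_gauss_def)
      show "(\<lambda>n. LINT y|distr M borel (Z n). iexp (t \<bullet> y)) \<longlonglongrightarrow> (LINT y|std_gauss. iexp (t \<bullet> y))" for t :: "real ^ 'd"
        using char[of t] by (simp add: integral_distr char_std_gauss Z_def[symmetric])
      show "\<bar>g (B *v x)\<bar> \<le> b" for x by (rule g(1))
      show "\<bar>g (B *v x) - g (B *v y)\<bar> \<le> \<bar>L\<bar> * onorm ((*v) B) * norm (x - y)" for x y
      proof -
        have "\<bar>g (B *v x) - g (B *v y)\<bar> \<le> L * norm (B *v x - B *v y)" by (rule g(2))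
        also have "\<dots> \<le> \<bar>L\<bar> * norm (B *v (x - y))" by (simp add: matrix_vector_mult_diff_distrib mult_right_mono)
        also have "\<dots> \<le> \<bar>L\<bar> * (onorm ((*v) B) * norm (x - y))"
          by (intro mult_left_mono onorm matrix_vector_mul_bounded_linear) simp
        finally show ?thesis by (simp add: mult.assoc)
      qed
    qed
    then have lim: "(\<lambda>n. expectation (\<lambda>\<omega>. g (B *v Z n \<omega>))) \<longlonglongrightarrow> (LINT y|std_gauss. g (B *v y))"
      by (simp add: integral_distr)
    have "(\<lambda>n. expectation (\<lambda>\<omega>. g (T n \<omega>)) - expectation (\<lambda>\<omega>. g (B *v Z n \<omega>))) \<longlonglongrightarrow> 0"
      by (rule expectation_Lipschitz_diff_tendsto_0[OF Tm _ close gm g]) auto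
    from tendsto_add[OF this lim]
    show "(\<lambda>n. LINT y|distr M borel (T n). g y) \<longlonglongrightarrow> (LINT y|multivariate_normal 0 \<Gamma>. g y)"
      by (simp add: normal integral_distr std_gauss_def)
  qed
  then show ?thesis unfolding T_def \<Gamma>_def J_def symmetric .
qed

end

lemma frechet_function_empirical_measure:
  assumes m: "(\<lambda>y. \<rho> x y) \<in> borel_measurable borel" and n: "n \<ge> 1"
  shows "frechet_function \<rho> (empirical_measure n X) x = ennreal ((\<Sum>i<n. (\<rho> x (X i))\<^sup>2) / real n)"
proof -
  have "frechet_function \<rho> (empirical_measure n X) x = (\<integral>\<^sup>+i. ennreal ((\<rho> x (X i))\<^sup>2) \<partial>uniform_count_measure {..<n})"
    unfolding frechet_function_def empirical_measure_def
    by (rule nn_integral_distr) (use m in \<open>auto simp: uniform_count_measure_def\<close>)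
  also have "\<dots> = (\<Sum>i<n. ennreal (1 / real n) * ennreal ((\<rho> x (X i))\<^sup>2))"
    unfolding uniform_count_measure_def by (subst nn_integral_point_measure_finite) (auto simp: mult.commute)
  also have "\<dots> = ennreal (\<Sum>i<n. (1 / real n) * (\<rho> x (X i))\<^sup>2)"
    by (subst sum_ennreal[symmetric]) (auto intro!: sum.cong simp flip: ennreal_mult)
  also have "(\<Sum>i<n. (1 / real n) * (\<rho> x (X i))\<^sup>2) = (\<Sum>i<n. (\<rho> x (X i))\<^sup>2) / real n"
    by (simp add: sum_divide_distrib)
  finally show ?thesis .
qed

text \<open>If both ends lie in the ball, the triangle inequality for their half sum and half
  difference puts \<open>x\<close> into the ball and bounds \<open>norm h\<close> by
  \<open>r\<close>.\<close>

lemma semiconcave_on_cballI: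
  fixes f :: "'a::real_inner \<Rightarrow> real"
  assumes "\<And>x h. x \<in> cball a r \<Longrightarrow> norm h \<le> r \<Longrightarrow> f (x + h) + f (x - h) \<le> 2 * f x + k * (norm h)\<^sup>2"
  shows "semiconcave_on (cball a r) k f"
  unfolding semiconcave_on_def
proof (intro allI impI)
  fix x h assume xh: "x + h \<in> cball a r" "x - h \<in> cball a r"
  have "2 *\<^sub>R (x - a) = (x + h - a) + (x - h - a)" "2 *\<^sub>R h = (x + h - a) - (x - h - a)"
    by (simp_all add: scaleR_2)
  then have "norm (2 *\<^sub>R (x - a)) \<le> r + r" "norm (2 *\<^sub>R h) \<le> r + r"
    using xh norm_triangle_le[of "x + h - a" "x - h - a" "r + r"] norm_triangle_le_diff[of "x + h - a" "x - h - a" "r + r"]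
    by (auto simp: dist_norm norm_minus_commute)
  then show "f (x + h) + f (x - h) \<le> 2 * f x + k * (norm h)\<^sup>2"
    by (intro assms) (auto simp: dist_norm norm_minus_commute)
qed

theorem theorem2p3:
  fixes A :: "('a::{t2_space, second_countable_topology}, 'd::finite) chart set"
    and G :: "('a, 'd) chart \<Rightarrow> 'a \<Rightarrow> real ^ 'd ^ 'd"
    and Q :: "'a measure" and P :: "'w measure" and X :: "nat \<Rightarrow> 'w \<Rightarrow> 'a"
    and U :: "'a set" and \<phi> :: "'a \<Rightarrow> real ^ 'd"
    and mu_I :: 'a and mu_nI :: "nat \<Rightarrow> 'w \<Rightarrow> 'a"
    and \<mu> z :: "real ^ 'd" and \<rho> :: "'a \<Rightarrow> 'a \<Rightarrow> real"
    and \<Lambda> C :: "real ^ 'd ^ 'd"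
  assumes manifold: "riemannian_manifold A G" "connected (UNIV :: 'a set)" "complete_manifold A G"
    and rho: "\<rho> = geodesic_dist A G"
    and Q: "prob_space Q" "sets Q = sets borel" "absolutely_continuous (riemannian_volume A G) Q"
    and iid: "prob_space P" "prob_space.indep_vars P (\<lambda>_. borel) X UNIV"
      "\<And>i. distr P borel (X i) = Q"
    and mean: "intrinsic_mean_set A G Q = {mu_I}"
    and chart: "manifold_chart A (U, \<phi>)" "emeasure Q U = 1" "mu_I \<in> U" "\<mu> = \<phi> mu_I"
    and Psi_moment: "\<And>i. (\<integral>\<^sup>+\<omega>. ennreal
        ((norm (Psi \<rho> (U, \<phi>) (chart_coord (U, \<phi>) z (X i \<omega>)) \<mu>))\<^sup>2) \<partial>P) < \<infinity>"
    and D_Psi_moment: "\<And>i r r'. (\<integral>\<^sup>+\<omega>. ennreal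
        (\<bar>D_Psi \<rho> (U, \<phi>) r' r (chart_coord (U, \<phi>) z (X i \<omega>)) \<mu>\<bar>\<^sup>2) \<partial>P) < \<infinity>"
    and hessian: "has_hessian (\<lambda>\<theta>. enn2real (frechet_function \<rho> Q (inv_into U \<phi> \<theta>))) \<Lambda> \<mu>"
      "invertible \<Lambda>"
    and covariance:
      "\<And>i. C = covariance_matrix P (\<lambda>\<omega>. Psi \<rho> (U, \<phi>) (chart_coord (U, \<phi>) z (X i \<omega>)) \<mu>)"
      "invertible C"
    and sample_mean: "\<And>n. n \<ge> 1 \<Longrightarrow> mu_nI n \<in> borel_measurable P"
      "\<And>n \<omega>. n \<ge> 1 \<Longrightarrow> \<omega> \<in> space P \<Longrightarrow>
         mu_nI n \<omega> \<in> intrinsic_mean_set A G (empirical_measure n (\<lambda>i. X i \<omega>))"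
  shows "weakly_converges
      (\<lambda>n. distr P borel (\<lambda>\<omega>. sqrt (real n) *\<^sub>R (chart_coord (U, \<phi>) z (mu_nI n \<omega>) - \<mu>)))
      (multivariate_normal 0 (matrix_inv \<Lambda> ** C ** matrix_inv (transpose \<Lambda>)))"
proof -
  interpret R: connected_riemannian A G by unfold_locales (rule manifold)+
  interpret P: prob_space P by (rule iid)
  interpret I: iid_sample P X Q by unfold_locales (rule iid)+
  interpret Q: prob_space Q by (rule Q)
  have \<rho>_nonneg: "\<rho> x y \<ge> 0" and \<rho>_sym: "\<rho> x y = \<rho> y x" and \<rho>_triangle: "\<rho> x y \<le> \<rho> x w + \<rho> w y" for x y w
    unfolding rho by (rule R.rho_nonneg R.rho_sym R.rho_triangle)+
  have \<rho>_cont: "continuous_on UNIV (\<rho> x)" for x unfolding rho by (rule R.continuous_rho)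
  then have \<rho>_meas [measurable]: "\<rho> x \<in> borel_measurable borel" for x by (rule borel_measurable_continuous_onI)
  define \<xi> where "\<xi> = inv_into U \<phi>"
  have tc: "open U" "open (\<phi> ` U)" "homeomorphism U (\<phi> ` U) \<phi> \<xi>"
    using chart(1) unfolding manifold_chart_def topological_chart_def \<xi>_def by auto
  have \<phi>_cont: "continuous_on U \<phi>" and \<xi>_\<phi>: "\<And>x. x \<in> U \<Longrightarrow> \<xi> (\<phi> x) = x"
    using tc(3) by (auto simp: homeomorphism_def)
  have \<xi>_\<mu>: "\<xi> \<mu> = mu_I" using \<xi>_\<phi> chart by simp

  have minQ: "frechet_function \<rho> Q mu_I \<le> frechet_function \<rho> Q y" for y
    using mean by (auto simp: intrinsic_mean_set_def rho)
  have ff: "frechet_function \<rho> Q y = (\<integral>\<^sup>+x. ennreal ((\<rho> x y)\<^sup>2) \<partial>Q)" for y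
    unfolding frechet_function_def by (simp only: \<rho>_sym[of y])
  \<comment> \<open>If the minimum were infinite, every point would be a minimizer. Uniqueness then
    leaves a single point in the manifold, where the function is 0.\<close>
  have finite: "frechet_function \<rho> Q mu_I < \<infinity>"
  proof (rule ccontr)
    assume "\<not> frechet_function \<rho> Q mu_I < \<infinity>"
    then have inf: "frechet_function \<rho> Q y = \<infinity>" for y
      using minQ[of y] by (auto simp: less_top[symmetric] top_unique)
    then have "y \<in> intrinsic_mean_set A G Q" for y by (simp add: intrinsic_mean_set_def rho)
    then have "y = mu_I" for y using mean by blast
    then have "\<rho> x y = 0" for x y by (metis R.rho_refl rho)
    then show False using inf[of mu_I] by (simp add: frechet_function_def)
  qed
  have sym_meas [measurable]: "(\<lambda>x. \<rho> x y) \<in> borel_measurable borel" for y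
    unfolding \<rho>_sym[of _ y] by measurable
  have sq_int: "integrable Q (\<lambda>x. (\<rho> x mu_I)\<^sup>2)"
    using finite unfolding ff by (intro integrableI_nonneg) auto
  have sq_int': "integrable Q (\<lambda>x. (\<rho> x y)\<^sup>2)" for y
  proof (rule Bochner_Integration.integrable_bound)
    show "integrable Q (\<lambda>x. 2 * (\<rho> x mu_I)\<^sup>2 + 2 * (\<rho> mu_I y)\<^sup>2)" using sq_int by auto
    show "AE x in Q. norm ((\<rho> x y)\<^sup>2) \<le> norm (2 * (\<rho> x mu_I)\<^sup>2 + 2 * (\<rho> mu_I y)\<^sup>2)"
    proof (rule AE_I2)
      fix x
      have "(\<rho> x y)\<^sup>2 \<le> (\<rho> x mu_I + \<rho> mu_I y)\<^sup>2" using \<rho>_triangle \<rho>_nonneg by (intro power_mono) auto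
      also have "\<dots> \<le> 2 * (\<rho> x mu_I)\<^sup>2 + 2 * (\<rho> mu_I y)\<^sup>2"
        using zero_le_power2[of "\<rho> x mu_I - \<rho> mu_I y"] by (simp add: power2_eq_square algebra_simps)
      finally show "norm ((\<rho> x y)\<^sup>2) \<le> norm (2 * (\<rho> x mu_I)\<^sup>2 + 2 * (\<rho> mu_I y)\<^sup>2)" by simp
    qed
  qed simp
  have ff_eq: "frechet_function \<rho> Q y = ennreal (LINT x|Q. (\<rho> x y)\<^sup>2)" for y
    unfolding ff using sq_int' by (intro nn_integral_eq_integral) auto
  have unique: "(LINT x|Q. (\<rho> x mu_I)\<^sup>2) < (LINT x|Q. (\<rho> x y)\<^sup>2)" if "y \<noteq> mu_I" for y
  proof -
    have "y \<notin> intrinsic_mean_set A G Q" using mean that by simp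
    then obtain w where "frechet_function \<rho> Q w < frechet_function \<rho> Q y"
      by (auto simp: intrinsic_mean_set_def rho not_le)
    then have "frechet_function \<rho> Q mu_I < frechet_function \<rho> Q y" using minQ[of w] by simp
    then show ?thesis unfolding ff_eq by (simp add: ennreal_less_iff)
  qed
  interpret S: frechet_sample P X Q \<rho> mu_I
  proof
    show "compact {y. \<rho> mu_I y \<le> R}" for R unfolding rho by (rule R.compact_rho_cball[OF manifold(3)])
    show "\<rho> x x = 0" for x unfolding rho by (rule R.rho_refl)
  qed (fact \<rho>_nonneg \<rho>_sym \<rho>_triangle \<rho>_cont sq_int unique)+

  obtain r K where rK: "r > 0" "K > 0" "cball \<mu> (2 * r) \<subseteq> \<phi> ` U"
    and sc: "\<forall>x. semiconcave_on (cball \<mu> r) (K * (1 + \<rho> x mu_I)) (\<lambda>\<theta>. (\<rho> x (\<xi> \<theta>))\<^sup>2)"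
    and lip: "\<forall>x u v. u \<in> cball \<mu> r \<longrightarrow> v \<in> cball \<mu> r \<longrightarrow> \<bar>\<rho> x (\<xi> u) - \<rho> x (\<xi> v)\<bar> \<le> K * norm (u - v)"
  proof (rule R.rho_sq_semiconcave_manifold_chart[OF chart(1,3)])
    fix r K assume *: "r > 0" "K > 0" "cball (\<phi> mu_I) (2 * r) \<subseteq> \<phi> ` U"
      "\<And>x \<theta> h. \<theta> \<in> cball (\<phi> mu_I) r \<Longrightarrow> norm h \<le> r \<Longrightarrow>
       (geodesic_dist A G x (inv_into U \<phi> (\<theta> + h)))\<^sup>2 + (geodesic_dist A G x (inv_into U \<phi> (\<theta> - h)))\<^sup>2 \<le>
         2 * (geodesic_dist A G x (inv_into U \<phi> \<theta>))\<^sup>2 + K * (1 + geodesic_dist A G x mu_I) * (norm h)\<^sup>2"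
      "\<And>x u v. u \<in> cball (\<phi> mu_I) (2 * r) \<Longrightarrow> v \<in> cball (\<phi> mu_I) (2 * r) \<Longrightarrow>
       \<bar>geodesic_dist A G x (inv_into U \<phi> u) - geodesic_dist A G x (inv_into U \<phi> v)\<bar> \<le> K * norm (u - v)"
    show thesis
    proof (rule that[of r K])
      show "\<forall>x. semiconcave_on (cball \<mu> r) (K * (1 + \<rho> x mu_I)) (\<lambda>\<theta>. (\<rho> x (\<xi> \<theta>))\<^sup>2)"
        unfolding \<xi>_def rho chart(4) by (intro allI semiconcave_on_cballI *(4))
      have sub: "cball (\<phi> mu_I) r \<subseteq> cball (\<phi> mu_I) (2 * r)" using *(1) by auto
      show "\<forall>x u v. u \<in> cball \<mu> r \<longrightarrow> v \<in> cball \<mu> r \<longrightarrow> \<bar>\<rho> x (\<xi> u) - \<rho> x (\<xi> v)\<bar> \<le> K * norm (u - v)"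
        unfolding \<xi>_def rho chart(4) by (intro allI impI *(5) subsetD[OF sub])
    qed (use * chart(4) in simp_all)
  qed
  interpret E: frechet_chart P X Q \<rho> mu_I \<xi> \<mu> r K
    by unfold_locales (use rK sc lip \<xi>_\<mu> in auto)
  have F: "E.F = (\<lambda>\<theta>. enn2real (frechet_function \<rho> Q (inv_into U \<phi> \<theta>)))"
    by (rule ext) (simp add: E.F_def E.f_def ff_eq flip: \<xi>_def)
  have H: "has_hessian E.F \<Lambda> \<mu>" unfolding F by (rule hessian)
  note min = has_hessian_minimum[OF H hessian(2) E.F_minimum]
  obtain c where c: "c > 0" "\<And>h. c * (norm h)\<^sup>2 \<le> h \<bullet> (\<Lambda> *v h)"
    using positive_definite_coercive[OF min(2)] by blast
  interpret T: frechet_expansion P X Q \<rho> mu_I \<xi> \<mu> r K \<Lambda> c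
    by unfold_locales (use has_hessian_expansion[OF H min(1)] has_hessian_symmetric[OF H] c in auto)

  have Psi: "Psi \<rho> (U, \<phi>) u \<mu> = E.\<psi> (\<xi> u)" for u
    by (simp add: Psi_def grad_def partial_deriv_def chart_dist_def E.\<psi>_def E.f_def flip: \<xi>_def)
  \<comment> \<open>\<open>Psi\<close> is evaluated at the sample coordinates, which default to
    \<open>z\<close> off \<open>U\<close>. Seen on the manifold this replaces \<open>x\<close> by
    \<open>\<tau> x\<close>, which is \<open>x\<close> on \<open>U\<close>, a set of full
    measure.\<close>
  define \<tau> where "\<tau> x = \<xi> (chart_coord (U, \<phi>) z x)" for x
  have \<tau>_U: "\<tau> x = x" if "x \<in> U" for x using that by (simp add: \<tau>_def chart_coord_def \<xi>_\<phi>)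
  have U_borel [measurable]: "U \<in> sets borel" using tc(1) by simp
  have \<tau>_meas [measurable]: "\<tau> \<in> borel_measurable borel"
  proof -
    have "\<tau> = (\<lambda>x. if x \<in> U then x else \<xi> z)" by (rule ext) (auto simp: \<tau>_def chart_coord_def \<xi>_\<phi>)
    then show ?thesis by simp
  qed
  have "AE x in Q. x \<in> U" using chart(2) by (intro Q.AE_I_eq_1) (auto simp: Q.emeasure_eq_measure I.space_Q)
  then have AE_\<tau>: "AE x in Q. E.\<psi> (\<tau> x) = E.\<psi> x" by eventually_elim (simp add: \<tau>_U)
  have \<psi>_nth [measurable]: "(\<lambda>x. E.\<psi> x $ i) \<in> borel_measurable borel" for i
    by (rule measurable_compose[OF E.\<psi>_measurable borel_measurable_continuous_onI]) (intro continuous_intros)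
  have \<psi>\<tau>_nth [measurable]: "(\<lambda>x. E.\<psi> (\<tau> x) $ i) \<in> borel_measurable borel" for i
    by (rule measurable_compose[OF \<tau>_meas \<psi>_nth])
  have mean_\<tau>: "(LINT x|Q. E.\<psi> (\<tau> x) $ i) = 0" for i
  proof -
    have "(LINT x|Q. E.\<psi> (\<tau> x) $ i) = (LINT x|Q. axis i 1 \<bullet> E.\<psi> x)"
      unfolding inner_axis' by (rule integral_cong_AE, measurable) (use AE_\<tau> in auto)
    then show ?thesis by (simp add: E.\<psi>_mean)
  qed
  have C_eq: "C $ i $ j = (LINT x|Q. E.\<psi> x $ i * E.\<psi> x $ j)" for i j
  proof -
    \<comment> \<open>Since \<open>\<psi>\<close> is centered, the covariances are plain second
      moments.\<close>
    have e: "(\<integral>\<omega>. E.\<psi> (\<tau> (X 0 \<omega>)) $ i \<partial>P) = 0" for i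
      using I.expectation_X[of "\<lambda>x. E.\<psi> (\<tau> x) $ i" 0] mean_\<tau> by simp
    have "C $ i $ j = (\<integral>\<omega>. E.\<psi> (\<tau> (X 0 \<omega>)) $ i * E.\<psi> (\<tau> (X 0 \<omega>)) $ j \<partial>P)"
      unfolding covariance(1)[of 0] by (simp add: covariance_matrix_def Psi e flip: \<tau>_def)
    also have "\<dots> = (LINT x|Q. E.\<psi> (\<tau> x) $ i * E.\<psi> (\<tau> x) $ j)"
      by (rule I.expectation_X[of "\<lambda>x. E.\<psi> (\<tau> x) $ i * E.\<psi> (\<tau> x) $ j" 0]) measurable
    also have "\<dots> = (LINT x|Q. E.\<psi> x $ i * E.\<psi> x $ j)"
      by (rule integral_cong_AE, measurable) (use AE_\<tau> in auto)
    finally show ?thesis .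
  qed

  have coord_meas: "chart_coord (U, \<phi>) z \<in> borel_measurable borel"
  proof -
    have "(\<lambda>x. if x \<in> U then \<phi> x else z) \<in> borel_measurable borel"
      by (intro borel_measurable_continuous_on_if U_borel \<phi>_cont continuous_on_const)
    then show ?thesis by (simp only: chart_coord_def[abs_def] fst_conv snd_conv)
  qed
  have sample: "(\<Sum>i<n. (\<rho> (X i \<omega>) (mu_nI n \<omega>))\<^sup>2) \<le> (\<Sum>i<n. (\<rho> (X i \<omega>) y)\<^sup>2)" if n: "n \<ge> 1" and \<omega>: "\<omega> \<in> space P" for n \<omega> y
  proof -
    have "frechet_function \<rho> (empirical_measure n (\<lambda>i. X i \<omega>)) (mu_nI n \<omega>) \<le> frechet_function \<rho> (empirical_measure n (\<lambda>i. X i \<omega>)) y"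
      using sample_mean(2)[OF n \<omega>] by (simp add: intrinsic_mean_set_def rho)
    then have "(\<Sum>i<n. (\<rho> (mu_nI n \<omega>) (X i \<omega>))\<^sup>2) / real n \<le> (\<Sum>i<n. (\<rho> y (X i \<omega>))\<^sup>2) / real n"
      using n by (simp add: frechet_function_empirical_measure sum_nonneg)
    then show ?thesis using n by (simp add: divide_le_cancel \<rho>_sym[of "X _ \<omega>"])
  qed
  show ?thesis
  proof (rule T.minimizer_clt[OF C_eq covariance(2)])
    show "(\<lambda>\<omega>. chart_coord (U, \<phi>) z (mu_nI n \<omega>)) \<in> borel_measurable P" if "n \<ge> 1" for n
      by (rule measurable_compose[OF sample_mean(1)[OF that] coord_meas])
    fix s e :: real assume s: "s > 0" and e: "e > 0"
    \<comment> \<open>A neighbourhood of the mean inside the chart domain. By consistency the sample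
      mean lies in it on the likely event, so the default value \<open>z\<close> does not occur
      there.\<close>
    define N where "N = U \<inter> \<phi> -` ball \<mu> s"
    have "open N" unfolding N_def by (rule continuous_open_preimage[OF \<phi>_cont tc(1) open_ball])
    moreover have "mu_I \<in> N" using chart s by (simp add: N_def)
    ultimately have "P.likely e (\<lambda>n \<omega>. \<forall>y. y \<notin> N \<longrightarrow> (\<Sum>i<n. (\<rho> (X i \<omega>) mu_I)\<^sup>2) < (\<Sum>i<n. (\<rho> (X i \<omega>) y)\<^sup>2))"
      using e by (rule S.consistency)
    then show "P.likely e (\<lambda>n \<omega>. chart_coord (U, \<phi>) z (mu_nI n \<omega>) \<in> cball \<mu> s \<and>
      (\<forall>\<theta>'. (\<Sum>i<n. E.f (X i \<omega>) (chart_coord (U, \<phi>) z (mu_nI n \<omega>))) \<le> (\<Sum>i<n. E.f (X i \<omega>) \<theta>')))"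
    proof (rule P.likely_mono[where N=1])
      fix n \<omega> assume n: "1 \<le> n" and \<omega>: "\<omega> \<in> space P"
        and *: "\<forall>y. y \<notin> N \<longrightarrow> (\<Sum>i<n. (\<rho> (X i \<omega>) mu_I)\<^sup>2) < (\<Sum>i<n. (\<rho> (X i \<omega>) y)\<^sup>2)"
      have "mu_nI n \<omega> \<in> N" using * sample[OF n \<omega>, of mu_I] by (meson not_le)
      then have "mu_nI n \<omega> \<in> U" "\<phi> (mu_nI n \<omega>) \<in> cball \<mu> s" by (auto simp: N_def)
      \<comment> \<open>For \<open>\<theta>'\<close> outside the chart image,
        \<open>\<xi> \<theta>'\<close> is still a point of the manifold, so minimality among all
        points covers every \<open>\<theta>'\<close>.\<close>
      then show "chart_coord (U, \<phi>) z (mu_nI n \<omega>) \<in> cball \<mu> s \<and>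
        (\<forall>\<theta>'. (\<Sum>i<n. E.f (X i \<omega>) (chart_coord (U, \<phi>) z (mu_nI n \<omega>))) \<le> (\<Sum>i<n. E.f (X i \<omega>) \<theta>'))"
        using sample[OF n \<omega>] by (simp add: chart_coord_def E.f_def \<xi>_\<phi>)
    qed simp
  qed
qed

end
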